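(* Let $N$ be a point process on $\bar{\mathbb{R}}_0=[-\infty,\infty]\setminus\{0\}$ with $\mathbf{P}(N(\bar{\mathbb{R}}_0)>0)>0$, and fix $\alpha>0$. Then the following statements are equivalent. (B1) $N$ is a scale-decorated Poisson point process on $\bar{\mathbb{R}}_0$ with Poisson intensity $m_\alpha$, where $m_\alpha$ is the measure on $(0,\infty)$ with $m_\alpha((x,\infty))=x^{-\alpha}$ for every $x>0$. (B2) $N$ is a strictly $\alpha$-stable point process. (B3) The scaled Laplace functional of $N$ is scale-uniquely supported on the class $[\Phi_\alpha]_{sc}$, where $\Phi_\alpha(x)=\exp(-x^{-\alpha})$ for $x>0$.
   Context: $\mathbb{R}_+=(0,\infty)$. A point process on $\bar{\mathbb{R}}_0=[-\infty,\infty]\setminus\{0\}$ is a random Radon (locally finite) point measure on $\bar{\mathbb{R}}_0$ that puts no mass on $\{\pm\infty\}$. For $b>0$ and a point measure $\sum_i\delta_{u_i}$, put $\mathbf{S}_b\sum_i\delta_{u_i}=\sum_i\delta_{bu_i}$. For a measurable function $f:\bar{\mathbb{R}}_0\to[0,\infty)$ and $y>0$, $\mathbf{S}_yf(\cdot)=f(y\,\cdot)$. $C_c^+(\bar{\mathbb{R}}_0)$ is the space of nonnegative continuous functions on $\bar{\mathbb{R}}_0$ with compact support (hence vanishing in a neighbourhood of $0$). $N$ is strictly $\alpha$-stable if for every $b_1,b_2>0$, $\mathbf{S}_{b_1}N_1+\mathbf{S}_{b_2}N_2\overset{d}{=}\mathbf{S}_{(b_1^\alpha+b_2^\alpha)^{1/\alpha}}N$,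 where $N_1,N_2$ are independent copies of $N$ and $+$ denotes superposition. $N$ is a scale-decorated Poisson point process with Poisson intensity $m$ and scale-decoration $\mathcal{P}$ (a point process) if $N\overset{d}{=}\sum_{i\ge1}\mathbf{S}_{\lambda_i}\mathcal{P}_i$, where $\Lambda=\sum_{i\ge1}\delta_{\lambda_i}$ is a Poisson random measure on $(0,\infty)$ with intensity measure $m$ and $(\mathcal{P}_i)_{i\ge1}$ are independent copies of $\mathcal{P}$, independent of $\Lambda$; in (B1) the scale-decoration is some point process $\mathcal{P}$. The Laplace functional of $N$ is $\Psi_N(f)=\mathbf{E}(\exp\{-\int f\,dN\})$ and the scaled Laplace functional is $\Psi_N(f\|y)=\Psi_N(\mathbf{S}_{y^{-1}}f)$, $y>0$. For $g:(0,\infty)\to(0,\infty)$ measurable, $[g]_{sc}$ is the class of all positive measurable functions $f:\mathbb{R}_+\to\mathbb{R}_+$ such that for some $y>0$, $f(x)=g(yx)$ for all $x>0$. The scaled Laplace functional of $N$ is scale-uniquely supported on $[g]_{sc}$ if for any $f\in C_c^+(\bar{\mathbb{R}}_0)$ there exists a constant $c_f$ (depending on $f$ only) such that $\Psi_N(f\|y)=g(yc_f)$ for all $y>0$.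
   Formalization: In (B3) the constant c_f may be infinite, with g(∞) read as the limit of g at infinity; with finite c_f only, (B3) never holds, since f = 0 gives Ψ_N(f‖y) = 1 while Φ_α < 1 on (0,∞). *)

theory Defs
  imports "HOL-Probability.Probability"
begin

section \<open>Random measures\<close>

text \<open>
  The measurable space of all measures on \<open>K\<close>, with the \<open>\<sigma>\<close>-algebra generated by the evaluations
  \<open>\<mu> \<mapsto> \<mu>(A)\<close>. Infinite measures are admitted (unlike in \<^const>\<open>subprob_algebra\<close>), so that every
  superposition of random measures is a random element of this space and its law makes sense even
  if it fails to be locally finite on a null set.
\<close>

definition measure_algebra :: "'a measure \<Rightarrow> 'a measure measure" where
  "measure_algebra K =
     (SUP A \<in> sets K. vimage_algebra {\<mu>. sets \<mu> = sets K} (\<lambda>\<mu>. emeasure \<mu> A) borel)"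

definition superpose :: "'a measure \<Rightarrow> 'a measure \<Rightarrow> 'a measure" where
  "superpose \<mu> \<nu> = measure_of (space \<mu>) (sets \<mu>) (\<lambda>A. emeasure \<mu> A + emeasure \<nu> A)"

definition superposition :: "'a measure \<Rightarrow> (nat \<Rightarrow> 'a measure) \<Rightarrow> 'a measure" where
  "superposition K \<mu> = measure_of (space K) (sets K) (\<lambda>A. \<Sum>i. emeasure (\<mu> i) A)"

lemma emeasure_superpose:
  assumes "sets \<nu> = sets \<mu>" "A \<in> sets \<mu>"
  shows "emeasure (superpose \<mu> \<nu>) A = emeasure \<mu> A + emeasure \<nu> A"
proof (rule emeasure_measure_of[OF superpose_def])
  show "countably_additive (sets (superpose \<mu> \<nu>)) (\<lambda>A. emeasure \<mu> A + emeasure \<nu> A)"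
    unfolding countably_additive_def superpose_def using assms(1)
    by (auto simp: suminf_add[symmetric] suminf_emeasure)
qed (use assms in \<open>auto simp: positive_def superpose_def dest: sets.sets_into_space\<close>)

lemma emeasure_superposition:
  assumes "\<And>i. sets (\<mu> i) = sets K" "A \<in> sets K"
  shows "emeasure (superposition K \<mu>) A = (\<Sum>i. emeasure (\<mu> i) A)"
proof (rule emeasure_measure_of[OF superposition_def])
  have swap: "(\<Sum>i. \<Sum>j. f i j) = (\<Sum>j. \<Sum>i. f i j)" for f :: "nat \<Rightarrow> nat \<Rightarrow> ennreal"
    using nn_integral_suminf[of "\<lambda>i j. f i j" "count_space UNIV"]
    by (simp add: nn_integral_count_space_nat)
  show "countably_additive (sets (superposition K \<mu>)) (\<lambda>A. \<Sum>i. emeasure (\<mu> i) A)"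
    unfolding countably_additive_def
  proof (intro allI impI)
    fix A :: "nat \<Rightarrow> 'a set"
    assume A: "range A \<subseteq> sets (superposition K \<mu>)" and "disjoint_family A"
    have "range A \<subseteq> sets K"
      using A by (simp add: superposition_def)
    with \<open>disjoint_family A\<close> show "(\<Sum>j. \<Sum>i. emeasure (\<mu> i) (A j)) = (\<Sum>i. emeasure (\<mu> i) (\<Union> (range A)))"
      using assms(1) by (subst swap) (simp add: suminf_emeasure)
  qed
qed (use assms in \<open>auto simp: positive_def superposition_def dest: sets.sets_into_space\<close>)

text \<open>
  The Poisson probabilities are spelled out because \<^const>\<open>poisson_pmf\<close> excludes rate \<open>0\<close>.
\<close>

definition poisson_random_measure ::
    "'w measure \<Rightarrow> 'a measure \<Rightarrow> ('w \<Rightarrow> 'a measure) \<Rightarrow> bool" where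
  "poisson_random_measure M m \<Lambda> \<longleftrightarrow>
     \<Lambda> \<in> M \<rightarrow>\<^sub>M measure_algebra m \<and>
     (\<forall>A\<in>sets m. emeasure m A < \<infinity> \<longrightarrow>
        (\<forall>k::nat. measure M {\<omega>\<in>space M. emeasure (\<Lambda> \<omega>) A = of_nat k} =
           exp (- measure m A) * measure m A ^ k / fact k)) \<and>
     (\<forall>A\<in>sets m. emeasure m A = \<infinity> \<longrightarrow> (AE \<omega> in M. emeasure (\<Lambda> \<omega>) A = \<infinity>)) \<and>
     (\<forall>A :: nat \<Rightarrow> 'a set. range A \<subseteq> sets m \<and> disjoint_family A \<longrightarrow>
        prob_space.indep_vars M (\<lambda>_. borel) (\<lambda>i \<omega>. emeasure (\<Lambda> \<omega>) (A i)) UNIV)"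

section \<open>Point processes on the extended real line without the origin\<close>

abbreviation ereal_no0 :: "ereal measure" where
  "ereal_no0 \<equiv> restrict_space borel (UNIV - {0})"

abbreviation real_pos :: "real measure" where
  "real_pos \<equiv> restrict_space borel {0<..}"

text \<open>
  The point measure \<open>\<Sum>\<^bsub>i \<in> I\<^esub> \<delta>\<^bsub>u i\<^esub>\<close> is written as the image under \<open>u\<close> of the counting measure
  on the (finite or infinite) index set \<open>I\<close>. Compact subsets of the space are the compact sets of
  extended reals that avoid \<open>0\<close>; they may contain \<open>\<plusminus>\<infinity>\<close>.
\<close>

definition radon_point_measure :: "ereal measure \<Rightarrow> bool" where
  "radon_point_measure \<mu> \<longleftrightarrow>
     (\<exists>(I :: nat set) u. u \<in> I \<rightarrow> UNIV - {0} \<and> \<mu> = distr (count_space I) ereal_no0 u) \<and>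
     (\<forall>K. compact K \<and> K \<subseteq> UNIV - {0} \<longrightarrow> emeasure \<mu> K < \<infinity>) \<and>
     emeasure \<mu> {-\<infinity>, \<infinity>} = 0"

definition point_process :: "'w measure \<Rightarrow> ('w \<Rightarrow> ereal measure) \<Rightarrow> bool" where
  "point_process M N \<longleftrightarrow>
     N \<in> M \<rightarrow>\<^sub>M measure_algebra ereal_no0 \<and> (\<forall>\<omega>\<in>space M. radon_point_measure (N \<omega>))"

definition scale_measure_pts :: "real \<Rightarrow> ereal measure \<Rightarrow> ereal measure" where
  "scale_measure_pts b \<mu> = distr \<mu> ereal_no0 (\<lambda>u. ereal b * u)"

text \<open>
  Independent copies are realised on product spaces: the two coordinates of \<open>M \<Otimes>\<^sub>M M\<close> below, and
  the coordinates of the infinite power of \<open>D\<close> for the decorations.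
\<close>

definition strictly_stable ::
    "real \<Rightarrow> 'w measure \<Rightarrow> ('w \<Rightarrow> ereal measure) \<Rightarrow> bool" where
  "strictly_stable \<alpha> M N \<longleftrightarrow>
     (\<forall>b1>0. \<forall>b2>0.
        distr (M \<Otimes>\<^sub>M M) (measure_algebra ereal_no0)
          (\<lambda>(\<omega>1, \<omega>2). superpose (scale_measure_pts b1 (N \<omega>1)) (scale_measure_pts b2 (N \<omega>2))) =
        distr M (measure_algebra ereal_no0)
          (\<lambda>\<omega>. scale_measure_pts ((b1 powr \<alpha> + b2 powr \<alpha>) powr (1 / \<alpha>)) (N \<omega>)))"

text \<open>
  \<open>scale_decorated_poisson m D P M N\<close>: \<open>N\<close> (on \<open>M\<close>) has Poisson intensity \<open>m\<close> and scale-decoration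
  \<open>P\<close> (on \<open>D\<close>). The sequence \<open>l\<close> enumerates the Poisson points; it lives on \<open>L\<close>, and independence of
  the decorations is built into the product with \<open>L\<close>. Only the law of \<open>l\<close> matters, so
  \<open>nat \<Rightarrow> real\<close> is a large enough sample space. As \<open>l\<close> is an infinite sequence, the definition is
  meant for \<open>m\<close> of infinite total mass.
\<close>

definition scale_decorated_poisson ::
    "real measure \<Rightarrow> 'd measure \<Rightarrow> ('d \<Rightarrow> ereal measure) \<Rightarrow>
     'w measure \<Rightarrow> ('w \<Rightarrow> ereal measure) \<Rightarrow> bool" where
  "scale_decorated_poisson m D P M N \<longleftrightarrow>
     prob_space D \<and> point_process D P \<and>
     (\<exists>(L :: (nat \<Rightarrow> real) measure) l.
        prob_space L \<and> (\<forall>i::nat. l i \<in> L \<rightarrow>\<^sub>M real_pos) \<and>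
        poisson_random_measure L m (\<lambda>\<omega>. distr (count_space UNIV) real_pos (\<lambda>i. l i \<omega>)) \<and>
        distr M (measure_algebra ereal_no0) N =
        distr (L \<Otimes>\<^sub>M (\<Pi>\<^sub>M i\<in>UNIV. D)) (measure_algebra ereal_no0)
          (\<lambda>(\<omega>, \<eta>). superposition ereal_no0 (\<lambda>i. scale_measure_pts (l i \<omega>) (P (\<eta> i)))))"

section \<open>Scaled Laplace functionals\<close>

text \<open>
  Functions on the punctured extended line are total functions whose value at \<open>0\<close> is irrelevant.
\<close>

definition Cc_plus :: "(ereal \<Rightarrow> real) set" where
  "Cc_plus = {f. continuous_on (UNIV - {0}) f \<and> (\<forall>x. x \<noteq> 0 \<longrightarrow> 0 \<le> f x) \<and>
     (\<exists>K. compact K \<and> K \<subseteq> UNIV - {0} \<and> (\<forall>x. x \<noteq> 0 \<and> x \<notin> K \<longrightarrow> f x = 0))}"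

definition scale_fun :: "real \<Rightarrow> (ereal \<Rightarrow> real) \<Rightarrow> ereal \<Rightarrow> real" where
  "scale_fun y f x = f (ereal y * x)"

definition exp_neg :: "ennreal \<Rightarrow> real" where
  "exp_neg t = (if t = \<infinity> then 0 else exp (- enn2real t))"

definition laplace_functional ::
    "'w measure \<Rightarrow> ('w \<Rightarrow> ereal measure) \<Rightarrow> (ereal \<Rightarrow> real) \<Rightarrow> real" where
  "laplace_functional M N f = (\<integral>\<omega>. exp_neg (\<integral>\<^sup>+u. ennreal (f u) \<partial>N \<omega>) \<partial>M)"

definition scaled_laplace_functional ::
    "'w measure \<Rightarrow> ('w \<Rightarrow> ereal measure) \<Rightarrow> (ereal \<Rightarrow> real) \<Rightarrow> real \<Rightarrow> real" where
  "scaled_laplace_functional M N f y = laplace_functional M N (scale_fun (1 / y) f)"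

text \<open>Functions on \<open>(0, \<infinity>)\<close> are likewise total functions, constrained only on the positive half-line.\<close>

definition sc_class :: "(real \<Rightarrow> real) \<Rightarrow> (real \<Rightarrow> real) set" where
  "sc_class g = {f \<in> borel_measurable real_pos. (\<forall>x>0. f x > 0) \<and> (\<exists>y>0. \<forall>x>0. f x = g (y * x))}"

text \<open>
  The constant \<open>c\<^sub>f\<close> ranges over \<open>(0, \<infinity>]\<close>, with \<open>g(\<infinity>)\<close> read as the limit of \<open>g\<close> at infinity. The
  value \<open>\<infinity>\<close> cannot be dispensed with: for \<open>f = 0\<close> (or \<open>f\<close> supported where \<open>N\<close> has no points) the
  scaled Laplace functional is identically \<open>1\<close>, which for \<open>g(x) = exp (-x\<^bsup>-\<alpha>\<^esup>)\<close> is attained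
  only at \<open>\<infinity>\<close>.
\<close>

definition at_infty_ext :: "(real \<Rightarrow> real) \<Rightarrow> ereal \<Rightarrow> real" where
  "at_infty_ext g x = (if x = \<infinity> then Lim at_top g else g (real_of_ereal x))"

text \<open>The representative \<open>g\<close> of the class is immaterial, as rescaling it only rescales \<open>c\<^sub>f\<close>.\<close>

definition scale_uniquely_supported ::
    "'w measure \<Rightarrow> ('w \<Rightarrow> ereal measure) \<Rightarrow> (real \<Rightarrow> real) set \<Rightarrow> bool" where
  "scale_uniquely_supported M N C \<longleftrightarrow>
     (\<exists>g\<in>C. \<forall>f\<in>Cc_plus. \<exists>c::ereal. c > 0 \<and>
        (\<forall>y>0. scaled_laplace_functional M N f y = at_infty_ext g (ereal y * c)))"

definition frechet :: "real \<Rightarrow> real \<Rightarrow> real" where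
  "frechet \<alpha> x = exp (- (x powr (- \<alpha>)))"

end

theory Submission
  imports Defs
begin

text \<open>
  Strict stability says that \<open>t \<mapsto> \<Psi>\<^sub>N(f(t\<^bsup>1/\<alpha>\<^esup> \<cdot>))\<close> is multiplicative, hence equal to \<open>exp(- h(f) t)\<close>,
  which is the scale-unique support property; conversely the latter gives stability because Laplace
  functionals determine laws. For a scale-decorated process \<open>h(f) = \<integral> (1 - \<Psi>\<^sub>P(f(x \<cdot>))) dm\<^sub>\<alpha>(x)\<close>, which
  is homogeneous under scaling of \<open>f\<close>. The main point is to find \<open>P\<close> for a stable \<open>N\<close>. With
  \<open>S\<^sub>t = t\<^bsup>1/\<alpha>\<^esup> N\<close>, the rates \<open>E[G(S\<^sub>t)] / t\<close> converge as \<open>t \<rightarrow> 0\<close> for every bounded measurable \<open>G\<close>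
  depending only on the points outside a neighbourhood of the origin and vanishing if there are none
  (superadditivity). Their limit on configurations whose largest modulus lies in \<open>(1, 2]\<close> is finite;
  normalised, it gives a consistent family of laws of the coordinates of a configuration, hence by
  Kolmogorov extension the law of \<open>P\<close> up to a scale factor.
\<close>

section \<open>Laplace transforms and uniqueness of laws\<close>

text \<open>The object behind the construction is the Levy measure of \<open>N\<close>: the limit,
  off the void configuration, of the law of \<open>S t\<close> divided by t. Stability makes it
  homogeneous under scaling, so sorting configurations by largest modulus should split it into
  m_\<alpha> and a law of shapes. Fixing the largest modulus at exactly 1 would call for a
  disintegration; confining it to a factor-2 window replaces that by a conditional law. The
  imprecision is harmless because l^\<alpha> dm_\<alpha>(l) = \<alpha> dl / l is scale-invariant and
  gives all intervals [s/2, s) the same mass. The remaining obstacle is countable additivity of the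
  limiting rates. The superadditive limit is an infimum over t, so its value at t = 1 bounds it by a
  constant times the law of \<open>S 1\<close>, and domination by a finite measure yields continuity
  at the empty set. Kolmogorov extension works on Polish coordinate spaces, which is why each
  annulus of a configuration is coded by a real sequence.\<close>

lemma exp_neg_bounds: "0 \<le> exp_neg t" "exp_neg t \<le> 1"
  by (auto simp: exp_neg_def)

lemma exp_neg_0[simp]: "exp_neg 0 = 1" and exp_neg_top[simp]: "exp_neg \<infinity> = 0" "exp_neg top = 0"
  by (auto simp: exp_neg_def)

lemma exp_neg_ennreal: "0 \<le> x \<Longrightarrow> exp_neg (ennreal x) = exp (- x)"
  by (auto simp: exp_neg_def)

lemma exp_neg_add: "exp_neg (a + b) = exp_neg a * exp_neg b"
  by (auto simp: exp_neg_def enn2real_plus exp_add[symmetric] less_top)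

lemma exp_neg_sum: "finite I \<Longrightarrow> exp_neg (\<Sum>i\<in>I. f i) = (\<Prod>i\<in>I. exp_neg (f i))"
  by (induction I rule: finite_induct) (auto simp: exp_neg_add)

lemma exp_neg_mono: "a \<le> b \<Longrightarrow> exp_neg b \<le> exp_neg a"
  by (auto simp: exp_neg_def top_unique intro: enn2real_mono simp: less_top)

lemma exp_neg_inj: "exp_neg a = exp_neg b \<longleftrightarrow> a = b"
proof (cases "a = \<infinity> \<or> b = \<infinity>")
  case True then show ?thesis by (auto simp: exp_neg_def)
next
  case False
  then obtain x y where "a = ennreal x" "b = ennreal y" "0 \<le> x" "0 \<le> y"
    by (metis ennreal_cases infinity_ennreal_def)
  then show ?thesis by (simp add: exp_neg_ennreal)
qed

lemma measurable_exp_neg[measurable]: "exp_neg \<in> borel_measurable borel"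
  unfolding exp_neg_def by measurable

lemma tendsto_exp_neg:
  assumes "(f \<longlongrightarrow> x) F" shows "((\<lambda>n. exp_neg (f n)) \<longlongrightarrow> exp_neg x) F"
proof (cases "x = \<infinity>")
  case False
  then have x: "x < top" by (simp add: less_top)
  have "((\<lambda>n. exp (- enn2real (f n))) \<longlongrightarrow> exp (- enn2real x)) F"
    using x assms by (intro tendsto_intros tendsto_enn2real) auto
  moreover have "eventually (\<lambda>n. exp (- enn2real (f n)) = exp_neg (f n)) F"
    using order_tendstoD(2)[OF assms x] by eventually_elim (auto simp: exp_neg_def)
  ultimately have "((\<lambda>n. exp_neg (f n)) \<longlongrightarrow> exp (- enn2real x)) F"
    by (rule Lim_transform_eventually)
  then show ?thesis using False by (simp add: exp_neg_def)
next
  case True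
  show ?thesis unfolding True exp_neg_top
  proof (rule order_tendstoI)
    fix a :: real assume "a < 0" then show "eventually (\<lambda>n. a < exp_neg (f n)) F"
      using exp_neg_bounds(1) by (auto intro!: always_eventually intro: less_le_trans)
  next
    fix a :: real assume a: "0 < a"
    define r where "r = max 0 (- ln a) + 1"
    have "ennreal r < x" using True by simp
    from order_tendstoD(1)[OF assms this] show "eventually (\<lambda>n. exp_neg (f n) < a) F"
    proof eventually_elim
      case (elim n)
      have "exp_neg (f n) \<le> exp_neg (ennreal r)" using elim by (intro exp_neg_mono) auto
      also have "\<dots> = exp (- r)" by (intro exp_neg_ennreal) (auto simp: r_def)
      also have "\<dots> < exp (ln a)" by (auto simp: r_def)
      finally show ?case using a by simp
    qed
  qed
qed

text \<open>The inverse of \<open>exp_neg\<close> on [0, 1]. With the value infinity at 0, an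
  infinite product of factors in [0, 1] can be written as an \<open>ennreal\<close> sum even when
  some factor vanishes.\<close>

definition neg_ln :: "real \<Rightarrow> ennreal" where
  "neg_ln p = (if p \<le> 0 then \<infinity> else ennreal (- ln p))"

lemma measurable_neg_ln[measurable]: "neg_ln \<in> borel_measurable borel"
  unfolding neg_ln_def by measurable

lemma exp_neg_neg_ln: "0 \<le> p \<Longrightarrow> p \<le> 1 \<Longrightarrow> exp_neg (neg_ln p) = p"
  by (auto simp: neg_ln_def exp_neg_ennreal)

lemma neg_ln_exp_neg: "neg_ln (exp_neg x) = x"
  using exp_neg_inj exp_neg_neg_ln exp_neg_bounds by blast

lemma integrable_unit_interval:
  fixes f :: "'a \<Rightarrow> real"
  assumes "finite_measure M" "f \<in> borel_measurable M" "\<And>x. x \<in> space M \<Longrightarrow> 0 \<le> f x \<and> f x \<le> 1"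
  shows "integrable M f"
  using assms by (intro finite_measure.integrable_const_bound[where B=1]) auto

lemma integrable_exp_neg:
  assumes "finite_measure M" "f \<in> borel_measurable M"
  shows "integrable M (\<lambda>x. exp_neg (f x))"
  using assms exp_neg_bounds by (intro integrable_unit_interval) auto

lemma (in prob_space) integral_unit_interval:
  fixes f :: "'a \<Rightarrow> real"
  assumes "f \<in> borel_measurable M" "\<And>x. x \<in> space M \<Longrightarrow> 0 \<le> f x \<and> f x \<le> 1"
  shows "0 \<le> expectation f" "expectation f \<le> 1"
proof -
  show "0 \<le> expectation f" using assms by (intro integral_nonneg_AE) auto
  have "expectation f \<le> (\<integral>x. 1 \<partial>M)"
    using assms by (intro integral_mono integrable_unit_interval) (auto intro: finite_measure_axioms)
  then show "expectation f \<le> 1" by (simp add: prob_space)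
qed

lemma tendsto_integral_unit_interval:
  fixes f :: "nat \<Rightarrow> 'a \<Rightarrow> real"
  assumes "finite_measure M" "\<And>n. f n \<in> borel_measurable M" "g \<in> borel_measurable M"
    "\<And>n x. x \<in> space M \<Longrightarrow> 0 \<le> f n x \<and> f n x \<le> 1"
    "\<And>x. x \<in> space M \<Longrightarrow> (\<lambda>n. f n x) \<longlonglongrightarrow> g x"
  shows "(\<lambda>n. \<integral>x. f n x \<partial>M) \<longlonglongrightarrow> (\<integral>x. g x \<partial>M)"
  using assms by (intro integral_dominated_convergence[where w="\<lambda>_. 1"])
     (auto intro!: AE_I2 simp: finite_measure.integrable_const)

lemma prod_list_unit_interval:
  fixes xs :: "real list"
  assumes "\<And>x. x \<in> set xs \<Longrightarrow> 0 \<le> x \<and> x \<le> 1"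
  shows "0 \<le> prod_list xs \<and> prod_list xs \<le> 1"
  using assms by (induction xs) (auto intro: mult_le_one)

section \<open>From a multiplicative class of functions to equality of laws\<close>

text \<open>Induction on the list with \<open>h\<close> general. Powers of the \<open>f\<close> in
  the head are absorbed into \<open>h\<close>, as \<open>F\<close> is closed under products;
  linearity then covers polynomials in \<open>f\<close>, and uniform approximation on [0, 1] covers
  continuous \<open>g\<close>. The constant 1 is adjoined to \<open>F\<close> as a start value for
  \<open>h\<close>.\<close>

lemma integral_eq_multiplicative:
  fixes F :: "('a \<Rightarrow> real) set"
  assumes AB: "prob_space A" "prob_space B" and sets_eq: "sets A = sets B"
    and F: "\<And>f. f \<in> F \<Longrightarrow> f \<in> borel_measurable A"
      "\<And>f x. f \<in> F \<Longrightarrow> x \<in> space A \<Longrightarrow> 0 \<le> f x \<and> f x \<le> 1"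
    and mult: "\<And>f g. f \<in> F \<Longrightarrow> g \<in> F \<Longrightarrow> (\<lambda>x. f x * g x) \<in> F"
    and eq: "\<And>f. f \<in> F \<Longrightarrow> (\<integral>x. f x \<partial>A) = (\<integral>x. f x \<partial>B)"
    and h: "h \<in> insert (\<lambda>_. 1) F"
    and xs: "\<And>g f. (g, f) \<in> set xs \<Longrightarrow> f \<in> F \<and> continuous_on {0..1} g
      \<and> g \<in> borel_measurable borel \<and> (\<forall>u\<in>{0..1::real}. g u \<in> {0..1::real})"
  shows "(\<integral>x. h x * (\<Prod>(g, f)\<leftarrow>xs. g (f x)) \<partial>A) = (\<integral>x. h x * (\<Prod>(g, f)\<leftarrow>xs. g (f x)) \<partial>B)"
  using h xs
proof (induction xs arbitrary: h)
  case Nil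
  then show ?case using eq prob_space.prob_space[OF AB(1)] prob_space.prob_space[OF AB(2)] by auto
next
  case (Cons gf xs)
  obtain g f where gf: "gf = (g, f)" by (cases gf)
  interpret A: prob_space A by fact
  interpret B: prob_space B by fact
  have sp: "space A = space B" using sets_eq by (rule sets_eq_imp_space_eq)
  have mB: "\<And>u. u \<in> borel_measurable A \<longleftrightarrow> u \<in> borel_measurable B"
    using sets_eq by (simp cong: measurable_cong_sets)
  have g: "f \<in> F" "continuous_on {0..1} g" "g \<in> borel_measurable borel" "\<And>u. u\<in>{0..1} \<Longrightarrow> g u \<in> {0..1}"
    using Cons.prems(2)[of g f] gf by auto
  define q where "q x = (\<Prod>(g, f)\<leftarrow>xs. g (f x))" for x
  have xsI: "f \<in> F \<and> continuous_on {0..1} g \<and> g \<in> borel_measurable borel \<and> (\<forall>u\<in>{0..1}. g u \<in> {0..1})"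
    if "(g, f) \<in> set xs" for g f using Cons.prems(2)[of g f] that by auto
  have q[measurable]: "q \<in> borel_measurable A"
    unfolding q_def using xsI
  proof (induction xs)
    case (Cons a xs)
    obtain g f where a: "a = (g, f)" by (cases a)
    have "f \<in> borel_measurable A" "g \<in> borel_measurable borel" using Cons.prems[of g f] a F by auto
    then have [measurable]: "(\<lambda>x. g (f x)) \<in> borel_measurable A" by measurable
    have [measurable]: "(\<lambda>x. \<Prod>(g, f)\<leftarrow>xs. g (f x)) \<in> borel_measurable A"
      using Cons by auto
    show ?case by (simp add: a)
  qed simp
  have q01: "0 \<le> q x \<and> q x \<le> 1" if "x \<in> space A" for x
    unfolding q_def using xsI F(2)[OF _ that] by (intro prod_list_unit_interval) fastforce
  have hmeas: "h' \<in> borel_measurable A" and h01: "\<And>x. x \<in> space A \<Longrightarrow> 0 \<le> h' x \<and> h' x \<le> 1"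
    if "h' \<in> insert (\<lambda>_. 1) F" for h' using that F by auto
  have fm[measurable]: "f \<in> borel_measurable A" "h \<in> borel_measurable A" "g \<in> borel_measurable borel"
    using F(1)[OF g(1)] hmeas[OF Cons.prems(1)] g(3) by auto
  have f01: "x \<in> space A \<Longrightarrow> f x \<in> {0..1}" for x using F(2)[OF g(1), of x] by auto
  \<comment> \<open>For \<open>h\<close> = 1 and i = 0 the product is the constant 1, which
    \<open>F\<close> may lack; from i = 1 on it lies in \<open>F\<close>.\<close>
  have pow: "(\<lambda>x. h x * f x ^ i) \<in> insert (\<lambda>_. 1) F" for i
  proof (induction i)
    case 0 then show ?case using Cons.prems(1) by auto
  next
    case (Suc i)
    from Suc have "(\<lambda>x. (h x * f x ^ i) * f x) \<in> F"
    proof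
      assume "(\<lambda>x. h x * f x ^ i) = (\<lambda>_. 1)"
      from fun_cong[OF this] have "h x * f x ^ i * f x = f x" for x by simp
      then have "(\<lambda>x. (h x * f x ^ i) * f x) = f" by (rule ext)
      then show ?thesis using g(1) by simp
    qed (use mult[of "\<lambda>x. h x * f x ^ i" f] g(1) in auto)
    then show ?case by (simp add: mult_ac)
  qed
  have hq: "0 \<le> h x * q x \<and> h x * q x \<le> 1" if "x \<in> space A" for x
    using q01[OF that] h01[OF Cons.prems(1) that] by (auto intro: mult_le_one)
  have IH: "(\<integral>x. (h x * f x ^ i) * q x \<partial>A) = (\<integral>x. (h x * f x ^ i) * q x \<partial>B)" for i
    using Cons.IH[OF pow xsI] unfolding q_def .
  have pow01: "0 \<le> h x * f x ^ i * q x \<and> h x * f x ^ i * q x \<le> 1" if "x \<in> space A" for x i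
    using q01[OF that] h01[OF pow that] by (auto intro: mult_le_one)
  have int_pow: "integrable A (\<lambda>x. (h x * f x ^ i) * q x)" "integrable B (\<lambda>x. (h x * f x ^ i) * q x)" for i
    using pow01 by (auto intro!: integrable_unit_interval A.finite_measure_axioms B.finite_measure_axioms
        simp: sp[symmetric] mB[symmetric])
  have gm: "(\<lambda>x. h x * q x * g (f x)) \<in> borel_measurable A" by measurable
  have g01: "0 \<le> h x * q x * g (f x) \<and> h x * q x * g (f x) \<le> 1" if "x \<in> space A" for x
    using hq[OF that] g(4)[OF f01[OF that]] by (auto intro: mult_le_one)
  have int_g: "integrable A (\<lambda>x. h x * q x * g (f x))" "integrable B (\<lambda>x. h x * q x * g (f x))"
    using g01 gm by (auto intro!: integrable_unit_interval A.finite_measure_axioms B.finite_measure_axioms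
        simp: sp[symmetric] mB[symmetric])
  \<comment> \<open>The polynomial integrals agree under both laws; replacing \<open>g\<close> by
    the polynomial costs at most e under each of them, as the other factors are bounded by
    1.\<close>
  have close: "\<bar>(\<integral>x. h x * q x * g (f x) \<partial>A) - (\<integral>x. h x * q x * g (f x) \<partial>B)\<bar> \<le> 2 * e" if "e > 0" for e
  proof -
    obtain p where p: "real_polynomial_function p" "\<And>u. u \<in> {0..1} \<Longrightarrow> \<bar>g u - p u\<bar> < e"
      using Stone_Weierstrass_real_polynomial_function[OF _ g(2) \<open>e > 0\<close>] by auto
    then obtain a n where pa: "p = (\<lambda>x. \<Sum>i\<le>n. a i * x ^ i)"
      using real_polynomial_function_iff_sum by blast
    have pe: "h x * q x * p (f x) = (\<Sum>i\<le>n. a i * (h x * f x ^ i * q x))" for x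
      unfolding pa by (simp add: sum_distrib_left mult_ac)
    have eqp: "(\<integral>x. h x * q x * p (f x) \<partial>A) = (\<integral>x. h x * q x * p (f x) \<partial>B)"
      unfolding pe using int_pow IH by (subst (1 2) Bochner_Integration.integral_sum) auto
    have int_p: "integrable A (\<lambda>x. h x * q x * p (f x))" "integrable B (\<lambda>x. h x * q x * p (f x))"
      unfolding pe using int_pow by auto
    have near: "\<bar>h x * q x * g (f x) - h x * q x * p (f x)\<bar> \<le> e" if "x \<in> space A" for x
    proof -
      have "\<bar>h x * q x * g (f x) - h x * q x * p (f x)\<bar> = (h x * q x) * \<bar>g (f x) - p (f x)\<bar>"
        using hq[OF that] by (simp only: right_diff_distrib[symmetric] abs_mult[of "h x * q x"] abs_of_nonneg)
      also have "\<dots> \<le> 1 * e" using hq[OF that] p(2)[OF f01[OF that]] by (intro mult_mono) auto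
      finally show ?thesis by simp
    qed
    have diff: "\<bar>(\<integral>x. u x \<partial>D) - (\<integral>x. v x \<partial>D)\<bar> \<le> e"
      if "prob_space D" "integrable D u" "integrable D v" "\<And>x. x \<in> space D \<Longrightarrow> \<bar>u x - v x\<bar> \<le> e"
      for D :: "'a measure" and u v :: "'a \<Rightarrow> real"
    proof -
      interpret prob_space D by fact
      have "\<bar>\<integral>x. u x - v x \<partial>D\<bar> \<le> (\<integral>x. e \<partial>D)"
        using that by (intro order_trans[OF integral_abs_bound] integral_mono) auto
      then show ?thesis using that(2,3) by (simp add: prob_space)
    qed
    have "\<bar>(\<integral>x. h x * q x * g (f x) \<partial>A) - (\<integral>x. h x * q x * p (f x) \<partial>A)\<bar> \<le> e"
      using int_g(1) int_p(1) near by (intro diff AB) auto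
    moreover have "\<bar>(\<integral>x. h x * q x * g (f x) \<partial>B) - (\<integral>x. h x * q x * p (f x) \<partial>B)\<bar> \<le> e"
      using int_g(2) int_p(2) near by (intro diff AB) (auto simp: sp)
    ultimately show ?thesis using eqp by linarith
  qed
  have "(\<integral>x. h x * q x * g (f x) \<partial>A) = (\<integral>x. h x * q x * g (f x) \<partial>B)"
  proof (rule ccontr)
    assume "\<not> ?thesis"
    then have "\<bar>(\<integral>x. h x * q x * g (f x) \<partial>A) - (\<integral>x. h x * q x * g (f x) \<partial>B)\<bar> > 0" (is "?d > 0") by simp
    with close[of "?d / 4"] show False by simp
  qed
  then show ?case by (simp add: gf q_def[symmetric] mult_ac)
qed

text \<open>
  Multiplicativity lets one replace, factor by factor, the powers of the generating functions by
  arbitrary continuous functions of them (Weierstrass), and hence by indicators of half-lines.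
\<close>

proposition measure_eqI_multiplicative:
  fixes F :: "('a \<Rightarrow> real) set"
  assumes AB: "prob_space A" "prob_space B" and sets_eq: "sets A = sets B"
    and F: "\<And>f. f \<in> F \<Longrightarrow> f \<in> borel_measurable A"
      "\<And>f x. f \<in> F \<Longrightarrow> x \<in> space A \<Longrightarrow> 0 \<le> f x \<and> f x \<le> 1"
    and mult: "\<And>f g. f \<in> F \<Longrightarrow> g \<in> F \<Longrightarrow> (\<lambda>x. f x * g x) \<in> F"
    and eq: "\<And>f. f \<in> F \<Longrightarrow> (\<integral>x. f x \<partial>A) = (\<integral>x. f x \<partial>B)"
    and gen: "\<And>G. space G = space A \<Longrightarrow> (\<And>f. f \<in> F \<Longrightarrow> f \<in> borel_measurable G) \<Longrightarrow> sets A \<subseteq> sets G"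
  shows "A = B"
proof -
  interpret A: prob_space A by fact
  interpret B: prob_space B by fact
  have sp: "space A = space B" using sets_eq by (rule sets_eq_imp_space_eq)
  have mB: "\<And>u. u \<in> borel_measurable A \<longleftrightarrow> u \<in> borel_measurable B"
    using sets_eq by (simp cong: measurable_cong_sets)
  \<comment> \<open>Finite intersections of sets c < f: concatenating lists intersects them, and the
    empty list gives the whole space.\<close>
  define S where "S xs = {x \<in> space A. \<forall>(f, c)\<in>set xs. c < f x}" for xs :: "(('a \<Rightarrow> real) \<times> real) list"
  define E where "E = {S xs | xs. \<forall>(f, c)\<in>set xs. f \<in> F}"
  have S_sets: "S xs \<in> sets A" if "\<forall>(f, c)\<in>set xs. f \<in> F" for xs
  proof -
    have "S xs = space A \<inter> (\<Inter>(f, c)\<in>set xs. {x \<in> space A. c < f x})" by (auto simp: S_def)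
    also have "\<dots> \<in> sets A" using that F(1)
      by (cases "xs = []") (auto intro!: sets.Int sets.finite_INT borel_measurable_less)
    finally show ?thesis .
  qed
  have S_append: "S (xs @ ys) = S xs \<inter> S ys" for xs ys by (auto simp: S_def)
  \<comment> \<open>Continuous ramps increasing to the indicator of c < u; they carry the statement
    on continuous factors over to indicators.\<close>
  define \<phi> where "\<phi> n c u = min 1 (real n * max 0 (u - c))" for n :: nat and c u :: real
  have \<phi>_lim: "(\<lambda>n. \<phi> n c u) \<longlonglongrightarrow> (if c < u then 1 else 0)" for c u
  proof (cases "c < u")
    case True
    obtain N :: nat where N: "1 / (u - c) < real N" using reals_Archimedean2 by blast
    have "\<phi> n c u = 1" if "n \<ge> N" for n
    proof -
      have "1 < real N * (u - c)" using N True by (simp add: field_simps)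
      also have "\<dots> \<le> real n * (u - c)" using that True by (intro mult_right_mono) auto
      finally show ?thesis using True by (auto simp: \<phi>_def)
    qed
    then show ?thesis using True by (auto intro!: tendsto_eventually eventually_sequentiallyI)
  qed (auto simp: \<phi>_def)
  have meas: "measure A (S xs) = measure B (S xs)" if xs: "\<forall>(f, c)\<in>set xs. f \<in> F" for xs
  proof -
    define g where "g n x = (\<Prod>(f, c)\<leftarrow>xs. \<phi> n c (f x))" for n x
    have g_eq: "g n x = 1 * (\<Prod>(g, f)\<leftarrow>map (\<lambda>(f, c). (\<phi> n c, f)) xs. g (f x))" for n x
      by (simp add: g_def o_def case_prod_unfold)
    have g_lim: "(\<lambda>n. g n x) \<longlonglongrightarrow> indicator (S xs) x" if "x \<in> space A" for x
      using that unfolding g_def S_def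
    proof (induction xs)
      case (Cons a xs)
      obtain f c where a: "a = (f, c)" by (cases a)
      have "indicator {x \<in> space A. \<forall>(f, c)\<in>set (a # xs). c < f x} x =
        (if c < f x then 1 else 0) * (indicator {x \<in> space A. \<forall>(f, c)\<in>set xs. c < f x} x :: real)"
        using Cons.prems by (auto simp: a indicator_def)
      then show ?case using tendsto_mult[OF \<phi>_lim[of c "f x"] Cons.IH[OF Cons.prems]]
        unfolding a list.map prod_list.Cons prod.case by (simp only:)
    qed simp
    have gm: "g n \<in> borel_measurable A" for n
      unfolding g_def using xs
    proof (induction xs)
      case (Cons a xs)
      obtain f c where a: "a = (f, c)" by (cases a)
      have [measurable]: "f \<in> borel_measurable A" using Cons.prems a F by auto
      have "(\<lambda>x. \<phi> n c (f x)) \<in> borel_measurable A" unfolding \<phi>_def by measurable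
      from borel_measurable_times[OF this, of "\<lambda>x. \<Prod>(f, c)\<leftarrow>xs. \<phi> n c (f x)"] show ?case
        using Cons by (simp add: a)
    qed simp
    have g01: "0 \<le> g n x \<and> g n x \<le> 1" for n x
      unfolding g_def by (intro prod_list_unit_interval) (auto simp: \<phi>_def)
    have limA: "(\<lambda>n. \<integral>x. g n x \<partial>A) \<longlonglongrightarrow> (\<integral>x. indicator (S xs) x \<partial>A)"
      using gm g01 g_lim S_sets[OF xs] by (intro tendsto_integral_unit_interval A.finite_measure_axioms) auto
    have limB: "(\<lambda>n. \<integral>x. g n x \<partial>B) \<longlonglongrightarrow> (\<integral>x. indicator (S xs) x \<partial>B)"
      using gm g01 g_lim S_sets[OF xs]
      by (intro tendsto_integral_unit_interval B.finite_measure_axioms) (auto simp: sp mB[symmetric] sets_eq[symmetric])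
    have g_AB: "(\<integral>x. g n x \<partial>A) = (\<integral>x. g n x \<partial>B)" for n
      unfolding g_eq
    proof (rule integral_eq_multiplicative[OF AB sets_eq, where h="\<lambda>_. 1" and F=F])
      fix g f assume "(g, f) \<in> set (map (\<lambda>(f, c). (\<phi> n c, f)) xs)"
      then obtain c where "(f, c) \<in> set xs" and g: "g = \<phi> n c" by auto
      then have "f \<in> F" using xs by auto
      then show "f \<in> F \<and> continuous_on {0..1} g \<and> g \<in> borel_measurable borel \<and> (\<forall>u\<in>{0..1}. g u \<in> {0..1})"
        unfolding g \<phi>_def by (auto intro!: continuous_intros)
    qed (use F mult eq in auto)
    have "(\<integral>x. indicator (S xs) x \<partial>A) = (\<integral>x. indicator (S xs) x \<partial>B :: real)"
      by (rule LIMSEQ_unique[OF limA]) (use limB in \<open>simp add: g_AB\<close>)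
    moreover have "S xs \<subseteq> space A" by (auto simp: S_def)
    ultimately show ?thesis by (simp add: Int_absorb2 sp)
  qed
  have "S [] = space A" by (simp add: S_def)
  have sub: "E \<subseteq> Pow (space A)" by (auto simp: E_def S_def)
  have gE: "sets A = sigma_sets (space A) E"
  proof
    \<comment> \<open>\<open>gen\<close> is applied to the sigma-algebra generated by
      \<open>E\<close>, for which every member of \<open>F\<close> is measurable because its open
      superlevel sets lie in \<open>E\<close>.\<close>
    have "sets A \<subseteq> sets (sigma (space A) E)"
    proof (rule gen)
      fix f assume f: "f \<in> F"
      have "{x \<in> space A. c < f x} \<in> E" for c
        unfolding E_def using f by (intro CollectI exI[of _ "[(f, c)]"]) (auto simp: S_def)
      then show "f \<in> borel_measurable (sigma (space A) E)"
        using sub by (intro borel_measurableI_greater) (auto simp: sets_measure_of space_measure_of)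
    qed (use sub in \<open>simp add: space_measure_of\<close>)
    then show "sets A \<subseteq> sigma_sets (space A) E" using sub by simp
    show "sigma_sets (space A) E \<subseteq> sets A"
      using S_sets by (intro sets.sigma_sets_subset) (auto simp: E_def)
  qed
  show ?thesis
  proof (rule measure_eqI_generator_eq[where A="\<lambda>_. space A" and E=E and \<Omega>="space A"])
    show "Int_stable E"
    proof (rule Int_stableI)
      fix a b assume "a \<in> E" "b \<in> E"
      then obtain xs ys where "a = S xs" "\<forall>(f, c)\<in>set xs. f \<in> F" "b = S ys" "\<forall>(f, c)\<in>set ys. f \<in> F"
        unfolding E_def by blast
      then show "a \<inter> b \<in> E" unfolding E_def
        by (intro CollectI exI[of _ "xs @ ys"]) (auto simp: S_append)
    qed
    show "emeasure A X = emeasure B X" if "X \<in> E" for X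
      using that meas by (auto simp: E_def A.emeasure_eq_measure B.emeasure_eq_measure)
    show "range (\<lambda>_. space A) \<subseteq> E"
      unfolding E_def using \<open>S [] = space A\<close> by (auto intro!: exI[of _ "[]"])
  qed (use gE sub sets_eq in auto)
qed

section \<open>Random measures\<close>

lemma space_measure_algebra: "space (measure_algebra K) = {\<mu>. sets \<mu> = sets K}"
  unfolding measure_algebra_def space_Sup_eq_UN by (auto simp: space_vimage_algebra)

lemma measurable_emeasure_measure_algebra:
  assumes "A \<in> sets K" shows "(\<lambda>\<mu>. emeasure \<mu> A) \<in> borel_measurable (measure_algebra K)"
  unfolding measure_algebra_def
  by (rule measurable_SUP1[OF assms measurable_vimage_algebra1]) auto

lemma measurable_measure_algebraI:
  assumes "\<And>x. x \<in> space M \<Longrightarrow> sets (f x) = sets K"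
    "\<And>A. A \<in> sets K \<Longrightarrow> (\<lambda>x. emeasure (f x) A) \<in> borel_measurable M"
  shows "f \<in> M \<rightarrow>\<^sub>M measure_algebra K"
  unfolding measure_algebra_def
  by (rule measurable_SUP2) (use assms in \<open>auto intro!: measurable_vimage_algebra2\<close>)

lemma measurable_measure_algebraD:
  assumes "f \<in> M \<rightarrow>\<^sub>M measure_algebra K"
  shows "x \<in> space M \<Longrightarrow> sets (f x) = sets K"
    and "A \<in> sets K \<Longrightarrow> (\<lambda>x. emeasure (f x) A) \<in> borel_measurable M"
  using measurable_space[OF assms] measurable_compose[OF assms measurable_emeasure_measure_algebra]
  by (auto simp: space_measure_algebra)

lemma measurable_nn_integral_measure_algebra:
  assumes "f \<in> borel_measurable K"
  shows "(\<lambda>\<mu>. \<integral>\<^sup>+x. f x \<partial>\<mu>) \<in> borel_measurable (measure_algebra K)"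
  using assms
proof (induction rule: borel_measurable_induct)
  case (cong f g)
  have "(\<integral>\<^sup>+x. f x \<partial>\<mu>) = (\<integral>\<^sup>+x. g x \<partial>\<mu>)" if "\<mu> \<in> space (measure_algebra K)" for \<mu>
    using that cong(3) by (intro nn_integral_cong) (auto simp: space_measure_algebra dest: sets_eq_imp_space_eq)
  with cong(4) show ?case by (simp cong: measurable_cong)
next
  case (set A)
  then have "(\<integral>\<^sup>+x. indicator A x \<partial>\<mu>) = emeasure \<mu> A" if "\<mu> \<in> space (measure_algebra K)" for \<mu>
    using that by (auto simp: space_measure_algebra)
  with measurable_emeasure_measure_algebra[OF set] show ?case by (simp cong: measurable_cong)
next
  case (mult u c)
  then have "(\<integral>\<^sup>+x. c * u x \<partial>\<mu>) = c * (\<integral>\<^sup>+x. u x \<partial>\<mu>)" if "\<mu> \<in> space (measure_algebra K)" for \<mu>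
    using that by (intro nn_integral_cmult) (auto simp: space_measure_algebra cong: measurable_cong_sets)
  with mult show ?case by (simp cong: measurable_cong)
next
  case (add u v)
  then have "(\<integral>\<^sup>+x. v x + u x \<partial>\<mu>) = (\<integral>\<^sup>+x. v x \<partial>\<mu>) + (\<integral>\<^sup>+x. u x \<partial>\<mu>)"
    if "\<mu> \<in> space (measure_algebra K)" for \<mu>
    using that by (intro nn_integral_add) (auto simp: space_measure_algebra cong: measurable_cong_sets)
  with add show ?case by (simp cong: measurable_cong)
next
  case (seq U)
  then have "(\<integral>\<^sup>+x. (SUP i. U i) x \<partial>\<mu>) = (SUP i. \<integral>\<^sup>+x. U i x \<partial>\<mu>)"
    if "\<mu> \<in> space (measure_algebra K)" for \<mu>
    unfolding SUP_apply
    using that by (intro nn_integral_monotone_convergence_SUP) (auto simp: space_measure_algebra cong: measurable_cong_sets)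
  with seq show ?case by (simp cong: measurable_cong)
qed

lemma measurable_nn_integral_random_measure:
  assumes "N \<in> M \<rightarrow>\<^sub>M measure_algebra K" "f \<in> borel_measurable K"
  shows "(\<lambda>\<omega>. \<integral>\<^sup>+x. f x \<partial>N \<omega>) \<in> borel_measurable M"
  using measurable_compose[OF assms(1) measurable_nn_integral_measure_algebra[OF assms(2)]] .

lemma sets_superpose[simp]: "sets (superpose \<mu> \<nu>) = sets \<mu>"
  by (simp add: superpose_def)

lemma sets_superposition[simp]: "sets (superposition K \<mu>) = sets K"
  by (simp add: superposition_def)

lemma suminf_ennreal_SUP:
  fixes f :: "nat \<Rightarrow> nat \<Rightarrow> ennreal"
  assumes "\<And>i. incseq (f i)"
  shows "(\<Sum>i. SUP k. f i k) = (SUP k. \<Sum>i. f i k)"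
  using nn_integral_monotone_convergence_SUP[of "\<lambda>k i. f i k" "count_space UNIV"] assms
  by (simp add: nn_integral_count_space_nat incseq_def le_fun_def)

lemma nn_integral_superposition:
  assumes \<mu>: "\<And>i. sets (\<mu> i) = sets K" and f: "f \<in> borel_measurable K"
  shows "(\<integral>\<^sup>+x. f x \<partial>superposition K \<mu>) = (\<Sum>i. \<integral>\<^sup>+x. f x \<partial>\<mu> i)"
  using f
proof (induction rule: borel_measurable_induct)
  case (cong f g)
  have sp: "space (superposition K \<mu>) = space K" "\<And>i. space (\<mu> i) = space K"
    by (intro sets_eq_imp_space_eq; use \<mu> in simp)+
  have "(\<integral>\<^sup>+x. f x \<partial>superposition K \<mu>) = (\<integral>\<^sup>+x. g x \<partial>superposition K \<mu>)"
    "\<And>i. (\<integral>\<^sup>+x. f x \<partial>\<mu> i) = (\<integral>\<^sup>+x. g x \<partial>\<mu> i)"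
    by (intro nn_integral_cong; use cong(3) sp in simp)+
  note eqs = this
  show ?case unfolding eqs by (rule cong(4))
next
  case (set A)
  then show ?case by (simp add: \<mu> emeasure_superposition)
next
  case (mult u c)
  then have "u \<in> borel_measurable (\<mu> i)" "u \<in> borel_measurable (superposition K \<mu>)" for i
    using \<mu> by (auto cong: measurable_cong_sets)
  with mult show ?case by (simp add: nn_integral_cmult)
next
  case (add u v)
  then have "u \<in> borel_measurable (\<mu> i)" "u \<in> borel_measurable (superposition K \<mu>)"
     "v \<in> borel_measurable (\<mu> i)" "v \<in> borel_measurable (superposition K \<mu>)" for i
    using \<mu> by (auto cong: measurable_cong_sets)
  with add show ?case by (simp add: nn_integral_add suminf_add)
next
  case (seq U)
  then have [measurable]: "U k \<in> borel_measurable (\<mu> i)" "U k \<in> borel_measurable (superposition K \<mu>)" for i k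
    using \<mu> by (auto cong: measurable_cong_sets)
  have "(\<integral>\<^sup>+x. (SUP i. U i) x \<partial>\<nu>) = (SUP i. \<integral>\<^sup>+x. U i x \<partial>\<nu>)"
    if "\<And>k. U k \<in> borel_measurable \<nu>" for \<nu>
    unfolding SUP_apply using that seq by (intro nn_integral_monotone_convergence_SUP) auto
  moreover have "incseq (\<lambda>k. \<integral>\<^sup>+x. U k x \<partial>\<mu> i)" for i
    using seq by (auto intro!: nn_integral_mono simp: incseq_def le_fun_def)
  ultimately show ?case using seq by (simp add: suminf_ennreal_SUP)
qed

text \<open>Two summands are a countable superposition padded with null measures, which reduces the
  claim to the formula for sequences.\<close>

lemma nn_integral_superpose:
  assumes "sets \<mu> = sets K" "sets \<nu> = sets K" "f \<in> borel_measurable K"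
  shows "(\<integral>\<^sup>+x. f x \<partial>superpose \<mu> \<nu>) = (\<integral>\<^sup>+x. f x \<partial>\<mu>) + (\<integral>\<^sup>+x. f x \<partial>\<nu>)"
proof -
  define \<kappa> where "\<kappa> i = (if i = 0 then \<mu> else if i = Suc 0 then \<nu> else null_measure K)" for i
  have \<kappa>: "\<kappa> 0 = \<mu>" "\<kappa> (Suc 0) = \<nu>" "\<And>i. i \<notin> {0, Suc 0} \<Longrightarrow> \<kappa> i = null_measure K" "sets (\<kappa> i) = sets K" for i
    using assms by (auto simp: \<kappa>_def)
  have two: "(\<Sum>i. F (\<kappa> i)) = F \<mu> + F \<nu>" if "F (null_measure K) = 0" for F :: "'a measure \<Rightarrow> ennreal"
    using suminf_finite[of "{0, Suc 0}" "\<lambda>i. F (\<kappa> i)"] that \<kappa> by simp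
  have "superpose \<mu> \<nu> = superposition K \<kappa>"
  proof (rule measure_eqI)
    fix A assume "A \<in> sets (superpose \<mu> \<nu>)"
    then have A: "A \<in> sets \<mu>" by simp
    have "emeasure (superpose \<mu> \<nu>) A = emeasure \<mu> A + emeasure \<nu> A"
      using assms A by (intro emeasure_superpose) auto
    also have "\<dots> = (\<Sum>i. emeasure (\<kappa> i) A)" by (rule two[symmetric]) simp
    also have "\<dots> = emeasure (superposition K \<kappa>) A"
      using A assms(1) \<kappa>(4) by (intro emeasure_superposition[symmetric]) auto
    finally show "emeasure (superpose \<mu> \<nu>) A = emeasure (superposition K \<kappa>) A" .
  qed (simp add: assms)
  then have "(\<integral>\<^sup>+x. f x \<partial>superpose \<mu> \<nu>) = (\<Sum>i. \<integral>\<^sup>+x. f x \<partial>\<kappa> i)"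
    using \<kappa>(4) assms(3) by (simp add: nn_integral_superposition)
  also have "\<dots> = (\<integral>\<^sup>+x. f x \<partial>\<mu>) + (\<integral>\<^sup>+x. f x \<partial>\<nu>)"
    by (rule two) (simp add: nn_integral_null_measure)
  finally show ?thesis .
qed

lemma measurable_superpose:
  assumes "f \<in> M \<rightarrow>\<^sub>M measure_algebra K" "g \<in> M \<rightarrow>\<^sub>M measure_algebra K"
  shows "(\<lambda>\<omega>. superpose (f \<omega>) (g \<omega>)) \<in> M \<rightarrow>\<^sub>M measure_algebra K"
proof (rule measurable_measure_algebraI)
  note D = measurable_measure_algebraD[OF assms(1)] measurable_measure_algebraD[OF assms(2)]
  fix A assume A: "A \<in> sets K"
  have "emeasure (superpose (f \<omega>) (g \<omega>)) A = emeasure (f \<omega>) A + emeasure (g \<omega>) A" if "\<omega> \<in> space M" for \<omega>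
    using that D A by (intro emeasure_superpose) auto
  with D A show "(\<lambda>\<omega>. emeasure (superpose (f \<omega>) (g \<omega>)) A) \<in> borel_measurable M"
    by (simp cong: measurable_cong)
qed (use measurable_measure_algebraD[OF assms(1)] in simp)

lemma measurable_superposition:
  assumes "\<And>i. f i \<in> M \<rightarrow>\<^sub>M measure_algebra K"
  shows "(\<lambda>\<omega>. superposition K (\<lambda>i. f i \<omega>)) \<in> M \<rightarrow>\<^sub>M measure_algebra K"
proof (rule measurable_measure_algebraI)
  note D = measurable_measure_algebraD[OF assms]
  fix A assume A: "A \<in> sets K"
  have "emeasure (superposition K (\<lambda>i. f i \<omega>)) A = (\<Sum>i. emeasure (f i \<omega>) A)" if "\<omega> \<in> space M" for \<omega>
    using that D A by (intro emeasure_superposition) auto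
  with D A show "(\<lambda>\<omega>. emeasure (superposition K (\<lambda>i. f i \<omega>)) A) \<in> borel_measurable M"
    by (simp cong: measurable_cong)
qed simp

text \<open>The test functions are \<open>ennreal\<close>-valued so that they may be infinite:
  infinity times an indicator turns the Laplace functional into a void probability.\<close>

definition LF :: "'w measure \<Rightarrow> ('w \<Rightarrow> 'a measure) \<Rightarrow> ('a \<Rightarrow> ennreal) \<Rightarrow> real" where
  "LF M N f = (\<integral>\<omega>. exp_neg (\<integral>\<^sup>+u. f u \<partial>N \<omega>) \<partial>M)"

lemma (in prob_space) LF_bounds:
  assumes "N \<in> M \<rightarrow>\<^sub>M measure_algebra K" "f \<in> borel_measurable K"
  shows "0 \<le> LF M N f" "LF M N f \<le> 1"
proof -
  note [measurable] = measurable_nn_integral_random_measure[OF assms]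
  show "0 \<le> LF M N f" "LF M N f \<le> 1"
    unfolding LF_def by (intro integral_unit_interval; use exp_neg_bounds in simp)+
qed

lemma LF_distr:
  assumes "N \<in> M \<rightarrow>\<^sub>M measure_algebra K" "f \<in> borel_measurable K"
  shows "LF (distr M (measure_algebra K) N) (\<lambda>\<mu>. \<mu>) f = LF M N f"
  unfolding LF_def using assms
  by (subst integral_distr) (auto intro!: measurable_compose[OF measurable_nn_integral_measure_algebra])

lemma LF_eq_if_distr_eq:
  assumes "N \<in> M \<rightarrow>\<^sub>M measure_algebra K" "N' \<in> M' \<rightarrow>\<^sub>M measure_algebra K"
    "distr M (measure_algebra K) N = distr M' (measure_algebra K) N'" "f \<in> borel_measurable K"
  shows "LF M N f = LF M' N' f"
  using LF_distr[OF assms(1,4)] LF_distr[OF assms(2,4)] assms(3) by simp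

text \<open>
  The sample points may be confined to a set of measures \<open>S\<close>, on which the integrals of the test
  functions need to generate the \<open>\<sigma>\<close>-algebra.
\<close>

lemma distr_eq_if_LF_eq_on:
  assumes M: "prob_space M" "prob_space M'"
    and N: "N \<in> M \<rightarrow>\<^sub>M measure_algebra K" "N' \<in> M' \<rightarrow>\<^sub>M measure_algebra K"
    and S: "S \<in> sets (measure_algebra K)" "\<And>\<omega>. \<omega> \<in> space M \<Longrightarrow> N \<omega> \<in> S" "\<And>\<omega>. \<omega> \<in> space M' \<Longrightarrow> N' \<omega> \<in> S"
    and C: "\<And>f. f \<in> C \<Longrightarrow> f \<in> borel_measurable K" "\<And>f g. f \<in> C \<Longrightarrow> g \<in> C \<Longrightarrow> (\<lambda>x. f x + g x) \<in> C"
    and eq: "\<And>f. f \<in> C \<Longrightarrow> LF M N f = LF M' N' f"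
    and gen: "\<And>G A. space G = S \<Longrightarrow> (\<And>f. f \<in> C \<Longrightarrow> (\<lambda>\<mu>. \<integral>\<^sup>+x. f x \<partial>\<mu>) \<in> borel_measurable G)
       \<Longrightarrow> A \<in> sets K \<Longrightarrow> (\<lambda>\<mu>. emeasure \<mu> A) \<in> borel_measurable G"
  shows "distr M (measure_algebra K) N = distr M' (measure_algebra K) N'"
proof -
  let ?R = "restrict_space (measure_algebra K) S"
  have SK: "S \<subseteq> {\<mu>. sets \<mu> = sets K}"
    using sets.sets_into_space[OF S(1)] by (simp add: space_measure_algebra)
  have spR: "space ?R = S" using SK by (auto simp: space_restrict_space space_measure_algebra)
  have NR: "N \<in> M \<rightarrow>\<^sub>M ?R" "N' \<in> M' \<rightarrow>\<^sub>M ?R"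
    using N S by (auto intro!: measurable_restrict_space2)
  have int: "(\<lambda>\<mu>. \<integral>\<^sup>+x. f x \<partial>\<mu>) \<in> borel_measurable ?R" if "f \<in> C" for f
    using measurable_nn_integral_measure_algebra[OF C(1)[OF that]] by (rule measurable_restrict_space1)
  \<comment> \<open>Equality is asked only on \<open>S\<close>: elsewhere the integral need not be
    additive in the test function, and products would leave the class.\<close>
  define F where "F = {\<phi>. \<exists>f\<in>C. \<forall>\<mu>\<in>S. \<phi> \<mu> = exp_neg (\<integral>\<^sup>+x. f x \<partial>\<mu>)}"
  have F_meas: "\<phi> \<in> borel_measurable ?R" if \<phi>: "\<phi> \<in> F" for \<phi>
  proof -
    obtain f where f: "f \<in> C" "\<forall>\<mu>\<in>S. \<phi> \<mu> = exp_neg (\<integral>\<^sup>+x. f x \<partial>\<mu>)" using \<phi> unfolding F_def by blast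
    note [measurable] = int[OF f(1)]
    have "(\<lambda>\<mu>. exp_neg (\<integral>\<^sup>+x. f x \<partial>\<mu>)) \<in> borel_measurable ?R" by measurable
    then show ?thesis using f(2) spR measurable_cong[of ?R \<phi>] by simp
  qed
  have "distr M ?R N = distr M' ?R N'"
  proof (rule measure_eqI_multiplicative[where F=F])
    show "prob_space (distr M ?R N)" "prob_space (distr M' ?R N')"
      using M NR by (auto intro: prob_space.prob_space_distr)
    fix \<phi> assume \<phi>: "\<phi> \<in> F"
    then obtain f where f: "f \<in> C" "\<forall>\<mu>\<in>S. \<phi> \<mu> = exp_neg (\<integral>\<^sup>+x. f x \<partial>\<mu>)" unfolding F_def by blast
    show "\<phi> \<in> borel_measurable (distr M ?R N)" using F_meas[OF \<phi>] by simp
    have "(\<integral>x. \<phi> x \<partial>distr M ?R N) = LF M N f" "(\<integral>x. \<phi> x \<partial>distr M' ?R N') = LF M' N' f"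
      using f(2) S(2,3) F_meas[OF \<phi>] NR
      by (auto simp: integral_distr LF_def intro!: Bochner_Integration.integral_cong)
    then show "(\<integral>x. \<phi> x \<partial>distr M ?R N) = (\<integral>x. \<phi> x \<partial>distr M' ?R N')"
      using eq[OF f(1)] by simp
    fix \<psi> assume "\<psi> \<in> F"
    then obtain g where g: "g \<in> C" "\<forall>\<mu>\<in>S. \<psi> \<mu> = exp_neg (\<integral>\<^sup>+x. g x \<partial>\<mu>)" unfolding F_def by blast
    have "(\<integral>\<^sup>+x. f x + g x \<partial>\<mu>) = (\<integral>\<^sup>+x. f x \<partial>\<mu>) + (\<integral>\<^sup>+x. g x \<partial>\<mu>)" if "sets \<mu> = sets K" for \<mu>
      using C(1)[OF f(1)] C(1)[OF g(1)] that by (intro nn_integral_add) (auto cong: measurable_cong_sets)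
    then show "(\<lambda>x. \<phi> x * \<psi> x) \<in> F"
      unfolding F_def using SK f g C(2)[OF f(1) g(1)]
      by (auto intro!: bexI[of _ "\<lambda>x. f x + g x"] simp: exp_neg_add)
  next
    fix \<phi> \<mu> assume "\<phi> \<in> F" "\<mu> \<in> space (distr M ?R N)"
    then show "0 \<le> \<phi> \<mu> \<and> \<phi> \<mu> \<le> 1" using exp_neg_bounds spR by (auto simp: F_def)
  next
    fix G assume "space G = space (distr M ?R N)" and F: "\<And>f. f \<in> F \<Longrightarrow> f \<in> borel_measurable G"
    then have G: "space G = S" using spR by simp
    have "(\<lambda>\<mu>. \<integral>\<^sup>+x. f x \<partial>\<mu>) \<in> borel_measurable G" if "f \<in> C" for f
    proof -
      have "(\<lambda>\<mu>. exp_neg (\<integral>\<^sup>+x. f x \<partial>\<mu>)) \<in> borel_measurable G" using that by (intro F) (auto simp: F_def)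
      from measurable_compose[OF this measurable_neg_ln] show ?thesis by (simp add: neg_ln_exp_neg)
    qed
    from gen[OF G this] have "(\<lambda>\<mu>. \<mu>) \<in> G \<rightarrow>\<^sub>M measure_algebra K"
      using G SK by (intro measurable_measure_algebraI) auto
    then have "(\<lambda>\<mu>. \<mu>) \<in> G \<rightarrow>\<^sub>M ?R" using G by (intro measurable_restrict_space2) auto
    from measurable_sets[OF this] show "sets (distr M ?R N) \<subseteq> sets G"
      using G spR sets.sets_into_space[of _ ?R] by (fastforce simp: Int_absorb2)
  qed simp
  then have "distr (distr M ?R N) (measure_algebra K) (\<lambda>\<mu>. \<mu>) = distr (distr M' ?R N') (measure_algebra K) (\<lambda>\<mu>. \<mu>)"
    by simp
  moreover have id: "(\<lambda>\<mu>. \<mu>) \<in> ?R \<rightarrow>\<^sub>M measure_algebra K" by (rule measurable_restrict_space1) simp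
  ultimately show ?thesis using NR by (simp add: distr_distr[OF id] o_def)
qed

section \<open>Laplace transforms of sums over independent coordinates\<close>

lemma integral_PiM_prod:
  fixes g :: "nat \<Rightarrow> 'a \<Rightarrow> real"
  assumes D: "\<And>i. prob_space (D i)" and g: "\<And>i. g i \<in> borel_measurable (D i)" "\<And>i x. 0 \<le> g i x \<and> g i x \<le> 1"
  shows "(\<integral>\<eta>. (\<Prod>i<n. g i (\<eta> i)) \<partial>PiM UNIV D) = (\<Prod>i<n. \<integral>x. g i x \<partial>D i)"
proof -
  interpret product_prob_space D UNIV
    using D by (auto intro!: product_prob_spaceI)
  have [measurable]: "(\<lambda>x. \<Prod>i<n. g i (x i)) \<in> borel_measurable (PiM {..<n} D)"
    using g(1) by (intro borel_measurable_prod) (auto intro: measurable_compose[OF measurable_component_singleton])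
  have "(\<integral>\<eta>. (\<Prod>i<n. g i (\<eta> i)) \<partial>PiM UNIV D) =
    (\<integral>x. (\<Prod>i<n. g i (x i)) \<partial>distr (PiM UNIV D) (PiM {..<n} D) (\<lambda>x. restrict x {..<n}))"
    by (subst integral_distr) (auto intro!: measurable_restrict_subset)
  also have "distr (PiM UNIV D) (PiM {..<n} D) (\<lambda>x. restrict x {..<n}) = PiM {..<n} D"
    by (rule distr_PiM_restrict_finite) auto
  also have "(\<integral>x. (\<Prod>i<n. g i (x i)) \<partial>PiM {..<n} D) = (\<Prod>i<n. \<integral>x. g i x \<partial>D i)"
    using g prob_space.finite_measure[OF D]
    by (intro product_integral_prod) (auto intro!: integrable_unit_interval)
  finally show ?thesis .
qed

lemma exp_neg_suminf: "(\<lambda>n. \<Prod>i<n. exp_neg (f i)) \<longlonglongrightarrow> exp_neg (\<Sum>i. f i)"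
  using tendsto_exp_neg[OF summable_LIMSEQ[OF summableI, of f]] by (simp add: exp_neg_sum)

text \<open>The value is the infinite product of the coordinate transforms. It is coded as
  \<open>exp_neg\<close> of a sum of \<open>neg_ln\<close>, since that sum later becomes an integral
  against the Poisson points.\<close>

lemma integral_exp_neg_suminf_PiM:
  assumes D: "\<And>i::nat. prob_space (D i)" and h: "\<And>i. h i \<in> borel_measurable (D i)"
  shows "(\<integral>\<eta>. exp_neg (\<Sum>i. h i (\<eta> i)) \<partial>PiM UNIV D) = exp_neg (\<Sum>i. neg_ln (\<integral>x. exp_neg (h i x) \<partial>D i))"
proof -
  interpret product_prob_space D UNIV using D by (auto intro!: product_prob_spaceI)
  have [measurable]: "(\<lambda>\<eta>. h i (\<eta> i)) \<in> borel_measurable (PiM UNIV D)" for i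
    using h by (auto intro: measurable_compose[OF measurable_component_singleton])
  have lim: "(\<lambda>n. \<integral>\<eta>. (\<Prod>i<n. exp_neg (h i (\<eta> i))) \<partial>PiM UNIV D) \<longlonglongrightarrow> (\<integral>\<eta>. exp_neg (\<Sum>i. h i (\<eta> i)) \<partial>PiM UNIV D)"
    by (intro tendsto_integral_unit_interval)
       (auto intro!: exp_neg_suminf prod_nonneg prod_le_1 exp_neg_bounds finite_measure_axioms)
  have eq: "(\<integral>\<eta>. (\<Prod>i<n. exp_neg (h i (\<eta> i))) \<partial>PiM UNIV D) = (\<Prod>i<n. exp_neg (neg_ln (\<integral>x. exp_neg (h i x) \<partial>D i)))" for n
  proof -
    have "exp_neg (neg_ln (\<integral>x. exp_neg (h i x) \<partial>D i)) = (\<integral>x. exp_neg (h i x) \<partial>D i)" for i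
      using h D exp_neg_bounds by (intro exp_neg_neg_ln prob_space.integral_unit_interval) auto
    then show ?thesis using h by (subst integral_PiM_prod[OF D]) (auto simp: exp_neg_bounds)
  qed
  show ?thesis by (rule LIMSEQ_unique[OF lim]) (unfold eq, rule exp_neg_suminf)
qed

text \<open>Truncating \<open>P x\<close> to \<open>A n\<close> and dividing by 1 +
  \<open>P x (A n)\<close> gives a subprobability kernel whose normalisation is measurable and never
  divides by 0. Multiplying back and taking the supremum over n recovers the integral.\<close>

lemma measurable_nn_integral_kernel:
  assumes P: "P \<in> M \<rightarrow>\<^sub>M measure_algebra K"
    and A: "range A \<subseteq> sets K" "incseq A" "(\<Union>n::nat. A n) = space K" "space K \<noteq> {}"
    and fin: "\<And>x n. x \<in> space M \<Longrightarrow> emeasure (P x) (A n) < \<infinity>"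
    and f[measurable]: "(\<lambda>(x, u). f x u) \<in> borel_measurable (M \<Otimes>\<^sub>M K)"
  shows "(\<lambda>x. \<integral>\<^sup>+u. f x u \<partial>P x) \<in> borel_measurable M"
proof -
  note sets_P = measurable_measure_algebraD(1)[OF P]
  have [measurable]: "(\<lambda>x. emeasure (P x) B) \<in> borel_measurable M" if "B \<in> sets K" for B
    using measurable_measure_algebraD(2)[OF P that] .
  have An[measurable]: "A n \<in> sets K" for n using A by auto
  define c where "c n x = 1 / (1 + emeasure (P x) (A n))" for n x
  define Q where "Q n x = density (P x) (\<lambda>u. c n x * indicator (A n) u)" for n x
  have [measurable]: "c n \<in> borel_measurable M" for n unfolding c_def by measurable
  have eQ: "emeasure (Q n x) B = c n x * emeasure (P x) (A n \<inter> B)" if "x \<in> space M" "B \<in> sets K" for n x B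
  proof -
    have "emeasure (Q n x) B = (\<integral>\<^sup>+u. c n x * indicator (A n \<inter> B) u \<partial>P x)"
      unfolding Q_def using sets_P[OF that(1)] that(2) An[of n]
      by (subst emeasure_density) (auto intro!: nn_integral_cong simp: indicator_def)
    then show ?thesis using sets_P[OF that(1)] that(2) An[of n] by (subst (asm) nn_integral_cmult_indicator) auto
  qed
  have QK: "Q n \<in> M \<rightarrow>\<^sub>M subprob_algebra K" for n
  proof (rule measurable_subprob_algebra)
    fix x assume x: "x \<in> space M"
    show "sets (Q n x) = sets K" using sets_P[OF x] by (simp add: Q_def)
    have sp: "space (Q n x) = space K" using sets_eq_imp_space_eq[OF sets_P[OF x]] by (simp add: Q_def)
    have "emeasure (Q n x) (space K) = emeasure (P x) (A n) / (1 + emeasure (P x) (A n))"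
      using sets.sets_into_space[OF An[of n]] ennreal_times_divide[of "emeasure (P x) (A n)" 1 "1 + emeasure (P x) (A n)"]
      by (subst eQ[OF x]) (auto simp: c_def Int_absorb2 mult.commute)
    also have "\<dots> \<le> 1" using fin[OF x, of n] by (intro divide_le_posI_ennreal) (auto simp: add_pos_nonneg)
    finally show "subprob_space (Q n x)" using A(4) by (intro subprob_spaceI) (auto simp: sp)
  next
    fix B assume B: "B \<in> sets K"
    then have "(\<lambda>x. c n x * emeasure (P x) (A n \<inter> B)) \<in> borel_measurable M" by measurable
    then show "(\<lambda>x. emeasure (Q n x) B) \<in> borel_measurable M" using eQ[OF _ B] by (simp cong: measurable_cong)
  qed
  have fx: "f x \<in> borel_measurable (P x)" if "x \<in> space M" for x
    using measurable_compose[OF measurable_Pair1'[OF that] f] sets_P[OF that] by (simp cong: measurable_cong_sets)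
  have "(\<integral>\<^sup>+u. f x u \<partial>P x) = (SUP n. (1 + emeasure (P x) (A n)) * (\<integral>\<^sup>+u. f x u \<partial>Q n x))" if x: "x \<in> space M" for x
  proof -
    note [measurable] = fx[OF x] and [measurable_cong] = sets_P[OF x]
    have "(1 + emeasure (P x) (A n)) * (\<integral>\<^sup>+u. f x u \<partial>Q n x) = (\<integral>\<^sup>+u. f x u * indicator (A n) u \<partial>P x)" for n
    proof -
      have "(\<integral>\<^sup>+u. f x u \<partial>Q n x) = (\<integral>\<^sup>+u. c n x * (f x u * indicator (A n) u) \<partial>P x)"
        unfolding Q_def by (subst nn_integral_density) (auto intro!: nn_integral_cong simp: mult_ac)
      also have "\<dots> = c n x * (\<integral>\<^sup>+u. f x u * indicator (A n) u \<partial>P x)"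
        by (rule nn_integral_cmult) measurable
      also have "(1 + emeasure (P x) (A n)) * \<dots> = ((1 + emeasure (P x) (A n)) * c n x) * (\<integral>\<^sup>+u. f x u * indicator (A n) u \<partial>P x)"
        by (simp add: mult.assoc)
      also have "(1 + emeasure (P x) (A n)) * c n x = 1"
        unfolding c_def using fin[OF x, of n] by (simp add: ennreal_times_divide ennreal_divide_self)
      finally show ?thesis by simp
    qed
    moreover have "(\<integral>\<^sup>+u. f x u \<partial>P x) = (SUP n. \<integral>\<^sup>+u. f x u * indicator (A n) u \<partial>P x)"
    proof -
      have "(SUP n. f x u * indicator (A n) u) = f x u" if u: "u \<in> space (P x)" for u
      proof -
        obtain n where "u \<in> A n" using u A(3) sets_eq_imp_space_eq[OF sets_P[OF x]] by auto
        then show ?thesis by (intro antisym SUP_least SUP_upper2[of n]) (auto simp: indicator_def)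
      qed
      then have "(\<integral>\<^sup>+u. f x u \<partial>P x) = (\<integral>\<^sup>+u. (SUP n. f x u * indicator (A n) u) \<partial>P x)"
        by (intro nn_integral_cong) simp
      also have "\<dots> = (SUP n. \<integral>\<^sup>+u. f x u * indicator (A n) u \<partial>P x)"
        using A(2) by (intro nn_integral_monotone_convergence_SUP)
          (auto simp: incseq_def le_fun_def indicator_def)
      finally show ?thesis .
    qed
    ultimately show ?thesis by simp
  qed
  moreover have "(\<lambda>x. SUP n. (1 + emeasure (P x) (A n)) * (\<integral>\<^sup>+u. f x u \<partial>Q n x)) \<in> borel_measurable M"
    using nn_integral_measurable_subprob_algebra2[OF f QK] by measurable
  ultimately show ?thesis by (simp cong: measurable_cong)
qed

section \<open>Poisson random measures\<close>

text \<open>The weights sum to 1, so \<open>X\<close> is almost surely a natural number although it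
  is only known to be \<open>ennreal\<close>-valued. What remains is the Poisson generating function
  at \<open>exp_neg c\<close>.\<close>

lemma poisson_laplace_transform:
  assumes L: "prob_space L" and X[measurable]: "X \<in> borel_measurable L" and "0 \<le> a"
    and law: "\<And>k::nat. measure L {\<omega> \<in> space L. X \<omega> = of_nat k} = exp (- a) * a ^ k / fact k"
  shows "(\<integral>\<omega>. exp_neg (c * X \<omega>) \<partial>L) = exp (- (1 - exp_neg c) * a)"
proof -
  interpret prob_space L by fact
  define E where "E k = {\<omega> \<in> space L. X \<omega> = of_nat k}" for k :: nat
  have [measurable]: "E k \<in> sets L" for k unfolding E_def by measurable
  have disj: "disjoint_family E" by (auto simp: disjoint_family_on_def E_def)
  have "(\<lambda>k. exp (- a) * a ^ k / fact k) sums (exp (- a) * exp a)"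
    using sums_mult[OF exp_converges[of a], of "exp (- a)"] by (simp add: scaleR_conv_of_real divide_inverse mult_ac)
  moreover have "(\<lambda>k. measure L (E k)) sums measure L (\<Union>k. E k)"
    using disj by (intro finite_measure_UNION) auto
  ultimately have "prob (\<Union>k. E k) = 1"
    using law by (simp add: E_def sums_unique2 flip: exp_add)
  then have "AE \<omega> in L. \<omega> \<in> (\<Union>k. E k)" by (intro AE_prob_1) 
  \<comment> \<open>On \<open>E k\<close> the series has the single term
    \<open>exp_neg c ^ k\<close>. This covers infinite c as well: on \<open>E 0\<close> both sides
    are 1, since infinity * 0 = 0.\<close>
  then have AE: "AE \<omega> in L. (\<Sum>k. ennreal (exp_neg c ^ k) * indicator (E k) \<omega>) = ennreal (exp_neg (c * X \<omega>))"
  proof eventually_elim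
    case (elim \<omega>)
    then obtain k where k: "\<omega> \<in> E k" by auto
    have "exp_neg (c * of_nat k) = exp_neg c ^ k" for k
      by (induction k) (auto simp: exp_neg_add algebra_simps)
    moreover have X: "X \<omega> = of_nat k" using k by (simp add: E_def)
    moreover have "(\<Sum>j. ennreal (exp_neg c ^ j) * indicator (E j) \<omega>) = (\<Sum>j\<in>{k}. ennreal (exp_neg c ^ j) * indicator (E j) \<omega>)"
      using k by (intro suminf_finite) (auto simp: E_def indicator_def)
    moreover have "\<dots> = ennreal (exp_neg c ^ k)" using k by simp
    ultimately show ?case by metis
  qed
  have "ennreal (\<integral>\<omega>. exp_neg (c * X \<omega>) \<partial>L) = (\<integral>\<^sup>+\<omega>. ennreal (exp_neg (c * X \<omega>)) \<partial>L)"
    by (intro nn_integral_eq_integral[symmetric] integrable_exp_neg) (auto intro: finite_measure_axioms exp_neg_bounds)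
  also have "\<dots> = (\<integral>\<^sup>+\<omega>. (\<Sum>k. ennreal (exp_neg c ^ k) * indicator (E k) \<omega>) \<partial>L)"
    using AE by (intro nn_integral_cong_AE) auto
  also have "\<dots> = (\<Sum>k. ennreal (exp_neg c ^ k) * emeasure L (E k))"
    by (subst nn_integral_suminf) (auto simp: nn_integral_cmult_indicator)
  also have "\<dots> = (\<Sum>k. ennreal (exp (- a) * ((exp_neg c * a) ^ k / fact k)))"
    using law \<open>0 \<le> a\<close> exp_neg_bounds[of c]
    by (intro suminf_cong) (simp add: emeasure_eq_measure E_def power_mult_distrib mult_ac flip: ennreal_mult)
  also have "\<dots> = ennreal (exp (- a) * exp (exp_neg c * a))"
    using \<open>0 \<le> a\<close> exp_neg_bounds[of c] sums_mult[OF exp_converges[of "exp_neg c * a"], of "exp (- a)"]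
    by (intro suminf_ennreal_eq) (auto simp: scaleR_conv_of_real divide_inverse mult_ac)
  finally show ?thesis
    using exp_neg_bounds integral_unit_interval(1)[of "\<lambda>\<omega>. exp_neg (c * X \<omega>)"]
    by (subst (asm) ennreal_inj) (auto simp: algebra_simps exp_add[symmetric])
qed

lemma poisson_random_measureD:
  assumes "poisson_random_measure L m \<Lambda>"
  shows "\<Lambda> \<in> L \<rightarrow>\<^sub>M measure_algebra m"
    and "A \<in> sets m \<Longrightarrow> emeasure m A < \<infinity> \<Longrightarrow>
      measure L {\<omega>\<in>space L. emeasure (\<Lambda> \<omega>) A = of_nat k} = exp (- measure m A) * measure m A ^ k / fact k"
    and "A \<in> sets m \<Longrightarrow> emeasure m A = \<infinity> \<Longrightarrow> AE \<omega> in L. emeasure (\<Lambda> \<omega>) A = \<infinity>"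
    and "range B \<subseteq> sets m \<Longrightarrow> disjoint_family B \<Longrightarrow>
      prob_space.indep_vars L (\<lambda>_. borel) (\<lambda>i \<omega>. emeasure (\<Lambda> \<omega>) (B i)) (UNIV :: nat set)"
  using assms unfolding poisson_random_measure_def by auto

text \<open>If \<open>A\<close> has infinite mass, the count is almost surely infinite and both
  sides are 0, except for c = 0, where both are 1 because 0 * infinity = 0.\<close>

lemma poisson_random_measure_laplace_set:
  assumes L: "prob_space L" and \<Lambda>: "poisson_random_measure L m \<Lambda>" and A: "A \<in> sets m"
  shows "(\<integral>\<omega>. exp_neg (c * emeasure (\<Lambda> \<omega>) A) \<partial>L) = exp_neg (ennreal (1 - exp_neg c) * emeasure m A)"
proof (cases "emeasure m A = \<infinity>")
  case False
  then have fin: "emeasure m A = ennreal (measure m A)" by (simp add: emeasure_eq_ennreal_measure)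
  have "(\<integral>\<omega>. exp_neg (c * emeasure (\<Lambda> \<omega>) A) \<partial>L) = exp (- (1 - exp_neg c) * measure m A)"
    using False poisson_random_measureD(1,2)[OF \<Lambda>] A
    by (intro poisson_laplace_transform[OF L]) (auto simp: less_top measurable_measure_algebraD(2))
  then show ?thesis using exp_neg_bounds[of c]
    by (simp add: fin exp_neg_ennreal flip: ennreal_mult) (simp add: algebra_simps)
next
  case True
  interpret prob_space L by fact
  show ?thesis
  proof (cases "c = 0")
    case True then show ?thesis by (simp add: prob_space)
  next
    case False
    have "AE \<omega> in L. exp_neg (c * emeasure (\<Lambda> \<omega>) A) = 0"
      using poisson_random_measureD(3)[OF \<Lambda> A True] False by (auto simp: ennreal_mult_top)
    then have "(\<integral>\<omega>. exp_neg (c * emeasure (\<Lambda> \<omega>) A) \<partial>L) = (\<integral>\<omega>. 0 \<partial>L)"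
      using measurable_measure_algebraD(2)[OF poisson_random_measureD(1)[OF \<Lambda>] A] by (intro integral_cong_AE) auto
    moreover have "exp_neg c \<noteq> 1" using False exp_neg_inj[of c 0] by simp
    then have "ennreal (1 - exp_neg c) * \<infinity> = \<infinity>"
      using exp_neg_bounds[of c] by (simp add: ennreal_mult_top)
    ultimately show ?thesis using True by simp
  qed
qed

text \<open>The level sets of \<open>g\<close> are disjoint, hence their counts are independent; the
  expectation factors and the transforms of the single counts multiply up.\<close>

lemma poisson_random_measure_laplace_simple:
  assumes L: "prob_space L" and \<Lambda>: "poisson_random_measure L m \<Lambda>" and g: "simple_function m g"
  shows "LF L \<Lambda> g = exp_neg (\<integral>\<^sup>+x. ennreal (1 - exp_neg (g x)) \<partial>m)"
proof -
  interpret prob_space L by fact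
  have fin: "finite (g ` space m)" using simple_functionD(1)[OF g] .
  obtain h where h: "bij_betw h {0..<card (g ` space m)} (g ` space m)"
    using ex_bij_betw_nat_finite[OF fin] by blast
  define n where "n = card (g ` space m)"
  \<comment> \<open>Indices from \<open>n\<close> on get the empty set, because independence of
    counts is formulated for infinite sequences of disjoint sets.\<close>
  define A where "A i = (if i < n then g -` {h i} \<inter> space m else {})" for i
  have A[measurable]: "A i \<in> sets m" for i using simple_functionD(2)[OF g] by (simp add: A_def)
  have disj: "disjoint_family A"
    using h by (auto simp: disjoint_family_on_def A_def n_def bij_betw_def inj_on_def)
  have comb: "F (g x) = (\<Sum>i<n. F (h i) * indicator (A i) x)" if x: "x \<in> space m" for x and F :: "ennreal \<Rightarrow> ennreal"
  proof -
    have "g x \<in> h ` {0..<n}" using h x by (simp add: bij_betw_def n_def)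
    then obtain i where i: "i < n" "g x = h i" by auto
    then have xi: "x \<in> A i" using x by (simp add: A_def)
    have "x \<notin> A j" if "j \<noteq> i" for j
      using disjoint_family_onD[OF disj _ _ that] xi by blast
    then have "(\<Sum>j<n. F (h j) * indicator (A j) x) = (\<Sum>j<n. if j = i then F (h i) else 0)"
      using xi by (intro sum.cong) auto
    also have "\<dots> = F (g x)" using i by simp
    finally show ?thesis by simp
  qed
  have int: "(\<integral>\<^sup>+x. F (g x) \<partial>\<mu>) = (\<Sum>i<n. F (h i) * emeasure \<mu> (A i))" if \<mu>: "sets \<mu> = sets m" for F :: "ennreal \<Rightarrow> ennreal" and \<mu>
  proof -
    note [measurable_cong] = \<mu>
    have "(\<integral>\<^sup>+x. F (g x) \<partial>\<mu>) = (\<integral>\<^sup>+x. (\<Sum>i<n. F (h i) * indicator (A i) x) \<partial>\<mu>)"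
      using comb sets_eq_imp_space_eq[OF \<mu>] by (intro nn_integral_cong) auto
    also have "\<dots> = (\<Sum>i<n. \<integral>\<^sup>+x. F (h i) * indicator (A i) x \<partial>\<mu>)"
      by (rule nn_integral_sum) measurable
    also have "\<dots> = (\<Sum>i<n. F (h i) * emeasure \<mu> (A i))"
      by (intro sum.cong refl nn_integral_cmult_indicator) measurable
    finally show ?thesis .
  qed
  note \<Lambda>m = measurable_measure_algebraD[OF poisson_random_measureD(1)[OF \<Lambda>]]
  have [measurable]: "(\<lambda>\<omega>. emeasure (\<Lambda> \<omega>) (A i)) \<in> borel_measurable L" for i using \<Lambda>m(2) by auto
  have "indep_vars (\<lambda>_. borel) (\<lambda>i \<omega>. emeasure (\<Lambda> \<omega>) (A i)) UNIV"
    using A disj by (intro poisson_random_measureD(4)[OF \<Lambda>]) auto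
  then have "indep_vars (\<lambda>_. borel) (\<lambda>i \<omega>. emeasure (\<Lambda> \<omega>) (A i)) {..<n}"
    by (rule indep_vars_subset) auto
  then have ind: "indep_vars (\<lambda>_. borel) (\<lambda>i \<omega>. exp_neg (h i * emeasure (\<Lambda> \<omega>) (A i))) {..<n}"
    by (rule indep_vars_compose2[where Y="\<lambda>i x. exp_neg (h i * x)"]) measurable
  have "LF L \<Lambda> g = (\<integral>\<omega>. (\<Prod>i<n. exp_neg (h i * emeasure (\<Lambda> \<omega>) (A i))) \<partial>L)"
    unfolding LF_def using \<Lambda>m(1) by (intro Bochner_Integration.integral_cong) (auto simp: int[of _ "\<lambda>x. x"] exp_neg_sum)
  also have "\<dots> = (\<Prod>i<n. \<integral>\<omega>. exp_neg (h i * emeasure (\<Lambda> \<omega>) (A i)) \<partial>L)"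
    by (intro indep_vars_lebesgue_integral ind) (auto intro!: integrable_exp_neg finite_measure_axioms)
  also have "\<dots> = exp_neg (\<Sum>i<n. ennreal (1 - exp_neg (h i)) * emeasure m (A i))"
    using poisson_random_measure_laplace_set[OF L \<Lambda> A] by (simp add: exp_neg_sum)
  also have "\<dots> = exp_neg (\<integral>\<^sup>+x. ennreal (1 - exp_neg (g x)) \<partial>m)"
    by (simp add: int[of m "\<lambda>x. ennreal (1 - exp_neg x)", OF refl])
  finally show ?thesis .
qed

text \<open>Simple functions increase to \<open>g\<close>. The left side converges by domination,
  and the exponent monotonically, because 1 - \<open>exp_neg\<close> is increasing.\<close>

proposition poisson_random_measure_laplace:
  assumes L: "prob_space L" and \<Lambda>: "poisson_random_measure L m \<Lambda>" and g: "g \<in> borel_measurable m"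
  shows "LF L \<Lambda> g = exp_neg (\<integral>\<^sup>+x. ennreal (1 - exp_neg (g x)) \<partial>m)"
proof -
  interpret prob_space L by fact
  obtain G where G: "\<And>i. simple_function m (G i)" "incseq G" "\<And>x. (SUP i. G i x) = g x"
    using borel_measurable_implies_simple_function_sequence'[OF g] by metis
  have Gx: "(\<lambda>i. G i x) \<longlonglongrightarrow> g x" "incseq (\<lambda>i. G i x)" for x
  proof -
    show "incseq (\<lambda>i. G i x)" using G(2) by (auto simp: incseq_def le_fun_def)
    then show "(\<lambda>i. G i x) \<longlonglongrightarrow> g x" using LIMSEQ_SUP[of "\<lambda>i. G i x"] G(3) by simp
  qed
  note \<Lambda>m = measurable_measure_algebraD[OF poisson_random_measureD(1)[OF \<Lambda>]]
  have Gm[measurable]: "G i \<in> borel_measurable m" for i using G(1) by (rule borel_measurable_simple_function)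
  have "(\<lambda>i. LF L \<Lambda> (G i)) \<longlonglongrightarrow> LF L \<Lambda> g" unfolding LF_def
  proof (intro tendsto_integral_unit_interval finite_measure_axioms)
    fix \<omega> assume \<omega>: "\<omega> \<in> space L"
    have "(\<lambda>i. \<integral>\<^sup>+x. G i x \<partial>\<Lambda> \<omega>) \<longlonglongrightarrow> (\<integral>\<^sup>+x. g x \<partial>\<Lambda> \<omega>)"
      using Gx G(2) Gm by (intro nn_integral_LIMSEQ) (auto simp: \<Lambda>m(1)[OF \<omega>] cong: measurable_cong_sets)
    then show "(\<lambda>i. exp_neg (\<integral>\<^sup>+x. G i x \<partial>\<Lambda> \<omega>)) \<longlonglongrightarrow> exp_neg (\<integral>\<^sup>+x. g x \<partial>\<Lambda> \<omega>)"
      by (rule tendsto_exp_neg)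
  qed (auto simp: exp_neg_bounds intro!: measurable_compose[OF _ measurable_exp_neg]
        measurable_nn_integral_random_measure[OF poisson_random_measureD(1)[OF \<Lambda>]] g)
  moreover have "(\<lambda>i. exp_neg (\<integral>\<^sup>+x. ennreal (1 - exp_neg (G i x)) \<partial>m)) \<longlonglongrightarrow> exp_neg (\<integral>\<^sup>+x. ennreal (1 - exp_neg (g x)) \<partial>m)"
  proof (intro tendsto_exp_neg nn_integral_LIMSEQ)
    show "incseq (\<lambda>i x. ennreal (1 - exp_neg (G i x)))"
      using G(2) by (auto simp: incseq_def le_fun_def intro!: ennreal_leI exp_neg_mono)
    show "(\<lambda>i. ennreal (1 - exp_neg (G i x))) \<longlonglongrightarrow> ennreal (1 - exp_neg (g x))" for x
      by (intro tendsto_ennrealI tendsto_diff tendsto_const tendsto_exp_neg Gx)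
  qed measurable
  ultimately show ?thesis
    using poisson_random_measure_laplace_simple[OF L \<Lambda> G(1)] LIMSEQ_unique by simp
qed

section \<open>Point processes away from the origin\<close>

text \<open>The strict inequality makes these sets open, which gives finite subcovers of compact
  sets and continuity from below in the radius. The points \<open>\<infinity>\<close> and
  \<open>-\<infinity>\<close> belong to all of them.\<close>

definition outside :: "real \<Rightarrow> ereal set" where
  "outside \<epsilon> = {u. ereal \<epsilon> < \<bar>u\<bar>}"

lemma space_ereal_no0: "space ereal_no0 = UNIV - {0}" by (simp add: space_restrict_space)

lemma outside_sets[measurable]: "0 \<le> \<epsilon> \<Longrightarrow> outside \<epsilon> \<in> sets ereal_no0"
proof -
  assume "0 \<le> \<epsilon>"
  have "outside \<epsilon> \<in> sets borel" unfolding outside_def by measurable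
  moreover have "outside \<epsilon> \<subseteq> UNIV - {0}" using \<open>0 \<le> \<epsilon>\<close> by (auto simp: outside_def)
  ultimately show ?thesis by (auto simp: sets_restrict_space)
qed

lemma outside_antimono: "\<delta> \<le> \<epsilon> \<Longrightarrow> outside \<epsilon> \<subseteq> outside \<delta>"
  using le_less_trans[of "ereal \<delta>" "ereal \<epsilon>"] by (auto simp: outside_def)

lemma Union_outside: "(\<Union>n. outside (1 / real (Suc n))) = UNIV - {0}"
proof
  show "UNIV - {0} \<subseteq> (\<Union>n. outside (1 / real (Suc n)))"
  proof
    fix u :: ereal assume "u \<in> UNIV - {0}"
    then have u: "u \<noteq> 0" by simp
    show "u \<in> (\<Union>n. outside (1 / real (Suc n)))"
    proof (cases u)
      case (real r)
      then obtain n where "inverse (real (Suc n)) < \<bar>r\<bar>" using u reals_Archimedean[of "\<bar>r\<bar>"] by auto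
      then show ?thesis using real by (auto simp: outside_def divide_inverse)
    qed (auto simp: outside_def)
  qed
qed (auto simp: outside_def)

lemma incseq_outside: "incseq (\<lambda>n. outside (1 / real (Suc n)))"
  by (intro incseq_SucI outside_antimono) (simp add: field_simps)

lemma scale_mem_outside: "0 < b \<Longrightarrow> ereal b * u \<in> outside \<epsilon> \<longleftrightarrow> u \<in> outside (\<epsilon> / b)"
proof (cases u)
  case (real r)
  then show "0 < b \<Longrightarrow> ?thesis" by (simp add: outside_def abs_mult pos_divide_less_eq mult.commute)
qed (auto simp: outside_def)

lemma radon_point_measure_sets: "radon_point_measure \<mu> \<Longrightarrow> sets \<mu> = sets ereal_no0"
  by (auto simp: radon_point_measure_def)

lemma radon_point_measure_outside_finite:
  assumes "radon_point_measure \<mu>" "0 < \<epsilon>" shows "emeasure \<mu> (outside \<epsilon>) < \<infinity>"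
proof -
  have "closed {u :: ereal. ereal \<epsilon> \<le> \<bar>u\<bar>}" by (intro closed_Collect_le continuous_intros)
  then have "compact {u :: ereal. ereal \<epsilon> \<le> \<bar>u\<bar>}" by (simp add: compact_eq_closed)
  moreover have *: "{u :: ereal. ereal \<epsilon> \<le> \<bar>u\<bar>} \<subseteq> UNIV - {0}" using assms(2) by auto
  ultimately have "emeasure \<mu> {u. ereal \<epsilon> \<le> \<bar>u\<bar>} < \<infinity>" using assms(1) by (auto simp: radon_point_measure_def)
  moreover have "emeasure \<mu> (outside \<epsilon>) \<le> emeasure \<mu> {u. ereal \<epsilon> \<le> \<bar>u\<bar>}"
  proof (rule emeasure_mono)
    have "{u :: ereal. ereal \<epsilon> \<le> \<bar>u\<bar>} \<in> sets borel" by measurable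
    then show "{u. ereal \<epsilon> \<le> \<bar>u\<bar>} \<in> sets \<mu>"
      using * by (auto simp: radon_point_measure_sets[OF assms(1)] sets_restrict_space)
  qed (auto simp: outside_def)
  ultimately show ?thesis by (rule le_less_trans[rotated])
qed

lemma point_processD:
  assumes "point_process M N"
  shows "N \<in> M \<rightarrow>\<^sub>M measure_algebra ereal_no0" "\<omega> \<in> space M \<Longrightarrow> radon_point_measure (N \<omega>)"
    "\<omega> \<in> space M \<Longrightarrow> sets (N \<omega>) = sets ereal_no0"
    "\<omega> \<in> space M \<Longrightarrow> 0 < \<epsilon> \<Longrightarrow> emeasure (N \<omega>) (outside \<epsilon>) < \<infinity>"
  using assms radon_point_measure_sets radon_point_measure_outside_finite
  by (auto simp: point_process_def)

lemma measurable_scale_pair: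
  "(\<lambda>(l, u). ereal l * u) \<in> real_pos \<Otimes>\<^sub>M ereal_no0 \<rightarrow>\<^sub>M ereal_no0"
proof (rule measurable_restrict_space2)
  show "(\<lambda>(l, u). ereal l * u) \<in> space (real_pos \<Otimes>\<^sub>M ereal_no0) \<rightarrow> UNIV - {0}"
    by (auto simp: space_pair_measure space_restrict_space)
  have "(\<lambda>x. fst x) \<in> real_pos \<Otimes>\<^sub>M ereal_no0 \<rightarrow>\<^sub>M borel"
    by (rule measurable_compose[OF measurable_fst measurable_restrict_space1]) simp
  moreover have "(\<lambda>x. snd x) \<in> real_pos \<Otimes>\<^sub>M ereal_no0 \<rightarrow>\<^sub>M borel"
    by (rule measurable_compose[OF measurable_snd measurable_restrict_space1]) simp
  ultimately show "(\<lambda>(l, u). ereal l * u) \<in> real_pos \<Otimes>\<^sub>M ereal_no0 \<rightarrow>\<^sub>M borel"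
    unfolding case_prod_beta by (intro borel_measurable_ereal_times borel_measurable_ereal)
qed

lemma measurable_scale: "0 < b \<Longrightarrow> (\<lambda>u. ereal b * u) \<in> ereal_no0 \<rightarrow>\<^sub>M ereal_no0"
  using measurable_compose[OF measurable_Pair1'[of b real_pos ereal_no0] measurable_scale_pair]
  by (simp add: space_restrict_space)

lemma sets_scale_measure_pts[simp]: "sets (scale_measure_pts b \<mu>) = sets ereal_no0"
  by (simp add: scale_measure_pts_def)

lemma nn_integral_scale_measure_pts:
  assumes "0 < b" "sets \<mu> = sets ereal_no0" "f \<in> borel_measurable ereal_no0"
  shows "(\<integral>\<^sup>+u. f u \<partial>scale_measure_pts b \<mu>) = (\<integral>\<^sup>+u. f (ereal b * u) \<partial>\<mu>)"
  unfolding scale_measure_pts_def using measurable_scale[OF assms(1)] assms(2,3)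
  by (subst nn_integral_distr) (auto cong: measurable_cong_sets)

lemma emeasure_scale_measure_pts:
  assumes "0 < b" "sets \<mu> = sets ereal_no0" "A \<in> sets ereal_no0"
  shows "emeasure (scale_measure_pts b \<mu>) A = emeasure \<mu> ((\<lambda>u. ereal b * u) -` A \<inter> (UNIV - {0}))"
proof -
  have "(\<lambda>u. ereal b * u) \<in> \<mu> \<rightarrow>\<^sub>M ereal_no0" using measurable_scale[OF assms(1)] assms(2) by (simp cong: measurable_cong_sets)
  moreover have "space \<mu> = UNIV - {0}" using sets_eq_imp_space_eq[OF assms(2)] by (simp add: space_ereal_no0)
  ultimately show ?thesis using assms(3) by (simp add: scale_measure_pts_def emeasure_distr)
qed

lemma emeasure_scale_outside:
  assumes "0 < b" "sets \<mu> = sets ereal_no0" "0 \<le> \<epsilon>"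
  shows "emeasure (scale_measure_pts b \<mu>) (outside \<epsilon>) = emeasure \<mu> (outside (\<epsilon> / b))"
proof -
  have "outside (\<epsilon> / b) \<subseteq> UNIV - {0}" using assms sets.sets_into_space[OF outside_sets[of "\<epsilon> / b"]]
    by (simp add: space_ereal_no0)
  then have "(\<lambda>u. ereal b * u) -` outside \<epsilon> \<inter> (UNIV - {0}) = outside (\<epsilon> / b)"
    using scale_mem_outside[OF assms(1)] by auto
  then show ?thesis using assms by (simp add: emeasure_scale_measure_pts)
qed

lemma scale_scale_measure_pts:
  assumes "0 < a" "0 < b" "sets \<mu> = sets ereal_no0"
  shows "scale_measure_pts a (scale_measure_pts b \<mu>) = scale_measure_pts (a * b) \<mu>"
  unfolding scale_measure_pts_def using measurable_scale[OF assms(1)] measurable_scale[OF assms(2)] assms(3)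
  by (subst distr_distr) (auto simp: o_def mult.assoc[symmetric] cong: measurable_cong_sets)

text \<open>Joint measurability in the scale and the sample point: the mass of a set is a kernel
  integral with an integrand depending on the scale, and the sets
  \<open>outside (1 / real (Suc n))\<close> exhaust the space with finite mass.\<close>

lemma measurable_scale_process:
  assumes "point_process D P"
  shows "(\<lambda>(l, d). scale_measure_pts l (P d)) \<in> real_pos \<Otimes>\<^sub>M D \<rightarrow>\<^sub>M measure_algebra ereal_no0"
proof (rule measurable_measure_algebraI)
  note P = point_processD[OF assms]
  fix B assume B: "B \<in> sets ereal_no0"
  have "(\<lambda>x. \<integral>\<^sup>+u. indicator B (ereal (fst x) * u) \<partial>P (snd x)) \<in> borel_measurable (real_pos \<Otimes>\<^sub>M D)"
  proof (rule measurable_nn_integral_kernel[where K=ereal_no0 and A="\<lambda>n. outside (1 / real (Suc n))"])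
    show "(\<lambda>x. P (snd x)) \<in> real_pos \<Otimes>\<^sub>M D \<rightarrow>\<^sub>M measure_algebra ereal_no0"
      using P(1) by measurable
    have "(\<lambda>(x, u). (fst x, u)) \<in> (real_pos \<Otimes>\<^sub>M D) \<Otimes>\<^sub>M ereal_no0 \<rightarrow>\<^sub>M real_pos \<Otimes>\<^sub>M ereal_no0" by measurable
    from measurable_compose[OF measurable_compose[OF this measurable_scale_pair] borel_measurable_indicator[OF B]]
    show "(\<lambda>(x, u). indicator B (ereal (fst x) * u) :: ennreal) \<in> borel_measurable ((real_pos \<Otimes>\<^sub>M D) \<Otimes>\<^sub>M ereal_no0)"
      by (simp add: case_prod_unfold)
    have "ereal 1 \<in> UNIV - {0}" by simp
    then show "space ereal_no0 \<noteq> {}" unfolding space_ereal_no0 by blast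
  qed (use P(4) Union_outside incseq_outside in \<open>auto simp: space_pair_measure space_ereal_no0\<close>)
  moreover have "emeasure (scale_measure_pts (fst x) (P (snd x))) B = (\<integral>\<^sup>+u. indicator B (ereal (fst x) * u) \<partial>P (snd x))"
    if "x \<in> space (real_pos \<Otimes>\<^sub>M D)" for x
    using that B P(3) nn_integral_scale_measure_pts[of "fst x" "P (snd x)" "indicator B"]
    by (auto simp: space_pair_measure space_restrict_space)
  ultimately show "(\<lambda>x. emeasure (case x of (l, d) \<Rightarrow> scale_measure_pts l (P d)) B) \<in> borel_measurable (real_pos \<Otimes>\<^sub>M D)"
    by (simp add: case_prod_beta cong: measurable_cong)
qed auto

lemma measurable_scale_process_const:
  assumes "N \<in> M \<rightarrow>\<^sub>M measure_algebra ereal_no0" "0 < b"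
  shows "(\<lambda>\<omega>. scale_measure_pts b (N \<omega>)) \<in> M \<rightarrow>\<^sub>M measure_algebra ereal_no0"
proof (rule measurable_measure_algebraI)
  fix A assume A: "A \<in> sets ereal_no0"
  have B: "(\<lambda>u. ereal b * u) -` A \<inter> (UNIV - {0}) \<in> sets ereal_no0"
    using measurable_sets[OF measurable_scale[OF assms(2)] A] by (simp add: space_ereal_no0)
  note N = measurable_measure_algebraD[OF assms(1)]
  show "(\<lambda>\<omega>. emeasure (scale_measure_pts b (N \<omega>)) A) \<in> borel_measurable M"
    using N(2)[OF B] emeasure_scale_measure_pts[OF assms(2) N(1) A] by (simp cong: measurable_cong)
qed simp

section \<open>The Laplace functional of a scale-decorated Poisson process\<close>

definition decorated :: "(nat \<Rightarrow> 'l \<Rightarrow> real) \<Rightarrow> ('d \<Rightarrow> ereal measure) \<Rightarrow> 'l \<times> (nat \<Rightarrow> 'd) \<Rightarrow> ereal measure" where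
  "decorated l P = (\<lambda>(\<omega>, \<eta>). superposition ereal_no0 (\<lambda>i. scale_measure_pts (l i \<omega>) (P (\<eta> i))))"

lemma measurable_decorated:
  assumes P: "point_process D P" and l: "\<And>i. l i \<in> L \<rightarrow>\<^sub>M real_pos"
  shows "decorated l P \<in> L \<Otimes>\<^sub>M (\<Pi>\<^sub>M i\<in>UNIV. D) \<rightarrow>\<^sub>M measure_algebra ereal_no0"
proof -
  have "(\<lambda>x. superposition ereal_no0 (\<lambda>i. scale_measure_pts (l i (fst x)) (P (snd x i))))
    \<in> L \<Otimes>\<^sub>M (\<Pi>\<^sub>M i\<in>UNIV. D) \<rightarrow>\<^sub>M measure_algebra ereal_no0"
  proof (rule measurable_superposition)
    fix i
    have "(\<lambda>x. (l i (fst x), snd x i)) \<in> L \<Otimes>\<^sub>M (\<Pi>\<^sub>M i\<in>UNIV. D) \<rightarrow>\<^sub>M real_pos \<Otimes>\<^sub>M D"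
      using l by measurable
    from measurable_compose[OF this measurable_scale_process[OF P]]
    show "(\<lambda>x. scale_measure_pts (l i (fst x)) (P (snd x i))) \<in> L \<Otimes>\<^sub>M (\<Pi>\<^sub>M i\<in>UNIV. D) \<rightarrow>\<^sub>M measure_algebra ereal_no0"
      by simp
  qed
  then show ?thesis by (simp add: decorated_def case_prod_beta)
qed

lemma measurable_LF_scale:
  assumes D: "prob_space D" and P: "point_process D P" and f: "f \<in> borel_measurable ereal_no0"
  shows "(\<lambda>x. LF D P (\<lambda>u. f (ereal x * u))) \<in> borel_measurable real_pos"
proof -
  interpret prob_space D by fact
  have "(\<lambda>x. exp_neg (\<integral>\<^sup>+u. f u \<partial>(case x of (l, d) \<Rightarrow> scale_measure_pts l (P d)))) \<in> borel_measurable (real_pos \<Otimes>\<^sub>M D)"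
    using measurable_nn_integral_random_measure[OF measurable_scale_process[OF P] f] by measurable
  then have "(\<lambda>x. \<integral>d. exp_neg (\<integral>\<^sup>+u. f u \<partial>scale_measure_pts x (P d)) \<partial>D) \<in> borel_measurable real_pos"
    by (intro borel_measurable_lebesgue_integral) (simp add: case_prod_beta)
  moreover have "LF D P (\<lambda>u. f (ereal x * u)) = (\<integral>d. exp_neg (\<integral>\<^sup>+u. f u \<partial>scale_measure_pts x (P d)) \<partial>D)"
    if "x \<in> space real_pos" for x
    unfolding LF_def using that point_processD(3)[OF P] f
    by (intro Bochner_Integration.integral_cong) (auto simp: nn_integral_scale_measure_pts space_restrict_space)
  ultimately show ?thesis by (subst measurable_cong)
qed

text \<open>Given the Poisson points, the independent decorations contribute the product of \<phi>
  over the points, that is \<open>exp_neg\<close> of the integral of \<open>neg_ln \<phi>\<close>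
  against the random measure. In the Poisson formula the outer \<open>exp_neg\<close> then cancels
  \<open>neg_ln\<close>.\<close>

proposition LF_decorated:
  assumes L: "prob_space L" and D: "prob_space D" and P: "point_process D P" and l: "\<And>i. l i \<in> L \<rightarrow>\<^sub>M real_pos"
    and m: "sets m = sets real_pos"
    and \<Lambda>: "poisson_random_measure L m (\<lambda>\<omega>. distr (count_space UNIV) real_pos (\<lambda>i. l i \<omega>))"
    and f: "f \<in> borel_measurable ereal_no0"
  shows "LF (L \<Otimes>\<^sub>M (\<Pi>\<^sub>M i\<in>UNIV. D)) (decorated l P) f =
    exp_neg (\<integral>\<^sup>+x. ennreal (1 - LF D P (\<lambda>u. f (ereal x * u))) \<partial>m)"
proof -
  let ?\<Pi> = "\<Pi>\<^sub>M i\<in>(UNIV :: nat set). D"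
  interpret L: prob_space L by fact
  interpret D: prob_space D by fact
  interpret \<Pi>: product_prob_space "\<lambda>_. D" "UNIV :: nat set" by (intro product_prob_spaceI D)
  interpret pair_prob_space L ?\<Pi> ..
  define \<phi> where "\<phi> x = LF D P (\<lambda>u. f (ereal x * u))" for x
  have \<phi>m[measurable]: "\<phi> \<in> borel_measurable real_pos"
    unfolding \<phi>_def by (rule measurable_LF_scale[OF D P f])
  have lpos: "0 < l i \<omega>" if "\<omega> \<in> space L" for i \<omega> using measurable_space[OF l that] by (simp add: space_restrict_space)
  have fl: "(\<lambda>u. f (ereal b * u)) \<in> borel_measurable ereal_no0" if "0 < b" for b
    using measurable_compose[OF measurable_scale[OF that] f] .
  have \<phi>01: "0 \<le> \<phi> x" "\<phi> x \<le> 1" if "0 < x" for x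
    unfolding \<phi>_def using D.LF_bounds[OF point_processD(1)[OF P] fl[OF that]] by auto
  note [measurable] = measurable_nn_integral_random_measure[OF measurable_decorated[OF P l] f]
  have "LF (L \<Otimes>\<^sub>M ?\<Pi>) (decorated l P) f = (\<integral>\<omega>. (\<integral>\<eta>. exp_neg (\<integral>\<^sup>+u. f u \<partial>decorated l P (\<omega>, \<eta>)) \<partial>?\<Pi>) \<partial>L)"
    unfolding LF_def
    by (rule integral_fst'[symmetric]) (auto intro!: integrable_exp_neg finite_measure_axioms)
  also have "\<dots> = (\<integral>\<omega>. exp_neg (\<integral>\<^sup>+x. neg_ln (\<phi> x) \<partial>distr (count_space UNIV) real_pos (\<lambda>i. l i \<omega>)) \<partial>L)"
  proof (rule Bochner_Integration.integral_cong)
    fix \<omega> assume \<omega>: "\<omega> \<in> space L"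
    define h where "h i d = (\<integral>\<^sup>+u. f (ereal (l i \<omega>) * u) \<partial>P d)" for i d
    have hm: "h i \<in> borel_measurable D" for i
      unfolding h_def by (intro measurable_nn_integral_random_measure[OF point_processD(1)[OF P]] fl lpos \<omega>)
    have "(\<integral>\<^sup>+u. f u \<partial>decorated l P (\<omega>, \<eta>)) = (\<Sum>i. h i (\<eta> i))" if "\<eta> \<in> space ?\<Pi>" for \<eta>
    proof -
      have "\<eta> i \<in> space D" for i using that by (auto simp: space_PiM)
      then show ?thesis
        unfolding decorated_def prod.case h_def using f lpos[OF \<omega>] point_processD(3)[OF P]
        by (subst nn_integral_superposition) (auto intro!: suminf_cong nn_integral_scale_measure_pts)
    qed
    then have "(\<integral>\<eta>. exp_neg (\<integral>\<^sup>+u. f u \<partial>decorated l P (\<omega>, \<eta>)) \<partial>?\<Pi>) = (\<integral>\<eta>. exp_neg (\<Sum>i. h i (\<eta> i)) \<partial>?\<Pi>)"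
      by (intro Bochner_Integration.integral_cong) auto
    also have "\<dots> = exp_neg (\<Sum>i. neg_ln (\<integral>x. exp_neg (h i x) \<partial>D))"
      by (rule integral_exp_neg_suminf_PiM[OF D hm])
    also have "(\<Sum>i. neg_ln (\<integral>x. exp_neg (h i x) \<partial>D)) = (\<Sum>i. neg_ln (\<phi> (l i \<omega>)))"
      by (simp add: \<phi>_def LF_def h_def)
    also have "\<dots> = (\<integral>\<^sup>+x. neg_ln (\<phi> x) \<partial>distr (count_space UNIV) real_pos (\<lambda>i. l i \<omega>))"
      using lpos[OF \<omega>]
      by (subst nn_integral_distr) (auto simp: nn_integral_count_space_nat space_restrict_space)
    finally show "(\<integral>\<eta>. exp_neg (\<integral>\<^sup>+u. f u \<partial>decorated l P (\<omega>, \<eta>)) \<partial>?\<Pi>) =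
      exp_neg (\<integral>\<^sup>+x. neg_ln (\<phi> x) \<partial>distr (count_space UNIV) real_pos (\<lambda>i. l i \<omega>))" .
  qed simp
  also have "\<dots> = LF L (\<lambda>\<omega>. distr (count_space UNIV) real_pos (\<lambda>i. l i \<omega>)) (\<lambda>x. neg_ln (\<phi> x))"
    by (simp add: LF_def)
  also have "\<dots> = exp_neg (\<integral>\<^sup>+x. ennreal (1 - exp_neg (neg_ln (\<phi> x))) \<partial>m)"
    using m by (intro poisson_random_measure_laplace[OF L \<Lambda>]) (auto cong: measurable_cong_sets)
  also have "\<dots> = exp_neg (\<integral>\<^sup>+x. ennreal (1 - \<phi> x) \<partial>m)"
  proof -
    have "0 < x" if "x \<in> space m" for x
      using that sets_eq_imp_space_eq[OF m] by (simp add: space_restrict_space)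
    then show ?thesis using \<phi>01 by (intro arg_cong[where f=exp_neg] nn_integral_cong) (simp add: exp_neg_neg_ln)
  qed
  finally show ?thesis by (simp add: \<phi>_def)
qed

section \<open>The power measure\<close>

lemma space_real_pos: "space real_pos = {0<..}" by (simp add: space_restrict_space)

lemma sets_real_pos_Ioi: "sets real_pos = sigma_sets {0<..} ((\<lambda>x. {x<..}) ` {0::real..})"
proof -
  have "sets real_pos = (\<inter>) {0<..} ` sigma_sets UNIV (range greaterThan)"
    by (simp add: sets_restrict_space borel_Ioi[where 'a=real])
  also have "\<dots> = sigma_sets {0<..} ((\<inter>) {0<..} ` range greaterThan)"
    by (rule sigma_sets_Int) (auto intro: sigma_sets.Basic)
  also have "(\<inter>) {0<..} ` range greaterThan = (\<lambda>x. {x<..}) ` {0::real..}"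
  proof -
    have "{0<..} \<inter> {a<..} = {max 0 a<..}" for a :: real by auto
    note Ioi = this
    show ?thesis
    proof (intro set_eqI iffI)
      fix X assume "X \<in> (\<inter>) {0<..} ` range (greaterThan :: real \<Rightarrow> _)"
      then obtain a :: real where "X = {0<..} \<inter> {a<..}" by auto
      then show "X \<in> greaterThan ` {0..}" unfolding Ioi by auto
    next
      fix X assume "X \<in> greaterThan ` {0::real..}"
      then obtain x :: real where "0 \<le> x" "X = {x<..}" by auto
      then have "X = {0<..} \<inter> {x<..}" by auto
      then show "X \<in> (\<inter>) {0<..} ` range greaterThan" by blast
    qed
  qed
  finally show ?thesis .
qed

locale power_measure =
  fixes \<alpha> :: real and m :: "real measure"
  assumes \<alpha>: "0 < \<alpha>" and sets_m: "sets m = sets real_pos"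
    and tail: "\<And>x. 0 < x \<Longrightarrow> emeasure m {x<..} = ennreal (x powr (- \<alpha>))"
begin

lemma space_m: "space m = {0<..}"
  using sets_eq_imp_space_eq[OF sets_m] by (simp add: space_real_pos)

lemma Ioi_sets: "0 \<le> x \<Longrightarrow> {x<..} \<in> sets m"
  unfolding sets_m sets_real_pos_Ioi by (auto intro: sigma_sets.Basic)

lemma emeasure_space_m: "emeasure m {0<..} = \<infinity>"
proof -
  have "of_nat n \<le> emeasure m {0<..}" for n
  proof -
    define x where "x = (real n + 1) powr (- 1 / \<alpha>)"
    have x: "0 < x" by (simp add: x_def)
    have "of_nat n \<le> ennreal (real n + 1)" by (simp add: ennreal_of_nat_eq_real_of_nat ennreal_leI)
    also have "\<dots> = emeasure m {x<..}" using \<alpha> by (subst tail[OF x]) (simp add: x_def powr_powr)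
    also have "\<dots> \<le> emeasure m {0<..}" using x by (intro emeasure_mono Ioi_sets) auto
    finally show ?thesis .
  qed
  then have "(SUP n. of_nat n) \<le> emeasure m {0<..}" by (rule SUP_least)
  then show ?thesis by (simp add: ennreal_SUP_of_nat_eq_top top_unique)
qed

text \<open>At x > 0 both measures have the tail s^\<alpha> x^(-\<alpha>). The half-line at 0, which
  is the trace of those at negative points, has infinite mass under both.\<close>

lemma distr_scale_m:
  assumes s: "0 < s"
  shows "distr m real_pos (\<lambda>x. s * x) = scale_measure (ennreal (s powr \<alpha>)) m"
proof (rule measure_eqI_generator_eq[where E="(\<lambda>x. {x<..}) ` {0..}" and \<Omega>="{0<..}" and A="\<lambda>n. {1 / real (Suc n)<..}"])
  have sc: "(\<lambda>x. s * x) \<in> m \<rightarrow>\<^sub>M real_pos"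
    using s by (intro measurable_restrict_space2)
      (auto simp: space_m measurable_cong_sets[OF sets_m refl] intro!: measurable_restrict_space1)
  show "Int_stable ((\<lambda>x. {x<..}) ` {0::real..})"
  proof (rule Int_stableI, elim imageE, simp)
    fix a b :: real assume "0 \<le> a" "0 \<le> b"
    moreover have "{a<..} \<inter> {b<..} = {max a b<..}" by auto
    ultimately show "{a<..} \<inter> {b<..} \<in> greaterThan ` {0..}" by auto
  qed
  have eq: "emeasure (distr m real_pos (\<lambda>x. s * x)) {x<..} = emeasure m {x / s<..}" if "0 \<le> x" for x
  proof -
    have "(\<lambda>x. s * x) -` {x<..} \<inter> space m = {x / s<..}"
    proof (intro set_eqI iffI)
      fix y assume "y \<in> {x / s<..}"
      moreover then have "0 < y" using s that by (auto intro: le_less_trans[of 0 "x / s"])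
      ultimately show "y \<in> (\<lambda>x. s * x) -` {x<..} \<inter> space m" using s by (simp add: space_m field_simps)
    qed (use s in \<open>simp add: space_m field_simps\<close>)
    then show ?thesis using sc Ioi_sets[OF that] sets_m by (simp add: emeasure_distr)
  qed
  show "emeasure (distr m real_pos (\<lambda>x. s * x)) X = emeasure (scale_measure (ennreal (s powr \<alpha>)) m) X"
    if "X \<in> (\<lambda>x. {x<..}) ` {0..}" for X
  proof -
    obtain x where x: "0 \<le> x" "X = {x<..}" using \<open>X \<in> _\<close> by auto
    show ?thesis
    proof (cases "x = 0")
      case True
      then show ?thesis using x eq[of 0] s by (simp add: emeasure_space_m ennreal_mult_top)
    next
      case False
      then show ?thesis using x s eq[OF x(1)]
        by (simp add: tail powr_divide powr_minus field_simps flip: ennreal_mult)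
    qed
  qed
  show "emeasure (distr m real_pos (\<lambda>x. s * x)) {1 / real (Suc i)<..} \<noteq> \<infinity>" for i
    using s eq[of "1 / real (Suc i)"] by (simp add: tail)
  show "(\<Union>i. {1 / real (Suc i)<..}) = {0<..}"
  proof
    show "{0<..} \<subseteq> (\<Union>i. {1 / real (Suc i)<..})"
      using reals_Archimedean by (auto simp: divide_inverse)
  qed (auto intro: le_less_trans[rotated])
qed (auto simp: sets_m sets_real_pos_Ioi)

lemma measurable_m_scale: "0 < s \<Longrightarrow> (\<lambda>x. s * x) \<in> m \<rightarrow>\<^sub>M real_pos"
    by (intro measurable_restrict_space2)
      (auto simp: space_m measurable_cong_sets[OF sets_m refl] intro!: measurable_restrict_space1)

lemma nn_integral_scale_m:
  assumes "0 < s" "g \<in> borel_measurable real_pos"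
  shows "(\<integral>\<^sup>+x. g (s * x) \<partial>m) = ennreal (s powr \<alpha>) * (\<integral>\<^sup>+x. g x \<partial>m)"
proof -
  have "(\<integral>\<^sup>+x. g (s * x) \<partial>m) = (\<integral>\<^sup>+x. g x \<partial>distr m real_pos (\<lambda>x. s * x))"
    using assms measurable_m_scale by (subst nn_integral_distr) auto
  then show ?thesis using assms(2)
    by (simp add: distr_scale_m[OF assms(1)] nn_integral_scale_measure measurable_cong_sets[OF sets_m refl])
qed

text \<open>As x^\<alpha> dm = \<alpha> dx / x, this number is \<alpha> ln 2.\<close>

definition window_mass :: real where
  "window_mass = enn2real (\<integral>\<^sup>+x. ennreal (x powr \<alpha>) * indicator {1/2..<1} x \<partial>m)"

text \<open>Homogeneity of \<open>m\<close> makes x^\<alpha> dm invariant under scaling, which moves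
  \<open>{s/2..<s}\<close> to \<open>{1/2..<1}\<close>. Finiteness comes from x^\<alpha> <= 1 below
  1, positivity from the strict difference of the tails at 1/2 and 3/4.\<close>

lemma window_mass:
  shows "0 < window_mass" and "0 < s \<Longrightarrow>
    (\<integral>\<^sup>+x. ennreal (x powr \<alpha>) * indicator {s/2..<s} x \<partial>m) = ennreal window_mass"
proof -
  have Ico: "{a..<b} \<in> sets m" if "0 < a" for a b :: real
    unfolding sets_m using that by (auto simp: sets_restrict_space image_iff intro!: bexI[of _ "{a..<b}"])
  have [measurable]: "(\<lambda>x. x powr \<alpha>) \<in> borel_measurable real_pos"
    by (rule measurable_restrict_space1) measurable
  let ?I = "\<integral>\<^sup>+x. ennreal (x powr \<alpha>) * indicator {1/2..<1} x \<partial>m"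
  have "?I \<le> (\<integral>\<^sup>+x. indicator {1/4<..} x \<partial>m)"
  proof (intro nn_integral_mono)
    fix x :: real
    have "x powr \<alpha> \<le> 1" if "1/2 \<le> x" "x < 1" using that \<alpha> powr_mono2[of \<alpha> x 1] by simp
    then show "ennreal (x powr \<alpha>) * indicator {1/2..<1} x \<le> indicator {1/4<..} x"
      by (auto simp: indicator_def)
  qed
  also have "\<dots> = emeasure m {1/4<..}" using Ioi_sets[of "1/4"] by simp
  also have "\<dots> < \<infinity>" by (simp add: tail)
  finally have fin: "?I < \<infinity>" .
  have "ennreal ((1/2) powr \<alpha>) * emeasure m {1/2..<1} \<le> ?I"
  proof -
    have "ennreal ((1/2) powr \<alpha>) * emeasure m {1/2..<1} = (\<integral>\<^sup>+x. ennreal ((1/2) powr \<alpha>) * indicator {1/2..<1} x \<partial>m)"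
      using Ico[of "1/2" 1] by (simp add: nn_integral_cmult_indicator)
    also have "\<dots> \<le> ?I" using \<alpha> by (intro nn_integral_mono) (auto simp: indicator_def intro!: ennreal_leI powr_mono2)
    finally show ?thesis .
  qed
  moreover have "0 < emeasure m {1/2..<1}"
  proof -
    have "emeasure m {1/2<..} \<le> emeasure m ({1/2..<1} \<union> {3/4<..})"
      using Ico[of "1/2" 1] Ioi_sets[of "3/4"] by (intro emeasure_mono) auto
    also have "\<dots> \<le> emeasure m {1/2..<1} + emeasure m {3/4<..}"
      using Ico[of "1/2" 1] Ioi_sets[of "3/4"] by (intro emeasure_subadditive) auto
    finally have "ennreal ((1/2) powr - \<alpha>) \<le> emeasure m {1/2..<1} + ennreal ((3/4) powr - \<alpha>)" by (simp add: tail)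
    moreover have "(3/4) powr - \<alpha> < (1/2) powr - \<alpha>" using \<alpha> by (intro powr_less_mono2_neg) auto
    ultimately have "emeasure m {1/2..<1} \<noteq> 0" by (auto simp: not_le)
    then show ?thesis by (simp add: zero_less_iff_neq_zero)
  qed
  ultimately have "0 < ?I" using less_le_trans[of 0 "ennreal ((1/2) powr \<alpha>) * emeasure m {1/2..<1}"]
    by (auto simp: ennreal_zero_less_mult_iff)
  then show "0 < window_mass" using fin by (simp add: window_mass_def enn2real_positive_iff)
  show "(\<integral>\<^sup>+x. ennreal (x powr \<alpha>) * indicator {s/2..<s} x \<partial>m) = ennreal window_mass" if s: "0 < s"
  proof -
    have "(\<lambda>x. ennreal (x powr \<alpha>) * indicator {1/2..<1} x) \<in> borel_measurable real_pos"
    proof -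
      have [measurable]: "{1/2..<1::real} \<in> sets real_pos" using Ico[of "1/2" 1] by (simp add: sets_m)
      show ?thesis by measurable
    qed
    from nn_integral_scale_m[of "1 / s", OF _ this] s
    have "(\<integral>\<^sup>+x. ennreal ((x / s) powr \<alpha>) * indicator {1/2..<1} (x / s) \<partial>m) = ennreal ((1 / s) powr \<alpha>) * ?I"
      by simp
    moreover have "(\<integral>\<^sup>+x. ennreal ((x / s) powr \<alpha>) * indicator {1/2..<1} (x / s) \<partial>m) =
      (\<integral>\<^sup>+x. ennreal ((1 / s) powr \<alpha>) * (ennreal (x powr \<alpha>) * indicator {s/2..<s} x) \<partial>m)"
      using s by (intro nn_integral_cong)
        (auto simp: indicator_def field_simps space_m powr_divide simp flip: ennreal_mult)
    moreover have "\<dots> = ennreal ((1 / s) powr \<alpha>) * (\<integral>\<^sup>+x. ennreal (x powr \<alpha>) * indicator {s/2..<s} x \<partial>m)"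
    proof (rule nn_integral_cmult)
      have [measurable]: "{s/2..<s} \<in> sets real_pos" using Ico[of "s/2" s] s by (simp add: sets_m)
      show "(\<lambda>x. ennreal (x powr \<alpha>) * indicator {s/2..<s} x) \<in> borel_measurable m"
        unfolding measurable_cong_sets[OF sets_m refl] by measurable
    qed
    ultimately have "ennreal ((1 / s) powr \<alpha>) * (\<integral>\<^sup>+x. ennreal (x powr \<alpha>) * indicator {s/2..<s} x \<partial>m) = ennreal ((1 / s) powr \<alpha>) * ?I"
      by simp
    then have "(\<integral>\<^sup>+x. ennreal (x powr \<alpha>) * indicator {s/2..<s} x \<partial>m) = ?I"
      using s by (subst (asm) ennreal_mult_cancel_left) auto
    then show ?thesis using fin by (simp add: window_mass_def)
  qed
qed

end

section \<open>Existence of the Poisson random measure\<close>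

text \<open>Exponentials with integer factors are closed under products, and the one with n = 1
  already generates the Borel sets, since \<open>neg_ln\<close> inverts it.\<close>

lemma law_eqI_exp_neg:
  assumes "prob_space M" "prob_space M'" and X[measurable]: "X \<in> borel_measurable M" "X' \<in> borel_measurable M'"
    and eq: "\<And>n::nat. (\<integral>\<omega>. exp_neg (of_nat n * X \<omega>) \<partial>M) = (\<integral>\<omega>. exp_neg (of_nat n * X' \<omega>) \<partial>M')"
  shows "distr M borel X = distr M' borel (X' :: _ \<Rightarrow> ennreal)"
proof (rule measure_eqI_multiplicative[where F="range (\<lambda>n::nat. \<lambda>x. exp_neg (of_nat n * x))"])
  show "prob_space (distr M borel X)" "prob_space (distr M' borel X')"
    using assms by (auto intro: prob_space.prob_space_distr)
  fix f assume "f \<in> range (\<lambda>n::nat. \<lambda>x. exp_neg (of_nat n * x))"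
  then obtain n :: nat where f: "f = (\<lambda>x. exp_neg (of_nat n * x))" by auto
  show "f \<in> borel_measurable (distr M borel X)" unfolding f by measurable
  show "(\<integral>x. f x \<partial>distr M borel X) = (\<integral>x. f x \<partial>distr M' borel X')"
    unfolding f using eq[of n] by (subst (1 2) integral_distr) auto
  fix g assume "g \<in> range (\<lambda>n::nat. \<lambda>x. exp_neg (of_nat n * x))"
  then obtain k :: nat where g: "g = (\<lambda>x. exp_neg (of_nat k * x))" by auto
  show "(\<lambda>x. f x * g x) \<in> range (\<lambda>n::nat. \<lambda>x. exp_neg (of_nat n * x))"
    unfolding f g by (rule image_eqI[of _ _ "n + k"]) (auto simp: exp_neg_add[symmetric] distrib_right)
next
  fix f x assume "f \<in> range (\<lambda>n::nat. \<lambda>x. exp_neg (of_nat n * x))"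
  then show "0 \<le> f x \<and> f x \<le> 1" using exp_neg_bounds by auto
next
  fix G :: "ennreal measure"
  assume G: "space G = space (distr M borel X)" "\<And>f. f \<in> range (\<lambda>n::nat. \<lambda>x. exp_neg (of_nat n * x)) \<Longrightarrow> f \<in> borel_measurable G"
  have "(\<lambda>x. exp_neg (of_nat 1 * x)) \<in> borel_measurable G" by (rule G(2)) blast
  then have "(\<lambda>x. exp_neg x) \<in> borel_measurable G" by simp
  from measurable_compose[OF this measurable_neg_ln] have "(\<lambda>x. x) \<in> borel_measurable G" by (simp add: neg_ln_exp_neg)
  from measurable_sets[OF this] show "sets (distr M borel X) \<subseteq> sets G" using G(1) by auto
qed simp

text \<open>Comparison with an actual Poisson variable of the same transform; rate 0 is represented
  by the point mass at 0.\<close>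

lemma poisson_law_if_laplace:
  assumes L: "prob_space L" and X[measurable]: "X \<in> borel_measurable L" and a: "0 \<le> a"
    and lap: "\<And>c. (\<integral>\<omega>. exp_neg (c * X \<omega>) \<partial>L) = exp (- (1 - exp_neg c) * a)"
  shows "measure L {\<omega> \<in> space L. X \<omega> = of_nat k} = exp (- a) * a ^ k / fact k"
proof -
  define p where "p = (if a = 0 then return_pmf 0 else poisson_pmf a)"
  have pk: "pmf p k = exp (- a) * a ^ k / fact k" for k
    using a by (cases k) (auto simp: p_def)
  have meas_p: "measure (measure_pmf p) {n \<in> space (measure_pmf p). (of_nat n :: ennreal) = of_nat k} = exp (- a) * a ^ k / fact k" for k
    by (simp add: measure_pmf_single pk)
  have "distr L borel X = distr (measure_pmf p) borel (\<lambda>n. of_nat n :: ennreal)"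
    by (rule law_eqI_exp_neg)
       (auto simp: lap poisson_laplace_transform[OF measure_pmf.prob_space_axioms _ a meas_p] intro: L measure_pmf.prob_space_axioms)
  then have "measure (distr L borel X) {of_nat k} = measure (distr (measure_pmf p) borel of_nat) {of_nat k :: ennreal}" by simp
  then show ?thesis using meas_p[of k] by (simp add: measure_distr vimage_def Int_def conj_commute)
qed

lemma measure_eqI_PiM_exp_neg:
  fixes A B :: "(nat \<Rightarrow> ennreal) measure"
  assumes AB: "prob_space A" "prob_space B" and sets: "sets A = sets (PiM UNIV (\<lambda>_. borel))" "sets B = sets (PiM UNIV (\<lambda>_. borel))"
    and eq: "\<And>(t :: nat \<Rightarrow> nat) n. (\<integral>x. (\<Prod>i<n. exp_neg (of_nat (t i) * x i)) \<partial>A) = (\<integral>x. (\<Prod>i<n. exp_neg (of_nat (t i) * x i)) \<partial>B)"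
  shows "A = B"
proof -
  define F where "F = {(\<lambda>x :: nat \<Rightarrow> ennreal. \<Prod>i<n. exp_neg (of_nat (t i) * x i)) | (t :: nat \<Rightarrow> nat) n. True}"
  have m: "(\<lambda>x. x i) \<in> borel_measurable A" for i :: nat
    unfolding measurable_cong_sets[OF sets(1) refl] by measurable
  show ?thesis
  proof (rule measure_eqI_multiplicative[OF AB, where F=F])
    fix f assume "f \<in> F"
    then obtain t n where f: "f = (\<lambda>x. \<Prod>i<n::nat. exp_neg (of_nat (t i) * x i))" unfolding F_def by blast
    note [measurable] = m
    show "f \<in> borel_measurable A" unfolding f by measurable
    show "(\<integral>x. f x \<partial>A) = (\<integral>x. f x \<partial>B)" unfolding f by (rule eq)
    fix g assume "g \<in> F"
    then obtain s k where g: "g = (\<lambda>x. \<Prod>i<k::nat. exp_neg (of_nat (s i) * x i))" unfolding F_def by blast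
    \<comment> \<open>Padding with exponents 0 brings two products to the common length
      \<open>max n k\<close>, where multiplying them adds exponents.\<close>
    have ext: "(\<Prod>i<n::nat. exp_neg (of_nat (t i) * x i)) = (\<Prod>i<max n k. exp_neg (of_nat (if i < n then t i else 0) * x i))" for n k t and x :: "nat \<Rightarrow> ennreal"
      by (intro prod.mono_neutral_cong_left) auto
    have "f x * g x = (\<Prod>i<max n k. exp_neg (of_nat ((if i < n then t i else 0) + (if i < k then s i else 0)) * x i))" for x
      unfolding f g ext[of t x n k] ext[of s x k n] max.commute[of k n] prod.distrib[symmetric]
      by (intro prod.cong) (auto simp: exp_neg_add[symmetric] distrib_right)
    then show "(\<lambda>x. f x * g x) \<in> F"
      unfolding F_def by (intro CollectI exI[of _ "\<lambda>i. (if i < n then t i else 0) + (if i < k then s i else 0)"] exI[of _ "max n k"]) auto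
  next
    fix f x assume "f \<in> F" then show "0 \<le> f x \<and> f x \<le> 1"
      unfolding F_def by (auto intro!: prod_nonneg prod_le_1 simp: exp_neg_bounds)
  next
    fix G assume G: "space G = space A" and F: "\<And>f. f \<in> F \<Longrightarrow> f \<in> borel_measurable G"
    have "(\<lambda>x. x i) \<in> borel_measurable G" for i
    proof -
      have "(\<lambda>x. exp_neg (x i)) = (\<lambda>x. \<Prod>j<Suc i. exp_neg (of_nat (if j = i then 1 else 0) * x j))"
        by (auto simp: fun_eq_iff)
      also have "\<dots> \<in> F" unfolding F_def
        by (intro CollectI exI[of _ "\<lambda>j. if j = i then 1 else 0"] exI[of _ "Suc i"]) simp
      finally have "(\<lambda>x. exp_neg (x i)) \<in> borel_measurable G" by (rule F)
      from measurable_compose[OF this measurable_neg_ln] show ?thesis by (simp add: neg_ln_exp_neg)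
    qed
    then have "(\<lambda>x. x) \<in> G \<rightarrow>\<^sub>M PiM UNIV (\<lambda>_. borel)"
      using G sets_eq_imp_space_eq[OF sets(1)] by (intro measurable_PiM_single') (auto simp: space_PiM)
    from measurable_sets[OF this] show "sets A \<subseteq> sets G"
      using G sets(1) sets_eq_imp_space_eq[OF sets(1)] by (auto simp: space_PiM)
  qed (use sets in simp)
qed

text \<open>The converse of the Laplace formula. Multiples of one indicator determine the law of
  each count; combinations of disjoint indicators determine the joint law, whose transform factors,
  which is independence.\<close>

proposition poisson_random_measureI_laplace:
  assumes L: "prob_space L" and \<Lambda>: "\<Lambda> \<in> L \<rightarrow>\<^sub>M measure_algebra m"
    and lap: "\<And>g. g \<in> borel_measurable m \<Longrightarrow> LF L \<Lambda> g = exp_neg (\<integral>\<^sup>+x. ennreal (1 - exp_neg (g x)) \<partial>m)"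
  shows "poisson_random_measure L m \<Lambda>"
proof -
  interpret prob_space L by fact
  note \<Lambda>m = measurable_measure_algebraD[OF \<Lambda>]
  have ind: "(\<integral>\<^sup>+x. c * indicator A x \<partial>\<Lambda> \<omega>) = c * emeasure (\<Lambda> \<omega>) A" if "A \<in> sets m" "\<omega> \<in> space L" for A c \<omega>
    using that \<Lambda>m by (intro nn_integral_cmult_indicator) auto
  have lapA: "(\<integral>\<omega>. exp_neg (c * emeasure (\<Lambda> \<omega>) A) \<partial>L) = exp_neg (ennreal (1 - exp_neg c) * emeasure m A)"
    if A: "A \<in> sets m" for A c
  proof -
    have "(\<integral>\<omega>. exp_neg (c * emeasure (\<Lambda> \<omega>) A) \<partial>L) = LF L \<Lambda> (\<lambda>x. c * indicator A x)"
      unfolding LF_def using ind[OF A] by (intro Bochner_Integration.integral_cong) auto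
    also have "\<dots> = exp_neg (\<integral>\<^sup>+x. ennreal (1 - exp_neg (c * indicator A x)) \<partial>m)"
    proof (rule lap)
      note [measurable] = A
      show "(\<lambda>x. c * indicator A x) \<in> borel_measurable m" by measurable
    qed
    also have "(\<integral>\<^sup>+x. ennreal (1 - exp_neg (c * indicator A x)) \<partial>m) = (\<integral>\<^sup>+x. ennreal (1 - exp_neg c) * indicator A x \<partial>m)"
      by (intro nn_integral_cong) (auto simp: indicator_def)
    also have "\<dots> = ennreal (1 - exp_neg c) * emeasure m A" using A by (rule nn_integral_cmult_indicator)
    finally show ?thesis .
  qed
  show ?thesis unfolding poisson_random_measure_def
  proof (intro conjI ballI impI allI \<Lambda>)
    fix A k assume A: "A \<in> sets m" "emeasure m A < \<infinity>"
    then have fin: "emeasure m A = ennreal (measure m A)" by (simp add: emeasure_eq_ennreal_measure)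
    have "exp_neg (ennreal (1 - exp_neg c) * emeasure m A) = exp (- (1 - exp_neg c) * measure m A)" for c
    proof -
      have "ennreal (1 - exp_neg c) * emeasure m A = ennreal ((1 - exp_neg c) * measure m A)"
        unfolding fin using exp_neg_bounds[of c] by (simp add: ennreal_mult)
      then show ?thesis using exp_neg_bounds[of c] by (simp add: exp_neg_ennreal) (simp add: algebra_simps)
    qed
    then show "prob {\<omega> \<in> space L. emeasure (\<Lambda> \<omega>) A = of_nat k} = exp (- measure m A) * measure m A ^ k / fact k"
      using \<Lambda>m(2)[OF A(1)] lapA[OF A(1)] by (intro poisson_law_if_laplace L) auto
  next
    fix A assume A: "A \<in> sets m" "emeasure m A = \<infinity>"
    have [measurable]: "(\<lambda>\<omega>. emeasure (\<Lambda> \<omega>) A) \<in> borel_measurable L" using \<Lambda>m(2)[OF A(1)] .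
    \<comment> \<open>c = 1 suffices: if the expectation of \<open>exp_neg\<close> of the count is
      0, the count is almost surely infinite.\<close>
    have "ennreal (1 - exp_neg 1) * emeasure m A = \<infinity>"
      using A(2) by (simp add: exp_neg_def ennreal_mult_top)
    then have "(\<integral>\<omega>. exp_neg (emeasure (\<Lambda> \<omega>) A) \<partial>L) = 0" using lapA[OF A(1), of 1] by simp
    then have "AE \<omega> in L. exp_neg (emeasure (\<Lambda> \<omega>) A) = 0"
      by (subst (asm) integral_nonneg_eq_0_iff_AE) (auto intro!: integrable_exp_neg finite_measure_axioms simp: exp_neg_bounds)
    then show "AE \<omega> in L. emeasure (\<Lambda> \<omega>) A = \<infinity>"
      by eventually_elim (simp add: exp_neg_def split: if_splits)
  next
    fix A :: "nat \<Rightarrow> 'b set"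
    assume A: "range A \<subseteq> sets m \<and> disjoint_family A"
    then have Am: "A i \<in> sets m" for i by auto
    have X[measurable]: "(\<lambda>\<omega>. emeasure (\<Lambda> \<omega>) (A i)) \<in> borel_measurable L" for i using \<Lambda>m(2)[OF Am] .
    \<comment> \<open>Independence is obtained as equality of the joint law with the product of the
      marginals.\<close>
    let ?D = "distr L (PiM UNIV (\<lambda>_. borel)) (\<lambda>\<omega>. \<lambda>i\<in>UNIV. emeasure (\<Lambda> \<omega>) (A i))"
    let ?P = "PiM UNIV (\<lambda>i. distr L borel (\<lambda>\<omega>. emeasure (\<Lambda> \<omega>) (A i)))"
    have pd: "prob_space (distr L borel (\<lambda>\<omega>. emeasure (\<Lambda> \<omega>) (A i)))" for i by (intro prob_space_distr) simp
    have Xm: "(\<lambda>\<omega>. \<lambda>i\<in>UNIV. emeasure (\<Lambda> \<omega>) (A i)) \<in> L \<rightarrow>\<^sub>M PiM UNIV (\<lambda>_. borel)" by measurable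
    have "?D = ?P"
    proof (rule measure_eqI_PiM_exp_neg)
      show "prob_space ?D" using Xm by (rule prob_space_distr)
      show "prob_space ?P" using pd by (rule prob_space_PiM)
      show "sets ?P = sets (PiM UNIV (\<lambda>_. borel))" by (intro sets_PiM_cong) auto
      fix t :: "nat \<Rightarrow> nat" and n
      have "(\<integral>x. (\<Prod>i<n. exp_neg (of_nat (t i) * x i)) \<partial>?D) = (\<integral>\<omega>. exp_neg (\<Sum>i<n. of_nat (t i) * emeasure (\<Lambda> \<omega>) (A i)) \<partial>L)"
        using Xm by (subst integral_distr) (auto simp: exp_neg_sum)
      also have "\<dots> = LF L \<Lambda> (\<lambda>x. \<Sum>i<n. of_nat (t i) * indicator (A i) x)"
      proof -
        have "(\<integral>\<^sup>+x. (\<Sum>i<n. of_nat (t i) * indicator (A i) x) \<partial>\<Lambda> \<omega>) = (\<Sum>i<n. of_nat (t i) * emeasure (\<Lambda> \<omega>) (A i))"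
          if "\<omega> \<in> space L" for \<omega>
          using that \<Lambda>m(1)[OF that] Am by (subst nn_integral_sum) (auto simp: ind)
        then show ?thesis unfolding LF_def by (intro Bochner_Integration.integral_cong) auto
      qed
      also have "\<dots> = exp_neg (\<integral>\<^sup>+x. ennreal (1 - exp_neg (\<Sum>i<n. of_nat (t i) * indicator (A i) x)) \<partial>m)"
      proof (rule lap)
        show "(\<lambda>x. \<Sum>i<n. of_nat (t i) * indicator (A i) x :: ennreal) \<in> borel_measurable m"
        proof (rule borel_measurable_sum)
          fix i
          have [measurable]: "A i \<in> sets m" by (rule Am)
          show "(\<lambda>x. of_nat (t i) * indicator (A i) x :: ennreal) \<in> borel_measurable m" by measurable
        qed
      qed
      also have "(\<integral>\<^sup>+x. ennreal (1 - exp_neg (\<Sum>i<n. of_nat (t i) * indicator (A i) x)) \<partial>m) =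
        (\<integral>\<^sup>+x. (\<Sum>i<n. ennreal (1 - exp_neg (of_nat (t i))) * indicator (A i) x) \<partial>m)"
      \<comment> \<open>A point lies in at most one \<open>A i\<close>, so each sum has at most one
        nonzero term and 1 - \<open>exp_neg\<close> passes through it.\<close>
      proof (intro nn_integral_cong)
        fix x
        show "ennreal (1 - exp_neg (\<Sum>i<n. of_nat (t i) * indicator (A i) x)) = (\<Sum>i<n. ennreal (1 - exp_neg (of_nat (t i))) * indicator (A i) x)"
        proof (cases "\<exists>i<n. x \<in> A i")
          case True
          then obtain i where i: "i < n" "x \<in> A i" by blast
          have "x \<notin> A j" if "j \<noteq> i" for j using A i(2) disjoint_family_onD[of A UNIV j i] that by blast
          then have "(\<Sum>j<n. F j * indicator (A j) x) = (\<Sum>j<n. if j = i then F i else 0)" for F :: "nat \<Rightarrow> ennreal"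
            using i(2) by (intro sum.cong) auto
          then have "(\<Sum>j<n. F j * indicator (A j) x) = F i" for F :: "nat \<Rightarrow> ennreal" using i(1) by simp
          then show ?thesis by metis
        next
          case False
          then have zero: "(\<Sum>j<n. F j * indicator (A j) x) = 0" for F :: "nat \<Rightarrow> ennreal"
            by (intro sum.neutral) auto
          show ?thesis by (simp only: zero exp_neg_0) simp
        qed
      qed
      also have "\<dots> = (\<Sum>i<n. ennreal (1 - exp_neg (of_nat (t i))) * emeasure m (A i))"
        using Am by (subst nn_integral_sum) (auto intro!: sum.cong nn_integral_cmult_indicator)
      also have "exp_neg \<dots> = (\<Prod>i<n. \<integral>\<omega>. exp_neg (of_nat (t i) * emeasure (\<Lambda> \<omega>) (A i)) \<partial>L)"
        by (simp add: exp_neg_sum lapA[OF Am])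
      also have "\<dots> = (\<Prod>i<n. \<integral>x. exp_neg (of_nat (t i) * x) \<partial>distr L borel (\<lambda>\<omega>. emeasure (\<Lambda> \<omega>) (A i)))"
        by (intro prod.cong refl integral_distr[symmetric]) auto
      also have "\<dots> = (\<integral>x. (\<Prod>i<n. exp_neg (of_nat (t i) * x i)) \<partial>?P)"
        by (rule integral_PiM_prod[symmetric, OF pd]) (auto simp: exp_neg_bounds)
      finally show "(\<integral>x. (\<Prod>i<n. exp_neg (of_nat (t i) * x i)) \<partial>?D) = (\<integral>x. (\<Prod>i<n. exp_neg (of_nat (t i) * x i)) \<partial>?P)" .
    qed simp
    then show "indep_vars (\<lambda>_. borel) (\<lambda>i \<omega>. emeasure (\<Lambda> \<omega>) (A i)) UNIV"
      by (subst indep_vars_iff_distr_eq_PiM) auto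
  qed
qed

section \<open>Construction of the Poisson points from blocks of mass one\<close>

text \<open>Take a Poisson number, of mean 1, of independent points with law \<open>D\<close>. Given
  k points the transform is p^k, and the Poisson generating function turns this into exp(-(1 - p)),
  where 1 - p is the integral of 1 - \<open>exp_neg (g x)\<close>.\<close>

lemma poisson_many_laplace:
  assumes D: "prob_space D" and g[measurable]: "g \<in> borel_measurable D"
  defines "S \<equiv> measure_pmf (poisson_pmf 1) \<Otimes>\<^sub>M (\<Pi>\<^sub>M i\<in>(UNIV :: nat set). D)"
  shows "prob_space S"
    and "(\<lambda>y. \<Sum>i. (if i < fst y then g (snd y i) else 0)) \<in> borel_measurable S"
    and "(\<integral>y. exp_neg (\<Sum>i. (if i < fst y then g (snd y i) else 0)) \<partial>S) = exp_neg (\<integral>\<^sup>+x. ennreal (1 - exp_neg (g x)) \<partial>D)"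
proof -
  let ?\<Pi> = "\<Pi>\<^sub>M i\<in>(UNIV :: nat set). D" and ?K = "measure_pmf (poisson_pmf 1)"
  interpret D: prob_space D by fact
  interpret K: prob_space ?K by (rule measure_pmf.prob_space_axioms)
  interpret \<Pi>: product_prob_space "\<lambda>_. D" "UNIV :: nat set" by (intro product_prob_spaceI D)
  interpret pair_prob_space ?K ?\<Pi> ..
  show "prob_space S" unfolding S_def by (rule prob_space_axioms)
  have [measurable]: "fst \<in> S \<rightarrow>\<^sub>M count_space UNIV"
    unfolding S_def by (rule measurable_compose[OF measurable_fst]) simp
  have [measurable]: "(\<lambda>y. g (snd y i)) \<in> borel_measurable S" for i unfolding S_def by measurable
  show m[measurable]: "(\<lambda>y. \<Sum>i. (if i < fst y then g (snd y i) else 0)) \<in> borel_measurable S" by measurable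
  define p where "p = D.expectation (\<lambda>x. exp_neg (g x))"
  have p: "0 \<le> p" "p \<le> 1" unfolding p_def using exp_neg_bounds by (intro D.integral_unit_interval; simp)+
  have inner: "(\<integral>\<eta>. exp_neg (\<Sum>i. (if i < k then g (\<eta> i) else 0)) \<partial>?\<Pi>) = p ^ k" for k :: nat
  proof -
    have "(\<integral>\<eta>. exp_neg (\<Sum>i. (if i < k then g (\<eta> i) else 0)) \<partial>?\<Pi>) = (\<integral>\<eta>. (\<Prod>i<k. exp_neg (g (\<eta> i))) \<partial>?\<Pi>)"
    proof (intro Bochner_Integration.integral_cong refl)
      fix \<eta> :: "nat \<Rightarrow> 'a"
      have "(\<Sum>i. (if i < k then g (\<eta> i) else 0)) = (\<Sum>i<k. (if i < k then g (\<eta> i) else 0))"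
        by (rule suminf_finite) auto
      then show "exp_neg (\<Sum>i. (if i < k then g (\<eta> i) else 0)) = (\<Prod>i<k. exp_neg (g (\<eta> i)))"
        by (simp add: exp_neg_sum)
    qed
    also have "\<dots> = p ^ k" by (subst integral_PiM_prod[OF D]) (auto simp: exp_neg_bounds p_def)
    finally show ?thesis .
  qed
  have "integrable (?K \<Otimes>\<^sub>M ?\<Pi>) (\<lambda>y. exp_neg (\<Sum>i. (if i < fst y then g (snd y i) else 0)))"
    using m unfolding S_def by (intro integrable_exp_neg finite_measure_axioms)
  from integral_fst'[OF this] have "(\<integral>y. exp_neg (\<Sum>i. (if i < fst y then g (snd y i) else 0)) \<partial>S) =
    (\<integral>k. (\<integral>\<eta>. exp_neg (\<Sum>i. (if i < k then g (\<eta> i) else 0)) \<partial>?\<Pi>) \<partial>?K)"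
    by (simp add: S_def cong: if_cong)
  also have "\<dots> = (\<integral>k. exp_neg (neg_ln p * of_nat k) \<partial>?K)"
  proof -
    have "exp_neg (neg_ln p * of_nat k) = p ^ k" for k :: nat
      by (induction k) (auto simp: exp_neg_add algebra_simps exp_neg_neg_ln p)
    then show ?thesis by (simp add: inner)
  qed
  also have "\<dots> = exp (- (1 - p) * 1)"
  proof -
    have "measure ?K {n \<in> space ?K. (of_nat n :: ennreal) = of_nat k} = exp (- 1) * 1 ^ k / fact k" for k
      by (simp add: measure_pmf_single)
    from poisson_laplace_transform[OF measure_pmf.prob_space_axioms _ _ this, of "neg_ln p"] show ?thesis
      by (simp add: exp_neg_neg_ln p)
  qed
  also have "\<dots> = exp_neg (ennreal (1 - p))" using p by (simp add: exp_neg_ennreal)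
  also have "ennreal (1 - p) = (\<integral>\<^sup>+x. ennreal (1 - exp_neg (g x)) \<partial>D)"
  proof -
    have "integrable D (\<lambda>x. exp_neg (g x))" by (intro integrable_exp_neg D.finite_measure_axioms) simp
    then show ?thesis by (subst nn_integral_eq_integral) (auto simp: p_def D.prob_space exp_neg_bounds)
  qed
  finally show "(\<integral>y. exp_neg (\<Sum>i. (if i < fst y then g (snd y i) else 0)) \<partial>S) = exp_neg (\<integral>\<^sup>+x. ennreal (1 - exp_neg (g x)) \<partial>D)" .
qed

text \<open>\<open>nth_mem T k\<close> agrees with \<^const>\<open>enumerate\<close> on infinite sets, but is visibly measurable in \<open>T\<close>.\<close>

primrec nth_mem :: "nat set \<Rightarrow> nat \<Rightarrow> nat" where
  "nth_mem T 0 = (LEAST n. n \<in> T)"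
| "nth_mem T (Suc k) = (LEAST n. n \<in> T \<and> nth_mem T k < n)"

lemma nth_mem_eq_enumerate: "infinite T \<Longrightarrow> nth_mem T k = enumerate T k"
  by (induction k) (auto simp: enumerate_0 enumerate_Suc'')

lemma measurable_nth_mem:
  assumes [measurable]: "\<And>n. Measurable.pred M (\<lambda>\<omega>. n \<in> T \<omega>)"
  shows "(\<lambda>\<omega>. nth_mem (T \<omega>) k) \<in> M \<rightarrow>\<^sub>M count_space UNIV"
  by (induction k) simp_all

lemma suminf_nth_mem:
  assumes "infinite T"
  shows "(\<Sum>k. F (nth_mem T k)) = (\<Sum>n. if n \<in> T then F n else (0 :: ennreal))"
proof -
  have "(\<Sum>k. F (nth_mem T k)) = (\<integral>\<^sup>+k. F (enumerate T k) \<partial>count_space UNIV)"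
    by (simp add: nn_integral_count_space_nat nth_mem_eq_enumerate[OF assms])
  also have "\<dots> = (\<integral>\<^sup>+n. F n \<partial>count_space T)"
    by (rule nn_integral_bij_count_space[OF bij_enumerate[OF assms]])
  also have "\<dots> = (\<integral>\<^sup>+n. F n * indicator T n \<partial>count_space UNIV)"
    by (simp add: nn_integral_count_space_indicator)
  also have "\<dots> = (\<Sum>n. if n \<in> T then F n else 0)"
    by (auto simp: nn_integral_count_space_nat intro!: suminf_cong)
  finally show ?thesis .
qed

text \<open>
  The space is cut into countably many pieces of mass one; on each piece a Poisson number of
  independent points is placed, and all the points are then listed in one sequence.
\<close>

lemma ex_poisson_sequence:
  fixes m :: "'a measure"
  assumes D: "\<And>j::nat. prob_space (D j)" "\<And>j. sets (D j) = sets m"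
    and sum: "\<And>g. g \<in> borel_measurable m \<Longrightarrow> (\<integral>\<^sup>+x. g x \<partial>m) = (\<Sum>j. \<integral>\<^sup>+x. g x \<partial>D j)"
  shows "\<exists>(\<Omega> :: (nat \<Rightarrow> nat \<times> (nat \<Rightarrow> 'a)) measure) l. prob_space \<Omega> \<and> (\<forall>k::nat. l k \<in> \<Omega> \<rightarrow>\<^sub>M m) \<and>
    (\<forall>g\<in>borel_measurable m. (\<integral>\<omega>. exp_neg (\<Sum>k. g (l k \<omega>)) \<partial>\<Omega>) = exp_neg (\<integral>\<^sup>+x. ennreal (1 - exp_neg (g x)) \<partial>m))"
proof -
  define S where "S j = measure_pmf (poisson_pmf 1) \<Otimes>\<^sub>M (\<Pi>\<^sub>M i\<in>(UNIV :: nat set). D j)" for j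
  define \<Omega> where "\<Omega> = PiM UNIV S"
  have S: "prob_space (S j)" for j
    unfolding S_def by (rule poisson_many_laplace(1)[where g="\<lambda>_. 0"]) (use D in auto)
  interpret \<Omega>: product_prob_space S UNIV by (intro product_prob_spaceI S)
  have ps: "prob_space \<Omega>" unfolding \<Omega>_def by unfold_locales
  interpret prob_space \<Omega> by (rule ps)
  \<comment> \<open>n encodes place i of block j; the place is in use when i is below the Poisson
    count of the block.\<close>
  define T where "T \<omega> = {n. snd (prod_decode n) < fst (\<omega> (fst (prod_decode n)))}" for \<omega> :: "nat \<Rightarrow> nat \<times> (nat \<Rightarrow> 'a)"
  define X where "X n \<omega> = snd (\<omega> (fst (prod_decode n))) (snd (prod_decode n))" for n and \<omega> :: "nat \<Rightarrow> nat \<times> (nat \<Rightarrow> 'a)"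
  have comp: "(\<lambda>\<omega>. \<omega> j) \<in> \<Omega> \<rightarrow>\<^sub>M S j" for j unfolding \<Omega>_def by (rule measurable_component_singleton) simp
  have fstS: "fst \<in> S j \<rightarrow>\<^sub>M count_space UNIV" for j
    unfolding S_def by (rule measurable_compose[OF measurable_fst]) simp
  have [measurable]: "(\<lambda>\<omega>. fst (\<omega> j)) \<in> \<Omega> \<rightarrow>\<^sub>M count_space UNIV" for j
    using measurable_compose[OF comp fstS] .
  have X[measurable]: "X n \<in> \<Omega> \<rightarrow>\<^sub>M m" for n
  proof -
    have "(\<lambda>y. snd y i) \<in> S j \<rightarrow>\<^sub>M D j" for i j unfolding S_def by measurable
    from measurable_compose[OF comp this] show ?thesis unfolding X_def measurable_cong_sets[OF refl D(2)] .
  qed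
  have T[measurable]: "Measurable.pred \<Omega> (\<lambda>\<omega>. n \<in> T \<omega>)" for n unfolding T_def by measurable
  define l where "l k \<omega> = X (nth_mem (T \<omega>) k) \<omega>" for k \<omega>
  have l: "l k \<in> \<Omega> \<rightarrow>\<^sub>M m" for k
    unfolding l_def by (rule measurable_compose_countable[OF X measurable_nth_mem[OF T]])
  have lap: "(\<integral>\<omega>. exp_neg (\<Sum>n. if n \<in> T \<omega> then g (X n \<omega>) else 0) \<partial>\<Omega>) = exp_neg (\<integral>\<^sup>+x. ennreal (1 - exp_neg (g x)) \<partial>m)"
    if g: "g \<in> borel_measurable m" for g
  proof -
    have gD: "g \<in> borel_measurable (D j)" for j using g D(2) by (simp cong: measurable_cong_sets)
    have "(\<Sum>n. if n \<in> T \<omega> then g (X n \<omega>) else 0) = (\<Sum>j. \<Sum>i. (if i < fst (\<omega> j) then g (snd (\<omega> j) i) else 0))" for \<omega>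
    proof -
      have "(\<Sum>n. (\<lambda>(j, i). if i < fst (\<omega> j) then g (snd (\<omega> j) i) else 0) (prod_decode n)) =
        (\<Sum>j. \<Sum>i. (if i < fst (\<omega> j) then g (snd (\<omega> j) i) else 0))"
        by (rule suminf_ennreal_2dimen) simp
      then show ?thesis by (simp add: T_def X_def case_prod_beta cong: if_cong)
    qed
    then have "(\<integral>\<omega>. exp_neg (\<Sum>n. if n \<in> T \<omega> then g (X n \<omega>) else 0) \<partial>\<Omega>) =
      (\<integral>\<omega>. exp_neg (\<Sum>j. \<Sum>i. (if i < fst (\<omega> j) then g (snd (\<omega> j) i) else 0)) \<partial>\<Omega>)" by simp
    also have "\<dots> = exp_neg (\<Sum>j. neg_ln (\<integral>y. exp_neg (\<Sum>i. (if i < fst y then g (snd y i) else 0)) \<partial>S j))"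
      unfolding \<Omega>_def by (rule integral_exp_neg_suminf_PiM[OF S]) (unfold S_def, rule poisson_many_laplace(2)[OF D(1) gD])
    also have "(\<lambda>j. neg_ln (\<integral>y. exp_neg (\<Sum>i. (if i < fst y then g (snd y i) else 0)) \<partial>S j)) = (\<lambda>j. \<integral>\<^sup>+x. ennreal (1 - exp_neg (g x)) \<partial>D j)"
      unfolding S_def poisson_many_laplace(3)[OF D(1) gD] by (simp add: neg_ln_exp_neg)
    also have "(\<Sum>j. \<integral>\<^sup>+x. ennreal (1 - exp_neg (g x)) \<partial>D j) = (\<integral>\<^sup>+x. ennreal (1 - exp_neg (g x)) \<partial>m)"
      using g by (intro sum[symmetric]) measurable
    finally show ?thesis .
  qed
  \<comment> \<open>Listing the used places in one sequence requires infinitely many of them. For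
    the test function 1 all blocks contribute the same positive amount, so the exponent, and hence
    almost surely the number of used places, is infinite.\<close>
  have inf: "AE \<omega> in \<Omega>. infinite (T \<omega>)"
  proof -
    have "(\<integral>\<^sup>+x. ennreal (1 - exp_neg 1) \<partial>D j) = ennreal (1 - exp_neg 1)" for j
      using prob_space.emeasure_space_1[OF D(1)] by simp
    then have "(\<integral>\<^sup>+x. ennreal (1 - exp_neg 1) \<partial>m) = (\<Sum>j::nat. ennreal (1 - exp_neg 1))"
      by (subst sum) auto
    also have "\<dots> = (\<integral>\<^sup>+j. ennreal (1 - exp_neg 1) \<partial>count_space (UNIV :: nat set))"
      by (simp only: nn_integral_count_space_nat)
    also have "\<dots> = \<infinity>" using exp_neg_ennreal[of 1] by (simp add: ennreal_mult_top)
    finally have "(\<integral>\<omega>. exp_neg (\<Sum>n. if n \<in> T \<omega> then 1 else 0) \<partial>\<Omega>) = 0"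
      using lap[of "\<lambda>_. 1"] by simp
    then have "AE \<omega> in \<Omega>. exp_neg (\<Sum>n. if n \<in> T \<omega> then 1 else 0) = 0"
      by (subst (asm) integral_nonneg_eq_0_iff_AE) (auto intro!: integrable_exp_neg finite_measure_axioms simp: exp_neg_bounds)
    then show ?thesis
    proof eventually_elim
      case (elim \<omega>)
      have "(\<Sum>n. if n \<in> T \<omega> then 1 else 0) = (\<Sum>n\<in>T \<omega>. if n \<in> T \<omega> then 1 else (0 :: ennreal))" if "finite (T \<omega>)"
        by (rule suminf_finite) (use that in auto)
      also have "\<dots> \<noteq> \<infinity>" if "finite (T \<omega>)" using that by simp
      finally show ?case using elim by (auto simp: exp_neg_def split: if_splits)
    qed
  qed
  have "(\<integral>\<omega>. exp_neg (\<Sum>k. g (l k \<omega>)) \<partial>\<Omega>) = exp_neg (\<integral>\<^sup>+x. ennreal (1 - exp_neg (g x)) \<partial>m)"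
    if g[measurable]: "g \<in> borel_measurable m" for g
  proof -
    note [measurable] = l
    have "(\<integral>\<omega>. exp_neg (\<Sum>k. g (l k \<omega>)) \<partial>\<Omega>) = (\<integral>\<omega>. exp_neg (\<Sum>n. if n \<in> T \<omega> then g (X n \<omega>) else 0) \<partial>\<Omega>)"
    proof (rule integral_cong_AE)
      show "AE \<omega> in \<Omega>. exp_neg (\<Sum>k. g (l k \<omega>)) = exp_neg (\<Sum>n. if n \<in> T \<omega> then g (X n \<omega>) else 0)"
        using inf by eventually_elim (simp add: l_def suminf_nth_mem[of _ "\<lambda>n. g (X n _)"])
    qed measurable
    then show ?thesis using lap[OF g] by simp
  qed
  then show ?thesis using ps l by blast
qed

context power_measure
begin

text \<open>The tail beyond j^(-1/\<alpha>) has mass exactly j. Consecutive differences therefore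
  have mass 1, and they exhaust (0, infinity) because these radii tend to 0.\<close>

lemma ex_unit_blocks:
  shows "\<exists>D :: nat \<Rightarrow> real measure. (\<forall>j. prob_space (D j) \<and> sets (D j) = sets m) \<and>
    (\<forall>g\<in>borel_measurable m. (\<integral>\<^sup>+x. g x \<partial>m) = (\<Sum>j. \<integral>\<^sup>+x. g x \<partial>D j))"
proof -
  \<comment> \<open>j = 0 is treated apart because \<open>0 powr _\<close> is 0, which would give
    the whole half-line instead of the empty set.\<close>
  define U where "U j = (if j = 0 then {} else {real j powr (- 1 / \<alpha>)<..})" for j :: nat
  have Um[measurable]: "U j \<in> sets m" for j unfolding U_def by (auto intro: Ioi_sets)
  have eU: "emeasure m (U j) = of_nat j" for j
    using \<alpha> by (auto simp: U_def tail powr_powr ennreal_of_nat_eq_real_of_nat)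
  have incU: "incseq U"
  proof (rule incseq_SucI)
    fix j show "U j \<subseteq> U (Suc j)"
      using powr_less_mono2_neg[of "- 1 / \<alpha>" "real j" "real (Suc j)"] \<alpha> by (auto simp: U_def)
  qed
  have UU: "(\<Union>j. U j) = {0<..}"
  proof
    show "{0<..} \<subseteq> (\<Union>j. U j)"
    proof
      fix x :: real assume "x \<in> {0<..}"
      then have x: "0 < x" by simp
      obtain j :: nat where j: "x powr (- \<alpha>) < real j" using reals_Archimedean2 by blast
      moreover have "0 < x powr (- \<alpha>)" using x by simp
      ultimately have "0 < real j" by linarith
      have "real j powr (- 1 / \<alpha>) < (x powr (- \<alpha>)) powr (- 1 / \<alpha>)"
        using j x \<alpha> by (intro powr_less_mono2_neg) auto
      also have "\<dots> = x" using x \<alpha> by (simp add: powr_powr)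
      finally show "x \<in> (\<Union>j. U j)" using \<open>0 < real j\<close> by (auto simp: U_def intro!: exI[of _ j])
    qed
  qed (auto simp: U_def intro: le_less_trans[rotated])
  define B where "B j = U (Suc j) - U j" for j
  have Bm[measurable]: "B j \<in> sets m" for j unfolding B_def by measurable
  have eB: "emeasure m (B j) = 1" for j
  proof -
    have "emeasure m (B j) = of_nat (Suc j) - of_nat j"
      unfolding B_def using incseqD[OF incU, of j "Suc j"] by (subst emeasure_Diff) (auto simp: eU)
    also have "\<dots> = ennreal (real (Suc j) - real j)"
      by (simp only: ennreal_of_nat_eq_real_of_nat ennreal_minus of_nat_0_le_iff)
    finally show ?thesis by simp
  qed
  have Bd: "disjoint_family B"
    unfolding B_def using incseqD[OF incU] by (auto simp: disjoint_family_on_def) (metis in_mono linorder_neqE_nat Suc_leI)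
  have UB: "(\<Union>j. B j) = space m"
  proof -
    have "U n \<subseteq> (\<Union>j. B j)" for n
      by (induction n) (auto simp: B_def U_def[of 0])
    then have "(\<Union>n. U n) \<subseteq> (\<Union>j. B j)" by blast
    moreover have "(\<Union>j. B j) \<subseteq> (\<Union>n. U n)" unfolding B_def by blast
    ultimately show ?thesis unfolding UU space_m by blast
  qed
  define D where "D j = density m (indicator (B j))" for j
  have "prob_space (D j)" for j
  proof (rule prob_spaceI)
    have "emeasure (D j) (space (D j)) = (\<integral>\<^sup>+x. indicator (B j) x * indicator (space m) x \<partial>m)"
      unfolding D_def space_density by (rule emeasure_density) auto
    also have "\<dots> = (\<integral>\<^sup>+x. indicator (B j) x \<partial>m)" by (intro nn_integral_cong) auto
    finally show "emeasure (D j) (space (D j)) = 1" by (simp add: eB)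
  qed
  moreover have "(\<integral>\<^sup>+x. g x \<partial>m) = (\<Sum>j. \<integral>\<^sup>+x. g x \<partial>D j)" if g[measurable]: "g \<in> borel_measurable m" for g
  proof -
    have "(\<Sum>j. \<integral>\<^sup>+x. g x \<partial>D j) = (\<Sum>j. \<integral>\<^sup>+x. g x * indicator (B j) x \<partial>m)"
      by (simp add: D_def nn_integral_density mult.commute)
    also have "\<dots> = (\<integral>\<^sup>+x. g x * indicator (\<Union>j. B j) x \<partial>m)"
      using Bd by (intro nn_integral_disjoint_family[symmetric]) auto
    also have "\<dots> = (\<integral>\<^sup>+x. g x \<partial>m)" unfolding UB by (intro nn_integral_cong) auto
    finally show ?thesis by simp
  qed
  ultimately show ?thesis by (intro exI[of _ D]) (auto simp: D_def)
qed

text \<open>Only the law of the sequence of points matters, so it is transported to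
  \<open>nat \<Rightarrow> real\<close>, the sample space that
  \<open>scale_decorated_poisson\<close> asks for.\<close>

proposition ex_poisson_random_measure:
  "\<exists>(L :: (nat \<Rightarrow> real) measure) l. prob_space L \<and> (\<forall>i::nat. l i \<in> L \<rightarrow>\<^sub>M real_pos) \<and>
     poisson_random_measure L m (\<lambda>\<omega>. distr (count_space UNIV) real_pos (\<lambda>i. l i \<omega>))"
proof -
  obtain D :: "nat \<Rightarrow> real measure" where D: "\<And>j. prob_space (D j)" "\<And>j. sets (D j) = sets m"
    "\<And>g. g \<in> borel_measurable m \<Longrightarrow> (\<integral>\<^sup>+x. g x \<partial>m) = (\<Sum>j. \<integral>\<^sup>+x. g x \<partial>D j)"
    using ex_unit_blocks by blast
  obtain \<Omega> :: "(nat \<Rightarrow> nat \<times> (nat \<Rightarrow> real)) measure" and l where \<Omega>: "prob_space \<Omega>" and l: "\<And>k::nat. l k \<in> \<Omega> \<rightarrow>\<^sub>M m"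
    and lap: "\<And>g. g \<in> borel_measurable m \<Longrightarrow> (\<integral>\<omega>. exp_neg (\<Sum>k. g (l k \<omega>)) \<partial>\<Omega>) = exp_neg (\<integral>\<^sup>+x. ennreal (1 - exp_neg (g x)) \<partial>m)"
    using ex_poisson_sequence[of D m, OF D] by blast
  have l_real: "l k \<in> borel_measurable \<Omega>" for k
  proof -
    have "(\<lambda>x. x) \<in> m \<rightarrow>\<^sub>M borel" unfolding measurable_cong_sets[OF sets_m refl]
      by (rule measurable_restrict_space1) simp
    from measurable_compose[OF l this] show ?thesis .
  qed
  have l_pos: "0 < l k \<omega>" if "\<omega> \<in> space \<Omega>" for k \<omega> using measurable_space[OF l that] by (simp add: space_m)
  define L where "L = distr \<Omega> (PiM UNIV (\<lambda>_. borel)) (\<lambda>\<omega> k. l k \<omega>)"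
  \<comment> \<open>The value 1 replaces nonpositive coordinates so that \<open>l'\<close> is
    positive at every point of the sequence space; along the original points nothing changes, as
    they are all positive.\<close>
  define l' :: "nat \<Rightarrow> (nat \<Rightarrow> real) \<Rightarrow> real" where "l' i x = (if 0 < x i then x i else 1)" for i x
  have seq: "(\<lambda>\<omega> k. l k \<omega>) \<in> \<Omega> \<rightarrow>\<^sub>M PiM UNIV (\<lambda>_. borel)"
    using l_real by (intro measurable_PiM_single') (auto simp: space_PiM)
  have L: "prob_space L" unfolding L_def by (rule prob_space.prob_space_distr[OF \<Omega> seq])
  have l': "l' i \<in> L \<rightarrow>\<^sub>M real_pos" for i
    unfolding L_def l'_def by (intro measurable_restrict_space2) auto
  let ?\<Lambda> = "\<lambda>\<omega>. distr (count_space UNIV) real_pos (\<lambda>i. l' i \<omega>)"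
  have int: "(\<integral>\<^sup>+x. g x \<partial>?\<Lambda> \<omega>) = (\<Sum>i. g (l' i \<omega>))" if "g \<in> borel_measurable real_pos" for g \<omega>
    using that by (subst nn_integral_distr) (auto simp: nn_integral_count_space_nat space_real_pos l'_def)
  have "poisson_random_measure L m ?\<Lambda>"
  proof (rule poisson_random_measureI_laplace[OF L])
    show "?\<Lambda> \<in> L \<rightarrow>\<^sub>M measure_algebra m"
    proof (rule measurable_measure_algebraI)
      fix A assume "A \<in> sets m"
      then have [measurable]: "A \<in> sets real_pos" by (simp add: sets_m)
      note [measurable] = l'
      have "emeasure (?\<Lambda> \<omega>) A = (\<Sum>i. indicator A (l' i \<omega>))" for \<omega>
        using int[of "indicator A" \<omega>] by simp
      moreover have "(\<lambda>\<omega>. \<Sum>i. indicator A (l' i \<omega>) :: ennreal) \<in> borel_measurable L" by measurable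
      ultimately show "(\<lambda>\<omega>. emeasure (?\<Lambda> \<omega>) A) \<in> borel_measurable L" by simp
    qed (simp add: sets_m)
    fix g :: "real \<Rightarrow> ennreal" assume g: "g \<in> borel_measurable m"
    then have gr: "g \<in> borel_measurable real_pos" by (simp add: measurable_cong_sets[OF sets_m refl])
    have "LF L ?\<Lambda> g = (\<integral>\<omega>. exp_neg (\<Sum>i. g (l' i \<omega>)) \<partial>L)" by (simp add: LF_def int[OF gr])
    also have "\<dots> = (\<integral>\<omega>. exp_neg (\<Sum>i. g (l' i (\<lambda>k. l k \<omega>))) \<partial>\<Omega>)"
    proof -
      note [measurable] = l' gr
      have "(\<lambda>\<omega>. exp_neg (\<Sum>i. g (l' i \<omega>))) \<in> borel_measurable L" by measurable
      then show ?thesis unfolding L_def using seq by (subst integral_distr) auto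
    qed
    also have "\<dots> = (\<integral>\<omega>. exp_neg (\<Sum>i. g (l i \<omega>)) \<partial>\<Omega>)"
      using l_pos by (intro Bochner_Integration.integral_cong) (auto simp: l'_def)
    finally show "LF L ?\<Lambda> g = exp_neg (\<integral>\<^sup>+x. ennreal (1 - exp_neg (g x)) \<partial>m)" using lap[OF g] by simp
  qed
  then show ?thesis using L l' by blast
qed

end

section \<open>Test functions\<close>

text \<open>Two classes of tests are kept. This one admits infinite values, hence void
  probabilities, and separates laws on all measures; \<open>Cc_tests\<close> is what the scaled
  Laplace functional sees.\<close>

definition away_tests :: "(ereal \<Rightarrow> ennreal) set" where
  "away_tests = {f \<in> borel_measurable ereal_no0. \<exists>\<epsilon>>0. \<forall>u. u \<noteq> 0 \<longrightarrow> u \<notin> outside \<epsilon> \<longrightarrow> f u = 0}"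

definition Cc_tests :: "(ereal \<Rightarrow> ennreal) set" where
  "Cc_tests = {h. \<exists>f\<in>Cc_plus. \<forall>u. u \<noteq> 0 \<longrightarrow> h u = ennreal (f u)}"

text \<open>Continuous tests reach Borel sets by way of complements, where masses are subtracted;
  finiteness away from 0 makes the subtraction legitimate.\<close>

definition finite_away :: "ereal measure set" where
  "finite_away = {\<mu>. sets \<mu> = sets ereal_no0 \<and> (\<forall>n. emeasure \<mu> (outside (1 / real (Suc n))) < \<infinity>)}"

lemma emeasure_SUP_outside:
  assumes "sets \<mu> = sets ereal_no0" "A \<in> sets ereal_no0"
  shows "emeasure \<mu> A = (SUP n. emeasure \<mu> (A \<inter> outside (1 / real (Suc n))))"
proof -
  have "A \<subseteq> UNIV - {0}" using sets.sets_into_space[OF assms(2)] by (simp add: space_ereal_no0)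
  then have "(\<Union>n. A \<inter> outside (1 / real (Suc n))) = A" using Union_outside by blast
  moreover have "(SUP n. emeasure \<mu> (A \<inter> outside (1 / real (Suc n)))) = emeasure \<mu> (\<Union>n. A \<inter> outside (1 / real (Suc n)))"
    using assms incseq_outside by (intro SUP_emeasure_incseq) (auto simp: incseq_def)
  ultimately show ?thesis by simp
qed

lemma away_testsE:
  assumes "f \<in> away_tests"
  obtains \<epsilon> where "f \<in> borel_measurable ereal_no0" "0 < \<epsilon>" "\<And>u. u \<noteq> 0 \<Longrightarrow> u \<notin> outside \<epsilon> \<Longrightarrow> f u = 0"
  using assms unfolding away_tests_def by blast

lemma Cc_testsE:
  assumes "h \<in> Cc_tests"
  obtains f K where "\<And>u. u \<noteq> 0 \<Longrightarrow> h u = ennreal (f u)" "continuous_on (UNIV - {0}) f" "\<And>x. x \<noteq> 0 \<Longrightarrow> 0 \<le> f x"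
    "compact K" "K \<subseteq> UNIV - {0}" "\<And>x. x \<noteq> 0 \<Longrightarrow> x \<notin> K \<Longrightarrow> f x = 0"
proof -
  obtain f where f: "f \<in> Cc_plus" "\<forall>u. u \<noteq> 0 \<longrightarrow> h u = ennreal (f u)"
    using assms unfolding Cc_tests_def by blast
  obtain K where "compact K" "K \<subseteq> UNIV - {0}" "\<forall>x. x \<noteq> 0 \<and> x \<notin> K \<longrightarrow> f x = 0"
    using f(1) unfolding Cc_plus_def by auto
  moreover have "continuous_on (UNIV - {0}) f" "\<forall>x. x \<noteq> 0 \<longrightarrow> 0 \<le> f x"
    using f(1) unfolding Cc_plus_def by auto
  ultimately show thesis using f(2) by (intro that[of f K]) auto
qed

lemma away_tests_add: "f \<in> away_tests \<Longrightarrow> g \<in> away_tests \<Longrightarrow> (\<lambda>x. f x + g x) \<in> away_tests"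
proof -
  assume f: "f \<in> away_tests" and g: "g \<in> away_tests"
  obtain \<delta> where fd: "f \<in> borel_measurable ereal_no0" "0 < \<delta>" "\<And>u. u \<noteq> 0 \<Longrightarrow> u \<notin> outside \<delta> \<Longrightarrow> f u = 0"
    using f by (rule away_testsE) blast
  obtain \<epsilon> where ge: "g \<in> borel_measurable ereal_no0" "0 < \<epsilon>" "\<And>u. u \<noteq> 0 \<Longrightarrow> u \<notin> outside \<epsilon> \<Longrightarrow> g u = 0"
    using g by (rule away_testsE) blast
  show ?thesis unfolding away_tests_def
  proof (intro CollectI conjI exI[of _ "min \<delta> \<epsilon>"] allI impI)
    fix u assume "u \<noteq> 0" "u \<notin> outside (min \<delta> \<epsilon>)"
    then show "f u + g u = 0"
      using fd(3)[of u] ge(3)[of u] outside_antimono[of "min \<delta> \<epsilon>" \<delta>] outside_antimono[of "min \<delta> \<epsilon>" \<epsilon>]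
      by (auto simp: subset_iff)
  qed (use fd(1,2) ge(1,2) in auto)
qed

lemma away_tests_scale:
  assumes "f \<in> away_tests" "0 < b" shows "(\<lambda>u. f (ereal b * u)) \<in> away_tests"
proof -
  obtain \<epsilon> where f: "f \<in> borel_measurable ereal_no0" "0 < \<epsilon>" "\<And>u. u \<noteq> 0 \<Longrightarrow> u \<notin> outside \<epsilon> \<Longrightarrow> f u = 0"
    using assms(1) unfolding away_tests_def by blast
  show ?thesis unfolding away_tests_def
  proof (intro CollectI conjI exI[of _ "\<epsilon> / b"] allI impI)
    show "(\<lambda>u. f (ereal b * u)) \<in> borel_measurable ereal_no0"
      using measurable_compose[OF measurable_scale[OF assms(2)] f(1)] .
    fix u :: ereal assume "u \<noteq> 0" "u \<notin> outside (\<epsilon> / b)"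
    then show "f (ereal b * u) = 0" using assms(2) scale_mem_outside[OF assms(2), of u \<epsilon>] by (intro f(3)) auto
  qed (use f(2) assms(2) in auto)
qed

lemma away_tests_indicator:
  assumes "A \<in> sets ereal_no0" "0 < \<epsilon>" shows "(\<lambda>u. c * indicator (A \<inter> outside \<epsilon>) u) \<in> away_tests"
proof -
  have [measurable]: "A \<inter> outside \<epsilon> \<in> sets ereal_no0" using assms by auto
  show ?thesis unfolding away_tests_def using assms(2) by (auto intro!: exI[of _ \<epsilon>])
qed

lemma away_testsD: "f \<in> away_tests \<Longrightarrow> f \<in> borel_measurable ereal_no0"
  by (simp add: away_tests_def)

text \<open>Meant for the decorated superposition, which is not known to be locally finite at every
  sample point: indicators of \<open>A \<inter> outside (1 / real (Suc n))\<close> are admissible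
  tests and increase to that of \<open>A\<close>, whatever the measure.\<close>

proposition distr_eq_if_LF_eq:
  assumes M: "prob_space M" "prob_space M'"
    and N: "N \<in> M \<rightarrow>\<^sub>M measure_algebra ereal_no0" "N' \<in> M' \<rightarrow>\<^sub>M measure_algebra ereal_no0"
    and eq: "\<And>f. f \<in> away_tests \<Longrightarrow> LF M N f = LF M' N' f"
  shows "distr M (measure_algebra ereal_no0) N = distr M' (measure_algebra ereal_no0) N'"
proof (rule distr_eq_if_LF_eq_on[OF M N, where C=away_tests and S="space (measure_algebra ereal_no0)"])
  fix G :: "ereal measure measure" and A
  assume G: "space G = space (measure_algebra ereal_no0)"
    and int: "\<And>f. f \<in> away_tests \<Longrightarrow> (\<lambda>\<mu>. \<integral>\<^sup>+x. f x \<partial>\<mu>) \<in> borel_measurable G" and A: "A \<in> sets ereal_no0"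
  have "emeasure \<mu> A = (SUP n. \<integral>\<^sup>+x. 1 * indicator (A \<inter> outside (1 / real (Suc n))) x \<partial>\<mu>)" if "\<mu> \<in> space G" for \<mu>
  proof -
    have "sets \<mu> = sets ereal_no0" using that G by (simp add: space_measure_algebra)
    then show ?thesis using A by (subst emeasure_SUP_outside) (auto simp: nn_integral_cmult_indicator intro!: SUP_cong)
  qed
  moreover have "(\<lambda>\<mu>. SUP n. \<integral>\<^sup>+x. 1 * indicator (A \<inter> outside (1 / real (Suc n))) x \<partial>\<mu>) \<in> borel_measurable G"
    by (intro borel_measurable_SUP int away_tests_indicator A) auto
  ultimately show "(\<lambda>\<mu>. emeasure \<mu> A) \<in> borel_measurable G" by (subst measurable_cong)
qed (use measurable_space[OF N(1)] measurable_space[OF N(2)] eq away_tests_add away_testsD in auto)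

lemma finite_away_sets: "finite_away \<in> sets (measure_algebra ereal_no0)"
proof -
  have [measurable]: "(\<lambda>\<mu>. emeasure \<mu> (outside (1 / real (Suc n)))) \<in> borel_measurable (measure_algebra ereal_no0)" for n
    by (intro measurable_emeasure_measure_algebra outside_sets) simp
  have eq: "finite_away = {\<mu> \<in> space (measure_algebra ereal_no0). \<forall>n. emeasure \<mu> (outside (1 / real (Suc n))) < \<infinity>}"
    by (auto simp: finite_away_def space_measure_algebra)
  show ?thesis unfolding eq by measurable
qed

lemma finite_awayD: "\<mu> \<in> finite_away \<Longrightarrow> 0 < \<epsilon> \<Longrightarrow> emeasure \<mu> (outside \<epsilon>) < \<infinity>"
proof -
  assume \<mu>: "\<mu> \<in> finite_away" and "0 < \<epsilon>"
  then obtain n where n: "1 / real (Suc n) < \<epsilon>" using reals_Archimedean[of \<epsilon>] by (auto simp: divide_inverse)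
  have "emeasure \<mu> (outside \<epsilon>) \<le> emeasure \<mu> (outside (1 / real (Suc n)))"
    using n \<mu> by (intro emeasure_mono outside_antimono) (auto simp: finite_away_def)
  also have "\<dots> < \<infinity>" using \<mu> by (simp add: finite_away_def)
  finally show ?thesis .
qed

section \<open>Continuous test functions and the sigma-algebra that they generate\<close>

text \<open>A clipped linear function, continuous on all of \<open>ereal\<close>. With growing slope
  it increases to the indicator of the open half-line above 0, infinity included.\<close>

definition ramp :: "nat \<Rightarrow> ereal \<Rightarrow> real" where
  "ramp k w = real_of_ereal (min 1 (max 0 (ereal (real k) * w)))"

lemma ramp_cases:
  "w \<le> 0 \<Longrightarrow> ramp k w = 0" "ramp (Suc k) \<infinity> = 1" "0 \<le> r \<Longrightarrow> ramp k (ereal r) = min 1 (real k * r)"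
proof -
  show "w \<le> 0 \<Longrightarrow> ramp k w = 0"
  proof -
    assume "w \<le> 0"
    then have "ereal (real k) * w \<le> 0" by (cases w) (auto simp: mult_nonneg_nonpos zero_ereal_def)
    then show ?thesis by (simp add: ramp_def max_absorb1)
  qed
  show "ramp (Suc k) \<infinity> = 1" by (simp add: ramp_def)
  show "0 \<le> r \<Longrightarrow> ramp k (ereal r) = min 1 (real k * r)"
    by (auto simp: ramp_def max_absorb2 min_def one_ereal_def)
qed

lemma ramp_bounds: "0 \<le> ramp k w" "ramp k w \<le> 1"
proof -
  have "0 \<le> min 1 (max 0 (ereal (real k) * w))" "min 1 (max 0 (ereal (real k) * w)) \<le> 1" by auto
  then show "0 \<le> ramp k w" "ramp k w \<le> 1" unfolding ramp_def
    by (auto simp: real_of_ereal_pos real_le_ereal_iff one_ereal_def simp del: min_less_iff_conj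
      intro: real_of_ereal_le_1)
qed

lemma ramp_mono: "ramp (Suc k) w \<le> ramp (Suc (Suc k)) w"
proof (cases "w \<le> 0")
  case False
  then show ?thesis
  proof (cases w)
    case (real r)
    then have "0 \<le> r" using False by simp
    then have "real (Suc k) * r \<le> real (Suc (Suc k)) * r" by (intro mult_right_mono) auto
    then show ?thesis using real \<open>0 \<le> r\<close> by (simp add: ramp_cases min_le_iff_disj)
  qed (auto simp: ramp_cases)
qed (simp add: ramp_cases)

lemma ramp_LIMSEQ: "(\<lambda>k. ramp (Suc k) w) \<longlonglongrightarrow> indicator {0<..} w"
proof (cases "w \<le> 0")
  case False
  then show ?thesis
  proof (cases w)
    case (real r)
    then have r: "0 < r" using False by simp
    obtain n :: nat where n: "1 / r < real n" using reals_Archimedean2 by blast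
    have "ramp (Suc k) w = 1" if "n \<le> k" for k
    proof -
      have "1 < real n * r" using n r by (simp add: field_simps)
      also have "\<dots> \<le> real (Suc k) * r" using that r by (intro mult_right_mono) auto
      finally show ?thesis using real r by (simp add: ramp_cases)
    qed
    then show ?thesis using r real by (auto intro!: tendsto_eventually eventually_sequentiallyI)
  qed (auto simp: ramp_cases)
qed (simp add: ramp_cases)

lemma tendsto_ramp: "(f \<longlongrightarrow> w) F \<Longrightarrow> ((\<lambda>x. ramp k (f x)) \<longlongrightarrow> ramp k w) F"
proof -
  assume f: "(f \<longlongrightarrow> w) F"
  have "((\<lambda>x. min 1 (max 0 (ereal (real k) * f x))) \<longlongrightarrow> min 1 (max 0 (ereal (real k) * w))) F"
    by (intro tendsto_min tendsto_max tendsto_const tendsto_cmult_ereal f) auto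
  moreover have "min 1 (max 0 (ereal (real k) * w)) = ereal (ramp k w)"
  proof -
    have "0 \<le> min 1 (max 0 (ereal (real k) * w))" "min 1 (max 0 (ereal (real k) * w)) \<le> 1" by auto
    moreover have "ereal (real_of_ereal z) = z" if "0 \<le> z" "z \<le> 1" for z using that by (cases z) auto
    ultimately show ?thesis unfolding ramp_def by metis
  qed
  ultimately show ?thesis unfolding ramp_def[of k "f _"] by (intro lim_real_of_ereal) simp
qed

lemma Cc_tests_ramp:
  assumes "0 < \<epsilon>" and g: "continuous_on UNIV g" "\<And>u. 0 \<le> g u"
  shows "(\<lambda>u. ennreal (g u * ramp k (\<bar>u\<bar> + ereal (- \<epsilon>)))) \<in> Cc_tests"
proof -
  have "continuous_on UNIV (\<lambda>u. ramp k (\<bar>u\<bar> + ereal (- \<epsilon>)))"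
    unfolding continuous_on_def by (intro ballI tendsto_ramp tendsto_add_left_ereal tendsto_abs_ereal tendsto_ident_at) auto
  then have "continuous_on (UNIV - {0}) (\<lambda>u. g u * ramp k (\<bar>u\<bar> + ereal (- \<epsilon>)))"
    by (intro continuous_on_mult continuous_on_subset[OF g(1)]) (auto intro: continuous_on_subset)
  moreover have "compact {u :: ereal. ereal \<epsilon> \<le> \<bar>u\<bar>}"
    by (simp add: compact_eq_closed) (intro closed_Collect_le continuous_intros)
  moreover have "{u :: ereal. ereal \<epsilon> \<le> \<bar>u\<bar>} \<subseteq> UNIV - {0}" using assms(1) by auto
  moreover have "g u * ramp k (\<bar>u\<bar> + ereal (- \<epsilon>)) = 0" if "u \<notin> {u. ereal \<epsilon> \<le> \<bar>u\<bar>}" for u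
    using that by (cases u) (auto simp: ramp_cases)
  ultimately have "(\<lambda>u. g u * ramp k (\<bar>u\<bar> + ereal (- \<epsilon>))) \<in> Cc_plus"
    unfolding Cc_plus_def using g(2) ramp_bounds by (auto intro!: exI[of _ "{u. ereal \<epsilon> \<le> \<bar>u\<bar>}"])
  then show ?thesis unfolding Cc_tests_def by (intro CollectI bexI) auto
qed

lemma compact_subset_outside:
  assumes K: "compact K" "K \<subseteq> UNIV - {0}"
  shows "\<exists>n. K \<subseteq> outside (1 / real (Suc n))"
proof -
  have op: "open (outside (1 / real (Suc n)))" for n
    unfolding outside_def by (intro open_Collect_less continuous_intros)
  have "K \<subseteq> (\<Union>n. outside (1 / real (Suc n)))" using K(2) Union_outside by simp
  from compactE_image[OF K(1) _ this] op obtain J where J: "finite J" "K \<subseteq> (\<Union>n\<in>J. outside (1 / real (Suc n)))" by auto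
  define n where "n = Max (insert 0 J)"
  have "K \<subseteq> outside (1 / real (Suc n))"
  proof
    fix x assume "x \<in> K"
    then obtain j where j: "j \<in> J" "x \<in> outside (1 / real (Suc j))" using J(2) by blast
    have "j \<le> n" using j(1) J(1) by (simp add: n_def)
    then show "x \<in> outside (1 / real (Suc n))"
      using j(2) incseqD[OF incseq_outside] by blast
  qed
  then show ?thesis by blast
qed

lemma Cc_tests_away: "Cc_tests \<subseteq> away_tests"
proof
  fix h assume "h \<in> Cc_tests"
  then obtain f K where f: "\<And>u. u \<noteq> 0 \<Longrightarrow> h u = ennreal (f u)" "continuous_on (UNIV - {0}) f"
    and K: "compact K" "K \<subseteq> UNIV - {0}" "\<And>x. x \<noteq> 0 \<Longrightarrow> x \<notin> K \<Longrightarrow> f x = 0"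
    by (rule Cc_testsE) blast
  have "f \<in> borel_measurable ereal_no0" using f(2) by (rule borel_measurable_continuous_on_restrict)
  then have "(\<lambda>u. ennreal (f u)) \<in> borel_measurable ereal_no0" by measurable
  then have "h \<in> borel_measurable ereal_no0"
    using f(1) by (subst measurable_cong[where g="\<lambda>u. ennreal (f u)"]) (auto simp: space_ereal_no0)
  moreover have "\<exists>\<epsilon>>0. \<forall>u. u \<noteq> 0 \<longrightarrow> u \<notin> outside \<epsilon> \<longrightarrow> h u = 0"
  proof -
    obtain n where K_out: "K \<subseteq> outside (1 / real (Suc n))" using compact_subset_outside[OF K(1,2)] by blast
    have "h u = 0" if "u \<noteq> 0" "u \<notin> outside (1 / real (Suc n))" for u
    proof -
      have "u \<notin> K" using that(2) K_out by blast
      then show ?thesis using that(1) K(3)[of u] f(1)[of u] by simp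
    qed
    then show ?thesis by (intro exI[of _ "1 / real (Suc n)"] conjI allI impI) auto
  qed
  ultimately show "h \<in> away_tests" unfolding away_tests_def by blast
qed

lemma Cc_tests_add: "f \<in> Cc_tests \<Longrightarrow> g \<in> Cc_tests \<Longrightarrow> (\<lambda>x. f x + g x) \<in> Cc_tests"
proof -
  assume f: "f \<in> Cc_tests" and g: "g \<in> Cc_tests"
  obtain a K where a: "\<And>u. u \<noteq> 0 \<Longrightarrow> f u = ennreal (a u)" "continuous_on (UNIV - {0}) a" "\<And>x. x \<noteq> 0 \<Longrightarrow> 0 \<le> a x"
    "compact K" "K \<subseteq> UNIV - {0}" "\<And>x. x \<noteq> 0 \<Longrightarrow> x \<notin> K \<Longrightarrow> a x = 0"
    using f by (rule Cc_testsE) blast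
  obtain b L where b: "\<And>u. u \<noteq> 0 \<Longrightarrow> g u = ennreal (b u)" "continuous_on (UNIV - {0}) b" "\<And>x. x \<noteq> 0 \<Longrightarrow> 0 \<le> b x"
    "compact L" "L \<subseteq> UNIV - {0}" "\<And>x. x \<noteq> 0 \<Longrightarrow> x \<notin> L \<Longrightarrow> b x = 0"
    using g by (rule Cc_testsE) blast
  have "continuous_on (UNIV - {0}) (\<lambda>u. a u + b u)" using a(2) b(2) by (rule continuous_on_add)
  moreover have "compact (K \<union> L)" "K \<union> L \<subseteq> UNIV - {0}" using a(4,5) b(4,5) by (auto intro: compact_Un)
  moreover have "\<forall>x. x \<noteq> 0 \<and> x \<notin> K \<union> L \<longrightarrow> a x + b x = 0" using a(6) b(6) by simp
  ultimately have "(\<lambda>u. a u + b u) \<in> Cc_plus"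
    unfolding Cc_plus_def using a(3) b(3)
    by (intro CollectI conjI exI[of _ "K \<union> L"] allI impI) auto
  moreover have "\<forall>u. u \<noteq> 0 \<longrightarrow> f u + g u = ennreal (a u + b u)" using a(1,3) b(1,3) by simp
  ultimately show ?thesis unfolding Cc_tests_def by (intro CollectI bexI)
qed

text \<open>Open half-lines cut off at \<open>outside \<epsilon>\<close> are increasing limits of
  tests in \<open>Cc_tests\<close>. A Dynkin argument extends this to Borel sets, complements being
  taken inside the finite mass of \<open>outside \<epsilon>\<close>.\<close>

lemma measurable_emeasure_outside_Cc:
  assumes G: "space G = finite_away"
    and int: "\<And>f. f \<in> Cc_tests \<Longrightarrow> (\<lambda>\<mu>. \<integral>\<^sup>+x. f x \<partial>\<mu>) \<in> borel_measurable G" and "0 < \<epsilon>"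
    and A: "A \<in> sets borel"
  shows "(\<lambda>\<mu>. emeasure \<mu> (A \<inter> outside \<epsilon>)) \<in> borel_measurable G"
proof -
  have A': "A \<inter> outside \<epsilon> \<in> sets ereal_no0" if "A \<in> sets borel" for A
    using that outside_sets[of \<epsilon>] \<open>0 < \<epsilon>\<close> by (simp add: sets_restrict_space_iff) blast
  have sets_G: "sets \<mu> = sets ereal_no0" "emeasure \<mu> (outside \<epsilon>) < \<infinity>" if "\<mu> \<in> space G" for \<mu>
    using that finite_awayD[OF _ \<open>0 < \<epsilon>\<close>] G by (auto simp: finite_away_def)
  have lim: "(\<lambda>\<mu>. emeasure \<mu> (A \<inter> outside \<epsilon>)) \<in> borel_measurable G"
    if g: "\<And>k. continuous_on UNIV (g k)" "\<And>k u. 0 \<le> g k u" "\<And>k u. g k u \<le> g (Suc k) u"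
      "\<And>u. (\<lambda>k. g k u) \<longlonglongrightarrow> indicator A u" and A: "A \<in> sets borel"
    for A and g :: "nat \<Rightarrow> ereal \<Rightarrow> real"
  proof -
    \<comment> \<open>The ramp factor vanishes near 0; as \<open>ereal\<close> is compact, this
      alone makes the support compact.\<close>
    define h where "h k u = ennreal (g k u * ramp (Suc k) (\<bar>u\<bar> + ereal (- \<epsilon>)))" for k u
    have hC: "h k \<in> Cc_tests" for k unfolding h_def using g \<open>0 < \<epsilon>\<close> by (intro Cc_tests_ramp) auto
    have "incseq h" unfolding h_def using g ramp_mono ramp_bounds
      by (intro incseq_SucI le_funI ennreal_leI mult_mono) auto
    have h_lim: "(\<lambda>k. h k u) \<longlonglongrightarrow> indicator (A \<inter> outside \<epsilon>) u" for u
    proof -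
      have "0 < \<bar>u\<bar> + ereal (- \<epsilon>) \<longleftrightarrow> u \<in> outside \<epsilon>" by (cases u) (auto simp: outside_def)
      then have "indicator (A \<inter> outside \<epsilon>) u = ennreal (indicator A u * indicator {0<..} (\<bar>u\<bar> + ereal (- \<epsilon>)))"
        by (auto simp: indicator_def)
      then show ?thesis unfolding h_def using g(4) ramp_LIMSEQ by (auto intro!: tendsto_ennrealI tendsto_mult)
    qed
    have "(\<lambda>k. \<integral>\<^sup>+u. h k u \<partial>\<mu>) \<longlonglongrightarrow> emeasure \<mu> (A \<inter> outside \<epsilon>)" if "\<mu> \<in> space G" for \<mu>
    proof -
      have "(\<lambda>k. \<integral>\<^sup>+u. h k u \<partial>\<mu>) \<longlonglongrightarrow> (\<integral>\<^sup>+u. indicator (A \<inter> outside \<epsilon>) u \<partial>\<mu>)"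
        using h_lim \<open>incseq h\<close> hC Cc_tests_away away_testsD sets_G(1)[OF that]
        by (intro nn_integral_LIMSEQ) (auto cong: measurable_cong_sets)
      then show ?thesis using A'[OF A] sets_G(1)[OF that] by simp
    qed
    moreover have "incseq (\<lambda>k. \<integral>\<^sup>+u. h k u \<partial>\<mu>)" for \<mu>
      using \<open>incseq h\<close> by (auto simp: incseq_def le_fun_def intro!: nn_integral_mono)
    ultimately have "emeasure \<mu> (A \<inter> outside \<epsilon>) = (SUP k. \<integral>\<^sup>+u. h k u \<partial>\<mu>)" if "\<mu> \<in> space G" for \<mu>
      using that LIMSEQ_unique LIMSEQ_SUP by blast
    moreover have "(\<lambda>\<mu>. SUP k. \<integral>\<^sup>+u. h k u \<partial>\<mu>) \<in> borel_measurable G"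
      by (intro borel_measurable_SUP int hC) auto
    ultimately show ?thesis by (subst measurable_cong)
  qed
  have UNIV_meas: "(\<lambda>\<mu>. emeasure \<mu> (UNIV \<inter> outside \<epsilon>)) \<in> borel_measurable G"
    by (rule lim[where g="\<lambda>_ _. 1"]) auto
  have Ioi_meas: "(\<lambda>\<mu>. emeasure \<mu> ({ereal a<..} \<inter> outside \<epsilon>)) \<in> borel_measurable G" for a
  proof (rule lim[where g="\<lambda>k u. ramp (Suc k) (u + ereal (- a))"])
    show "continuous_on UNIV (\<lambda>u. ramp (Suc k) (u + ereal (- a)))" for k
      unfolding continuous_on_def by (intro ballI tendsto_ramp tendsto_add_left_ereal tendsto_ident_at) auto
    have "0 < u + ereal (- a) \<longleftrightarrow> u \<in> {ereal a<..}" for u by (cases u) auto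
    then show "(\<lambda>k. ramp (Suc k) (u + ereal (- a))) \<longlonglongrightarrow> indicator {ereal a<..} u" for u
      using ramp_LIMSEQ[of "u + ereal (- a)"] by (simp add: indicator_def)
  qed (auto simp: ramp_bounds ramp_mono)
  have "Int_stable (range (greaterThan :: ereal \<Rightarrow> _))"
  proof (rule Int_stableI)
    fix X Y assume "X \<in> range (greaterThan :: ereal \<Rightarrow> _)" "Y \<in> range (greaterThan :: ereal \<Rightarrow> _)"
    then obtain a b where "X = {a<..}" "Y = {b<..}" by auto
    then have "X \<inter> Y = {max a b<..}" by auto
    then show "X \<inter> Y \<in> range greaterThan" by simp
  qed
  moreover have "range (greaterThan :: ereal \<Rightarrow> _) \<subseteq> Pow UNIV" by simp
  moreover have "A \<in> sigma_sets UNIV (range greaterThan)"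
    using A unfolding borel_Ioi by simp
  ultimately show ?thesis
  proof (induction rule: sigma_sets_induct_disjoint)
    case (basic B)
    then obtain a :: ereal where B: "B = {a<..}" by auto
    show ?case
    proof (cases a)
      case (real r) then show ?thesis using Ioi_meas B by simp
    next
      case PInf
      then have "B = {}" using B by auto
      then show ?thesis by simp
    next
      \<comment> \<open>The half-line above \<open>-\<infinity>\<close> has no real endpoint and is
        exhausted by the half-lines above -n.\<close>
      case MInf
      have "emeasure \<mu> (B \<inter> outside \<epsilon>) = (SUP n. emeasure \<mu> ({ereal (- real n)<..} \<inter> outside \<epsilon>))" if "\<mu> \<in> space G" for \<mu>
      proof -
        have "(\<Union>n. {ereal (- real n)<..} \<inter> outside \<epsilon>) = B \<inter> outside \<epsilon>"
        proof (intro set_eqI iffI)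
          fix u assume u: "u \<in> B \<inter> outside \<epsilon>"
          show "u \<in> (\<Union>n. {ereal (- real n)<..} \<inter> outside \<epsilon>)"
          proof (cases u)
            case (real r)
            obtain n :: nat where "- r < real n" using reals_Archimedean2 by blast
            then have "- real n < r" by simp
            then show ?thesis using real u by auto
          qed (use u B MInf in auto)
        qed (use B MInf in auto)
        moreover have "incseq (\<lambda>n. {ereal (- real n)<..} \<inter> outside \<epsilon>)"
          by (intro incseq_SucI) (auto intro: le_less_trans[rotated])
        ultimately show ?thesis
          using A' sets_G(1)[OF that] by (subst SUP_emeasure_incseq) auto
      qed
      moreover have "(\<lambda>\<mu>. SUP n. emeasure \<mu> ({ereal (- real n)<..} \<inter> outside \<epsilon>)) \<in> borel_measurable G"
        by (intro borel_measurable_SUP Ioi_meas) auto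
      ultimately show ?thesis by (subst measurable_cong)
    qed
  next
    case empty then show ?case by simp
  next
    case (compl B)
    have B: "B \<in> sets borel" using compl(1) unfolding borel_Ioi by simp
    have "emeasure \<mu> ((UNIV - B) \<inter> outside \<epsilon>) = emeasure \<mu> (UNIV \<inter> outside \<epsilon>) - emeasure \<mu> (B \<inter> outside \<epsilon>)"
      if "\<mu> \<in> space G" for \<mu>
    proof -
      have "(UNIV - B) \<inter> outside \<epsilon> = (UNIV \<inter> outside \<epsilon>) - (B \<inter> outside \<epsilon>)" by blast
      moreover have "emeasure \<mu> (B \<inter> outside \<epsilon>) \<le> emeasure \<mu> (outside \<epsilon>)"
        using A'[of UNIV] sets_G(1)[OF that] by (intro emeasure_mono) auto
      then have "emeasure \<mu> (B \<inter> outside \<epsilon>) \<noteq> \<infinity>" using sets_G(2)[OF that] by auto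
      ultimately show ?thesis
        using A'[OF B] A'[of UNIV] sets_G(1)[OF that] by (simp add: emeasure_Diff)
    qed
    moreover have "(\<lambda>\<mu>. emeasure \<mu> (UNIV \<inter> outside \<epsilon>) - emeasure \<mu> (B \<inter> outside \<epsilon>)) \<in> borel_measurable G"
      using UNIV_meas compl(2) by measurable
    ultimately show ?case by (subst measurable_cong)
  next
    case (union B)
    have B: "B i \<in> sets borel" for i using union(2) unfolding borel_Ioi by auto
    have "emeasure \<mu> ((\<Union>i. B i) \<inter> outside \<epsilon>) = (\<Sum>i. emeasure \<mu> (B i \<inter> outside \<epsilon>))" if "\<mu> \<in> space G" for \<mu>
    proof -
      have "(\<Union>i. B i) \<inter> outside \<epsilon> = (\<Union>i. B i \<inter> outside \<epsilon>)" by blast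
      moreover have "disjoint_family (\<lambda>i. B i \<inter> outside \<epsilon>)" using union(1) by (auto simp: disjoint_family_on_def)
      ultimately show ?thesis
        using A'[OF B] sets_G(1)[OF that] by (subst suminf_emeasure) auto
    qed
    moreover have "(\<lambda>\<mu>. \<Sum>i. emeasure \<mu> (B i \<inter> outside \<epsilon>)) \<in> borel_measurable G"
      using union(3) by measurable
    ultimately show ?case by (subst measurable_cong)
  qed
qed

proposition distr_eq_if_LF_eq_Cc:
  assumes M: "prob_space M" "prob_space M'"
    and N: "N \<in> M \<rightarrow>\<^sub>M measure_algebra ereal_no0" "N' \<in> M' \<rightarrow>\<^sub>M measure_algebra ereal_no0"
    and fin: "\<And>\<omega>. \<omega> \<in> space M \<Longrightarrow> N \<omega> \<in> finite_away" "\<And>\<omega>. \<omega> \<in> space M' \<Longrightarrow> N' \<omega> \<in> finite_away"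
    and eq: "\<And>f. f \<in> Cc_tests \<Longrightarrow> LF M N f = LF M' N' f"
  shows "distr M (measure_algebra ereal_no0) N = distr M' (measure_algebra ereal_no0) N'"
proof (rule distr_eq_if_LF_eq_on[OF M N finite_away_sets fin, where C=Cc_tests])
  fix G :: "ereal measure measure" and A
  assume G: "space G = finite_away"
    and int: "\<And>f. f \<in> Cc_tests \<Longrightarrow> (\<lambda>\<mu>. \<integral>\<^sup>+x. f x \<partial>\<mu>) \<in> borel_measurable G" and A: "A \<in> sets ereal_no0"
  have "A \<in> sets borel" using A by (auto simp: sets_restrict_space)
  then have "(\<lambda>\<mu>. SUP n. emeasure \<mu> (A \<inter> outside (1 / real (Suc n)))) \<in> borel_measurable G"
    by (intro borel_measurable_SUP measurable_emeasure_outside_Cc G int) auto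
  moreover have "emeasure \<mu> A = (SUP n. emeasure \<mu> (A \<inter> outside (1 / real (Suc n))))" if "\<mu> \<in> space G" for \<mu>
    using that G A by (intro emeasure_SUP_outside) (auto simp: finite_away_def)
  ultimately show "(\<lambda>\<mu>. emeasure \<mu> A) \<in> borel_measurable G" by (subst measurable_cong)
qed (use eq Cc_tests_add Cc_tests_away away_testsD in auto)

section \<open>Strict stability in terms of Laplace functionals\<close>

lemma LF_scale:
  assumes "N \<in> M \<rightarrow>\<^sub>M measure_algebra ereal_no0" "0 < b" "f \<in> borel_measurable ereal_no0"
  shows "LF M (\<lambda>\<omega>. scale_measure_pts b (N \<omega>)) f = LF M N (\<lambda>u. f (ereal b * u))"
  unfolding LF_def using assms measurable_measure_algebraD(1)[OF assms(1)]
  by (intro Bochner_Integration.integral_cong) (auto simp: nn_integral_scale_measure_pts)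

definition superposed :: "('w \<Rightarrow> ereal measure) \<Rightarrow> real \<Rightarrow> real \<Rightarrow> 'w \<times> 'w \<Rightarrow> ereal measure" where
  "superposed N b1 b2 = (\<lambda>(\<omega>1, \<omega>2). superpose (scale_measure_pts b1 (N \<omega>1)) (scale_measure_pts b2 (N \<omega>2)))"

lemma measurable_superposed:
  assumes N: "N \<in> M \<rightarrow>\<^sub>M measure_algebra ereal_no0" and b: "0 < b1" "0 < b2"
  shows "superposed N b1 b2 \<in> M \<Otimes>\<^sub>M M \<rightarrow>\<^sub>M measure_algebra ereal_no0"
  unfolding superposed_def case_prod_beta
  using measurable_compose[OF measurable_fst measurable_scale_process_const[OF N b(1)]]
    measurable_compose[OF measurable_snd measurable_scale_process_const[OF N b(2)]]
  by (rule measurable_superpose)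

lemma LF_superposed:
  assumes M: "prob_space M" and N: "N \<in> M \<rightarrow>\<^sub>M measure_algebra ereal_no0" and b: "0 < b1" "0 < b2"
    and f: "f \<in> borel_measurable ereal_no0"
  shows "LF (M \<Otimes>\<^sub>M M) (superposed N b1 b2) f = LF M N (\<lambda>u. f (ereal b1 * u)) * LF M N (\<lambda>u. f (ereal b2 * u))"
proof -
  interpret M: prob_space M by fact
  interpret pair_prob_space M M ..
  define F where "F b \<omega> = exp_neg (\<integral>\<^sup>+u. f u \<partial>scale_measure_pts b (N \<omega>))" for b \<omega>
  have F: "integrable M (F b)" "(\<integral>\<omega>. F b \<omega> \<partial>M) = LF M N (\<lambda>u. f (ereal b * u))" if "0 < b" for b
    unfolding F_def using LF_scale[OF N that f]
      measurable_nn_integral_random_measure[OF measurable_scale_process_const[OF N that] f]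
    by (auto intro!: integrable_exp_neg M.finite_measure_axioms simp: LF_def)
  have "LF (M \<Otimes>\<^sub>M M) (superposed N b1 b2) f = (\<integral>x. F b1 (fst x) * F b2 (snd x) \<partial>(M \<Otimes>\<^sub>M M))"
    unfolding LF_def superposed_def F_def case_prod_beta
    by (intro Bochner_Integration.integral_cong) (auto simp: nn_integral_superpose[OF _ _ f] exp_neg_add)
  also have "\<dots> = (\<integral>\<omega>1. (\<integral>\<omega>2. F b1 \<omega>1 * F b2 \<omega>2 \<partial>M) \<partial>M)"
  proof -
    have "integrable (M \<Otimes>\<^sub>M M) (\<lambda>x. F b1 (fst x) * F b2 (snd x))"
    proof (rule integrable_unit_interval)
      show "(\<lambda>x. F b1 (fst x) * F b2 (snd x)) \<in> borel_measurable (M \<Otimes>\<^sub>M M)"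
        using F(1)[OF b(1)] F(1)[OF b(2)] by measurable
      show "0 \<le> F b1 (fst x) * F b2 (snd x) \<and> F b1 (fst x) * F b2 (snd x) \<le> 1" for x
        unfolding F_def using exp_neg_bounds by (auto intro: mult_le_one)
    qed (rule finite_measure_axioms)
    from integral_fst'[OF this] show ?thesis by simp
  qed
  also have "\<dots> = (\<integral>\<omega>. F b1 \<omega> \<partial>M) * (\<integral>\<omega>. F b2 \<omega> \<partial>M)" by simp
  finally show ?thesis using F(2) b by simp
qed

lemma strictly_stable_alt:
  "strictly_stable \<alpha> M N \<longleftrightarrow> (\<forall>b1>0. \<forall>b2>0.
     distr (M \<Otimes>\<^sub>M M) (measure_algebra ereal_no0) (superposed N b1 b2) =
     distr M (measure_algebra ereal_no0) (\<lambda>\<omega>. scale_measure_pts ((b1 powr \<alpha> + b2 powr \<alpha>) powr (1 / \<alpha>)) (N \<omega>)))"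
  unfolding strictly_stable_def superposed_def ..

context
  fixes M :: "'w measure" and N :: "'w \<Rightarrow> ereal measure" and \<alpha> :: real
  assumes M: "prob_space M" and N: "point_process M N" and \<alpha>: "0 < \<alpha>"
begin

lemma stable_scale_pos: "0 < b1 \<Longrightarrow> 0 < b2 \<Longrightarrow> 0 < (b1 powr \<alpha> + b2 powr \<alpha>) powr (1 / \<alpha>)"
  using powr_gt_zero[of b1 \<alpha>] powr_gt_zero[of b2 \<alpha>] by (smt (verit) powr_gt_zero)

lemma stable_scale_powr: "0 < b1 \<Longrightarrow> 0 < b2 \<Longrightarrow> ((b1 powr \<alpha> + b2 powr \<alpha>) powr (1 / \<alpha>)) powr \<alpha> = b1 powr \<alpha> + b2 powr \<alpha>"
  using \<alpha> powr_gt_zero[of b1 \<alpha>] powr_gt_zero[of b2 \<alpha>] by (simp add: powr_powr)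

lemma strictly_stable_LF:
  assumes "strictly_stable \<alpha> M N" "0 < b1" "0 < b2" "f \<in> borel_measurable ereal_no0"
  shows "LF M N (\<lambda>u. f (ereal b1 * u)) * LF M N (\<lambda>u. f (ereal b2 * u)) =
    LF M N (\<lambda>u. f (ereal ((b1 powr \<alpha> + b2 powr \<alpha>) powr (1 / \<alpha>)) * u))"
proof -
  note Nm = point_processD(1)[OF N]
  let ?b = "(b1 powr \<alpha> + b2 powr \<alpha>) powr (1 / \<alpha>)"
  have b: "0 < ?b" using stable_scale_pos assms(2,3) .
  have "LF (M \<Otimes>\<^sub>M M) (superposed N b1 b2) f = LF M (\<lambda>\<omega>. scale_measure_pts ?b (N \<omega>)) f"
    by (rule LF_eq_if_distr_eq[OF measurable_superposed[OF Nm assms(2,3)] measurable_scale_process_const[OF Nm b] _ assms(4)])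
      (use assms(1-3) in \<open>simp add: strictly_stable_alt\<close>)
  then show ?thesis using LF_superposed[OF M Nm assms(2-4)] LF_scale[OF Nm b assms(4)] by simp
qed

lemma scale_superposed_finite_away:
  shows "\<omega> \<in> space M \<Longrightarrow> 0 < b \<Longrightarrow> scale_measure_pts b (N \<omega>) \<in> finite_away"
    and "x \<in> space (M \<Otimes>\<^sub>M M) \<Longrightarrow> 0 < b1 \<Longrightarrow> 0 < b2 \<Longrightarrow> superposed N b1 b2 x \<in> finite_away"
proof -
  show 1: "\<omega> \<in> space M \<Longrightarrow> 0 < b \<Longrightarrow> scale_measure_pts b (N \<omega>) \<in> finite_away" for \<omega> b
    using point_processD(3,4)[OF N] by (auto simp: finite_away_def emeasure_scale_outside)
  show "superposed N b1 b2 x \<in> finite_away" if "x \<in> space (M \<Otimes>\<^sub>M M)" "0 < b1" "0 < b2" for x b1 b2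
  proof -
    have *: "scale_measure_pts b1 (N (fst x)) \<in> finite_away" "scale_measure_pts b2 (N (snd x)) \<in> finite_away"
      using that by (auto intro!: 1 simp: space_pair_measure)
    have "emeasure (superposed N b1 b2 x) (outside (1 / real (Suc n))) < \<infinity>" for n
    proof -
      have "emeasure (superposed N b1 b2 x) (outside (1 / real (Suc n))) =
        emeasure (scale_measure_pts b1 (N (fst x))) (outside (1 / real (Suc n))) +
        emeasure (scale_measure_pts b2 (N (snd x))) (outside (1 / real (Suc n)))"
        unfolding superposed_def case_prod_beta by (intro emeasure_superpose) auto
      then show ?thesis using * by (simp add: finite_away_def)
    qed
    then show ?thesis by (auto simp: finite_away_def superposed_def case_prod_beta)
  qed
qed

text \<open>Both sides of the stability identity are finite away from 0, so compactly supported
  continuous tests decide equality of their laws.\<close>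

lemma strictly_stableI_LF:
  assumes "\<And>b1 b2 f. 0 < b1 \<Longrightarrow> 0 < b2 \<Longrightarrow> f \<in> Cc_tests \<Longrightarrow>
    LF M N (\<lambda>u. f (ereal b1 * u)) * LF M N (\<lambda>u. f (ereal b2 * u)) =
    LF M N (\<lambda>u. f (ereal ((b1 powr \<alpha> + b2 powr \<alpha>) powr (1 / \<alpha>)) * u))"
  shows "strictly_stable \<alpha> M N"
  unfolding strictly_stable_alt
proof (intro allI impI)
  fix b1 b2 :: real assume b: "0 < b1" "0 < b2"
  note Nm = point_processD(1)[OF N]
  interpret M: prob_space M by (rule M)
  interpret pair_prob_space M M ..
  let ?b = "(b1 powr \<alpha> + b2 powr \<alpha>) powr (1 / \<alpha>)"
  have b': "0 < ?b" using stable_scale_pos b .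
  show "distr (M \<Otimes>\<^sub>M M) (measure_algebra ereal_no0) (superposed N b1 b2) =
     distr M (measure_algebra ereal_no0) (\<lambda>\<omega>. scale_measure_pts ?b (N \<omega>))"
  proof (rule distr_eq_if_LF_eq_Cc)
    fix f assume f: "f \<in> Cc_tests"
    then have fm: "f \<in> borel_measurable ereal_no0" using Cc_tests_away away_testsD by blast
    show "LF (M \<Otimes>\<^sub>M M) (superposed N b1 b2) f = LF M (\<lambda>\<omega>. scale_measure_pts ?b (N \<omega>)) f"
      using assms[OF b f] LF_superposed[OF M Nm b fm] LF_scale[OF Nm b' fm] by simp
  qed (use M prob_space_axioms measurable_superposed[OF Nm b] measurable_scale_process_const[OF Nm b']
      scale_superposed_finite_away b b' in auto)
qed

end

section \<open>Bounded configurations and the exponential form of the Laplace functional\<close>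

lemma radon_point_measure_emeasure_nat:
  assumes "radon_point_measure \<mu>" "emeasure \<mu> A < \<infinity>" shows "\<exists>n::nat. emeasure \<mu> A = of_nat n"
proof (cases "A \<in> sets \<mu>")
  case True
  obtain I :: "nat set" and u where u: "u \<in> I \<rightarrow> UNIV - {0}" "\<mu> = distr (count_space I) ereal_no0 u"
    using assms(1) unfolding radon_point_measure_def by blast
  then have "emeasure \<mu> A = emeasure (count_space I) (u -` A \<inter> I)"
    using True by (auto simp: emeasure_distr space_ereal_no0)
  then show ?thesis using assms(2) by (cases "finite (u -` A \<inter> I)") auto
qed (auto simp: emeasure_notin_sets intro: exI[of _ 0])

text \<open>The masses of \<open>outside (real (Suc n))\<close> decrease to the mass of the points
  at infinity, which is 0; being integers, they are eventually 0.\<close>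

lemma radon_point_measure_bounded:
  assumes \<mu>: "radon_point_measure \<mu>"
  shows "\<exists>r>0. emeasure \<mu> (outside r) = 0"
proof -
  have sets: "sets \<mu> = sets ereal_no0" using \<mu> by (rule radon_point_measure_sets)
  have "(\<lambda>n. emeasure \<mu> (outside (real (Suc n)))) \<longlonglongrightarrow> emeasure \<mu> (\<Inter>n. outside (real (Suc n)))"
  proof (rule Lim_emeasure_decseq)
    show "decseq (\<lambda>n. outside (real (Suc n)))" by (intro decseq_SucI outside_antimono) auto
    show "emeasure \<mu> (outside (real (Suc n))) \<noteq> \<infinity>" for n
      using radon_point_measure_outside_finite[OF \<mu>, of "real (Suc n)"] by auto
  qed (auto simp: sets)
  also have "(\<Inter>n. outside (real (Suc n))) = {-\<infinity>, \<infinity>}"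
  proof (intro set_eqI iffI)
    fix u assume u: "u \<in> (\<Inter>n. outside (real (Suc n)))"
    show "u \<in> {-\<infinity>, \<infinity>}"
    proof (cases u)
      case (real r)
      obtain n :: nat where "\<bar>r\<bar> < real n" using reals_Archimedean2 by blast
      then have "u \<notin> outside (real (Suc n))" using real by (simp add: outside_def)
      then show ?thesis using u by blast
    qed auto
  qed (auto simp: outside_def)
  also have "emeasure \<mu> {-\<infinity>, \<infinity>} = 0" using \<mu> by (simp add: radon_point_measure_def)
  finally have "eventually (\<lambda>n. emeasure \<mu> (outside (real (Suc n))) < 1) sequentially"
    by (rule order_tendstoD) simp
  then obtain n where n: "emeasure \<mu> (outside (real (Suc n))) < 1"
    by (auto simp: eventually_sequentially)
  obtain k :: nat where "emeasure \<mu> (outside (real (Suc n))) = of_nat k"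
    using radon_point_measure_emeasure_nat[OF \<mu>] radon_point_measure_outside_finite[OF \<mu>, of "real (Suc n)"] by auto
  with n have "emeasure \<mu> (outside (real (Suc n))) = 0" by (cases k) auto
  then show ?thesis by (intro exI[of _ "real (Suc n)"]) auto
qed

text \<open>Cauchy's equation on (0, infinity): nonnegativity makes \<open>g\<close> monotone, and
  comparison with integer multiples pins it down.\<close>

lemma additive_nonneg_linear:
  fixes g :: "real \<Rightarrow> real"
  assumes add: "\<And>s t. 0 < s \<Longrightarrow> 0 < t \<Longrightarrow> g (s + t) = g s + g t" and nonneg: "\<And>t. 0 < t \<Longrightarrow> 0 \<le> g t" and t: "0 < t"
  shows "g t = t * g 1"
proof -
  have mult: "g (real (Suc n) * s) = real (Suc n) * g s" if "0 < s" for n s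
  proof (induction n)
    case (Suc n)
    have "g (real (Suc (Suc n)) * s) = g (real (Suc n) * s + s)" by (simp add: algebra_simps)
    also have "\<dots> = g (real (Suc n) * s) + g s" using that by (intro add) auto
    finally show ?case using Suc by (simp add: algebra_simps)
  qed simp
  have mono: "g s \<le> g t" if "0 < s" "s \<le> t" for s t
    using add[of s "t - s"] nonneg[of "t - s"] that by (cases "s = t") auto
  have bound: "\<bar>g t - t * g 1\<bar> \<le> 2 * g 1 / real (Suc n)" if n: "1 \<le> real (Suc n) * t" for n
  proof -
    \<comment> \<open>Both (n+1) g(t) and (n+1) t g(1) lie between k g(1) and (k+1) g(1). The
      condition on n ensures k >= 1, as \<open>g\<close> is only controlled at positive
      arguments.\<close>
    define k where "k = nat \<lfloor>real (Suc n) * t\<rfloor>"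
    have k: "real k \<le> real (Suc n) * t" "real (Suc n) * t < real k + 1" "1 \<le> k"
      using n by (auto simp: k_def nat_le_eq_zle le_nat_iff)
    have gk: "g (real j) = real j * g 1" if "1 \<le> j" for j
      using mult[of 1 "j - 1"] that by simp
    have "real k * g 1 \<le> real (Suc n) * g t"
      using mono[of "real k" "real (Suc n) * t"] k gk[of k] mult[OF t, of n] by simp
    moreover have "real (Suc n) * g t \<le> (real k + 1) * g 1"
      using mono[of "real (Suc n) * t" "real (Suc k)"] k gk[of "Suc k"] mult[OF t, of n] t by (simp add: algebra_simps)
    moreover have "real k * g 1 \<le> real (Suc n) * t * g 1" "real (Suc n) * t * g 1 \<le> (real k + 1) * g 1"
      using k nonneg[of 1] by (auto intro!: mult_right_mono)
    ultimately have "\<bar>real (Suc n) * (g t - t * g 1)\<bar> \<le> 2 * g 1"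
      using nonneg[of 1] unfolding right_diff_distrib mult.assoc by (simp add: algebra_simps abs_le_iff)
    then show ?thesis by (simp add: abs_mult pos_le_divide_eq mult.commute del: of_nat_Suc)
  qed
  have "(\<lambda>n. 2 * g 1 / real (Suc n)) \<longlonglongrightarrow> 0"
    using tendsto_mult[OF tendsto_const LIMSEQ_inverse_real_of_nat, of "2 * g 1"] by (simp add: divide_inverse)
  moreover have "eventually (\<lambda>n. \<bar>g t - t * g 1\<bar> \<le> 2 * g 1 / real (Suc n)) sequentially"
  proof -
    obtain n0 :: nat where n0: "1 / t < real n0" using reals_Archimedean2 by blast
    have "1 \<le> real (Suc n) * t" if "n0 \<le> n" for n
    proof -
      have "1 \<le> real n0 * t" using n0 t by (simp add: field_simps)
      also have "\<dots> \<le> real (Suc n) * t" using that t by (intro mult_right_mono) auto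
      finally show ?thesis .
    qed
    then show ?thesis using bound eventually_sequentiallyI by (intro eventually_sequentiallyI[of n0]) auto
  qed
  ultimately have "\<bar>g t - t * g 1\<bar> \<le> 0"
    by (intro tendsto_lowerbound[of "\<lambda>n. 2 * g 1 / real (Suc n)" 0 sequentially]) auto
  then show ?thesis by simp
qed

lemma nn_integral_eq_0_outside:
  assumes "f \<in> borel_measurable ereal_no0" "sets \<mu> = sets ereal_no0" "0 \<le> \<epsilon>"
    "\<And>u. u \<noteq> 0 \<Longrightarrow> u \<notin> outside \<epsilon> \<Longrightarrow> f u = 0" "emeasure \<mu> (outside \<epsilon>) = 0"
  shows "(\<integral>\<^sup>+u. f u \<partial>\<mu>) = 0"
proof -
  have "AE u in \<mu>. u \<notin> outside \<epsilon>"
    using assms(2,3,5) by (intro AE_not_in null_setsI) auto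
  moreover have "AE u in \<mu>. u \<noteq> 0"
    using sets_eq_imp_space_eq[OF assms(2)] by (intro AE_I2) (auto simp: space_ereal_no0)
  ultimately have "AE u in \<mu>. f u = 0" by eventually_elim (use assms(4) in auto)
  then show ?thesis using assms(1,2) by (subst nn_integral_0_iff_AE) (auto cong: measurable_cong_sets)
qed

context
  fixes M :: "'w measure" and N :: "'w \<Rightarrow> ereal measure" and \<alpha> :: real
  assumes M: "prob_space M" and N: "point_process M N" and \<alpha>: "0 < \<alpha>"
begin

interpretation prob_space M by (rule M)

text \<open>Each configuration is bounded, so once it is shrunk far enough it leaves the support of
  \<open>f\<close>. The dyadic times are those at which the multiplicative relation is
  iterated.\<close>

lemma LF_scale_tendsto_1:
  assumes f: "f \<in> away_tests" and t: "0 < t"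
  shows "(\<lambda>n. LF M N (\<lambda>u. f (ereal ((t / 2 ^ n) powr (1 / \<alpha>)) * u))) \<longlonglongrightarrow> 1"
proof -
  obtain \<epsilon> where f': "f \<in> borel_measurable ereal_no0" "0 < \<epsilon>" "\<And>u. u \<noteq> 0 \<Longrightarrow> u \<notin> outside \<epsilon> \<Longrightarrow> f u = 0"
    using f by (rule away_testsE) blast
  define b where "b n = (t / 2 ^ n) powr (1 / \<alpha>)" for n
  have b: "0 < b n" for n using t by (simp add: b_def)
  have fb: "(\<lambda>u. f (ereal (b n) * u)) \<in> borel_measurable ereal_no0" for n
    using away_tests_scale[OF f b] by (rule away_testsD)
  have b0: "b \<longlonglongrightarrow> 0"
  proof -
    have "(\<lambda>n. t / 2 ^ n) \<longlonglongrightarrow> 0"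
      using tendsto_mult[OF tendsto_const LIMSEQ_realpow_zero[of "1/2"], of t] by (simp add: power_divide)
    then show ?thesis unfolding b_def using t \<alpha> by (intro tendsto_zero_powrI[where b="1 / \<alpha>"]) auto
  qed
  have "(\<lambda>n. LF M N (\<lambda>u. f (ereal (b n) * u))) \<longlonglongrightarrow> (\<integral>\<omega>. 1 \<partial>M)" unfolding LF_def
  proof (intro tendsto_integral_unit_interval finite_measure_axioms)
    fix \<omega> assume \<omega>: "\<omega> \<in> space M"
    obtain r where r: "0 < r" "emeasure (N \<omega>) (outside r) = 0"
      using radon_point_measure_bounded[OF point_processD(2)[OF N \<omega>]] by blast
    have "eventually (\<lambda>n. b n < \<epsilon> / r) sequentially" using b0 f'(2) r(1) by (intro order_tendstoD) auto
    then have "eventually (\<lambda>n. (\<integral>\<^sup>+u. f (ereal (b n) * u) \<partial>N \<omega>) = 0) sequentially"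
    proof eventually_elim
      case (elim n)
      show ?case
      proof (rule nn_integral_eq_0_outside[OF fb])
        show "f (ereal (b n) * u) = 0" if "u \<noteq> 0" "u \<notin> outside r" for u
        proof (rule f'(3))
          have "r \<le> \<epsilon> / b n" using elim b[of n] r(1) by (simp add: field_simps)
          then have "u \<notin> outside (\<epsilon> / b n)" using that(2) outside_antimono by blast
          then show "ereal (b n) * u \<notin> outside \<epsilon>" using scale_mem_outside[OF b] by simp
        qed (use that b[of n] in auto)
      qed (use r point_processD(3)[OF N \<omega>] in auto)
    qed
    then show "(\<lambda>n. exp_neg (\<integral>\<^sup>+u. f (ereal (b n) * u) \<partial>N \<omega>)) \<longlonglongrightarrow> 1"
      by (intro tendsto_eventually) (auto elim: eventually_mono)
  qed (use exp_neg_bounds measurable_nn_integral_random_measure[OF point_processD(1)[OF N] fb] in auto)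
  then show ?thesis by (simp add: b_def prob_space)
qed

text \<open>In the time t = b^\<alpha>, stability reads \<psi>(s + t) = \<psi>(s) \<psi>(t), so - ln
  \<psi> solves Cauchy's equation with nonnegative values.\<close>

lemma stable_exponent:
  assumes st: "strictly_stable \<alpha> M N" and f: "f \<in> away_tests"
  shows "\<exists>h\<ge>0. \<forall>t>0. LF M N (\<lambda>u. f (ereal (t powr (1 / \<alpha>)) * u)) = exp (- h * t)"
proof -
  define \<psi> where "\<psi> t = LF M N (\<lambda>u. f (ereal (t powr (1 / \<alpha>)) * u))" for t
  have fb: "(\<lambda>u. f (ereal b * u)) \<in> borel_measurable ereal_no0" if "0 < b" for b
    using away_tests_scale[OF f that] by (rule away_testsD)
  have \<psi>01: "0 \<le> \<psi> t" "\<psi> t \<le> 1" if "0 < t" for t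
    unfolding \<psi>_def using that LF_bounds[OF point_processD(1)[OF N] fb] by auto
  have add: "\<psi> (s + t) = \<psi> s * \<psi> t" if "0 < s" "0 < t" for s t
    using strictly_stable_LF[OF M N \<alpha> st, of "s powr (1 / \<alpha>)" "t powr (1 / \<alpha>)" f] that \<alpha> away_testsD[OF f]
    by (simp add: \<psi>_def powr_powr)
  have dyadic: "\<psi> t = \<psi> (t / 2 ^ n) ^ (2 ^ n)" if t: "0 < t" for t n
  proof (induction n)
    case (Suc n)
    have "\<psi> (t / 2 ^ n) = \<psi> (t / 2 ^ Suc n) ^ 2"
      using add[of "t / 2 ^ Suc n" "t / 2 ^ Suc n"] t by (simp add: power2_eq_square)
    then show ?case using Suc by (simp flip: power_mult)
  qed simp
  \<comment> \<open>Positivity is not automatic, as \<open>f\<close> may be infinite. It holds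
    because \<psi>(t) is a power of \<psi>(t / 2^n), which tends to 1.\<close>
  have pos: "0 < \<psi> t" if t: "0 < t" for t
  proof -
    have "eventually (\<lambda>n. 0 < \<psi> (t / 2 ^ n)) sequentially"
      using LF_scale_tendsto_1[OF f t] unfolding \<psi>_def by (rule order_tendstoD) simp
    then obtain n where "0 < \<psi> (t / 2 ^ n)" by (auto simp: eventually_sequentially)
    then show ?thesis using dyadic[OF t, of n] by simp
  qed
  define g where "g t = - ln (\<psi> t)" for t
  have lin: "g t = t * g 1" if "0 < t" for t
  proof (rule additive_nonneg_linear[OF _ _ that])
    show "g (s + t) = g s + g t" if "0 < s" "0 < t" for s t
      using that pos[of s] pos[of t] by (simp add: g_def add ln_mult)
    show "0 \<le> g t" if "0 < t" for t
      using that pos[of t] \<psi>01[of t] by (simp add: g_def)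
  qed
  have "\<psi> t = exp (- g 1 * t)" if "0 < t" for t
  proof -
    have "\<psi> t = exp (- g t)" using pos[OF that] by (simp add: g_def)
    then show ?thesis by (simp add: lin[OF that] mult.commute)
  qed
  moreover have "0 \<le> g 1" using pos[of 1] \<psi>01[of 1] by (simp add: g_def)
  ultimately show ?thesis unfolding \<psi>_def by blast
qed

lemma scaled_laplace_functional_eq_LF:
  assumes "f \<in> Cc_plus" "0 < y"
  shows "scaled_laplace_functional M N f y = LF M N (\<lambda>u. ennreal (f (ereal (1 / y) * u)))"
  by (simp add: scaled_laplace_functional_def laplace_functional_def LF_def scale_fun_def)

section \<open>Strict stability and the Frechet profile\<close>

lemma tendsto_frechet: "(frechet \<alpha> \<longlongrightarrow> 1) at_top"
proof -
  have "((\<lambda>x. exp (- (x powr (- \<alpha>)))) \<longlongrightarrow> exp (- 0)) at_top"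
    using \<alpha> by (intro tendsto_intros tendsto_neg_powr filterlim_ident) auto
  then show ?thesis by (simp add: frechet_def[abs_def])
qed

text \<open>For h > 0 the constant is h^(-1/\<alpha>); h = 0 is the case of an infinite constant,
  where the limit 1 of the profile is read off.\<close>

lemma frechet_scale_exp:
  assumes "0 \<le> h"
  shows "\<exists>c::ereal. c > 0 \<and> (\<forall>y>0. exp (- h * y powr (- \<alpha>)) = at_infty_ext (frechet \<alpha>) (ereal y * c))"
proof (cases "h = 0")
  case True
  have "Lim at_top (frechet \<alpha>) = 1" by (rule tendsto_Lim[OF _ tendsto_frechet]) simp
  then show ?thesis using True by (intro exI[of _ \<infinity>]) (auto simp: at_infty_ext_def)
next
  case False
  then have h: "0 < h" using assms by simp
  have "exp (- h * y powr (- \<alpha>)) = frechet \<alpha> (y * h powr (- 1 / \<alpha>))" if "0 < y" for y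
    using that h \<alpha> by (simp add: frechet_def powr_mult powr_powr mult.commute)
  then show ?thesis using h by (intro exI[of _ "ereal (h powr (- 1 / \<alpha>))"]) (auto simp: at_infty_ext_def)
qed

lemma stable_imp_scale_uniquely_supported:
  assumes "strictly_stable \<alpha> M N"
  shows "scale_uniquely_supported M N (sc_class (frechet \<alpha>))"
  unfolding scale_uniquely_supported_def
proof (intro bexI ballI)
  have "frechet \<alpha> \<in> borel_measurable real_pos"
    unfolding frechet_def[abs_def] by (rule measurable_restrict_space1) measurable
  then show "frechet \<alpha> \<in> sc_class (frechet \<alpha>)"
    unfolding sc_class_def by (auto simp: frechet_def intro!: exI[of _ 1])
  fix f assume f: "f \<in> Cc_plus"
  then have "(\<lambda>u. ennreal (f u)) \<in> away_tests" using Cc_tests_away by (auto simp: Cc_tests_def)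
  then obtain h where h: "0 \<le> h" "\<And>t. 0 < t \<Longrightarrow> LF M N (\<lambda>u. ennreal (f (ereal (t powr (1 / \<alpha>)) * u))) = exp (- h * t)"
    using stable_exponent[OF assms] by blast
  \<comment> \<open>At time t = y^(-\<alpha>) the scale t^(1/\<alpha>) is 1/y, as in the scaled
    functional.\<close>
  have "scaled_laplace_functional M N f y = exp (- h * y powr (- \<alpha>))" if "0 < y" for y
  proof -
    have "(y powr (- \<alpha>)) powr (1 / \<alpha>) = y powr (- 1)" unfolding powr_powr using \<alpha> by simp
    then have "(y powr (- \<alpha>)) powr (1 / \<alpha>) = 1 / y" using that by (simp add: powr_neg_one)
    then show ?thesis using h(2)[of "y powr (- \<alpha>)"] that by (simp add: scaled_laplace_functional_eq_LF[OF f])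
  qed
  then show "\<exists>c::ereal. c > 0 \<and> (\<forall>y>0. scaled_laplace_functional M N f y = at_infty_ext (frechet \<alpha>) (ereal y * c))"
    using frechet_scale_exp[OF h(1)] by simp
qed

text \<open>The profile forces the Laplace functional of the test scaled by b to be exp(-k
  b^\<alpha>), with k depending on the test only. Such exponents add in b^\<alpha>, which is
  stability tested on \<open>Cc_tests\<close>.\<close>

lemma scale_uniquely_supported_imp_stable:
  assumes "scale_uniquely_supported M N (sc_class (frechet \<alpha>))"
  shows "strictly_stable \<alpha> M N"
proof (rule strictly_stableI_LF[OF M N \<alpha>])
  fix b1 b2 :: real and h assume b: "0 < b1" "0 < b2" and h: "h \<in> Cc_tests"
  obtain g where g: "g \<in> sc_class (frechet \<alpha>)"
    and sup: "\<forall>f\<in>Cc_plus. \<exists>c::ereal. c > 0 \<and> (\<forall>y>0. scaled_laplace_functional M N f y = at_infty_ext g (ereal y * c))"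
    using assms unfolding scale_uniquely_supported_def by blast
  obtain y0 where y0: "0 < y0" "\<And>x. 0 < x \<Longrightarrow> g x = frechet \<alpha> (y0 * x)" using g unfolding sc_class_def by auto
  obtain f where f: "f \<in> Cc_plus" "\<And>u. u \<noteq> 0 \<Longrightarrow> h u = ennreal (f u)"
    using h unfolding Cc_tests_def by blast
  obtain c :: ereal where c: "c > 0" "\<And>y. 0 < y \<Longrightarrow> scaled_laplace_functional M N f y = at_infty_ext g (ereal y * c)"
    using sup f(1) by blast
  \<comment> \<open>The value taken by \<open>at_infty_ext\<close> when c is infinite; it leads to k
    = 0.\<close>
  have limg: "Lim at_top g = 1"
  proof (rule tendsto_Lim)
    have "filterlim (\<lambda>x. y0 * x) at_top at_top" using y0(1)
      by (intro filterlim_tendsto_pos_mult_at_top[OF tendsto_const]) (auto intro: filterlim_ident)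
    from filterlim_compose[OF tendsto_frechet this] show "(g \<longlongrightarrow> 1) at_top"
      by (rule Lim_transform_eventually) (use y0(2) in \<open>auto intro!: eventually_mono[OF eventually_gt_at_top[of 0]]\<close>)
  qed simp
  obtain k where k: "\<And>b. 0 < b \<Longrightarrow> LF M N (\<lambda>u. h (ereal b * u)) = exp (- k * b powr \<alpha>)"
  proof -
    have LF_h: "LF M N (\<lambda>u. h (ereal b * u)) = at_infty_ext g (ereal (1 / b) * c)" if b: "0 < b" for b
    proof -
      have "LF M N (\<lambda>u. h (ereal b * u)) = LF M N (\<lambda>u. ennreal (f (ereal b * u)))"
        unfolding LF_def
      proof (intro Bochner_Integration.integral_cong refl arg_cong[where f=exp_neg] nn_integral_cong)
        fix \<omega> u assume "\<omega> \<in> space M" "u \<in> space (N \<omega>)"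
        then have "u \<noteq> 0" using sets_eq_imp_space_eq[OF point_processD(3)[OF N]] by (auto simp: space_ereal_no0)
        then show "h (ereal b * u) = ennreal (f (ereal b * u))" using b by (intro f(2)) auto
      qed
      also have "\<dots> = scaled_laplace_functional M N f (1 / b)"
        using b by (subst scaled_laplace_functional_eq_LF[OF f(1)]) auto
      also have "\<dots> = at_infty_ext g (ereal (1 / b) * c)" using b by (intro c(2)) auto
      finally show ?thesis .
    qed
    show thesis
    proof (cases c)
      case (real r)
      then have r: "0 < r" using c(1) by simp
      show thesis
      proof (rule that[of "(y0 * r) powr (- \<alpha>)"])
        fix b :: real assume b: "0 < b"
        have "LF M N (\<lambda>u. h (ereal b * u)) = frechet \<alpha> (y0 * (1 / b * r))"
          using LF_h[OF b] real b r y0(2)[of "1 / b * r"] by (simp add: at_infty_ext_def)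
        also have "\<dots> = exp (- ((y0 * r) powr (- \<alpha>)) * b powr \<alpha>)"
          using b r y0(1) by (simp add: frechet_def powr_mult powr_divide powr_minus_divide)
        finally show "LF M N (\<lambda>u. h (ereal b * u)) = exp (- ((y0 * r) powr (- \<alpha>)) * b powr \<alpha>)" .
      qed
    next
      case PInf
      show thesis
        by (rule that[of 0]) (use LF_h PInf limg in \<open>simp add: at_infty_ext_def\<close>)
    qed (use c(1) in auto)
  qed
  show "LF M N (\<lambda>u. h (ereal b1 * u)) * LF M N (\<lambda>u. h (ereal b2 * u)) =
    LF M N (\<lambda>u. h (ereal ((b1 powr \<alpha> + b2 powr \<alpha>) powr (1 / \<alpha>)) * u))"
    unfolding k[OF b(1)] k[OF b(2)] k[OF stable_scale_pos[OF M N \<alpha> b]] stable_scale_powr[OF M N \<alpha> b]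
    by (simp add: exp_add[symmetric] algebra_simps)
qed

end

context power_measure
begin

text \<open>By homogeneity of \<open>m\<close>, scaling the test by b multiplies the exponent
  \<open>I\<close> by b^\<alpha>. The identity stays meaningful for infinite \<open>I\<close>
  through \<open>exp_neg\<close>.\<close>

lemma decorated_imp_stable:
  assumes M: "prob_space M" and N: "point_process M N" and dec: "scale_decorated_poisson m D P M N"
  shows "strictly_stable \<alpha> M N"
proof (rule strictly_stableI_LF[OF M N \<alpha>])
  fix b1 b2 :: real and f assume b: "0 < b1" "0 < b2" and "f \<in> Cc_tests"
  then have f: "f \<in> borel_measurable ereal_no0" using Cc_tests_away away_testsD by blast
  note Nm = point_processD(1)[OF N]
  from dec obtain L :: "(nat \<Rightarrow> real) measure" and l where D: "prob_space D" and P: "point_process D P"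
    and L: "prob_space L" and l: "\<And>i::nat. l i \<in> L \<rightarrow>\<^sub>M real_pos"
    and \<Lambda>: "poisson_random_measure L m (\<lambda>\<omega>. distr (count_space UNIV) real_pos (\<lambda>i. l i \<omega>))"
    and eq: "distr M (measure_algebra ereal_no0) N = distr (L \<Otimes>\<^sub>M (\<Pi>\<^sub>M i\<in>UNIV. D)) (measure_algebra ereal_no0) (decorated l P)"
    unfolding scale_decorated_poisson_def decorated_def by blast
  define I where "I = (\<integral>\<^sup>+x. ennreal (1 - LF D P (\<lambda>u. f (ereal x * u))) \<partial>m)"
  have fb: "(\<lambda>u. f (ereal b * u)) \<in> borel_measurable ereal_no0" if "0 < b" for b
    using measurable_compose[OF measurable_scale[OF that] f] .
  have LF_b: "LF M N (\<lambda>u. f (ereal b * u)) = exp_neg (ennreal (b powr \<alpha>) * I)" if b: "0 < b" for b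
  proof -
    have "LF M N (\<lambda>u. f (ereal b * u)) = LF (L \<Otimes>\<^sub>M (\<Pi>\<^sub>M i\<in>UNIV. D)) (decorated l P) (\<lambda>u. f (ereal b * u))"
      by (rule LF_eq_if_distr_eq[OF Nm measurable_decorated[OF P l] eq fb[OF b]])
    also have "\<dots> = exp_neg (\<integral>\<^sup>+x. ennreal (1 - LF D P (\<lambda>u. f (ereal b * (ereal x * u)))) \<partial>m)"
      by (rule LF_decorated[OF L D P l sets_m \<Lambda> fb[OF b]])
    also have "(\<integral>\<^sup>+x. ennreal (1 - LF D P (\<lambda>u. f (ereal b * (ereal x * u)))) \<partial>m) =
      (\<integral>\<^sup>+x. ennreal (1 - LF D P (\<lambda>u. f (ereal (b * x) * u))) \<partial>m)"
      by (simp add: mult.assoc[symmetric])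
    also have "\<dots> = ennreal (b powr \<alpha>) * I"
      unfolding I_def using measurable_LF_scale[OF D P f] b by (intro nn_integral_scale_m) auto
    finally show ?thesis .
  qed
  show "LF M N (\<lambda>u. f (ereal b1 * u)) * LF M N (\<lambda>u. f (ereal b2 * u)) =
    LF M N (\<lambda>u. f (ereal ((b1 powr \<alpha> + b2 powr \<alpha>) powr (1 / \<alpha>)) * u))"
    unfolding LF_b[OF b(1)] LF_b[OF b(2)] LF_b[OF stable_scale_pos[OF M N \<alpha> b]] stable_scale_powr[OF M N \<alpha> b]
    by (simp add: exp_neg_add[symmetric] distrib_right)
qed

end

section \<open>The Levy measure of a strictly stable point process\<close>

text \<open>A continuous-time Fekete lemma at 0. The limit is the infimum of b(t)/t, and it is this
  extra bound L <= b(t)/t that later provides domination.\<close>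

lemma superadditive_tendsto:
  fixes b :: "real \<Rightarrow> real"
  assumes super: "\<And>s t. 0 < s \<Longrightarrow> 0 < t \<Longrightarrow> b s + b t \<le> b (s + t)" and nonneg: "\<And>t. 0 < t \<Longrightarrow> 0 \<le> b t"
  obtains L where "0 \<le> L" "\<And>t. 0 < t \<Longrightarrow> L \<le> b t / t" "((\<lambda>t. b t / t) \<longlongrightarrow> L) (at_right 0)"
proof -
  define S where "S = (\<lambda>t. b t / t) ` {0<..}"
  define L where "L = Inf S"
  have S: "S \<noteq> {}" "bdd_below S" using nonneg by (auto simp: S_def intro!: bdd_belowI[of _ 0])
  have mult: "real (Suc n) * b s \<le> b (real (Suc n) * s)" if "0 < s" for n s
  proof (induction n)
    case (Suc n)
    have "real (Suc (Suc n)) * b s \<le> b (real (Suc n) * s) + b s" using Suc by (simp add: algebra_simps)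
    also have "\<dots> \<le> b (real (Suc n) * s + s)" using that by (intro super) auto
    finally show ?case by (simp add: algebra_simps)
  qed simp
  have mono: "b s \<le> b t" if "0 < s" "s \<le> t" for s t
    using super[of s "t - s"] nonneg[of "t - s"] that by (cases "s = t") auto
  \<comment> \<open>With n = floor(t0 / t) steps, n b(t) <= b(t0), while n t exceeds t0 - t; letting
    t tend to 0 compares every small-time quotient with b(t0)/t0.\<close>
  have upper: "b t / t \<le> b t0 / (t0 - t)" if "0 < t" "t < t0" for t t0
  proof -
    define n where "n = nat \<lfloor>t0 / t\<rfloor>"
    have "1 < t0 / t" using that by (simp add: field_simps)
    then have n: "1 \<le> n" "real n \<le> t0 / t" "t0 / t < real n + 1" by (auto simp: n_def nat_le_eq_zle le_nat_iff)
    then have nt: "real n * t \<le> t0" "t0 - t < real n * t" using that by (auto simp: field_simps)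
    have "real n * b t \<le> b t0"
      using mult[OF that(1), of "n - 1"] mono[of "real n * t" t0] n nt that(1) by simp
    then have "b t / t \<le> b t0 / (real n * t)" using n that(1) by (simp add: field_simps)
    also have "\<dots> \<le> b t0 / (t0 - t)" using nt that nonneg[of t0] by (intro divide_left_mono) auto
    finally show ?thesis .
  qed
  have lower: "L \<le> b t / t" if "0 < t" for t
    unfolding L_def using S that by (intro cInf_lower) (auto simp: S_def)
  show thesis
  proof (rule that[of L])
    show "0 \<le> L" unfolding L_def using S nonneg by (intro cInf_greatest) (auto simp: S_def)
    show "((\<lambda>t. b t / t) \<longlongrightarrow> L) (at_right 0)"
    proof (rule order_tendstoI)
      fix y assume "y < L"
      then show "eventually (\<lambda>t. y < b t / t) (at_right 0)"
        using lower by (auto simp: eventually_at_right_field intro!: exI[of _ 1] intro: less_le_trans)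
    next
      fix y assume "L < y"
      then obtain x where "x \<in> S" "x < y" unfolding L_def using cInf_lessD[OF S(1)] by blast
      then obtain t0 where t0: "0 < t0" "b t0 / t0 < y" by (auto simp: S_def)
      have "((\<lambda>t. b t0 / (t0 - t)) \<longlongrightarrow> b t0 / (t0 - 0)) (at_right 0)"
        using t0(1) by (intro tendsto_intros) auto
      then have "eventually (\<lambda>t. b t0 / (t0 - t) < y) (at_right 0)" using t0 by (intro order_tendstoD) auto
      moreover have "eventually (\<lambda>t. t \<in> {0<..<t0}) (at_right 0)" using t0(1) by (rule eventually_at_right_real)
      ultimately show "eventually (\<lambda>t. b t / t < y) (at_right 0)"
        by eventually_elim (use upper in \<open>auto intro: le_less_trans\<close>)
    qed
  qed (rule lower)
qed

text \<open>The functionals for which small-time rates exist: they vanish on configurations void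
  beyond \<epsilon>, which keeps the rate finite, and they ignore points within \<epsilon>, so a
  summand that is void beyond \<epsilon> is invisible in a superposition.\<close>

definition local_at :: "real \<Rightarrow> (ereal measure \<Rightarrow> real) \<Rightarrow> bool" where
  "local_at \<epsilon> G \<longleftrightarrow> G \<in> borel_measurable (measure_algebra ereal_no0) \<and> (\<forall>\<mu>. 0 \<le> G \<mu> \<and> G \<mu> \<le> 1) \<and>
     (\<forall>\<mu>. sets \<mu> = sets ereal_no0 \<longrightarrow> emeasure \<mu> (outside \<epsilon>) = 0 \<longrightarrow> G \<mu> = 0) \<and>
     (\<forall>\<mu> \<nu>. sets \<mu> = sets ereal_no0 \<longrightarrow> sets \<nu> = sets ereal_no0 \<longrightarrow>
        (\<forall>A\<in>sets ereal_no0. A \<subseteq> outside \<epsilon> \<longrightarrow> emeasure \<mu> A = emeasure \<nu> A) \<longrightarrow> G \<mu> = G \<nu>)"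

lemma local_atD:
  assumes "local_at \<epsilon> G"
  shows "G \<in> borel_measurable (measure_algebra ereal_no0)" "0 \<le> G \<mu>" "G \<mu> \<le> 1"
    "sets \<mu> = sets ereal_no0 \<Longrightarrow> emeasure \<mu> (outside \<epsilon>) = 0 \<Longrightarrow> G \<mu> = 0"
    "sets \<mu> = sets ereal_no0 \<Longrightarrow> sets \<nu> = sets ereal_no0 \<Longrightarrow>
        (\<And>A. A \<in> sets ereal_no0 \<Longrightarrow> A \<subseteq> outside \<epsilon> \<Longrightarrow> emeasure \<mu> A = emeasure \<nu> A) \<Longrightarrow> G \<mu> = G \<nu>"
proof -
  have loc: "\<forall>\<mu> \<nu>. sets \<mu> = sets ereal_no0 \<longrightarrow> sets \<nu> = sets ereal_no0 \<longrightarrow>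
        (\<forall>A\<in>sets ereal_no0. A \<subseteq> outside \<epsilon> \<longrightarrow> emeasure \<mu> A = emeasure \<nu> A) \<longrightarrow> G \<mu> = G \<nu>"
    using assms unfolding local_at_def by (elim conjE)
  show "G \<mu> = G \<nu>" if "sets \<mu> = sets ereal_no0" "sets \<nu> = sets ereal_no0"
    "\<And>A. A \<in> sets ereal_no0 \<Longrightarrow> A \<subseteq> outside \<epsilon> \<Longrightarrow> emeasure \<mu> A = emeasure \<nu> A"
    by (intro loc[rule_format] that)
qed (use assms in \<open>auto simp: local_at_def\<close>)

lemma local_at_superpose:
  assumes G: "local_at \<epsilon> G" and \<epsilon>: "0 < \<epsilon>" and \<mu>: "sets \<mu> = sets ereal_no0" and \<nu>: "sets \<nu> = sets ereal_no0"
    and 0: "emeasure \<nu> (outside \<epsilon>) = 0"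
  shows "G (superpose \<mu> \<nu>) = G \<mu>" "G (superpose \<nu> \<mu>) = G \<mu>"
proof -
  have z: "emeasure \<nu> A = 0" if "A \<in> sets ereal_no0" "A \<subseteq> outside \<epsilon>" for A
    using emeasure_mono[of A "outside \<epsilon>" \<nu>] that \<nu> 0 \<epsilon> by simp
  show "G (superpose \<mu> \<nu>) = G \<mu>" "G (superpose \<nu> \<mu>) = G \<mu>"
    by (rule local_atD(5)[OF G]; use \<mu> \<nu> z in \<open>simp add: emeasure_superpose\<close>)+
qed

locale stable_process = prob_space M + power_measure \<alpha> m
  for M :: "'w measure" and \<alpha> :: real and m :: "real measure" +
  fixes N :: "'w \<Rightarrow> ereal measure"
  assumes N: "point_process M N" and stable: "strictly_stable \<alpha> M N"
    and nontrivial: "0 < measure M {\<omega> \<in> space M. emeasure (N \<omega>) (UNIV - {0}) > 0}"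
begin

lemma M: "prob_space M" by (rule prob_space_axioms)

text \<open>The exponent 1/\<alpha> makes stability additive in time: the laws of \<open>S t\<close>
  form a convolution semigroup, and scaling by r is the time change by r^\<alpha>.\<close>

definition S :: "real \<Rightarrow> 'w \<Rightarrow> ereal measure" where
  "S t \<omega> = scale_measure_pts (t powr (1 / \<alpha>)) (N \<omega>)"

lemma sets_S[simp]: "sets (S t \<omega>) = sets ereal_no0" by (simp add: S_def)

lemma S_measurable: "0 < t \<Longrightarrow> S t \<in> M \<rightarrow>\<^sub>M measure_algebra ereal_no0"
  unfolding S_def by (rule measurable_scale_process_const[OF point_processD(1)[OF N]]) auto

lemma nn_integral_S:
  assumes "0 < t" "\<omega> \<in> space M" "f \<in> borel_measurable ereal_no0"
  shows "(\<integral>\<^sup>+u. f u \<partial>S t \<omega>) = (\<integral>\<^sup>+u. f (ereal (t powr (1 / \<alpha>)) * u) \<partial>N \<omega>)"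
  unfolding S_def using assms point_processD(3)[OF N] by (intro nn_integral_scale_measure_pts) auto

lemma emeasure_S_outside:
  assumes "0 < t" "\<omega> \<in> space M" "0 \<le> \<epsilon>"
  shows "emeasure (S t \<omega>) (outside \<epsilon>) = emeasure (N \<omega>) (outside (\<epsilon> / t powr (1 / \<alpha>)))"
  unfolding S_def using assms point_processD(3)[OF N] by (intro emeasure_scale_outside) auto

lemma scale_S:
  assumes "0 < t" "0 < r" "\<omega> \<in> space M"
  shows "scale_measure_pts r (S t \<omega>) = S (r powr \<alpha> * t) \<omega>"
proof -
  have "(r powr \<alpha> * t) powr (1 / \<alpha>) = r * t powr (1 / \<alpha>)" using assms \<alpha> by (simp add: powr_mult powr_powr)
  then show ?thesis unfolding S_def using assms point_processD(3)[OF N] by (simp add: scale_scale_measure_pts)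
qed

lemma integral_S_add:
  fixes G :: "ereal measure \<Rightarrow> real"
  assumes G: "G \<in> borel_measurable (measure_algebra ereal_no0)" and st: "0 < s" "0 < t"
  shows "(\<integral>\<omega>. G (S (s + t) \<omega>) \<partial>M) = (\<integral>x. G (superpose (S s (fst x)) (S t (snd x))) \<partial>(M \<Otimes>\<^sub>M M))"
proof -
  let ?b = "s powr (1 / \<alpha>)" and ?c = "t powr (1 / \<alpha>)"
  have b: "0 < ?b" "0 < ?c" using st by auto
  have *: "(?b powr \<alpha> + ?c powr \<alpha>) powr (1 / \<alpha>) = (s + t) powr (1 / \<alpha>)" using st \<alpha> by (simp add: powr_powr)
  have eq: "distr (M \<Otimes>\<^sub>M M) (measure_algebra ereal_no0) (superposed N ?b ?c) = distr M (measure_algebra ereal_no0) (S (s + t))"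
    using stable[unfolded strictly_stable_alt, rule_format, OF b] unfolding * S_def .
  have "(\<integral>\<omega>. G (S (s + t) \<omega>) \<partial>M) = (\<integral>\<mu>. G \<mu> \<partial>distr M (measure_algebra ereal_no0) (S (s + t)))"
    using G S_measurable[of "s + t"] st by (subst integral_distr) auto
  also have "\<dots> = (\<integral>x. G (superposed N ?b ?c x) \<partial>(M \<Otimes>\<^sub>M M))"
    unfolding eq[symmetric] using G measurable_superposed[OF point_processD(1)[OF N] b] by (subst integral_distr) auto
  finally show ?thesis by (simp add: superposed_def S_def case_prod_beta)
qed

lemma measurable_emeasure_N: "0 \<le> r \<Longrightarrow> (\<lambda>\<omega>. emeasure (N \<omega>) (outside r)) \<in> borel_measurable M"
  using measurable_measure_algebraD(2)[OF point_processD(1)[OF N] outside_sets] .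

lemma measurable_emeasure_S: "0 < t \<Longrightarrow> 0 \<le> r \<Longrightarrow> (\<lambda>\<omega>. emeasure (S t \<omega>) (outside r)) \<in> borel_measurable M"
  using measurable_measure_algebraD(2)[OF S_measurable outside_sets] .

text \<open>Infinity times the indicator of \<open>outside 1\<close> is a test whose Laplace
  functional is the void probability, so \<open>stable_exponent\<close> supplies c.\<close>

lemma ex_void_rate: "\<exists>c>0. \<forall>r>0. prob {\<omega> \<in> space M. emeasure (N \<omega>) (outside r) = 0} = exp (- c * r powr (- \<alpha>))"
proof -
  have tst: "(\<lambda>u. \<infinity> * indicator ((UNIV - {0}) \<inter> outside 1) u :: ennreal) \<in> away_tests"
    by (rule away_tests_indicator) (auto simp: sets_restrict_space_iff)
  have "(UNIV - {0}) \<inter> outside 1 = outside 1" by (auto simp: outside_def)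
  with tst have "(\<lambda>u. \<infinity> * indicator (outside 1) u :: ennreal) \<in> away_tests" by simp
  from stable_exponent[OF M N \<alpha> stable this]
  obtain c where c: "0 \<le> c" "\<And>t. 0 < t \<Longrightarrow>
      LF M N (\<lambda>u. \<infinity> * indicator (outside 1) (ereal (t powr (1 / \<alpha>)) * u)) = exp (- c * t)" by auto
  have void: "prob {\<omega> \<in> space M. emeasure (N \<omega>) (outside r) = 0} = exp (- c * r powr (- \<alpha>))" if r: "0 < r" for r
  proof -
    have "(r powr (- \<alpha>)) powr (1 / \<alpha>) = r powr (- 1)" unfolding powr_powr using \<alpha> by simp
    then have b: "(r powr (- \<alpha>)) powr (1 / \<alpha>) = 1 / r" using r by (simp add: powr_neg_one)
    have ind: "indicator (outside 1) (ereal (1 / r) * u) = (indicator (outside r) u :: ennreal)" for u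
      using scale_mem_outside[of "1 / r" u 1] r by (simp add: indicator_def)
    have [measurable]: "(\<lambda>\<omega>. emeasure (N \<omega>) (outside r)) \<in> borel_measurable M" using measurable_emeasure_N r by simp
    have "LF M N (\<lambda>u. \<infinity> * indicator (outside 1) (ereal (1 / r) * u)) =
      (\<integral>\<omega>. indicator {\<omega> \<in> space M. emeasure (N \<omega>) (outside r) = 0} \<omega> \<partial>M)"
      unfolding LF_def ind
    proof (intro Bochner_Integration.integral_cong refl)
      fix \<omega> assume \<omega>: "\<omega> \<in> space M"
      have "(\<integral>\<^sup>+u. \<infinity> * indicator (outside r) u \<partial>N \<omega>) = \<infinity> * emeasure (N \<omega>) (outside r)"
        using point_processD(3)[OF N \<omega>] r by (intro nn_integral_cmult_indicator) auto
      then show "exp_neg (\<integral>\<^sup>+u. \<infinity> * indicator (outside r) u \<partial>N \<omega>) =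
        indicator {\<omega> \<in> space M. emeasure (N \<omega>) (outside r) = 0} \<omega>"
        using \<omega> by (cases "emeasure (N \<omega>) (outside r) = 0") (auto simp: ennreal_top_mult)
    qed
    then show ?thesis using c(2)[of "r powr (- \<alpha>)"] r b by simp
  qed
  \<comment> \<open>For c = 0 all regions away from 0, hence the whole space, would almost surely
    carry no points, contradicting \<open>nontrivial\<close>.\<close>
  have "c \<noteq> 0"
  proof
    assume "c = 0"
    have "AE \<omega> in M. emeasure (N \<omega>) (outside (1 / real (Suc n))) = 0" for n
    proof -
      have [measurable]: "(\<lambda>\<omega>. emeasure (N \<omega>) (outside (1 / real (Suc n)))) \<in> borel_measurable M"
        by (rule measurable_emeasure_N) simp
      have "prob {\<omega> \<in> space M. emeasure (N \<omega>) (outside (1 / real (Suc n))) = 0} = 1"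
        using void[of "1 / real (Suc n)"] \<open>c = 0\<close> by simp
      then show ?thesis by (subst (asm) prob_Collect_eq_1) measurable
    qed
    then have "AE \<omega> in M. \<forall>n. emeasure (N \<omega>) (outside (1 / real (Suc n))) = 0" by (simp add: AE_all_countable)
    then have "AE \<omega> in M. \<not> emeasure (N \<omega>) (UNIV - {0}) > 0"
    proof (rule AE_mp, intro AE_I2 impI)
      fix \<omega> assume \<omega>: "\<omega> \<in> space M" "\<forall>n. emeasure (N \<omega>) (outside (1 / real (Suc n))) = 0"
      have "UNIV - {0} \<in> sets ereal_no0" using sets.top[of ereal_no0] by (simp add: space_ereal_no0)
      then have "emeasure (N \<omega>) (UNIV - {0}) = (SUP n. emeasure (N \<omega>) ((UNIV - {0}) \<inter> outside (1 / real (Suc n))))"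
        by (rule emeasure_SUP_outside[OF point_processD(3)[OF N \<omega>(1)]])
      also have "\<dots> = (SUP n. emeasure (N \<omega>) (outside (1 / real (Suc n))))"
      proof (rule SUP_cong[OF refl])
        fix n
        have "(UNIV - {0}) \<inter> outside (1 / real (Suc n)) = outside (1 / real (Suc n))"
          using Union_outside by blast
        then show "emeasure (N \<omega>) ((UNIV - {0}) \<inter> outside (1 / real (Suc n))) = emeasure (N \<omega>) (outside (1 / real (Suc n)))"
          by simp
      qed
      finally show "\<not> emeasure (N \<omega>) (UNIV - {0}) > 0" using \<omega>(2) by simp
    qed
    then have "prob {\<omega> \<in> space M. emeasure (N \<omega>) (UNIV - {0}) > 0} = 0"
      by (intro prob_eq_0_AE) 
    then show False using nontrivial by simp
  qed
  then show ?thesis using c(1) void by (intro exI[of _ c]) auto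
qed

definition rate :: real where
  "rate = (SOME c. c > 0 \<and> (\<forall>r>0. prob {\<omega> \<in> space M. emeasure (N \<omega>) (outside r) = 0} = exp (- c * r powr (- \<alpha>))))"

lemma rate_pos: "0 < rate"
  and void_N: "0 < r \<Longrightarrow> prob {\<omega> \<in> space M. emeasure (N \<omega>) (outside r) = 0} = exp (- rate * r powr (- \<alpha>))"
proof -
  have *: "0 < rate \<and> (\<forall>r>0. prob {\<omega> \<in> space M. emeasure (N \<omega>) (outside r) = 0} = exp (- rate * r powr (- \<alpha>)))"
    unfolding rate_def by (rule someI_ex[OF ex_void_rate])
  then show "0 < rate" by (rule conjunct1)
  show "0 < r \<Longrightarrow> prob {\<omega> \<in> space M. emeasure (N \<omega>) (outside r) = 0} = exp (- rate * r powr (- \<alpha>))"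
    using conjunct2[OF *] by simp
qed

lemma void_S:
  assumes "0 < t" "0 < \<epsilon>"
  shows "prob {\<omega> \<in> space M. emeasure (S t \<omega>) (outside \<epsilon>) = 0} = exp (- (rate * \<epsilon> powr (- \<alpha>)) * t)"
proof -
  have "{\<omega> \<in> space M. emeasure (S t \<omega>) (outside \<epsilon>) = 0} =
    {\<omega> \<in> space M. emeasure (N \<omega>) (outside (\<epsilon> / t powr (1 / \<alpha>))) = 0}"
    using emeasure_S_outside assms by auto
  moreover have "(\<epsilon> / t powr (1 / \<alpha>)) powr (- \<alpha>) = \<epsilon> powr (- \<alpha>) * t"
  proof -
    have "(t powr (1 / \<alpha>)) powr (- \<alpha>) = t powr (- 1)" unfolding powr_powr using \<alpha> by simp
    then show ?thesis using assms by (simp add: powr_divide powr_neg_one)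
  qed
  ultimately show ?thesis using assms void_N[of "\<epsilon> / t powr (1 / \<alpha>)"] by (simp add: mult.assoc)
qed

text \<open>
  Up to the events in which both summands charge the region, a local functional is additive on
  the convolution semigroup of the laws of \<open>S t\<close>; this makes its rescaled expectation superadditive.
\<close>

proposition local_limit:
  assumes G: "local_at \<epsilon> G" and \<epsilon>: "0 < \<epsilon>"
  obtains L where "0 \<le> L" "((\<lambda>t. (\<integral>\<omega>. G (S t \<omega>) \<partial>M) / t) \<longlongrightarrow> L) (at_right 0)"
    "L \<le> exp (rate * \<epsilon> powr (- \<alpha>)) * (\<integral>\<omega>. G (S 1 \<omega>) \<partial>M)"
proof -
  define k where "k = rate * \<epsilon> powr (- \<alpha>)"
  define a where "a t = (\<integral>\<omega>. G (S t \<omega>) \<partial>M)" for t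
  \<comment> \<open>Indicator that \<open>S t\<close> is void beyond \<epsilon>; its expectation is
    exp(-k t).\<close>
  define V where "V t \<omega> = (if emeasure (S t \<omega>) (outside \<epsilon>) = 0 then 1 else 0 :: real)" for t \<omega>
  note GD = local_atD[OF G]
  have Gm: "(\<lambda>\<omega>. G (S t \<omega>)) \<in> borel_measurable M" if "0 < t" for t
    using measurable_compose[OF S_measurable[OF that] GD(1)] .
  have Vm: "V t \<in> borel_measurable M" if "0 < t" for t
  proof -
    have [measurable]: "(\<lambda>\<omega>. emeasure (S t \<omega>) (outside \<epsilon>)) \<in> borel_measurable M"
      using that \<epsilon> by (intro measurable_emeasure_S) auto
    show ?thesis unfolding V_def by measurable
  qed
  have intG: "integrable M (\<lambda>\<omega>. G (S t \<omega>))" "integrable M (V t)" if "0 < t" for t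
    using Gm[OF that] Vm[OF that] GD(2,3)
    by (auto intro!: integrable_unit_interval finite_measure_axioms simp: V_def)
  have V01: "0 \<le> V t \<omega>" "V t \<omega> \<le> 1" for t \<omega> by (auto simp: V_def)
  have a0: "0 \<le> a t" for t unfolding a_def using GD(2) by simp
  have V: "(\<integral>\<omega>. V t \<omega> \<partial>M) = exp (- k * t)" if "0 < t" for t
  proof -
    have "(\<integral>\<omega>. V t \<omega> \<partial>M) = (\<integral>\<omega>. indicator {\<omega> \<in> space M. emeasure (S t \<omega>) (outside \<epsilon>) = 0} \<omega> \<partial>M)"
      by (intro Bochner_Integration.integral_cong) (auto simp: V_def indicator_def)
    moreover have "{\<omega> \<in> space M. emeasure (S t \<omega>) (outside \<epsilon>) = 0} \<subseteq> space M" by auto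
    ultimately show ?thesis using void_S[OF that \<epsilon>] by (simp add: k_def Int_absorb2)
  qed
  have super: "a s * exp (- k * t) + a t * exp (- k * s) \<le> a (s + t)" if st: "0 < s" "0 < t" for s t
  proof -
    interpret pair_prob_space M M ..
    have Gs: "(\<lambda>x. G (superpose (S s (fst x)) (S t (snd x)))) \<in> borel_measurable (M \<Otimes>\<^sub>M M)"
      using measurable_compose[OF measurable_superpose[OF
        measurable_compose[OF measurable_fst S_measurable[OF st(1)]]
        measurable_compose[OF measurable_snd S_measurable[OF st(2)]]] GD(1)] .
    note [measurable] = Gm[OF st(1)] Gm[OF st(2)] Vm[OF st(1)] Vm[OF st(2)]
    have i1: "integrable (M \<Otimes>\<^sub>M M) (\<lambda>x. G (S s (fst x)) * V t (snd x))"
      and i2: "integrable (M \<Otimes>\<^sub>M M) (\<lambda>x. V s (fst x) * G (S t (snd x)))"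
      and i3: "integrable (M \<Otimes>\<^sub>M M) (\<lambda>x. G (superpose (S s (fst x)) (S t (snd x))))"
      using GD(2,3) Gs V01 by (auto intro!: integrable_unit_interval finite_measure_axioms mult_le_one)
    have e1: "(\<integral>x. G (S s (fst x)) * V t (snd x) \<partial>(M \<Otimes>\<^sub>M M)) = a s * exp (- k * t)"
      using integral_fst'[OF i1] by (simp add: a_def V st)
    have e2: "(\<integral>x. V s (fst x) * G (S t (snd x)) \<partial>(M \<Otimes>\<^sub>M M)) = exp (- k * s) * a t"
      using integral_fst'[OF i2] by (simp add: a_def V st)
    \<comment> \<open>Pointwise: a term is nonzero only if the other summand is void beyond
      \<epsilon>, and then it equals \<open>G\<close> of the superposition. If both are void, both
      terms vanish together with \<open>G\<close>.\<close>
    have "(\<integral>x. G (S s (fst x)) * V t (snd x) + V s (fst x) * G (S t (snd x)) \<partial>(M \<Otimes>\<^sub>M M)) \<le>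
      (\<integral>x. G (superpose (S s (fst x)) (S t (snd x))) \<partial>(M \<Otimes>\<^sub>M M))"
    proof (rule integral_mono)
      fix x
      note sup = local_at_superpose[OF G \<epsilon> sets_S sets_S]
      show "G (S s (fst x)) * V t (snd x) + V s (fst x) * G (S t (snd x)) \<le> G (superpose (S s (fst x)) (S t (snd x)))"
        using sup[of t "snd x" s "fst x"] sup[of s "fst x" t "snd x"] GD(2) GD(4)[OF sets_S]
        by (auto simp: V_def)
    qed (use i1 i2 i3 in auto)
    then show ?thesis using i1 i2 e1 e2 integral_S_add[OF GD(1) st] by (simp add: a_def mult.commute)
  qed
  \<comment> \<open>The factor exp(k t) cancels the void probabilities and leaves plain
    superadditivity; it tends to 1, so the limit of the rates is unaffected.\<close>
  define b where "b t = a t * exp (k * t)" for t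
  have b_super: "b s + b t \<le> b (s + t)" if "0 < s" "0 < t" for s t
  proof -
    have "b s + b t = (a s * exp (- k * t) + a t * exp (- k * s)) * exp (k * (s + t))"
      by (simp add: b_def distrib_right mult.assoc distrib_left flip: exp_add)
    also have "\<dots> \<le> b (s + t)" unfolding b_def using super[OF that] by (intro mult_right_mono) auto
    finally show ?thesis .
  qed
  have "0 \<le> b t" for t using a0 by (simp add: b_def)
  then obtain L where L: "0 \<le> L" "\<And>t. 0 < t \<Longrightarrow> L \<le> b t / t" "((\<lambda>t. b t / t) \<longlongrightarrow> L) (at_right 0)"
    using superadditive_tendsto[of b] b_super by blast
  show thesis
  proof (rule that[OF L(1)])
    have "((\<lambda>t. exp (- k * t)) \<longlongrightarrow> exp (- k * 0)) (at_right 0)" by (intro tendsto_intros)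
    from tendsto_mult[OF this L(3)] have "((\<lambda>t. exp (- k * t) * (b t / t)) \<longlongrightarrow> L) (at_right 0)" by simp
    moreover have "(\<lambda>t. exp (- k * t) * (b t / t)) = (\<lambda>t. a t / t)"
    proof
      fix t
      have "exp (- k * t) * (b t / t) = a t * (exp (- k * t) * exp (k * t)) / t" by (simp add: b_def mult_ac)
      also have "exp (- k * t) * exp (k * t) = 1" by (simp flip: exp_add)
      finally show "exp (- k * t) * (b t / t) = a t / t" by simp
    qed
    ultimately show "((\<lambda>t. (\<integral>\<omega>. G (S t \<omega>) \<partial>M) / t) \<longlongrightarrow> L) (at_right 0)" by (simp only: a_def)
    show "L \<le> exp (rate * \<epsilon> powr (- \<alpha>)) * (\<integral>\<omega>. G (S 1 \<omega>) \<partial>M)"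
      using L(2)[of 1] by (simp add: b_def a_def k_def mult.commute)
  qed
qed

end

section \<open>Coordinates for point configurations\<close>

text \<open>
  The points of a configuration in one annulus are listed in decreasing order; the code of a
  missing point is \<open>0\<close>, which lies in no annulus.
\<close>

definition annulus :: "nat \<Rightarrow> ereal set" where
  "annulus j = outside (1 / real (Suc j)) - (if j = 0 then {} else outside (1 / real j))"

text \<open>The (i+1)-st largest point of the annulus: the highest level at or above which i+1
  points lie. Rational levels make this a countable supremum, hence measurable; with too few points
  it is \<open>-\<infinity>\<close>.\<close>

definition ranked_point :: "nat \<Rightarrow> nat \<Rightarrow> ereal measure \<Rightarrow> ereal" where
  "ranked_point j i \<mu> = (SUP q\<in>\<rat>. if of_nat (Suc i) \<le> emeasure \<mu> (annulus j \<inter> {ereal q..}) then ereal q else -\<infinity>)"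

definition coordinates :: "nat \<Rightarrow> ereal measure \<Rightarrow> nat \<Rightarrow> real" where
  "coordinates j \<mu> = (\<lambda>i. real_of_ereal (ranked_point j i \<mu>))"

lemma annulus_sets[measurable]: "annulus j \<in> sets ereal_no0"
  unfolding annulus_def by auto

lemma annulus_outside: "annulus j \<subseteq> outside (1 / real (Suc j))"
  by (auto simp: annulus_def)

lemma disjoint_family_annulus: "disjoint_family annulus"
proof -
  have "annulus i \<inter> annulus j = {}" if "i < j" for i j
  proof -
    have "outside (1 / real (Suc i)) \<subseteq> outside (1 / real j)"
      using that by (intro outside_antimono divide_left_mono) auto
    then show ?thesis using that by (auto simp: annulus_def)
  qed
  then show ?thesis unfolding disjoint_family_on_def by (metis Int_commute linorder_neqE_nat)
qed

lemma Union_annulus_atMost: "(\<Union>j\<le>n. annulus j) = outside (1 / real (Suc n))"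
proof (induction n)
  case (Suc n)
  have "outside (1 / real (Suc n)) \<subseteq> outside (1 / real (Suc (Suc n)))"
    by (intro outside_antimono divide_left_mono) auto
  then show ?case using Suc by (auto simp: atMost_Suc annulus_def)
qed (simp add: annulus_def)

lemma Union_annulus: "(\<Union>j. annulus j) = UNIV - {0}"
proof -
  have "(\<Union>j. annulus j) = (\<Union>n. \<Union>j\<le>n. annulus j)" by auto
  then show ?thesis unfolding Union_annulus_atMost Union_outside .
qed

lemma annulus_Ici_sets: "annulus j \<inter> {ereal v..} \<in> sets ereal_no0"
proof -
  have "annulus j \<in> sets borel" using annulus_sets[of j] by (auto simp: sets_restrict_space_iff)
  then have "annulus j \<inter> {ereal v..} \<in> sets borel" by auto
  moreover have "annulus j \<inter> {ereal v..} \<subseteq> UNIV - {0}"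
    using sets.sets_into_space[OF annulus_sets[of j]] by (auto simp: space_ereal_no0)
  ultimately show ?thesis by (simp add: sets_restrict_space_iff)
qed

lemma measurable_coordinates: "coordinates j \<in> measure_algebra ereal_no0 \<rightarrow>\<^sub>M borel"
proof -
  have "(\<lambda>\<mu>. coordinates j \<mu> i) \<in> borel_measurable (measure_algebra ereal_no0)" for i
  proof -
    have [measurable]: "(\<lambda>\<mu>. emeasure \<mu> (annulus j \<inter> {ereal q..})) \<in> borel_measurable (measure_algebra ereal_no0)" for q
      by (rule measurable_emeasure_measure_algebra[OF annulus_Ici_sets])
    have "(\<lambda>\<mu>. ranked_point j i \<mu>) \<in> borel_measurable (measure_algebra ereal_no0)"
      unfolding ranked_point_def by (intro borel_measurable_SUP countable_rat) measurable
    then show ?thesis unfolding coordinates_def by measurable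
  qed
  then have "coordinates j \<in> measure_algebra ereal_no0 \<rightarrow>\<^sub>M PiM UNIV (\<lambda>_. borel)"
    by (intro measurable_PiM_single') (auto simp: space_PiM)
  then show ?thesis by (simp add: sets_PiM_equal_borel cong: measurable_cong_sets)
qed

lemma coordinates_local:
  assumes "\<And>A. A \<in> sets ereal_no0 \<Longrightarrow> A \<subseteq> outside (1 / real (Suc j)) \<Longrightarrow> emeasure \<mu> A = emeasure \<nu> A"
  shows "coordinates j \<mu> = coordinates j \<nu>"
proof -
  have "emeasure \<mu> (annulus j \<inter> {ereal q..}) = emeasure \<nu> (annulus j \<inter> {ereal q..})" for q
    using annulus_outside[of j] by (intro assms annulus_Ici_sets) auto
  then show ?thesis by (simp add: coordinates_def ranked_point_def)
qed

context
  fixes \<mu> :: "ereal measure" and j :: nat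
  assumes \<mu>: "radon_point_measure \<mu>"
begin

lemma annulus_finite: "emeasure \<mu> (annulus j \<inter> B) < \<infinity>"
proof -
  have "emeasure \<mu> (annulus j \<inter> B) \<le> emeasure \<mu> (outside (1 / real (Suc j)))"
    using annulus_outside[of j] radon_point_measure_sets[OF \<mu>] by (intro emeasure_mono) auto
  also have "\<dots> < \<infinity>" using \<mu> by (rule radon_point_measure_outside_finite) simp
  finally show ?thesis .
qed

text \<open>The count above a level is continuous from the left in the level, since the annulus
  carries finite mass; hence the supremum in \<open>ranked_point\<close> is attained.\<close>

lemma ranked_point_ge_iff:
  "ereal v \<le> ranked_point j i \<mu> \<longleftrightarrow> of_nat (Suc i) \<le> emeasure \<mu> (annulus j \<inter> {ereal v..})"
proof
  assume R: "of_nat (Suc i) \<le> emeasure \<mu> (annulus j \<inter> {ereal v..})"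
  have "ereal v \<le> ranked_point j i \<mu>"
  proof (rule dense_le)
    fix y assume y: "y < ereal v"
    then obtain q where q: "q \<in> \<rat>" "y < ereal q" "q < v"
    proof (cases y)
      case (real r)
      then have "r < v" using y by simp
      then show thesis using Rats_dense_in_real that real by (metis less_ereal.simps(1))
    next
      case MInf
      then show thesis using Rats_dense_in_real[of "v - 1" v] that by auto
    qed auto
    have "emeasure \<mu> (annulus j \<inter> {ereal v..}) \<le> emeasure \<mu> (annulus j \<inter> {ereal q..})"
      using q annulus_Ici_sets radon_point_measure_sets[OF \<mu>]
      by (intro emeasure_mono) (auto intro: order_trans[of "ereal q" "ereal v"])
    then have "ereal q \<le> ranked_point j i \<mu>"
      unfolding ranked_point_def using R q by (intro SUP_upper2[of q]) (auto intro: order_trans)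
    then show "y \<le> ranked_point j i \<mu>" using q by (auto intro: order_trans less_imp_le)
  qed
  then show "ereal v \<le> ranked_point j i \<mu>" .
next
  assume L: "ereal v \<le> ranked_point j i \<mu>"
  have le: "of_nat (Suc i) \<le> emeasure \<mu> (annulus j \<inter> {ereal w..})" if "w < v" for w
  proof -
    have "ereal w < ranked_point j i \<mu>" using that L by (auto intro: less_le_trans[of _ "ereal v"])
    then obtain q where q: "q \<in> \<rat>" "ereal w < (if of_nat (Suc i) \<le> emeasure \<mu> (annulus j \<inter> {ereal q..}) then ereal q else -\<infinity>)"
      unfolding ranked_point_def less_SUP_iff by blast
    then have "of_nat (Suc i) \<le> emeasure \<mu> (annulus j \<inter> {ereal q..})" "w < q" by (auto split: if_splits)
    moreover have "emeasure \<mu> (annulus j \<inter> {ereal q..}) \<le> emeasure \<mu> (annulus j \<inter> {ereal w..})"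
      using \<open>w < q\<close> annulus_Ici_sets radon_point_measure_sets[OF \<mu>]
      by (intro emeasure_mono) (auto intro: order_trans[of "ereal w" "ereal q"])
    ultimately show ?thesis by (auto intro: order_trans)
  qed
  have "(\<lambda>n. emeasure \<mu> (annulus j \<inter> {ereal (v - 1 / real (Suc n))..})) \<longlonglongrightarrow>
    emeasure \<mu> (\<Inter>n. annulus j \<inter> {ereal (v - 1 / real (Suc n))..})"
  proof (rule Lim_emeasure_decseq)
    show "decseq (\<lambda>n. annulus j \<inter> {ereal (v - 1 / real (Suc n))..})"
    proof (intro decseq_SucI)
      fix n
      have "1 / real (Suc (Suc n)) \<le> 1 / real (Suc n)" by (intro divide_left_mono) auto
      then have "ereal (v - 1 / real (Suc n)) \<le> ereal (v - 1 / real (Suc (Suc n)))" by simp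
      then show "annulus j \<inter> {ereal (v - 1 / real (Suc (Suc n)))..} \<subseteq> annulus j \<inter> {ereal (v - 1 / real (Suc n))..}"
        using order_trans by (blast intro: order_trans)
    qed
  qed (use annulus_finite annulus_Ici_sets radon_point_measure_sets[OF \<mu>] in \<open>auto simp: less_top[symmetric]\<close>)
  also have "(\<Inter>n. annulus j \<inter> {ereal (v - 1 / real (Suc n))..}) = annulus j \<inter> {ereal v..}"
  proof -
    have "(\<forall>n. ereal (v - 1 / real (Suc n)) \<le> u) \<longleftrightarrow> ereal v \<le> u" for u
    proof (cases u)
      case (real r)
      have "v \<le> r" if "\<forall>n. v - 1 / real (Suc n) \<le> r"
      proof (rule ccontr)
        assume "\<not> v \<le> r"
        then obtain n where "1 / real (Suc n) < v - r" using reals_Archimedean[of "v - r"] by (auto simp: divide_inverse)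
        then show False using that[rule_format, of n] by simp
      qed
      moreover have "v - 1 / real (Suc n) \<le> r" if "v \<le> r" for n
        using that by (smt (verit) of_nat_0_le_iff zero_le_divide_1_iff)
      ultimately show ?thesis using real by auto
    qed auto
    then show ?thesis by auto
  qed
  finally show "of_nat (Suc i) \<le> emeasure \<mu> (annulus j \<inter> {ereal v..})"
    by (rule tendsto_lowerbound) (auto intro!: always_eventually le simp del: of_nat_Suc)
qed

lemma ranked_point_real:
  "ranked_point j i \<mu> < \<infinity>"
  "ereal v \<le> ranked_point j i \<mu> \<Longrightarrow> ranked_point j i \<mu> = ereal (coordinates j \<mu> i)"
proof -
  obtain r where r: "0 < r" "emeasure \<mu> (outside r) = 0" using radon_point_measure_bounded[OF \<mu>] by blast
  show 1: "ranked_point j i \<mu> < \<infinity>"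
  proof (rule ccontr)
    assume "\<not> ?thesis"
    then have "ereal (r + 1) \<le> ranked_point j i \<mu>" by simp
    then have "of_nat (Suc i) \<le> emeasure \<mu> (annulus j \<inter> {ereal (r + 1)..})" by (simp only: ranked_point_ge_iff)
    also have "\<dots> \<le> emeasure \<mu> (outside r)"
    proof (intro emeasure_mono)
      show "annulus j \<inter> {ereal (r + 1)..} \<subseteq> outside r"
      proof
        fix u assume "u \<in> annulus j \<inter> {ereal (r + 1)..}"
        then show "u \<in> outside r" using r(1) by (cases u) (auto simp: outside_def)
      qed
    qed (use r radon_point_measure_sets[OF \<mu>] in auto)
    finally show False using r(2) by (simp del: of_nat_Suc add: of_nat_eq_0_iff)
  qed
  show "ranked_point j i \<mu> = ereal (coordinates j \<mu> i)" if "ereal v \<le> ranked_point j i \<mu>"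
    using 1 that unfolding coordinates_def by (cases "ranked_point j i \<mu>") auto
qed

text \<open>Were the value x not in the annulus, the part of the annulus above x would be the
  increasing union of the parts above x + 1/(n+1). Each of these holds at most i points, whereas i+1
  points lie at or above x.\<close>

lemma coordinate_in_annulus:
  assumes "ereal v \<le> ranked_point j i \<mu>"
  shows "ereal (coordinates j \<mu> i) \<in> annulus j"
proof (rule ccontr)
  define x where "x = coordinates j \<mu> i"
  have rx: "ranked_point j i \<mu> = ereal x" using ranked_point_real(2)[OF assms] by (simp add: x_def)
  assume "ereal (coordinates j \<mu> i) \<notin> annulus j"
  then have notin: "ereal x \<notin> annulus j" by (simp add: x_def)
  let ?A = "\<lambda>n. annulus j \<inter> {ereal (x + 1 / real (Suc n))..}"
  have "annulus j \<inter> {ereal x..} = (\<Union>n. ?A n)"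
  proof (intro set_eqI iffI)
    fix u assume u: "u \<in> annulus j \<inter> {ereal x..}"
    then have "ereal x < u" using notin by (cases "u = ereal x") auto
    show "u \<in> (\<Union>n. ?A n)"
    proof (cases u)
      case (real r)
      then obtain n where "1 / real (Suc n) < r - x"
        using \<open>ereal x < u\<close> reals_Archimedean[of "r - x"] by (auto simp: divide_inverse)
      then have "ereal (x + 1 / real (Suc n)) \<le> u" using real by simp
      then show ?thesis using u by blast
    qed (use u \<open>ereal x < u\<close> in auto)
  next
    fix u assume "u \<in> (\<Union>n. ?A n)"
    then obtain n where "u \<in> annulus j" "ereal (x + 1 / real (Suc n)) \<le> u" by auto
    moreover have "ereal x \<le> ereal (x + 1 / real (Suc n))" by simp
    ultimately show "u \<in> annulus j \<inter> {ereal x..}" using order_trans by blast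
  qed
  moreover have "(SUP n. emeasure \<mu> (?A n)) = emeasure \<mu> (\<Union>n. ?A n)"
  proof (rule SUP_emeasure_incseq)
    show "range ?A \<subseteq> sets \<mu>" using annulus_Ici_sets radon_point_measure_sets[OF \<mu>] by auto
    show "incseq ?A"
    proof (rule incseq_SucI)
      fix n
      have "1 / real (Suc (Suc n)) \<le> 1 / real (Suc n)" by (intro divide_left_mono) auto
      then have "ereal (x + 1 / real (Suc (Suc n))) \<le> ereal (x + 1 / real (Suc n))" by simp
      then show "?A n \<subseteq> ?A (Suc n)" by (blast intro: order_trans)
    qed
  qed
  moreover have "(SUP n. emeasure \<mu> (?A n)) \<le> of_nat i"
  proof (rule SUP_least)
    fix n
    obtain k :: nat where k: "emeasure \<mu> (?A n) = of_nat k"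
      using radon_point_measure_emeasure_nat[OF \<mu> annulus_finite] by blast
    have "\<not> ereal (x + 1 / real (Suc n)) \<le> ranked_point j i \<mu>" unfolding rx by simp
    then have "\<not> (of_nat (Suc i) :: ennreal) \<le> of_nat k" unfolding ranked_point_ge_iff k .
    then have "k \<le> i" by (simp only: of_nat_le_iff)
    then show "emeasure \<mu> (?A n) \<le> of_nat i" unfolding k by (simp only: of_nat_le_iff)
  qed
  moreover have "of_nat (Suc i) \<le> emeasure \<mu> (annulus j \<inter> {ereal x..})"
    using ranked_point_ge_iff[of x i] rx by simp
  ultimately have "(of_nat (Suc i) :: ennreal) \<le> of_nat i" by (metis order_trans)
  then show False by (simp only: of_nat_le_iff)
qed

lemma coordinate_ge_iff:
  "ereal (coordinates j \<mu> i) \<in> annulus j \<inter> {ereal v..} \<longleftrightarrow> of_nat (Suc i) \<le> emeasure \<mu> (annulus j \<inter> {ereal v..})"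
proof
  assume L: "ereal (coordinates j \<mu> i) \<in> annulus j \<inter> {ereal v..}"
  \<comment> \<open>A nonzero coordinate cannot come from an infinite ranked point, since
    \<open>real_of_ereal\<close> sends those to 0.\<close>
  then have "ereal (coordinates j \<mu> i) \<noteq> 0"
    using sets.sets_into_space[OF annulus_sets[of j]] by (auto simp: space_ereal_no0)
  then have "ranked_point j i \<mu> = ereal (coordinates j \<mu> i)"
    unfolding coordinates_def by (cases "ranked_point j i \<mu>") auto
  then show "of_nat (Suc i) \<le> emeasure \<mu> (annulus j \<inter> {ereal v..})"
    using L ranked_point_ge_iff[of v i] by simp
next
  assume "of_nat (Suc i) \<le> emeasure \<mu> (annulus j \<inter> {ereal v..})"
  then have "ereal v \<le> ranked_point j i \<mu>" unfolding ranked_point_ge_iff .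
  then show "ereal (coordinates j \<mu> i) \<in> annulus j \<inter> {ereal v..}"
    using coordinate_in_annulus ranked_point_real(2) by auto
qed

text \<open>Both sides are finite measures in \<open>B\<close>. If a closed half-line meets the
  annulus in k points, exactly the coordinates below k lie there, so the two measures agree on
  half-lines.\<close>

lemma suminf_coordinates:
  assumes B: "B \<in> sets borel"
  shows "(\<Sum>i. indicator (annulus j \<inter> B) (ereal (coordinates j \<mu> i))) = emeasure \<mu> (annulus j \<inter> B)"
proof -
  note sets_\<mu> = radon_point_measure_sets[OF \<mu>]
  define x where "x i = ereal (coordinates j \<mu> i)" for i
  have annb: "annulus j \<in> sets borel" using annulus_sets[of j] by (auto simp: sets_restrict_space_iff)
  have in_\<mu>: "annulus j \<inter> B \<in> sets \<mu>" if "B \<in> sets borel" for B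
    using that annulus_sets[of j] unfolding sets_\<mu> by (auto simp: sets_restrict_space_iff)
  define \<nu>1 where "\<nu>1 = distr (restrict_space \<mu> (annulus j)) borel (\<lambda>u. u)"
  define \<nu>2 where "\<nu>2 = distr (count_space {i. x i \<in> annulus j}) borel x"
  have e1: "emeasure \<nu>1 B = emeasure \<mu> (annulus j \<inter> B)" if B: "B \<in> sets borel" for B
  proof -
    have "(\<lambda>u. u) \<in> restrict_space \<mu> (annulus j) \<rightarrow>\<^sub>M borel"
    proof (rule measurable_restrict_space1)
      show "(\<lambda>u. u) \<in> \<mu> \<rightarrow>\<^sub>M borel"
        unfolding measurable_cong_sets[OF sets_\<mu> refl] by (rule measurable_restrict_space1) simp
    qed
    moreover have "space (restrict_space \<mu> (annulus j)) = annulus j"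
      using sets.sets_into_space[OF in_\<mu>[of UNIV]] by (auto simp: space_restrict_space)
    ultimately show ?thesis
      unfolding \<nu>1_def using B in_\<mu>[OF B] in_\<mu>[of UNIV] by (simp add: emeasure_distr emeasure_restrict_space Int_commute)
  qed
  have e2: "emeasure \<nu>2 B = (\<Sum>i. indicator (annulus j \<inter> B) (x i))" if B: "B \<in> sets borel" for B
  proof -
    have "emeasure \<nu>2 B = emeasure (count_space {i. x i \<in> annulus j}) (x -` B \<inter> {i. x i \<in> annulus j})"
      unfolding \<nu>2_def using B by (subst emeasure_distr) auto
    also have "x -` B \<inter> {i. x i \<in> annulus j} = {i. x i \<in> annulus j \<inter> B}" by auto
    also have "emeasure (count_space {i. x i \<in> annulus j}) {i. x i \<in> annulus j \<inter> B} = emeasure (count_space UNIV) {i. x i \<in> annulus j \<inter> B}"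
      by (subst (1 2) emeasure_count_space) auto
    also have "\<dots> = (\<integral>\<^sup>+i. indicator {i. x i \<in> annulus j \<inter> B} i \<partial>count_space UNIV)" by simp
    also have "\<dots> = (\<Sum>i. indicator (annulus j \<inter> B) (x i))"
      by (simp add: nn_integral_count_space_nat indicator_def)
    finally show ?thesis .
  qed
  have Ici: "emeasure \<nu>1 {ereal v..} = emeasure \<nu>2 {ereal v..}" for v
  proof -
    obtain k :: nat where k: "emeasure \<mu> (annulus j \<inter> {ereal v..}) = of_nat k"
      using radon_point_measure_emeasure_nat[OF \<mu> annulus_finite] by blast
    have "x i \<in> annulus j \<inter> {ereal v..} \<longleftrightarrow> i < k" for i
      unfolding x_def coordinate_ge_iff k by (simp only: of_nat_le_iff) auto
    then have "(\<Sum>i. indicator (annulus j \<inter> {ereal v..}) (x i)) = (\<Sum>i. if i < k then 1 else (0 :: ennreal))"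
      by (intro suminf_cong) (auto simp: indicator_def)
    also have "\<dots> = (\<Sum>i<k. if i < k then 1 else 0)" by (rule suminf_finite) auto
    also have "\<dots> = of_nat k" by simp
    finally show ?thesis using e1[of "{ereal v..}"] e2[of "{ereal v..}"] k by simp
  qed
  have chain: "emeasure \<nu>1 (\<Union>n. {ereal (v n)..}) = emeasure \<nu>2 (\<Union>n. {ereal (v n)..})" if v: "decseq v" for v
  proof -
    have incs: "incseq (\<lambda>n. {ereal (v n)..})"
    proof (rule incseq_SucI)
      fix n
      have "ereal (v (Suc n)) \<le> ereal (v n)" using v by (simp add: decseq_Suc_iff)
      then show "{ereal (v n)..} \<subseteq> {ereal (v (Suc n))..}" by auto
    qed
    have "emeasure \<nu> (\<Union>n. {ereal (v n)..}) = (SUP n. emeasure \<nu> {ereal (v n)..})" if "sets \<nu> = sets borel" for \<nu>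
      by (rule SUP_emeasure_incseq[OF _ incs, symmetric]) (simp add: that image_subset_iff)
    from this[of \<nu>1] this[of \<nu>2] show ?thesis by (simp add: \<nu>1_def \<nu>2_def Ici[unfolded \<nu>1_def \<nu>2_def])
  qed
  have Ioi: "emeasure \<nu>1 {a<..} = emeasure \<nu>2 {a<..}" for a
  proof (cases a)
    case (real r)
    have "decseq (\<lambda>n. r + 1 / real (Suc n))" by (intro decseq_SucI add_left_mono divide_left_mono) auto
    moreover have "(\<Union>n. {ereal (r + 1 / real (Suc n))..}) = {a<..}"
    proof (intro set_eqI iffI)
      fix u assume u: "u \<in> {a<..}"
      show "u \<in> (\<Union>n. {ereal (r + 1 / real (Suc n))..})"
      proof (cases u)
        case (real s)
        then obtain n where "1 / real (Suc n) < s - r"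
          using u \<open>a = ereal r\<close> reals_Archimedean[of "s - r"] by (auto simp: divide_inverse)
        then have "ereal (r + 1 / real (Suc n)) \<le> u" using real by simp
        then show ?thesis by blast
      qed (use u in auto)
    next
      fix u assume "u \<in> (\<Union>n. {ereal (r + 1 / real (Suc n))..})"
      then obtain n where n: "ereal (r + 1 / real (Suc n)) \<le> u" by auto
      have "ereal r < ereal (r + 1 / real (Suc n))" by simp
      also note n
      finally show "u \<in> {a<..}" using real by simp
    qed
    ultimately show ?thesis using chain by metis
  next
    case PInf
    then have "{a<..} = {}" by auto
    then show ?thesis by simp
  next
    case MInf
    have "decseq (\<lambda>n. - real n)" by (intro decseq_SucI) auto
    moreover have "(\<Union>n. {ereal (- real n)..}) = {a<..}"
    proof (intro set_eqI iffI)
      fix u assume u: "u \<in> {a<..}"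
      show "u \<in> (\<Union>n. {ereal (- real n)..})"
      proof (cases u)
        case (real s)
        obtain n :: nat where "- s < real n" using reals_Archimedean2 by blast
        then have "ereal (- real n) \<le> u" using real by simp
        then show ?thesis by blast
      qed (use u MInf in auto)
    qed (use MInf in auto)
    ultimately show ?thesis using chain by metis
  qed
  have UN: "emeasure \<nu>1 UNIV = emeasure \<nu>2 UNIV"
  proof -
    \<comment> \<open>Open half-lines miss only \<open>-\<infinity>\<close>, which neither measure
      charges.\<close>
    have U: "UNIV = {-\<infinity><..} \<union> {-\<infinity>::ereal}"
    proof (intro set_eqI iffI)
      fix u :: ereal show "u \<in> {-\<infinity><..} \<union> {-\<infinity>}" by (cases u) auto
    qed simp
    have "emeasure \<mu> (annulus j \<inter> {-\<infinity>}) \<le> emeasure \<mu> {-\<infinity>, \<infinity>}"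
    proof (rule emeasure_mono)
      have "{-\<infinity>, \<infinity>} \<subseteq> UNIV - {0::ereal}" by auto
      then show "{-\<infinity>, \<infinity>} \<in> sets \<mu>" unfolding sets_\<mu> by (simp add: sets_restrict_space_iff)
    qed auto
    also have "\<dots> = 0" using \<mu> by (simp add: radon_point_measure_def)
    finally have z1: "emeasure \<nu>1 {-\<infinity>} = 0" using e1[of "{-\<infinity>}"] by simp
    have z2: "emeasure \<nu>2 {-\<infinity>} = 0" using e2[of "{-\<infinity>}"] by (simp add: x_def indicator_def)
    have "emeasure \<nu> UNIV = emeasure \<nu> {-\<infinity><..} + emeasure \<nu> {-\<infinity>}" if "sets \<nu> = sets borel" for \<nu> :: "ereal measure"
    proof -
      have "emeasure \<nu> {-\<infinity><..} + emeasure \<nu> {-\<infinity>} = emeasure \<nu> ({-\<infinity><..} \<union> {-\<infinity>})"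
        by (rule plus_emeasure) (simp_all add: that)
      then show ?thesis by (simp only: U[symmetric])
    qed
    from this[of \<nu>1] this[of \<nu>2] show ?thesis using Ioi z1 z2 by (simp add: \<nu>1_def \<nu>2_def)
  qed
  have "\<nu>1 = \<nu>2"
  proof (rule measure_eqI_generator_eq[where E="insert UNIV (range greaterThan)" and \<Omega>=UNIV and A="\<lambda>_. UNIV"])
    show "Int_stable (insert UNIV (range (greaterThan :: ereal \<Rightarrow> _)))"
    proof (rule Int_stableI)
      fix X Y :: "ereal set" assume XY: "X \<in> insert UNIV (range greaterThan)" "Y \<in> insert UNIV (range greaterThan)"
      have "{a<..} \<inter> {b<..} = {max a b<..}" for a b :: ereal by auto
      then show "X \<inter> Y \<in> insert UNIV (range greaterThan)" using XY by auto
    qed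
    have "sets (borel :: ereal measure) = sigma_sets UNIV (insert UNIV (range greaterThan))"
    proof (rule antisym)
      show "sets (borel :: ereal measure) \<subseteq> sigma_sets UNIV (insert UNIV (range greaterThan))"
        unfolding borel_Ioi by (simp, rule sigma_sets_mono') auto
      show "sigma_sets UNIV (insert UNIV (range greaterThan)) \<subseteq> sets (borel :: ereal measure)"
      proof -
        have "insert UNIV (range greaterThan) \<subseteq> sets (borel :: ereal measure)" by auto
        from sets.sigma_sets_subset[OF this] show ?thesis by (simp only: space_borel)
      qed
    qed
    then show "sets \<nu>1 = sigma_sets UNIV (insert UNIV (range greaterThan))"
      "sets \<nu>2 = sigma_sets UNIV (insert UNIV (range greaterThan))"
      by (simp_all add: \<nu>1_def \<nu>2_def)
    show "emeasure \<nu>1 UNIV \<noteq> \<infinity>" for i :: nat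
      using e1[of UNIV] annulus_finite[of UNIV] by simp
  qed (use Ioi UN in auto)
  then show ?thesis using e1[OF B] e2[OF B] by (simp add: x_def)
qed

end

section \<open>Reconstruction of a configuration from its codes\<close>

text \<open>Pairs (j, i) are coded as naturals to match the index sets in
  \<open>radon_point_measure\<close>. Entries outside their own annulus are dropped, so padding
  entries contribute no point.\<close>

definition configuration :: "(nat \<Rightarrow> nat \<Rightarrow> real) \<Rightarrow> ereal measure" where
  "configuration z = distr (count_space {n. case prod_decode n of (j, i) \<Rightarrow> ereal (z j i) \<in> annulus j})
     ereal_no0 (\<lambda>n. case prod_decode n of (j, i) \<Rightarrow> ereal (z j i))"

lemma annulus_nonzero: "u \<in> annulus j \<Longrightarrow> u \<noteq> 0"
  using sets.sets_into_space[OF annulus_sets[of j]] by (auto simp: space_ereal_no0)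

lemma sets_configuration[simp]: "sets (configuration z) = sets ereal_no0"
  by (simp add: configuration_def)

lemma nn_integral_configuration:
  assumes f: "f \<in> borel_measurable ereal_no0"
  shows "(\<integral>\<^sup>+u. f u \<partial>configuration z) =
    (\<Sum>j. \<Sum>i. if ereal (z j i) \<in> annulus j then f (ereal (z j i)) else 0)"
proof -
  let ?I = "{n. case prod_decode n of (j, i) \<Rightarrow> ereal (z j i) \<in> annulus j}"
  let ?u = "\<lambda>n. case prod_decode n of (j, i) \<Rightarrow> ereal (z j i)"
  have "(\<integral>\<^sup>+u. f u \<partial>configuration z) = (\<integral>\<^sup>+n. f (?u n) \<partial>count_space ?I)"
    unfolding configuration_def using f
    by (intro nn_integral_distr) (auto simp: space_ereal_no0 dest: annulus_nonzero)
  also have "\<dots> = (\<integral>\<^sup>+n. f (?u n) * indicator ?I n \<partial>count_space UNIV)"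
    by (simp add: nn_integral_count_space_indicator)
  also have "\<dots> = (\<Sum>n. (\<lambda>(j, i). if ereal (z j i) \<in> annulus j then f (ereal (z j i)) else 0) (prod_decode n))"
    unfolding nn_integral_count_space_nat by (intro suminf_cong) (auto simp: indicator_def split: prod.splits)
  also have "\<dots> = (\<Sum>j. \<Sum>i. if ereal (z j i) \<in> annulus j then f (ereal (z j i)) else 0)"
    by (rule suminf_ennreal_2dimen) simp
  finally show ?thesis .
qed

lemma emeasure_configuration:
  assumes "A \<in> sets ereal_no0"
  shows "emeasure (configuration z) A = (\<Sum>j. \<Sum>i. indicator (annulus j \<inter> A) (ereal (z j i)))"
proof -
  have "emeasure (configuration z) A = (\<integral>\<^sup>+u. indicator A u \<partial>configuration z)" using assms by simp
  also have "\<dots> = (\<Sum>j. \<Sum>i. if ereal (z j i) \<in> annulus j then indicator A (ereal (z j i)) else 0)"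
    using assms by (intro nn_integral_configuration) auto
  also have "\<dots> = (\<Sum>j. \<Sum>i. indicator (annulus j \<inter> A) (ereal (z j i)))"
    by (intro suminf_cong) (auto simp: indicator_def)
  finally show ?thesis .
qed

lemma configuration_coordinates:
  assumes \<mu>: "radon_point_measure \<mu>"
  shows "configuration (\<lambda>j. coordinates j \<mu>) = \<mu>"
proof (rule measure_eqI)
  note sets_\<mu> = radon_point_measure_sets[OF \<mu>]
  show "sets (configuration (\<lambda>j. coordinates j \<mu>)) = sets \<mu>" by (simp add: sets_\<mu>)
  fix A assume "A \<in> sets (configuration (\<lambda>j. coordinates j \<mu>))"
  then have A: "A \<in> sets ereal_no0" by simp
  then have Ab: "A \<in> sets borel" by (auto simp: sets_restrict_space_iff)
  have "emeasure (configuration (\<lambda>j. coordinates j \<mu>)) A = (\<Sum>j. emeasure \<mu> (annulus j \<inter> A))"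
    using emeasure_configuration[OF A] suminf_coordinates[OF \<mu> Ab] by simp
  also have "\<dots> = emeasure \<mu> (\<Union>j. annulus j \<inter> A)"
    using A disjoint_family_annulus by (intro suminf_emeasure) (auto simp: sets_\<mu> disjoint_family_on_def)
  also have "(\<Union>j. annulus j \<inter> A) = A"
    using sets.sets_into_space[OF A] Union_annulus by (auto simp: space_ereal_no0)
  finally show "emeasure (configuration (\<lambda>j. coordinates j \<mu>)) A = emeasure \<mu> A" .
qed

lemma suminf_indicator_finite_iff: "(\<Sum>i. indicator A (x i) :: ennreal) < \<infinity> \<longleftrightarrow> finite {i :: nat. x i \<in> A}"
proof -
  have "(\<Sum>i. indicator A (x i) :: ennreal) = (\<integral>\<^sup>+i. indicator {i. x i \<in> A} i \<partial>count_space UNIV)"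
    by (simp add: nn_integral_count_space_nat indicator_def)
  also have "\<dots> = emeasure (count_space UNIV) {i. x i \<in> A}" by simp
  finally show ?thesis by (simp add: emeasure_count_space of_nat_less_top)
qed

lemma finite_coordinates:
  assumes "radon_point_measure \<mu>" shows "finite {i. ereal (coordinates j \<mu> i) \<in> annulus j}"
  using suminf_coordinates[OF assms, of UNIV j] annulus_finite[OF assms, of j UNIV]
    suminf_indicator_finite_iff[of "annulus j" "\<lambda>i. ereal (coordinates j \<mu> i)"] by simp

text \<open>A compact set avoids a neighbourhood of 0 and thus meets only finitely many annuli; all
  points are real, so none sits at infinity.\<close>

lemma radon_configuration:
  assumes fin: "\<And>j. finite {i. ereal (z j i) \<in> annulus j}"
  shows "radon_point_measure (configuration z)"
  unfolding radon_point_measure_def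
proof (intro conjI allI impI)
  show "\<exists>(I :: nat set) u. u \<in> I \<rightarrow> UNIV - {0} \<and> configuration z = distr (count_space I) ereal_no0 u"
    unfolding configuration_def by (intro exI conjI refl) (auto dest: annulus_nonzero)
  have "{-\<infinity>, \<infinity>} \<in> sets ereal_no0" by (auto simp: sets_restrict_space_iff)
  then show "emeasure (configuration z) {-\<infinity>, \<infinity>} = 0" by (simp add: emeasure_configuration)
  fix K :: "ereal set" assume "compact K \<and> K \<subseteq> UNIV - {0}"
  then obtain n where n: "K \<subseteq> outside (1 / real (Suc n))" using compact_subset_outside by blast
  have out: "outside (1 / real (Suc n)) \<in> sets ereal_no0" by (rule outside_sets) simp
  have "emeasure (configuration z) K \<le> emeasure (configuration z) (outside (1 / real (Suc n)))"
    using n out by (intro emeasure_mono) auto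
  also have "\<dots> = (\<Sum>j. \<Sum>i. indicator (annulus j \<inter> outside (1 / real (Suc n))) (ereal (z j i)))"
    by (rule emeasure_configuration[OF out])
  also have "\<dots> = (\<Sum>j\<le>n. \<Sum>i. indicator (annulus j \<inter> outside (1 / real (Suc n))) (ereal (z j i)))"
  proof (rule suminf_finite)
    fix j assume "j \<notin> {..n}"
    then have "annulus j \<inter> annulus k = {}" if "k \<le> n" for k
      using disjoint_family_onD[OF disjoint_family_annulus, of j k] that by auto
    then have "annulus j \<inter> outside (1 / real (Suc n)) = {}"
      unfolding Union_annulus_atMost[symmetric] by blast
    then show "(\<Sum>i. indicator (annulus j \<inter> outside (1 / real (Suc n))) (ereal (z j i)) :: ennreal) = 0" by simp
  qed simp
  also have "\<dots> < \<infinity>"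
  proof -
    have "finite {i. ereal (z j i) \<in> annulus j \<inter> outside (1 / real (Suc n))}" for j
      by (rule finite_subset[OF _ fin[of j]]) auto
    then have "(\<Sum>i. indicator (annulus j \<inter> outside (1 / real (Suc n))) (ereal (z j i)) :: ennreal) < \<infinity>" for j
      by (simp only: suminf_indicator_finite_iff)
    then show ?thesis by (simp add: less_top[symmetric])
  qed
  finally show "emeasure (configuration z) K < \<infinity>" .
qed

section \<open>Setwise limits of measures\<close>

text \<open>Finite additivity survives the limit. Domination by the finite measure
  \<open>\<rho>\<close> gives continuity at the empty set, which upgrades it to countable
  additivity.\<close>

lemma ex_setwise_limit:
  fixes \<kappa> :: "nat \<Rightarrow> 'a measure"
  assumes \<kappa>: "\<And>n. finite_measure (\<kappa> n)" "\<And>n. sets (\<kappa> n) = sets K"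
    and lim: "\<And>E. E \<in> sets K \<Longrightarrow> (\<lambda>n. measure (\<kappa> n) E) \<longlonglongrightarrow> l E"
    and \<rho>: "finite_measure \<rho>" "sets \<rho> = sets K" and dom: "\<And>E. E \<in> sets K \<Longrightarrow> l E \<le> C * measure \<rho> E"
  shows "\<exists>\<nu>. sets \<nu> = sets K \<and> (\<forall>E\<in>sets K. emeasure \<nu> E = ennreal (l E))"
proof -
  interpret \<rho>: finite_measure \<rho> by fact
  have l0: "0 \<le> l E" if "E \<in> sets K" for E
    using lim[OF that] by (rule LIMSEQ_le_const) auto
  have l_empty: "l {} = 0" using LIMSEQ_unique[OF lim[of "{}"], of 0] by simp
  have l_add: "l (A \<union> B) = l A + l B" if AB: "A \<in> sets K" "B \<in> sets K" "A \<inter> B = {}" for A B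
  proof (rule LIMSEQ_unique[OF lim])
    have "measure (\<kappa> n) (A \<union> B) = measure (\<kappa> n) A + measure (\<kappa> n) B" for n
      using AB finite_measure.finite_measure_Union[OF \<kappa>(1)] by (simp add: \<kappa>(2))
    then show "(\<lambda>n. measure (\<kappa> n) (A \<union> B)) \<longlonglongrightarrow> l A + l B" using lim AB by (auto intro: tendsto_add)
  qed (use AB in auto)
  have pos: "positive (sets K) (\<lambda>E. ennreal (l E))" by (simp add: positive_def l_empty)
  have "countably_additive (sets K) (\<lambda>E. ennreal (l E))"
  proof (rule sets.empty_continuous_imp_countably_additive[OF pos])
    show "additive (sets K) (\<lambda>E. ennreal (l E))" using l_add l0 by (auto simp: additive_def)
    fix A :: "nat \<Rightarrow> 'a set" assume A: "range A \<subseteq> sets K" "decseq A" "(\<Inter>i. A i) = {}"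
    have "(\<lambda>i. measure \<rho> (A i)) \<longlonglongrightarrow> measure \<rho> (\<Inter>i. A i)"
      using A by (intro \<rho>.finite_Lim_measure_decseq) (auto simp: \<rho>(2))
    then have lim0: "(\<lambda>i. C * measure \<rho> (A i)) \<longlonglongrightarrow> 0" using A(3) tendsto_mult_right_zero by auto
    have "(\<lambda>i. l (A i)) \<longlonglongrightarrow> 0"
    proof (rule tendsto_sandwich[OF _ _ tendsto_const lim0])
      have "A i \<in> sets K" for i using A(1) by auto
      then show "eventually (\<lambda>i. 0 \<le> l (A i)) sequentially" "eventually (\<lambda>i. l (A i) \<le> C * measure \<rho> (A i)) sequentially"
        using l0 dom by simp_all
    qed
    then show "(\<lambda>i. ennreal (l (A i))) \<longlonglongrightarrow> 0" using tendsto_ennrealI by fastforce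
  qed auto
  then have "emeasure (measure_of (space K) (sets K) (\<lambda>E. ennreal (l E))) E = ennreal (l E)" if "E \<in> sets K" for E
    using pos that by (intro emeasure_measure_of_sigma sets.sigma_algebra_axioms) auto
  then show ?thesis by (intro exI[of _ "measure_of (space K) (sets K) (\<lambda>E. ennreal (l E))"]) auto
qed

text \<open>The number of levels i/n not exceeding x is the floor of n x.\<close>

lemma staircase_approx:
  fixes x :: real
  assumes x: "0 \<le> x" "x \<le> 1" and n: "0 < n"
  shows "\<bar>x - (\<Sum>i\<in>{1..n}. indicator {y. real i / real n \<le> y} x) / real n\<bar> \<le> 1 / real n"
proof -
  define k where "k = nat \<lfloor>real n * x\<rfloor>"
  have nx: "0 \<le> real n * x" "real n * x \<le> real n" using x n by (auto simp: mult_left_le)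
  then have k: "real k \<le> real n * x" "real n * x < real k + 1" by (auto simp: k_def)
  have "k \<le> n" using k nx by linarith
  have "(\<Sum>i\<in>{1..n}. indicator {y. real i / real n \<le> y} x) = (\<Sum>i\<in>{1..n}. if i \<le> k then 1 else (0::real))"
  proof (rule sum.cong[OF refl])
    fix i
    have "real i / real n \<le> x \<longleftrightarrow> real i \<le> real n * x" using n by (simp add: field_simps)
    also have "\<dots> \<longleftrightarrow> i \<le> k" using k by linarith
    finally show "indicator {y. real i / real n \<le> y} x = (if i \<le> k then 1 else (0::real))" by (simp add: indicator_def)
  qed
  also have "\<dots> = real (card {i \<in> {1..n}. i \<le> k})" by (simp add: sum.If_cases Int_def)
  also have "{i \<in> {1..n}. i \<le> k} = {1..k}" using \<open>k \<le> n\<close> by auto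
  finally have "(\<Sum>i\<in>{1..n}. indicator {y. real i / real n \<le> y} x) = real k" by simp
  moreover have "\<bar>real n * (x - real k / real n)\<bar> \<le> 1" using k n by (simp add: right_diff_distrib)
  then have "real n * \<bar>x - real k / real n\<bar> \<le> 1" by (simp only: abs_mult abs_of_nat)
  then have "\<bar>x - real k / real n\<bar> \<le> 1 / real n"
    using n by (subst pos_le_divide_eq) (simp_all only: of_nat_0_less_iff mult.commute)
  ultimately show ?thesis by simp
qed

text \<open>The staircase built from p superlevel sets is within 1/p of \<Phi> uniformly. Its
  integrals converge set by set, and the error stays uniform in n since the total masses
  converge.\<close>

lemma tendsto_integral_setwise:
  fixes \<kappa> :: "nat \<Rightarrow> 'a measure" and \<Phi> :: "'a \<Rightarrow> real"
  assumes \<kappa>: "\<And>n. finite_measure (\<kappa> n)" "\<And>n. sets (\<kappa> n) = sets K"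
    and \<nu>: "finite_measure \<nu>" "sets \<nu> = sets K"
    and lim: "\<And>E. E \<in> sets K \<Longrightarrow> (\<lambda>n. measure (\<kappa> n) E) \<longlonglongrightarrow> measure \<nu> E"
    and \<Phi>: "\<Phi> \<in> borel_measurable K" "\<And>x. 0 \<le> \<Phi> x \<and> \<Phi> x \<le> 1"
  shows "(\<lambda>n. \<integral>x. \<Phi> x \<partial>\<kappa> n) \<longlonglongrightarrow> (\<integral>x. \<Phi> x \<partial>\<nu>)"
proof -
  define E where "E p i = {x \<in> space K. real i / real p \<le> \<Phi> x}" for p i :: nat
  define A where "A \<tau> p = (\<Sum>i\<in>{1..p}. measure \<tau> (E p i)) / real p" for \<tau> :: "'a measure" and p :: nat
  have E: "E p i \<in> sets K" for p i unfolding E_def using \<Phi>(1) by measurable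
  have approx: "\<bar>(\<integral>x. \<Phi> x \<partial>\<tau>) - A \<tau> p\<bar> \<le> measure \<tau> (space K) / real p"
    if \<tau>: "finite_measure \<tau>" "sets \<tau> = sets K" and p: "0 < p" for \<tau> p
  proof -
    interpret finite_measure \<tau> by fact
    have sp: "space \<tau> = space K" using \<tau>(2) by (rule sets_eq_imp_space_eq)
    let ?s = "\<lambda>x. (\<Sum>i\<in>{1..p}. indicator (E p i) x) / real p :: real"
    have int: "integrable \<tau> \<Phi>" "integrable \<tau> ?s"
      using \<Phi> \<tau> E by (auto intro!: integrable_unit_interval finite_measure_axioms
          Bochner_Integration.integrable_sum integrable_real_indicator simp: less_top[symmetric] cong: measurable_cong_sets)
    have "A \<tau> p = (\<integral>x. ?s x \<partial>\<tau>)"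
      unfolding A_def using E \<tau>(2) by (simp add: less_top[symmetric])
    then have "\<bar>(\<integral>x. \<Phi> x \<partial>\<tau>) - A \<tau> p\<bar> = \<bar>\<integral>x. \<Phi> x - ?s x \<partial>\<tau>\<bar>" using int by simp
    also have "\<dots> \<le> (\<integral>x. \<bar>\<Phi> x - ?s x\<bar> \<partial>\<tau>)" by (rule integral_abs_bound)
    also have "\<dots> \<le> (\<integral>x. 1 / real p \<partial>\<tau>)"
    proof (rule integral_mono)
      fix x assume "x \<in> space \<tau>"
      then have "?s x = (\<Sum>i\<in>{1..p}. indicator {y. real i / real p \<le> y} (\<Phi> x)) / real p"
        by (simp add: E_def sp indicator_def)
      then show "\<bar>\<Phi> x - ?s x\<bar> \<le> 1 / real p" using staircase_approx[of "\<Phi> x" p] \<Phi>(2) p by simp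
    qed (use int in auto)
    finally show ?thesis by (simp add: sp)
  qed
  have spK: "(\<lambda>n. measure (\<kappa> n) (space K)) \<longlonglongrightarrow> measure \<nu> (space K)" by (rule lim) simp
  show ?thesis
  proof (rule LIMSEQ_I)
    fix r :: real assume r: "0 < r"
    define c where "c = measure \<nu> (space K)"
    have c: "0 \<le> c" by (simp add: c_def)
    \<comment> \<open>The errors (c + 1)/p and c/p of the two staircases and 1/p for the convergence
      between them add up to (2 c + 2)/p < r.\<close>
    obtain p :: nat where p: "(2 * c + 2) / r < real p" using reals_Archimedean2 by blast
    then have p0: "0 < p" using r c by (metis add_nonneg_nonneg divide_nonneg_pos mult_nonneg_nonneg not_gr_zero of_nat_0 not_less zero_le_numeral)
    have Alim: "(\<lambda>n. A (\<kappa> n) p) \<longlonglongrightarrow> A \<nu> p"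
      unfolding A_def using p0 by (intro tendsto_divide tendsto_sum lim E) auto
    have e: "0 < 1 / real p" using p0 by simp
    have ev1: "eventually (\<lambda>n. \<bar>A (\<kappa> n) p - A \<nu> p\<bar> < 1 / real p) sequentially"
      using Alim e by (auto simp: tendsto_iff dist_real_def)
    have ev2: "eventually (\<lambda>n. measure (\<kappa> n) (space K) < c + 1) sequentially"
      using spK by (rule order_tendstoD) (simp add: c_def)
    have "eventually (\<lambda>n. \<bar>(\<integral>x. \<Phi> x \<partial>\<kappa> n) - (\<integral>x. \<Phi> x \<partial>\<nu>)\<bar> < r) sequentially"
      using ev1 ev2
    proof eventually_elim
      case (elim n)
      have "\<bar>(\<integral>x. \<Phi> x \<partial>\<kappa> n) - A (\<kappa> n) p\<bar> \<le> (c + 1) / real p"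
      proof -
        note approx[OF \<kappa>(1) \<kappa>(2) p0, of n]
        also have "measure (\<kappa> n) (space K) / real p \<le> (c + 1) / real p"
          using elim(2) by (intro divide_right_mono) auto
        finally show ?thesis .
      qed
      moreover have "\<bar>(\<integral>x. \<Phi> x \<partial>\<nu>) - A \<nu> p\<bar> \<le> c / real p"
        using approx[OF \<nu> p0] by (simp add: c_def)
      moreover have "(c + 1) / real p + c / real p + 1 / real p = (2 * c + 2) / real p" by (simp add: add_divide_distrib)
      moreover have "(2 * c + 2) / real p < r" using p r p0 by (simp add: field_simps)
      ultimately show ?case using elim(1) by linarith
    qed
    then show "\<exists>no. \<forall>n\<ge>no. norm ((\<integral>x. \<Phi> x \<partial>\<kappa> n) - (\<integral>x. \<Phi> x \<partial>\<nu>)) < r"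
      by (simp add: eventually_sequentially)
  qed
qed

section \<open>The law of the decoration\<close>

text \<open>In terms of the largest modulus s of a configuration: r < s <= 2 r. Excluding void
  configurations gives the window a finite rate.\<close>

definition window :: "real \<Rightarrow> ereal measure set" where
  "window r = {\<mu>. emeasure \<mu> (outside r) \<noteq> 0 \<and> emeasure \<mu> (outside (2 * r)) = 0}"

lemma local_at_mono: "local_at \<epsilon> G \<Longrightarrow> 0 \<le> \<delta> \<Longrightarrow> \<delta> \<le> \<epsilon> \<Longrightarrow> local_at \<delta> G"
proof -
  assume G: "local_at \<epsilon> G" and \<delta>: "0 \<le> \<delta>" "\<delta> \<le> \<epsilon>"
  have sub: "outside \<epsilon> \<subseteq> outside \<delta>" using \<delta>(2) by (rule outside_antimono)
  show "local_at \<delta> G" unfolding local_at_def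
  proof (intro conjI allI impI)
    show "G \<in> borel_measurable (measure_algebra ereal_no0)" by (rule local_atD(1)[OF G])
    show "0 \<le> G \<mu>" "G \<mu> \<le> 1" for \<mu> by (rule local_atD[OF G])+
    fix \<mu> :: "ereal measure" assume \<mu>: "sets \<mu> = sets ereal_no0"
    show "G \<mu> = 0" if "emeasure \<mu> (outside \<delta>) = 0"
    proof (rule local_atD(4)[OF G \<mu>])
      have "emeasure \<mu> (outside \<epsilon>) \<le> emeasure \<mu> (outside \<delta>)" using sub \<delta> \<mu> by (intro emeasure_mono) auto
      then show "emeasure \<mu> (outside \<epsilon>) = 0" using that by simp
    qed
    fix \<nu> :: "ereal measure" assume "sets \<nu> = sets ereal_no0"
      "\<forall>A\<in>sets ereal_no0. A \<subseteq> outside \<delta> \<longrightarrow> emeasure \<mu> A = emeasure \<nu> A"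
    then show "G \<mu> = G \<nu>" using sub \<mu> by (intro local_atD(5)[OF G]) auto
  qed
qed

lemma local_at_times:
  assumes G: "local_at \<epsilon> G" and H: "H \<in> borel_measurable (measure_algebra ereal_no0)" "\<And>\<mu>. 0 \<le> H \<mu> \<and> H \<mu> \<le> 1"
    "\<And>\<mu> \<nu>. sets \<mu> = sets ereal_no0 \<Longrightarrow> sets \<nu> = sets ereal_no0 \<Longrightarrow>
        (\<And>A. A \<in> sets ereal_no0 \<Longrightarrow> A \<subseteq> outside \<epsilon> \<Longrightarrow> emeasure \<mu> A = emeasure \<nu> A) \<Longrightarrow> H \<mu> = H \<nu>"
  shows "local_at \<epsilon> (\<lambda>\<mu>. G \<mu> * H \<mu>)"
  unfolding local_at_def
proof (intro conjI allI impI)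
  show "(\<lambda>\<mu>. G \<mu> * H \<mu>) \<in> borel_measurable (measure_algebra ereal_no0)"
    using local_atD(1)[OF G] H(1) by measurable
  show "0 \<le> G \<mu> * H \<mu>" "G \<mu> * H \<mu> \<le> 1" for \<mu>
    using local_atD(2,3)[OF G, of \<mu>] H(2)[of \<mu>] by (auto intro: mult_le_one)
  fix \<mu> :: "ereal measure" assume \<mu>: "sets \<mu> = sets ereal_no0"
  show "G \<mu> * H \<mu> = 0" if "emeasure \<mu> (outside \<epsilon>) = 0" using local_atD(4)[OF G \<mu> that] by simp
  fix \<nu> :: "ereal measure" assume "sets \<nu> = sets ereal_no0"
    "\<forall>A\<in>sets ereal_no0. A \<subseteq> outside \<epsilon> \<longrightarrow> emeasure \<mu> A = emeasure \<nu> A"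
  then have "G \<mu> = G \<nu>" "H \<mu> = H \<nu>" using \<mu> by (intro local_atD(5)[OF G] H(3); simp)+
  then show "G \<mu> * H \<mu> = G \<nu> * H \<nu>" by simp
qed

lemma measurable_window:
  assumes "0 \<le> r" shows "(indicator (window r) :: _ \<Rightarrow> real) \<in> borel_measurable (measure_algebra ereal_no0)"
proof -
  have [measurable]: "(\<lambda>\<mu>. emeasure \<mu> (outside r)) \<in> borel_measurable (measure_algebra ereal_no0)"
    "(\<lambda>\<mu>. emeasure \<mu> (outside (2 * r))) \<in> borel_measurable (measure_algebra ereal_no0)"
    using assms by (auto intro!: measurable_emeasure_measure_algebra)
  have "(indicator (window r) :: _ \<Rightarrow> real) =
    (\<lambda>\<mu>. if emeasure \<mu> (outside r) \<noteq> 0 \<and> emeasure \<mu> (outside (2 * r)) = 0 then 1 else 0)"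
    by (auto simp: window_def indicator_def)
  also have "\<dots> \<in> borel_measurable (measure_algebra ereal_no0)" by measurable
  finally show ?thesis .
qed

lemma indicator_window_cong:
  assumes "0 \<le> r" "\<And>A. A \<in> sets ereal_no0 \<Longrightarrow> A \<subseteq> outside r \<Longrightarrow> emeasure \<mu> A = emeasure \<nu> A"
  shows "indicator (window r) \<mu> = (indicator (window r) \<nu> :: real)"
proof -
  have "emeasure \<mu> (outside r) = emeasure \<nu> (outside r)" "emeasure \<mu> (outside (2 * r)) = emeasure \<nu> (outside (2 * r))"
    using assms(1) by (intro assms(2) outside_sets outside_antimono; simp)+
  then show ?thesis by (simp add: window_def indicator_def)
qed

lemma local_at_window:
  assumes "0 \<le> r" shows "local_at r (indicator (window r))"
  unfolding local_at_def
proof (intro conjI allI impI)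
  fix \<mu> \<nu> :: "ereal measure"
  assume "\<forall>A\<in>sets ereal_no0. A \<subseteq> outside r \<longrightarrow> emeasure \<mu> A = emeasure \<nu> A"
  then show "indicator (window r) \<mu> = (indicator (window r) \<nu> :: real)"
    by (intro indicator_window_cong assms) auto
qed (use measurable_window[OF assms] in \<open>auto simp: window_def indicator_def\<close>)

definition coords :: "nat set \<Rightarrow> ereal measure \<Rightarrow> nat \<Rightarrow> nat \<Rightarrow> real" where
  "coords J \<mu> = (\<lambda>j\<in>J. coordinates j \<mu>)"

lemma measurable_coords: "coords J \<in> measure_algebra ereal_no0 \<rightarrow>\<^sub>M PiM J (\<lambda>_. borel)"
  unfolding coords_def using measurable_coordinates by measurable

lemma restrict_coords: "J \<subseteq> H \<Longrightarrow> restrict (coords H \<mu>) J = coords J \<mu>"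
  by (auto simp: coords_def restrict_def fun_eq_iff)

lemma coords_local:
  assumes "finite J" "\<And>A. A \<in> sets ereal_no0 \<Longrightarrow> A \<subseteq> outside (1 / real (Suc (Max (insert 0 J)))) \<Longrightarrow> emeasure \<mu> A = emeasure \<nu> A"
  shows "coords J \<mu> = coords J \<nu>"
proof -
  have "coordinates j \<mu> = coordinates j \<nu>" if "j \<in> J" for j
  proof (rule coordinates_local)
    fix A assume A: "A \<in> sets ereal_no0" "A \<subseteq> outside (1 / real (Suc j))"
    have "j \<le> Max (insert 0 J)" using that assms(1) by simp
    then have "outside (1 / real (Suc j)) \<subseteq> outside (1 / real (Suc (Max (insert 0 J))))"
      by (intro outside_antimono divide_left_mono) auto
    then show "emeasure \<mu> A = emeasure \<nu> A" using A by (intro assms(2)) auto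
  qed
  then show ?thesis by (auto simp: coords_def fun_eq_iff)
qed

text \<open>A sequence of times, for limit theorems along sequences. It starts at 1, so that index 0
  gives the law of \<open>S 1\<close> that dominates the limit.\<close>

definition time :: "nat \<Rightarrow> real" where "time n = 1 / real (Suc n)"

lemma time_pos: "0 < time n" by (simp add: time_def)

lemma filterlim_time: "filterlim time (at_right 0) sequentially"
  unfolding filterlim_at
proof
  show "eventually (\<lambda>n. time n \<in> {0<..} \<and> time n \<noteq> 0) sequentially" by (simp add: time_pos less_imp_neq[symmetric])
  show "time \<longlonglongrightarrow> 0" unfolding time_def using LIMSEQ_inverse_real_of_nat by (simp add: divide_inverse)
qed

section \<open>Rates on the window and their projective limit\<close>

context stable_process
begin

definition intensity :: "(ereal measure \<Rightarrow> real) \<Rightarrow> real" where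
  "intensity G = Lim (at_right 0) (\<lambda>t. (\<integral>\<omega>. G (S t \<omega>) \<partial>M) / t)"

lemma intensity:
  assumes G: "local_at \<epsilon> G" and \<epsilon>: "0 < \<epsilon>"
  shows "((\<lambda>t. (\<integral>\<omega>. G (S t \<omega>) \<partial>M) / t) \<longlongrightarrow> intensity G) (at_right 0)"
    and "0 \<le> intensity G"
    and "intensity G \<le> exp (rate * \<epsilon> powr (- \<alpha>)) * (\<integral>\<omega>. G (S 1 \<omega>) \<partial>M)"
proof -
  obtain L where L: "0 \<le> L" "((\<lambda>t. (\<integral>\<omega>. G (S t \<omega>) \<partial>M) / t) \<longlongrightarrow> L) (at_right 0)"
    "L \<le> exp (rate * \<epsilon> powr (- \<alpha>)) * (\<integral>\<omega>. G (S 1 \<omega>) \<partial>M)"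
    using local_limit[OF G \<epsilon>] by blast
  then have "intensity G = L" unfolding intensity_def by (intro tendsto_Lim) auto
  then show "((\<lambda>t. (\<integral>\<omega>. G (S t \<omega>) \<partial>M) / t) \<longlongrightarrow> intensity G) (at_right 0)" "0 \<le> intensity G"
    "intensity G \<le> exp (rate * \<epsilon> powr (- \<alpha>)) * (\<integral>\<omega>. G (S 1 \<omega>) \<partial>M)"
    using L by auto
qed

lemma intensity_time:
  assumes "local_at \<epsilon> G" "0 < \<epsilon>"
  shows "(\<lambda>n. (\<integral>\<omega>. G (S (time n) \<omega>) \<partial>M) / time n) \<longlonglongrightarrow> intensity G"
  using filterlim_compose[OF intensity(1)[OF assms] filterlim_time] .

definition window_rate :: real where
  "window_rate = rate * (1 - 2 powr (- \<alpha>))"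

lemma window_rate_pos: "0 < window_rate"
proof -
  have "(2::real) powr (- \<alpha>) < 2 powr 0" using \<alpha> by (intro powr_less_mono) auto
  then show ?thesis using rate_pos by (simp add: window_rate_def)
qed

text \<open>\<open>S t\<close> lies in the window with probability exp(-rate 2^(-\<alpha>) t) -
  exp(-rate t), the difference of two void probabilities; \<open>window_rate\<close> is its
  derivative at 0.\<close>

lemma intensity_window: "intensity (indicator (window 1)) = window_rate"
proof -
  have void: "(\<integral>\<omega>. indicator (window 1) (S t \<omega>) \<partial>M) = exp (- (rate * 2 powr (- \<alpha>)) * t) - exp (- rate * t)" if t: "0 < t" for t
  proof -
    let ?V = "\<lambda>r. {\<omega> \<in> space M. emeasure (S t \<omega>) (outside r) = 0}"
    have [measurable]: "?V 1 \<in> events" "?V 2 \<in> events"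
      using measurable_emeasure_S[OF t, of 1] measurable_emeasure_S[OF t, of 2] by measurable
    have sub: "?V 1 \<subseteq> ?V 2"
    proof safe
      fix \<omega> assume "emeasure (S t \<omega>) (outside 1) = 0"
      moreover have "emeasure (S t \<omega>) (outside 2) \<le> emeasure (S t \<omega>) (outside 1)"
        by (intro emeasure_mono outside_antimono) auto
      ultimately show "emeasure (S t \<omega>) (outside 2) = 0" by simp
    qed
    have "(\<integral>\<omega>. indicator (window 1) (S t \<omega>) \<partial>M) = (\<integral>\<omega>. indicator (?V 2 - ?V 1) \<omega> \<partial>M)"
      by (intro Bochner_Integration.integral_cong) (auto simp: window_def indicator_def)
    also have "\<dots> = prob (?V 2 - ?V 1)" by (simp add: Int_absorb2 Diff_subset subset_iff)
    also have "\<dots> = prob (?V 2) - prob (?V 1)" using sub by (intro finite_measure_Diff) auto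
    finally show ?thesis using void_S[OF t, of 1] void_S[OF t, of 2] by simp
  qed
  have "((\<lambda>t. exp (- (rate * 2 powr (- \<alpha>)) * t) - exp (- rate * t)) has_field_derivative window_rate) (at 0)"
    by (auto intro!: derivative_eq_intros simp: window_rate_def algebra_simps)
  then have "((\<lambda>t. (exp (- (rate * 2 powr (- \<alpha>)) * t) - exp (- rate * t)) / t) \<longlongrightarrow> window_rate) (at 0)"
    by (simp add: DERIV_def)
  then have "((\<lambda>t. (exp (- (rate * 2 powr (- \<alpha>)) * t) - exp (- rate * t)) / t) \<longlongrightarrow> window_rate) (at_right 0)"
    by (rule tendsto_within_subset) simp
  then have "((\<lambda>t. (\<integral>\<omega>. indicator (window 1) (S t \<omega>) \<partial>M) / t) \<longlongrightarrow> window_rate) (at_right 0)"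
    by (rule Lim_transform_eventually)
      (use void in \<open>auto intro!: eventually_mono[OF eventually_at_right_less]\<close>)
  then show ?thesis unfolding intensity_def by (intro tendsto_Lim) auto
qed

text \<open>The law of \<open>X (S (time n))\<close> on the window event, divided by the limiting
  rate instead of the actual probability: its total mass is not 1, it only tends to 1.\<close>

definition window_law :: "nat \<Rightarrow> 'c measure \<Rightarrow> (ereal measure \<Rightarrow> 'c) \<Rightarrow> 'c measure" where
  "window_law n K X = distr (density M (\<lambda>\<omega>. ennreal (indicator (window 1) (S (time n) \<omega>) / (window_rate * time n)))) K (\<lambda>\<omega>. X (S (time n) \<omega>))"

lemma window_law:
  fixes K :: "'c measure" and f :: "'c \<Rightarrow> real"
  assumes X: "X \<in> measure_algebra ereal_no0 \<rightarrow>\<^sub>M K"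
  shows "sets (window_law n K X) = sets K" "finite_measure (window_law n K X)"
    and "f \<in> borel_measurable K \<Longrightarrow> (\<integral>x. f x \<partial>window_law n K X) =
      (\<integral>\<omega>. indicator (window 1) (S (time n) \<omega>) * f (X (S (time n) \<omega>)) \<partial>M) / (window_rate * time n)"
proof -
  show "sets (window_law n K X) = sets K" by (simp add: window_law_def)
  have [measurable]: "(\<lambda>\<omega>. indicator (window 1) (S (time n) \<omega>) :: real) \<in> borel_measurable M"
    using measurable_compose[OF S_measurable[OF time_pos] measurable_window[of 1]] by simp
  have Xm[measurable]: "(\<lambda>\<omega>. X (S (time n) \<omega>)) \<in> M \<rightarrow>\<^sub>M K"
    using measurable_compose[OF S_measurable[OF time_pos] X] .
  have c: "0 < window_rate * time n" using window_rate_pos time_pos by simp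
  show "finite_measure (window_law n K X)"
  proof (rule finite_measureI)
    have "emeasure (window_law n K X) (space (window_law n K X)) =
      (\<integral>\<^sup>+\<omega>. ennreal (indicator (window 1) (S (time n) \<omega>) / (window_rate * time n)) * indicator (space M) \<omega> \<partial>M)"
      unfolding window_law_def using measurable_space[OF Xm]
      by (subst emeasure_distr) (auto simp: emeasure_density Int_absorb2 subset_eq intro!: nn_integral_cong)
    also have "\<dots> \<le> (\<integral>\<^sup>+\<omega>. ennreal (1 / (window_rate * time n)) \<partial>M)"
      using c by (intro nn_integral_mono) (auto simp: indicator_def)
    also have "\<dots> < \<infinity>" by (simp add: emeasure_space_1)
    finally show "emeasure (window_law n K X) (space (window_law n K X)) \<noteq> \<infinity>" by simp
  qed
  assume [measurable]: "f \<in> borel_measurable K"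
  have "(\<integral>x. f x \<partial>window_law n K X) = (\<integral>\<omega>. (indicator (window 1) (S (time n) \<omega>) / (window_rate * time n)) *\<^sub>R f (X (S (time n) \<omega>)) \<partial>M)"
    unfolding window_law_def using c
    by (subst integral_distr, measurable, subst integral_density) (auto simp: divide_nonneg_pos)
  also have "\<dots> = (\<integral>\<omega>. indicator (window 1) (S (time n) \<omega>) * f (X (S (time n) \<omega>)) / (window_rate * time n) \<partial>M)"
    by simp
  finally show "(\<integral>x. f x \<partial>window_law n K X) =
      (\<integral>\<omega>. indicator (window 1) (S (time n) \<omega>) * f (X (S (time n) \<omega>)) \<partial>M) / (window_rate * time n)" by simp
qed

lemma measure_window_law:
  assumes X: "X \<in> measure_algebra ereal_no0 \<rightarrow>\<^sub>M K" and E: "E \<in> sets K"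
  shows "measure (window_law n K X) E =
      (\<integral>\<omega>. indicator (window 1) (S (time n) \<omega>) * indicator E (X (S (time n) \<omega>)) \<partial>M) / (window_rate * time n)"
proof -
  interpret finite_measure "window_law n K X" using window_law(2)[OF X] .
  have "E \<subseteq> space (window_law n K X)" using sets.sets_into_space[OF E] sets_eq_imp_space_eq[OF window_law(1)[OF X]] by simp
  then show ?thesis using window_law(3)[OF X, of "indicator E" n] E by (simp add: Int_absorb2)
qed

lemma local_at_coords:
  assumes J: "finite J" and E: "E \<in> sets (PiM J (\<lambda>_. borel))"
  shows "local_at (1 / real (Suc (Max (insert 0 J)))) (\<lambda>\<mu>. indicator (window 1) \<mu> * indicator E (coords J \<mu>))"
proof (rule local_at_times)
  show "local_at (1 / real (Suc (Max (insert 0 J)))) (indicator (window 1))"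
    by (rule local_at_mono[OF local_at_window]) auto
  show "(\<lambda>\<mu>. indicator E (coords J \<mu>) :: real) \<in> borel_measurable (measure_algebra ereal_no0)"
    using measurable_compose[OF measurable_coords borel_measurable_indicator[OF E]] .
  fix \<mu> \<nu> :: "ereal measure"
  assume "\<And>A. A \<in> sets ereal_no0 \<Longrightarrow> A \<subseteq> outside (1 / real (Suc (Max (insert 0 J)))) \<Longrightarrow> emeasure \<mu> A = emeasure \<nu> A"
  then have "coords J \<mu> = coords J \<nu>" by (rule coords_local[OF J])
  then show "indicator E (coords J \<mu>) = (indicator E (coords J \<nu>) :: real)" by simp
qed (auto simp: indicator_def)

definition cylinder_mass :: "nat set \<Rightarrow> (nat \<Rightarrow> nat \<Rightarrow> real) set \<Rightarrow> real" where
  "cylinder_mass J E = intensity (\<lambda>\<mu>. indicator (window 1) \<mu> * indicator E (coords J \<mu>)) / window_rate"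

lemma cylinder_mass_lim:
  assumes J: "finite J" and E: "E \<in> sets (PiM J (\<lambda>_. borel))"
  shows "(\<lambda>n. measure (window_law n (PiM J (\<lambda>_. borel)) (coords J)) E) \<longlonglongrightarrow> cylinder_mass J E"
proof -
  have "(\<lambda>n. (\<integral>\<omega>. indicator (window 1) (S (time n) \<omega>) * indicator E (coords J (S (time n) \<omega>)) \<partial>M) / time n / window_rate) \<longlonglongrightarrow> cylinder_mass J E"
    unfolding cylinder_mass_def using window_rate_pos
    by (intro tendsto_divide tendsto_const intensity_time[OF local_at_coords[OF J E]]) auto
  then show ?thesis by (simp add: measure_window_law[OF measurable_coords E] mult.commute)
qed

text \<open>The upper bound on \<open>intensity\<close> dominates the limit by a constant times the
  law at time 1, which is \<open>window_law 0\<close>. The constant depends on the innermost annulus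
  in \<open>J\<close>, so this works for finite \<open>J\<close> only.\<close>

lemma ex_cylinder_measure:
  assumes J: "finite J"
  shows "\<exists>\<nu>. sets \<nu> = sets (PiM J (\<lambda>_. borel)) \<and> (\<forall>E\<in>sets (PiM J (\<lambda>_. borel)). emeasure \<nu> E = ennreal (cylinder_mass J E))"
proof (rule ex_setwise_limit)
  let ?\<epsilon> = "1 / real (Suc (Max (insert 0 J)))"
  let ?K = "PiM J (\<lambda>_. borel :: (nat \<Rightarrow> real) measure)"
  show "finite_measure (window_law n ?K (coords J))" "sets (window_law n ?K (coords J)) = sets ?K" for n
    by (rule window_law[OF measurable_coords])+
  show "finite_measure (window_law 0 ?K (coords J))" "sets (window_law 0 ?K (coords J)) = sets ?K"
    by (rule window_law[OF measurable_coords])+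
  fix E assume E: "E \<in> sets ?K"
  show "(\<lambda>n. measure (window_law n ?K (coords J)) E) \<longlonglongrightarrow> cylinder_mass J E" by (rule cylinder_mass_lim[OF J E])
  have "cylinder_mass J E \<le> exp (rate * ?\<epsilon> powr (- \<alpha>)) *
      (\<integral>\<omega>. indicator (window 1) (S 1 \<omega>) * indicator E (coords J (S 1 \<omega>)) \<partial>M) / window_rate"
    unfolding cylinder_mass_def using window_rate_pos
    by (intro divide_right_mono intensity(3)[OF local_at_coords[OF J E]]) auto
  also have "\<dots> = exp (rate * ?\<epsilon> powr (- \<alpha>)) * measure (window_law 0 ?K (coords J)) E"
    by (subst measure_window_law[OF measurable_coords E]) (simp add: time_def)
  finally show "cylinder_mass J E \<le> exp (rate * ?\<epsilon> powr (- \<alpha>)) * measure (window_law 0 ?K (coords J)) E" .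
qed

definition cylinder_measure :: "nat set \<Rightarrow> (nat \<Rightarrow> nat \<Rightarrow> real) measure" where
  "cylinder_measure J = (SOME \<nu>. sets \<nu> = sets (PiM J (\<lambda>_. borel)) \<and>
     (\<forall>E\<in>sets (PiM J (\<lambda>_. borel)). emeasure \<nu> E = ennreal (cylinder_mass J E)))"

lemma cylinder_measure:
  assumes "finite J"
  shows "sets (cylinder_measure J) = sets (PiM J (\<lambda>_. borel))"
    "E \<in> sets (PiM J (\<lambda>_. borel)) \<Longrightarrow> emeasure (cylinder_measure J) E = ennreal (cylinder_mass J E)"
proof -
  have *: "sets (cylinder_measure J) = sets (PiM J (\<lambda>_. borel)) \<and>
     (\<forall>E\<in>sets (PiM J (\<lambda>_. borel)). emeasure (cylinder_measure J) E = ennreal (cylinder_mass J E))"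
    unfolding cylinder_measure_def by (rule someI_ex[OF ex_cylinder_measure[OF assms]])
  show "sets (cylinder_measure J) = sets (PiM J (\<lambda>_. borel))" using * by (rule conjunct1)
  show "E \<in> sets (PiM J (\<lambda>_. borel)) \<Longrightarrow> emeasure (cylinder_measure J) E = ennreal (cylinder_mass J E)"
    using conjunct2[OF *] by (rule bspec)
qed

text \<open>Consistency is inherited from the coordinates, as restricting \<open>coords H\<close>
  gives \<open>coords J\<close>; total mass 1 is the normalisation by
  \<open>window_rate\<close>.\<close>

lemma polish_projective_cylinder: "polish_projective UNIV cylinder_measure"
  unfolding polish_projective_def projective_family_def
proof (intro conjI allI impI)
  fix J :: "nat set" assume J: "finite J"
  have sp: "space (cylinder_measure J) = space (PiM J (\<lambda>_. borel))"
    using cylinder_measure(1)[OF J] by (rule sets_eq_imp_space_eq)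
  have "coords J \<mu> \<in> space (PiM J (\<lambda>_. borel))" for \<mu> by (simp add: coords_def space_PiM)
  then have "(\<lambda>\<mu>. indicator (window 1) \<mu> * indicator (space (PiM J (\<lambda>_. borel :: (nat \<Rightarrow> real) measure))) (coords J \<mu>)) = (indicator (window 1) :: _ \<Rightarrow> real)"
    by (auto simp: fun_eq_iff indicator_def)
  then have "cylinder_mass J (space (PiM J (\<lambda>_. borel))) = 1"
    unfolding cylinder_mass_def using window_rate_pos by (simp add: intensity_window)
  then show "prob_space (cylinder_measure J)"
    by (intro prob_spaceI) (simp add: sp cylinder_measure(2)[OF J])
next
  fix J H :: "nat set" assume JH: "J \<subseteq> H" "finite H"
  then have J: "finite J" by (rule finite_subset)
  show "cylinder_measure J = distr (cylinder_measure H) (PiM J (\<lambda>_. borel)) (\<lambda>f. restrict f J)"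
  proof (rule measure_eqI)
    show "sets (cylinder_measure J) = sets (distr (cylinder_measure H) (PiM J (\<lambda>_. borel)) (\<lambda>f. restrict f J))"
      using cylinder_measure(1)[OF J] by simp
    fix E assume "E \<in> sets (cylinder_measure J)"
    then have E: "E \<in> sets (PiM J (\<lambda>_. borel))" using cylinder_measure(1)[OF J] by simp
    let ?E = "(\<lambda>f. restrict f J) -` E \<inter> space (PiM H (\<lambda>_. borel :: (nat \<Rightarrow> real) measure))"
    have rm: "(\<lambda>f. restrict f J) \<in> PiM H (\<lambda>_. borel :: (nat \<Rightarrow> real) measure) \<rightarrow>\<^sub>M PiM J (\<lambda>_. borel)"
      using JH(1) by (rule measurable_restrict_subset)
    have E': "?E \<in> sets (PiM H (\<lambda>_. borel))" using measurable_sets[OF rm E] .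
    have "coords H \<mu> \<in> ?E \<longleftrightarrow> coords J \<mu> \<in> E" for \<mu>
      using restrict_coords[OF JH(1), of \<mu>] by (auto simp: coords_def space_PiM)
    then have "cylinder_mass H ?E = cylinder_mass J E" unfolding cylinder_mass_def by (simp add: indicator_def)
    moreover have "emeasure (distr (cylinder_measure H) (PiM J (\<lambda>_. borel)) (\<lambda>f. restrict f J)) E = emeasure (cylinder_measure H) ?E"
      using rm E sets_eq_imp_space_eq[OF cylinder_measure(1)[OF JH(2)]] cylinder_measure(1)[OF JH(2)]
      by (subst emeasure_distr) (auto cong: measurable_cong_sets)
    ultimately show "emeasure (cylinder_measure J) E = emeasure (distr (cylinder_measure H) (PiM J (\<lambda>_. borel)) (\<lambda>f. restrict f J)) E"
      using cylinder_measure(2)[OF J E] cylinder_measure(2)[OF JH(2) E'] by simp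
  qed
qed

text \<open>The finite-dimensional marginals of the projective limit are the setwise limits of the
  window laws, so expectations of bounded measurable functions of finitely many coordinates
  converge.\<close>

proposition ex_coordinate_law:
  obtains D :: "(nat \<Rightarrow> nat \<Rightarrow> real) measure"
  where "prob_space D" "sets D = sets (PiM UNIV (\<lambda>_. borel))"
    "\<And>J \<Phi>. finite J \<Longrightarrow> \<Phi> \<in> borel_measurable (PiM J (\<lambda>_. borel)) \<Longrightarrow> (\<And>z. 0 \<le> \<Phi> z \<and> \<Phi> z \<le> 1) \<Longrightarrow>
      (\<lambda>n. (\<integral>\<omega>. indicator (window 1) (S (time n) \<omega>) * \<Phi> (coords J (S (time n) \<omega>)) \<partial>M) / (window_rate * time n))
        \<longlonglongrightarrow> (\<integral>z. \<Phi> (restrict z J) \<partial>D)"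
proof -
  interpret P: polish_projective UNIV cylinder_measure by (rule polish_projective_cylinder)
  show thesis
  proof (rule that[of P.lim])
    show "prob_space P.lim" by (rule P.P.prob_space_axioms)
    fix J :: "nat set" and \<Phi> :: "(nat \<Rightarrow> nat \<Rightarrow> real) \<Rightarrow> real"
    assume J: "finite J" and \<Phi>: "\<Phi> \<in> borel_measurable (PiM J (\<lambda>_. borel))" "\<And>z. 0 \<le> \<Phi> z \<and> \<Phi> z \<le> 1"
    let ?K = "PiM J (\<lambda>_. borel :: (nat \<Rightarrow> real) measure)"
    have rm: "(\<lambda>f. restrict f J) \<in> P.lim \<rightarrow>\<^sub>M ?K"
      unfolding measurable_cong_sets[OF P.sets_lim refl] by (rule measurable_restrict_subset) simp
    let ?\<nu> = "distr P.lim ?K (\<lambda>f. restrict f J)"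
    have e: "emeasure ?\<nu> E = emeasure (cylinder_measure J) E" if E: "E \<in> sets ?K" for E
    proof -
      have "emeasure ?\<nu> E = emeasure P.lim ((\<lambda>f. restrict f J) -` E \<inter> space (PiM UNIV (\<lambda>_. borel)))"
        using rm E by (subst emeasure_distr) auto
      also have "(\<lambda>f. restrict f J) -` E \<inter> space (PiM UNIV (\<lambda>_. borel)) = prod_emb UNIV (\<lambda>_. borel) J E"
        by (simp add: prod_emb_def space_PiM)
      also have "emeasure P.lim \<dots> = emeasure (cylinder_measure J) E" using J E by (intro P.emeasure_lim_emb) auto
      finally show ?thesis .
    qed
    have "(\<lambda>n. \<integral>x. \<Phi> x \<partial>window_law n ?K (coords J)) \<longlonglongrightarrow> (\<integral>x. \<Phi> x \<partial>?\<nu>)"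
    proof (rule tendsto_integral_setwise[OF _ _ _ _ _ \<Phi>])
      show "finite_measure (window_law n ?K (coords J))" "sets (window_law n ?K (coords J)) = sets ?K" for n
        by (rule window_law[OF measurable_coords])+
      show "finite_measure ?\<nu>" using P.P.prob_space_distr[OF rm] by (rule prob_space.finite_measure)
      fix E assume E: "E \<in> sets ?K"
      have "0 \<le> cylinder_mass J E"
        unfolding cylinder_mass_def using intensity(2)[OF local_at_coords[OF J E]] window_rate_pos by simp
      then have "measure ?\<nu> E = cylinder_mass J E"
        using e[OF E] cylinder_measure(2)[OF J E] by (simp add: measure_def)
      then show "(\<lambda>n. measure (window_law n ?K (coords J)) E) \<longlonglongrightarrow> measure ?\<nu> E"
        using cylinder_mass_lim[OF J E] by simp
    qed simp
    also have "(\<integral>x. \<Phi> x \<partial>?\<nu>) = (\<integral>z. \<Phi> (restrict z J) \<partial>P.lim)" using rm \<Phi>(1) by (intro integral_distr) auto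
    finally show "(\<lambda>n. (\<integral>\<omega>. indicator (window 1) (S (time n) \<omega>) * \<Phi> (coords J (S (time n) \<omega>)) \<partial>M) / (window_rate * time n))
        \<longlonglongrightarrow> (\<integral>z. \<Phi> (restrict z J) \<partial>P.lim)"
      by (simp add: window_law(3)[OF measurable_coords \<Phi>(1)])
  qed simp
qed

end

section \<open>From the law of the coordinates back to a point process\<close>

lemma radon_point_measure_scale:
  assumes \<mu>: "radon_point_measure \<mu>" and b: "0 < b"
  shows "radon_point_measure (scale_measure_pts b \<mu>)"
  unfolding radon_point_measure_def
proof (intro conjI allI impI)
  note sets_\<mu> = radon_point_measure_sets[OF \<mu>]
  obtain I :: "nat set" and u where u: "u \<in> I \<rightarrow> UNIV - {0}" "\<mu> = distr (count_space I) ereal_no0 u"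
    using \<mu> unfolding radon_point_measure_def by blast
  have "scale_measure_pts b \<mu> = distr (count_space I) ereal_no0 (\<lambda>i. ereal b * u i)"
    unfolding scale_measure_pts_def u(2) using u(1) measurable_scale[OF b]
    by (subst distr_distr) (auto simp: space_ereal_no0 o_def)
  moreover have "(\<lambda>i. ereal b * u i) \<in> I \<rightarrow> UNIV - {0}" using u(1) b by auto
  ultimately show "\<exists>(I :: nat set) u. u \<in> I \<rightarrow> UNIV - {0} \<and> scale_measure_pts b \<mu> = distr (count_space I) ereal_no0 u"
    by blast
  have inf: "{-\<infinity>, \<infinity>} \<in> sets ereal_no0" by (auto simp: sets_restrict_space_iff)
  have "(\<lambda>u. ereal b * u) -` {-\<infinity>, \<infinity>} \<inter> (UNIV - {0}) = {-\<infinity>, \<infinity>}"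
  proof (intro set_eqI iffI)
    fix u assume "u \<in> (\<lambda>u. ereal b * u) -` {-\<infinity>, \<infinity>} \<inter> (UNIV - {0})"
    then show "u \<in> {-\<infinity>, \<infinity>}" by (cases u) auto
  qed (use b in auto)
  then show "emeasure (scale_measure_pts b \<mu>) {-\<infinity>, \<infinity>} = 0"
    using \<mu> by (simp add: emeasure_scale_measure_pts[OF b sets_\<mu> inf] radon_point_measure_def)
  fix K :: "ereal set" assume "compact K \<and> K \<subseteq> UNIV - {0}"
  then obtain n where n: "K \<subseteq> outside (1 / real (Suc n))" using compact_subset_outside by blast
  have "emeasure (scale_measure_pts b \<mu>) K \<le> emeasure (scale_measure_pts b \<mu>) (outside (1 / real (Suc n)))"
    using n by (intro emeasure_mono) auto
  also have "\<dots> < \<infinity>"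
    using b by (subst emeasure_scale_outside[OF b sets_\<mu>]) (auto intro!: radon_point_measure_outside_finite[OF \<mu>, unfolded infinity_ennreal_def])
  finally show "emeasure (scale_measure_pts b \<mu>) K < \<infinity>" .
qed

lemma point_process_scale:
  assumes "point_process D P" "0 < b"
  shows "point_process D (\<lambda>z. scale_measure_pts b (P z))"
  using measurable_scale_process_const[OF point_processD(1)[OF assms(1)] assms(2)]
    radon_point_measure_scale[OF point_processD(2)[OF assms(1)] assms(2)]
  by (auto simp: point_process_def)

lemma measurable_coordinate:
  assumes D: "sets D = sets (PiM J (\<lambda>_. borel :: (nat \<Rightarrow> real) measure))" and j: "j \<in> J"
  shows "(\<lambda>z. z j i) \<in> borel_measurable D"
proof -
  have "(\<lambda>x :: nat \<Rightarrow> real. x i) \<in> borel_measurable borel"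
    by (intro borel_measurable_continuous_onI continuous_on_product_coordinates)
  moreover have "(\<lambda>z. z j) \<in> D \<rightarrow>\<^sub>M (borel :: (nat \<Rightarrow> real) measure)"
    unfolding measurable_cong_sets[OF D refl] using j by (rule measurable_component_singleton)
  ultimately show ?thesis by (rule measurable_compose[rotated])
qed

definition locally_finite_code :: "(nat \<Rightarrow> nat \<Rightarrow> real) \<Rightarrow> bool" where
  "locally_finite_code z \<longleftrightarrow> (\<forall>j. finite {i. ereal (z j i) \<in> annulus j})"

text \<open>The definition of a point process asks for local finiteness at every sample point;
  arrays failing it are replaced by the zero array, which codes the empty configuration because 0
  lies in no annulus.\<close>

definition decode :: "(nat \<Rightarrow> nat \<Rightarrow> real) \<Rightarrow> ereal measure" where
  "decode z = configuration (if locally_finite_code z then z else (\<lambda>_ _. 0))"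

lemma annulus_borel: "annulus j \<in> sets borel"
  using annulus_sets[of j] by (auto simp: sets_restrict_space_iff)

lemma point_process_decode:
  assumes D: "sets D = sets (PiM UNIV (\<lambda>_. borel :: (nat \<Rightarrow> real) measure))"
  shows "point_process D decode"
  unfolding point_process_def
proof (intro conjI ballI)
  note [measurable] = measurable_coordinate[OF D UNIV_I] annulus_borel
  have lf_eq: "locally_finite_code = (\<lambda>z. \<forall>j. (\<Sum>i. indicator (annulus j) (ereal (z j i)) :: ennreal) < \<infinity>)"
    by (simp only: locally_finite_code_def[abs_def] suminf_indicator_finite_iff)
  have [measurable]: "Measurable.pred D locally_finite_code"
    unfolding lf_eq by measurable
  show "decode \<in> D \<rightarrow>\<^sub>M measure_algebra ereal_no0"
  proof (rule measurable_measure_algebraI)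
    fix A assume A: "A \<in> sets ereal_no0"
    then have [measurable]: "A \<in> sets borel" by (auto simp: sets_restrict_space_iff)
    have "emeasure (decode z) A = (\<Sum>j. \<Sum>i. indicator (annulus j \<inter> A) (ereal (if locally_finite_code z then z j i else 0)))" for z
      unfolding decode_def emeasure_configuration[OF A] by (intro suminf_cong) auto
    then show "(\<lambda>z. emeasure (decode z) A) \<in> borel_measurable D" by (simp only:) measurable
  qed (simp add: decode_def)
  fix z
  have z0: "ereal 0 \<notin> annulus j" for j
    using annulus_nonzero[of "ereal 0" j] by (auto simp: zero_ereal_def)
  show "radon_point_measure (decode z)"
    unfolding decode_def
  proof (rule radon_configuration)
    show "finite {i. ereal ((if locally_finite_code z then z else (\<lambda>_ _. 0)) j i) \<in> annulus j}" for j
      using z0 by (auto simp: locally_finite_code_def)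
  qed
qed

lemma local_at_laplace:
  assumes f: "f \<in> borel_measurable ereal_no0" and \<epsilon>: "0 < \<epsilon>" and f0: "\<And>u. u \<noteq> 0 \<Longrightarrow> u \<notin> outside \<epsilon> \<Longrightarrow> f u = 0"
  shows "local_at \<epsilon> (\<lambda>\<mu>. 1 - exp_neg (\<integral>\<^sup>+u. f u \<partial>\<mu>))"
  unfolding local_at_def
proof (intro conjI allI impI)
  show "(\<lambda>\<mu>. 1 - exp_neg (\<integral>\<^sup>+u. f u \<partial>\<mu>)) \<in> borel_measurable (measure_algebra ereal_no0)"
    using measurable_nn_integral_measure_algebra[OF f] by measurable
  show "0 \<le> 1 - exp_neg (\<integral>\<^sup>+u. f u \<partial>\<mu>)" "1 - exp_neg (\<integral>\<^sup>+u. f u \<partial>\<mu>) \<le> 1" for \<mu>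
    using exp_neg_bounds by auto
  fix \<mu> :: "ereal measure" assume \<mu>: "sets \<mu> = sets ereal_no0"
  show "1 - exp_neg (\<integral>\<^sup>+u. f u \<partial>\<mu>) = 0" if "emeasure \<mu> (outside \<epsilon>) = 0"
    using nn_integral_eq_0_outside[OF f \<mu> _ f0 that] \<epsilon> by simp
  fix \<nu> :: "ereal measure" assume \<nu>: "sets \<nu> = sets ereal_no0"
    and eq: "\<forall>A\<in>sets ereal_no0. A \<subseteq> outside \<epsilon> \<longrightarrow> emeasure \<mu> A = emeasure \<nu> A"
  have out: "outside \<epsilon> \<in> sets ereal_no0" using \<epsilon> by (intro outside_sets) simp
  have r: "(\<integral>\<^sup>+u. f u \<partial>\<tau>) = (\<integral>\<^sup>+u. f u \<partial>restrict_space \<tau> (outside \<epsilon>))" if \<tau>: "sets \<tau> = sets ereal_no0" for \<tau>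
  proof -
    have sp: "space \<tau> = UNIV - {0}" using sets_eq_imp_space_eq[OF \<tau>] by (simp add: space_ereal_no0)
    have "(\<integral>\<^sup>+u. f u \<partial>restrict_space \<tau> (outside \<epsilon>)) = (\<integral>\<^sup>+u. f u * indicator (outside \<epsilon>) u \<partial>\<tau>)"
      using out \<tau> sets.sets_into_space[OF out] by (intro nn_integral_restrict_space) (simp add: Int_absorb2 sp space_ereal_no0)
    also have "\<dots> = (\<integral>\<^sup>+u. f u \<partial>\<tau>)"
      using f0 by (intro nn_integral_cong) (auto simp: sp indicator_def)
    finally show ?thesis by simp
  qed
  have "restrict_space \<mu> (outside \<epsilon>) = restrict_space \<nu> (outside \<epsilon>)"
  proof (rule measure_eqI)
    show "sets (restrict_space \<mu> (outside \<epsilon>)) = sets (restrict_space \<nu> (outside \<epsilon>))"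
      using \<mu> \<nu> by (simp add: sets_restrict_space)
    fix A assume "A \<in> sets (restrict_space \<mu> (outside \<epsilon>))"
    then have A: "A \<in> sets ereal_no0" "A \<subseteq> outside \<epsilon>"
      using \<mu> out sets.sets_into_space[OF out] sets_eq_imp_space_eq[OF \<mu>]
      by (auto simp: sets_restrict_space_iff Int_absorb2)
    have "emeasure (restrict_space \<tau> (outside \<epsilon>)) A = emeasure \<tau> A" if \<tau>: "sets \<tau> = sets ereal_no0" for \<tau>
      using A(2) out \<tau> sets.sets_into_space[OF out] sets_eq_imp_space_eq[OF \<tau>]
      by (intro emeasure_restrict_space) (auto simp: Int_absorb2)
    then show "emeasure (restrict_space \<mu> (outside \<epsilon>)) A = emeasure (restrict_space \<nu> (outside \<epsilon>)) A"
      using A eq \<mu> \<nu> by simp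
  qed
  then show "1 - exp_neg (\<integral>\<^sup>+u. f u \<partial>\<mu>) = 1 - exp_neg (\<integral>\<^sup>+u. f u \<partial>\<nu>)" using r[OF \<mu>] r[OF \<nu>] by simp
qed

text \<open>s is the largest modulus of the configuration, taken as a supremum of radii. Strictness
  in \<open>outside\<close> makes the set of radii with points beyond them open to the right, so s
  itself is excluded.\<close>

lemma outside_threshold:
  assumes \<mu>: "radon_point_measure \<mu>" and ne: "emeasure \<mu> (outside \<epsilon>) \<noteq> 0" and \<epsilon>: "0 < \<epsilon>"
  shows "\<exists>s>0. \<forall>l>0. emeasure \<mu> (outside l) \<noteq> 0 \<longleftrightarrow> l < s"
proof -
  note sets_\<mu> = radon_point_measure_sets[OF \<mu>]
  define R where "R = {l. 0 < l \<and> emeasure \<mu> (outside l) \<noteq> 0}"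
  have down: "emeasure \<mu> (outside l) \<noteq> 0" if "emeasure \<mu> (outside l') \<noteq> 0" "l \<le> l'" "0 < l" for l l'
  proof
    assume "emeasure \<mu> (outside l) = 0"
    moreover have "emeasure \<mu> (outside l') \<le> emeasure \<mu> (outside l)"
      using that by (intro emeasure_mono outside_antimono) (auto simp: sets_\<mu>)
    ultimately show False using that(1) by simp
  qed
  obtain r where r: "0 < r" "emeasure \<mu> (outside r) = 0" using radon_point_measure_bounded[OF \<mu>] by blast
  have bdd: "bdd_above R"
  proof (rule bdd_aboveI[of _ r])
    fix l assume "l \<in> R"
    then show "l \<le> r" using down[of l r] r by (cases "l \<le> r") (auto simp: R_def)
  qed
  have "\<epsilon> \<in> R" using ne \<epsilon> by (simp add: R_def)
  define s where "s = Sup R"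
  have "0 < s" using cSup_upper[OF \<open>\<epsilon> \<in> R\<close> bdd] \<epsilon> by (simp add: s_def)
  have iff: "emeasure \<mu> (outside l) \<noteq> 0 \<longleftrightarrow> l < s" if l: "0 < l" for l
  proof
    assume nz: "emeasure \<mu> (outside l) \<noteq> 0"
    have "(SUP n. emeasure \<mu> (outside (l + 1 / real (Suc n)))) = emeasure \<mu> (\<Union>n. outside (l + 1 / real (Suc n)))"
    proof (rule SUP_emeasure_incseq)
      show "range (\<lambda>n. outside (l + 1 / real (Suc n))) \<subseteq> sets \<mu>" using l by (auto simp: sets_\<mu>)
      show "incseq (\<lambda>n. outside (l + 1 / real (Suc n)))"
        by (intro incseq_SucI outside_antimono add_left_mono divide_left_mono) auto
    qed
    also have "(\<Union>n. outside (l + 1 / real (Suc n))) = outside l"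
    proof (intro set_eqI iffI)
      fix u assume u: "u \<in> outside l"
      show "u \<in> (\<Union>n. outside (l + 1 / real (Suc n)))"
      proof (cases u)
        case (real x)
        then obtain n where "1 / real (Suc n) < \<bar>x\<bar> - l"
          using u reals_Archimedean[of "\<bar>x\<bar> - l"] by (auto simp: outside_def divide_inverse)
        then have "u \<in> outside (l + 1 / real (Suc n))" using real by (simp add: outside_def)
        then show ?thesis by blast
      qed (auto simp: outside_def)
    next
      fix u assume "u \<in> (\<Union>n. outside (l + 1 / real (Suc n)))"
      then obtain n where "u \<in> outside (l + 1 / real (Suc n))" by blast
      moreover have "outside (l + 1 / real (Suc n)) \<subseteq> outside l" by (rule outside_antimono) simp
      ultimately show "u \<in> outside l" by blast
    qed
    finally have "\<exists>n. emeasure \<mu> (outside (l + 1 / real (Suc n))) \<noteq> 0" using nz by (metis SUP_eq_const SUP_bot bot_ennreal UNIV_not_empty)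
    then obtain n where "emeasure \<mu> (outside (l + 1 / real (Suc n))) \<noteq> 0" by blast
    then have "l + 1 / real (Suc n) \<in> R" using l by (simp add: R_def add_pos_pos)
    then have "l + 1 / real (Suc n) \<le> s" unfolding s_def using bdd by (rule cSup_upper)
    moreover have "0 < 1 / real (Suc n)" by simp
    ultimately show "l < s" by linarith
  next
    assume "l < s"
    then obtain l' where "l' \<in> R" "l < l'" using less_cSupD[of R l] \<open>\<epsilon> \<in> R\<close> by (auto simp: s_def)
    then show "emeasure \<mu> (outside l) \<noteq> 0" using down[of l' l] l by (auto simp: R_def)
  qed
  with \<open>0 < s\<close> show ?thesis by blast
qed

context stable_process
begin

lemma radon_S: "0 < t \<Longrightarrow> \<omega> \<in> space M \<Longrightarrow> radon_point_measure (S t \<omega>)"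
  unfolding S_def by (intro radon_point_measure_scale point_processD(2)[OF N]) auto

text \<open>A test vanishing near 0 sees only finitely many annuli, so its integral is a function of
  finitely many coordinates and the assumed limit applies.\<close>

lemma decode_limit:
  assumes D: "prob_space D" "sets D = sets (PiM UNIV (\<lambda>_. borel))"
    and lim: "\<And>J \<Phi>. finite J \<Longrightarrow> \<Phi> \<in> borel_measurable (PiM J (\<lambda>_. borel)) \<Longrightarrow> (\<And>z. 0 \<le> \<Phi> z \<and> \<Phi> z \<le> 1) \<Longrightarrow>
      (\<lambda>n. (\<integral>\<omega>. indicator (window 1) (S (time n) \<omega>) * \<Phi> (coords J (S (time n) \<omega>)) \<partial>M) / (window_rate * time n))
        \<longlonglongrightarrow> (\<integral>z. \<Phi> (restrict z J) \<partial>D)"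
    and f: "f \<in> away_tests"
  shows "(\<lambda>n. (\<integral>\<omega>. indicator (window 1) (S (time n) \<omega>) * (1 - exp_neg (\<integral>\<^sup>+u. f u \<partial>S (time n) \<omega>)) \<partial>M) / (window_rate * time n))
        \<longlonglongrightarrow> 1 - LF D decode f"
proof -
  interpret D: prob_space D by fact
  note coordinate[measurable] = measurable_coordinate[OF D(2) UNIV_I]
  note [measurable] = annulus_borel
  obtain \<epsilon> where fm: "f \<in> borel_measurable ereal_no0" and \<epsilon>: "0 < \<epsilon>" "\<And>u. u \<noteq> 0 \<Longrightarrow> u \<notin> outside \<epsilon> \<Longrightarrow> f u = 0"
    using f by (rule away_testsE) blast
  obtain m where m: "1 / real (Suc m) < \<epsilon>" using reals_Archimedean[OF \<epsilon>(1)] by (auto simp: divide_inverse)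
  have f_ann: "f u = 0" if "u \<in> annulus j" "m < j" for u j
  proof (rule \<epsilon>(2))
    have "annulus j \<inter> annulus k = {}" if "k \<le> m" for k
      using disjoint_family_onD[OF disjoint_family_annulus, of j k] that \<open>m < j\<close> by auto
    then have "u \<notin> outside (1 / real (Suc m))"
      unfolding Union_annulus_atMost[symmetric] using that(1) by blast
    then show "u \<notin> outside \<epsilon>" using outside_antimono[of "1 / real (Suc m)" \<epsilon>] m by auto
  qed (use that annulus_nonzero in blast)
  define \<Sigma> where "\<Sigma> z = (\<Sum>j\<le>m. \<Sum>i. if ereal (z j i) \<in> annulus j then f (ereal (z j i)) else 0)" for z :: "nat \<Rightarrow> nat \<Rightarrow> real"
  have conf: "(\<integral>\<^sup>+u. f u \<partial>configuration z) = \<Sigma> z" for z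
  proof -
    have "(\<integral>\<^sup>+u. f u \<partial>configuration z) = (\<Sum>j. \<Sum>i. if ereal (z j i) \<in> annulus j then f (ereal (z j i)) else 0)"
      by (rule nn_integral_configuration[OF fm])
    also have "\<dots> = \<Sigma> z" unfolding \<Sigma>_def
    proof (rule suminf_finite)
      fix j assume "j \<notin> {..m}"
      then have "(if ereal (z j i) \<in> annulus j then f (ereal (z j i)) else 0) = 0" for i using f_ann by simp
      then show "(\<Sum>i. if ereal (z j i) \<in> annulus j then f (ereal (z j i)) else 0) = 0" by simp
    qed simp
    finally show ?thesis .
  qed
  have \<Sigma>_restrict: "\<Sigma> (restrict z {..m}) = \<Sigma> z" for z
    unfolding \<Sigma>_def by (intro sum.cong) (auto cong: if_cong)
  have \<Sigma>_meas: "\<Sigma> \<in> borel_measurable (PiM {..m} (\<lambda>_. borel))"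
  proof -
    have coord: "(\<lambda>z. z j i) \<in> borel_measurable (PiM {..m} (\<lambda>_. borel :: (nat \<Rightarrow> real) measure))" if "j \<le> m" for j i
      by (rule measurable_coordinate[OF refl]) (use that in simp)
    \<comment> \<open>\<open>f\<close> is measurable only on the punctured line; extending it by 0
      gives a Borel function of the real codes.\<close>
    define f' where "f' u = (if u \<in> UNIV - {0} then f u else 0)" for u
    have "f' \<in> borel_measurable borel" unfolding f'_def
      using fm by (subst (asm) measurable_restrict_space_iff) (auto)
    then have [measurable]: "f' \<in> borel_measurable borel" .
    have eq: "(if ereal (z j i) \<in> annulus j then f (ereal (z j i)) else 0) = (if ereal (z j i) \<in> annulus j then f' (ereal (z j i)) else 0)" for z :: "nat \<Rightarrow> nat \<Rightarrow> real" and i j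
      using annulus_nonzero[of "ereal (z j i)" j] by (auto simp: f'_def zero_ereal_def)
    show ?thesis unfolding \<Sigma>_def[abs_def] eq
    proof (rule borel_measurable_sum)
      fix j assume "j \<in> {..m}"
      then have [measurable]: "(\<lambda>z. z j i) \<in> borel_measurable (PiM {..m} (\<lambda>_. borel :: (nat \<Rightarrow> real) measure))" for i
        using coord by simp
      show "(\<lambda>z. \<Sum>i. if ereal (z j i) \<in> annulus j then f' (ereal (z j i)) else 0) \<in> borel_measurable (PiM {..m} (\<lambda>_. borel))"
        by measurable
    qed
  qed
  have int_S: "(\<integral>\<^sup>+u. f u \<partial>S (time n) \<omega>) = \<Sigma> (coords {..m} (S (time n) \<omega>))" if "\<omega> \<in> space M" for n \<omega>
  proof -
    have "(\<integral>\<^sup>+u. f u \<partial>S (time n) \<omega>) = \<Sigma> (\<lambda>j. coordinates j (S (time n) \<omega>))"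
      using conf configuration_coordinates[OF radon_S[OF time_pos that]] by metis
    also have "\<dots> = \<Sigma> (coords {..m} (S (time n) \<omega>))"
      using \<Sigma>_restrict[of "\<lambda>j. coordinates j (S (time n) \<omega>)"] by (simp add: coords_def)
    finally show ?thesis .
  qed
  have AE: "AE z in D. locally_finite_code z"
  proof -
    have "AE z in D. finite {i. ereal (z j i) \<in> annulus j}" for j
    proof -
      \<comment> \<open>The event of infinitely many codes in annulus j. It never occurs for a
        genuine configuration, so its rates are 0 and the limit law gives it probability 0.\<close>
      define B where "B = {z \<in> space (PiM {j} (\<lambda>_. borel :: (nat \<Rightarrow> real) measure)). \<not> finite {i. ereal (z j i) \<in> annulus j}}"
      have c: "(\<lambda>z. z j i) \<in> borel_measurable (PiM {j} (\<lambda>_. borel :: (nat \<Rightarrow> real) measure))" for i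
        by (rule measurable_coordinate[OF refl]) simp
      note [measurable] = c
      have B: "B \<in> sets (PiM {j} (\<lambda>_. borel))"
        unfolding B_def suminf_indicator_finite_iff[symmetric] by measurable
      have "coords {j} (S (time n) \<omega>) \<notin> B" if "\<omega> \<in> space M" for n \<omega>
        using finite_coordinates[OF radon_S[OF time_pos[of n] that], of j] by (simp add: B_def coords_def)
      then have "(\<integral>\<omega>. indicator (window 1) (S (time n) \<omega>) * indicator B (coords {j} (S (time n) \<omega>)) \<partial>M) = (\<integral>\<omega>. 0 \<partial>M :: real)" for n
        by (intro Bochner_Integration.integral_cong) auto
      then have limB: "(\<lambda>n::nat. 0 / (window_rate * time n)) \<longlonglongrightarrow> (\<integral>z. indicator B (restrict z {j}) \<partial>D)"
        using lim[of "{j}" "indicator B"] B by (simp add: indicator_def)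
      have "(\<integral>z. indicator B (restrict z {j}) \<partial>D) = (0 :: real)" using LIMSEQ_unique[OF limB, of 0] by simp
      moreover have rm: "(\<lambda>z. restrict z {j}) \<in> D \<rightarrow>\<^sub>M PiM {j} (\<lambda>_. borel)"
        unfolding measurable_cong_sets[OF D(2) refl] by (rule measurable_restrict_subset) simp
      have [measurable]: "(\<lambda>z. indicator B (restrict z {j}) :: real) \<in> borel_measurable D"
        using measurable_compose[OF rm borel_measurable_indicator[OF B]] .
      ultimately have "AE z in D. indicator B (restrict z {j}) = (0 :: real)"
        by (subst (asm) integral_nonneg_eq_0_iff_AE)
          (auto intro!: integrable_unit_interval D.finite_measure_axioms simp: indicator_def)
      then show ?thesis
        by eventually_elim (auto simp: B_def indicator_def space_PiM split: if_splits)
    qed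
    then show ?thesis unfolding locally_finite_code_def by (simp add: AE_all_countable)
  qed
  have PD: "point_process D decode" by (rule point_process_decode[OF D(2)])
  have dm: "(\<lambda>z. exp_neg (\<integral>\<^sup>+u. f u \<partial>decode z)) \<in> borel_measurable D"
    using measurable_nn_integral_random_measure[OF point_processD(1)[OF PD] fm] by measurable
  define \<Phi> where "\<Phi> z = 1 - exp_neg (\<Sigma> z)" for z
  have "(\<integral>z. \<Phi> (restrict z {..m}) \<partial>D) = (\<integral>z. 1 - exp_neg (\<integral>\<^sup>+u. f u \<partial>decode z) \<partial>D)"
  proof (rule integral_cong_AE)
    have rm: "(\<lambda>z. restrict z {..m}) \<in> D \<rightarrow>\<^sub>M PiM {..m} (\<lambda>_. borel)"
      unfolding measurable_cong_sets[OF D(2) refl] by (rule measurable_restrict_subset) simp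
    show "(\<lambda>z. \<Phi> (restrict z {..m})) \<in> borel_measurable D"
      unfolding \<Phi>_def using measurable_compose[OF rm \<Sigma>_meas] by measurable
    show "(\<lambda>z. 1 - exp_neg (\<integral>\<^sup>+u. f u \<partial>decode z)) \<in> borel_measurable D" using dm by measurable
    show "AE z in D. \<Phi> (restrict z {..m}) = 1 - exp_neg (\<integral>\<^sup>+u. f u \<partial>decode z)"
      using AE by eventually_elim (simp add: \<Phi>_def \<Sigma>_restrict decode_def conf)
  qed
  also have "\<dots> = 1 - LF D decode f"
    unfolding LF_def using dm by (subst Bochner_Integration.integral_diff)
      (auto intro!: integrable_unit_interval D.finite_measure_axioms exp_neg_bounds simp: D.prob_space)
  finally have eq: "(\<integral>z. \<Phi> (restrict z {..m}) \<partial>D) = 1 - LF D decode f" .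
  have "(\<lambda>n. (\<integral>\<omega>. indicator (window 1) (S (time n) \<omega>) * \<Phi> (coords {..m} (S (time n) \<omega>)) \<partial>M) / (window_rate * time n))
        \<longlonglongrightarrow> (\<integral>z. \<Phi> (restrict z {..m}) \<partial>D)"
    using \<Sigma>_meas exp_neg_bounds by (intro lim) (auto simp: \<Phi>_def[abs_def])
  moreover have "(\<integral>\<omega>. indicator (window 1) (S (time n) \<omega>) * \<Phi> (coords {..m} (S (time n) \<omega>)) \<partial>M) =
    (\<integral>\<omega>. indicator (window 1) (S (time n) \<omega>) * (1 - exp_neg (\<integral>\<^sup>+u. f u \<partial>S (time n) \<omega>)) \<partial>M)" for n
    by (intro Bochner_Integration.integral_cong) (simp_all add: \<Phi>_def int_S)
  ultimately show ?thesis unfolding eq by simp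
qed

end

section \<open>Stable point processes are scale-decorated Poisson processes\<close>

context stable_process
begin

text \<open>Scaling by l is the time change by l^\<alpha> and carries \<open>window 1\<close> to
  \<open>window l\<close>. The limit is thereby expressed through \<open>S (time n)\<close> with the
  unscaled test, which allows integration over l.\<close>

lemma decode_intensity:
  assumes D: "prob_space D" "sets D = sets (PiM UNIV (\<lambda>_. borel))"
    and lim: "\<And>J \<Phi>. finite J \<Longrightarrow> \<Phi> \<in> borel_measurable (PiM J (\<lambda>_. borel)) \<Longrightarrow> (\<And>z. 0 \<le> \<Phi> z \<and> \<Phi> z \<le> 1) \<Longrightarrow>
      (\<lambda>n. (\<integral>\<omega>. indicator (window 1) (S (time n) \<omega>) * \<Phi> (coords J (S (time n) \<omega>)) \<partial>M) / (window_rate * time n))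
        \<longlonglongrightarrow> (\<integral>z. \<Phi> (restrict z J) \<partial>D)"
    and f: "f \<in> away_tests" and l: "0 < l"
  shows "(\<lambda>n. l powr \<alpha> / (window_rate * time n) *
      (\<integral>\<omega>. indicator (window l) (S (time n) \<omega>) * (1 - exp_neg (\<integral>\<^sup>+u. f u \<partial>S (time n) \<omega>)) \<partial>M))
        \<longlonglongrightarrow> 1 - LF D decode (\<lambda>u. f (ereal l * u))"
proof -
  obtain \<epsilon> where fm: "f \<in> borel_measurable ereal_no0" and \<epsilon>: "0 < \<epsilon>" "\<And>u. u \<noteq> 0 \<Longrightarrow> u \<notin> outside \<epsilon> \<Longrightarrow> f u = 0"
    using f by (rule away_testsE) blast
  define G where "G \<mu> = 1 - exp_neg (\<integral>\<^sup>+u. f u \<partial>\<mu>)" for \<mu> :: "ereal measure"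
  define H where "H \<mu> = G \<mu> * indicator (window l) \<mu>" for \<mu>
  \<comment> \<open>A common radius of locality: the test looks beyond \<epsilon>, the window beyond
    l.\<close>
  define r where "r = min \<epsilon> l"
  have r: "0 < r" "r \<le> \<epsilon>" "r \<le> l" using \<epsilon>(1) l by (auto simp: r_def)
  have G: "local_at r G" unfolding G_def using r(1,2) by (intro local_at_mono[OF local_at_laplace[OF fm \<epsilon>]]) auto
  have H: "local_at r H" unfolding H_def
  proof (rule local_at_times[OF G])
    show "(\<lambda>\<mu>. indicator (window l) \<mu> :: real) \<in> borel_measurable (measure_algebra ereal_no0)"
      using measurable_window[of l] l by simp
    show "indicator (window l) \<mu> = (indicator (window l) \<nu> :: real)"
      if "\<And>A. A \<in> sets ereal_no0 \<Longrightarrow> A \<subseteq> outside r \<Longrightarrow> emeasure \<mu> A = emeasure \<nu> A" for \<mu> \<nu>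
      using l outside_antimono[OF r(3)] by (intro indicator_window_cong that) auto
  qed (simp add: indicator_def)
  note I = intensity(1)[OF H r(1)]
  have L: "0 < l powr \<alpha>" using l by simp
  have filt: "filterlim (\<lambda>n. l powr \<alpha> * time n) (at_right 0) sequentially"
  proof -
    have "time \<longlonglongrightarrow> 0" using filterlim_time by (simp add: filterlim_at)
    from tendsto_mult_right_zero[OF this, of "l powr \<alpha>"] show ?thesis
      unfolding filterlim_at using L time_pos by (auto simp: less_imp_neq[symmetric] intro!: always_eventually)
  qed
  have shift: "(\<integral>\<omega>. indicator (window 1) (S (time n) \<omega>) * (1 - exp_neg (\<integral>\<^sup>+u. f (ereal l * u) \<partial>S (time n) \<omega>)) \<partial>M) =
    (\<integral>\<omega>. H (S (l powr \<alpha> * time n) \<omega>) \<partial>M)" for n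
  proof (rule Bochner_Integration.integral_cong[OF refl])
    fix \<omega> assume \<omega>: "\<omega> \<in> space M"
    have sc: "S (l powr \<alpha> * time n) \<omega> = scale_measure_pts l (S (time n) \<omega>)"
      using scale_S[OF time_pos l \<omega>] by simp
    have "(\<integral>\<^sup>+u. f u \<partial>S (l powr \<alpha> * time n) \<omega>) = (\<integral>\<^sup>+u. f (ereal l * u) \<partial>S (time n) \<omega>)"
      unfolding sc by (rule nn_integral_scale_measure_pts[OF l sets_S fm])
    moreover have "emeasure (S (l powr \<alpha> * time n) \<omega>) (outside l) = emeasure (S (time n) \<omega>) (outside 1)"
      "emeasure (S (l powr \<alpha> * time n) \<omega>) (outside (2 * l)) = emeasure (S (time n) \<omega>) (outside 2)"
      unfolding sc using l by (simp_all add: emeasure_scale_outside)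
    ultimately show "indicator (window 1) (S (time n) \<omega>) * (1 - exp_neg (\<integral>\<^sup>+u. f (ereal l * u) \<partial>S (time n) \<omega>)) = H (S (l powr \<alpha> * time n) \<omega>)"
      by (simp add: H_def G_def window_def indicator_def)
  qed
  have "(\<lambda>n. (\<integral>\<omega>. H (S (l powr \<alpha> * time n) \<omega>) \<partial>M) / (window_rate * time n)) \<longlonglongrightarrow> 1 - LF D decode (\<lambda>u. f (ereal l * u))"
    using decode_limit[OF D lim away_tests_scale[OF f l]] unfolding shift .
  \<comment> \<open>The rate converges along all times tending to 0, so l^\<alpha> *
    \<open>time n\<close> serves as well as \<open>time n\<close>, at the price of the factor
    l^\<alpha>.\<close>
  moreover have "(\<lambda>n. (\<integral>\<omega>. H (S (l powr \<alpha> * time n) \<omega>) \<partial>M) / (window_rate * time n)) \<longlonglongrightarrow> l powr \<alpha> / window_rate * intensity H"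
  proof -
    have "(\<lambda>n. l powr \<alpha> / window_rate * ((\<integral>\<omega>. H (S (l powr \<alpha> * time n) \<omega>) \<partial>M) / (l powr \<alpha> * time n))) \<longlonglongrightarrow> l powr \<alpha> / window_rate * intensity H"
      by (intro tendsto_mult tendsto_const filterlim_compose[OF I filt])
    moreover have "l powr \<alpha> / window_rate * (x / (l powr \<alpha> * time n)) = x / (window_rate * time n)" for x n
      using L by simp
    ultimately show ?thesis by simp
  qed
  ultimately have "1 - LF D decode (\<lambda>u. f (ereal l * u)) = l powr \<alpha> / window_rate * intensity H"
    by (rule LIMSEQ_unique)
  moreover have "(\<lambda>n. l powr \<alpha> / window_rate * ((\<integral>\<omega>. H (S (time n) \<omega>) \<partial>M) / time n)) \<longlonglongrightarrow> l powr \<alpha> / window_rate * intensity H"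
    by (intro tendsto_mult tendsto_const intensity_time[OF H r(1)])
  ultimately show ?thesis by (simp add: H_def G_def mult.commute)
qed

lemma ex_laplace_exponent:
  assumes f: "f \<in> away_tests"
  obtains h where "0 \<le> h" "\<And>t. 0 < t \<Longrightarrow> (\<integral>\<omega>. exp_neg (\<integral>\<^sup>+u. f u \<partial>S t \<omega>) \<partial>M) = exp (- h * t)"
proof -
  obtain h where h: "0 \<le> h" "\<And>t. 0 < t \<Longrightarrow> LF M N (\<lambda>u. f (ereal (t powr (1 / \<alpha>)) * u)) = exp (- h * t)"
    using stable_exponent[OF M N \<alpha> stable f] by blast
  have "(\<integral>\<omega>. exp_neg (\<integral>\<^sup>+u. f u \<partial>S t \<omega>) \<partial>M) = exp (- h * t)" if "0 < t" for t
  proof -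
    have "(\<integral>\<omega>. exp_neg (\<integral>\<^sup>+u. f u \<partial>S t \<omega>) \<partial>M) = LF M N (\<lambda>u. f (ereal (t powr (1 / \<alpha>)) * u))"
      unfolding LF_def using that by (intro Bochner_Integration.integral_cong) (auto simp: nn_integral_S away_testsD[OF f])
    then show ?thesis using h(2)[OF that] by simp
  qed
  then show thesis using h(1) that by blast
qed

lemma tendsto_exp_rate: "(\<lambda>n. (1 - exp (- h * time n)) / time n) \<longlonglongrightarrow> h"
proof -
  have "((\<lambda>t. 1 - exp (- h * t)) has_field_derivative h) (at 0)"
    by (auto intro!: derivative_eq_intros)
  then have "((\<lambda>t. (1 - exp (- h * t)) / t) \<longlongrightarrow> h) (at 0)" by (simp add: DERIV_def)
  then have "((\<lambda>t. (1 - exp (- h * t)) / t) \<longlongrightarrow> h) (at_right 0)" by (rule tendsto_within_subset) simp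
  from filterlim_compose[OF this filterlim_time] show ?thesis .
qed

section \<open>Averaging over windows\<close>

text \<open>Fubini needs joint measurability in the radius and the sample point. As
  \<open>outside\<close> is continuous from below in the radius, points beyond c l exist exactly if
  they exist beyond some rational q > c l, a countable union.\<close>

lemma measurable_window_S:
  assumes t: "0 < t"
  shows "(\<lambda>x. indicator (window (fst x)) (S t (snd x)) :: real) \<in> borel_measurable (m \<Otimes>\<^sub>M M)"
proof -
  have fstm: "(\<lambda>x. c * fst x) \<in> borel_measurable (m \<Otimes>\<^sub>M M)" for c
  proof -
    have "(\<lambda>x. x) \<in> borel_measurable m"
      unfolding measurable_cong_sets[OF sets_m refl] by (rule measurable_restrict_space1) simp
    then show ?thesis by measurable
  qed
  have Q: "{x \<in> space (m \<Otimes>\<^sub>M M). emeasure (S t (snd x)) (outside (c * fst x)) \<noteq> 0} \<in> sets (m \<Otimes>\<^sub>M M)" if c: "0 < c" for c :: real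
  proof -
    have iff: "emeasure (S t \<omega>) (outside (c * l)) \<noteq> 0 \<longleftrightarrow> (\<exists>q\<in>\<rat> \<inter> {0<..}. c * l < q \<and> emeasure (S t \<omega>) (outside q) \<noteq> 0)"
      if l: "0 < l" and \<omega>: "\<omega> \<in> space M" for l \<omega>
    proof
      have cl: "0 < c * l" using c l by simp
      assume "emeasure (S t \<omega>) (outside (c * l)) \<noteq> 0"
      from outside_threshold[OF radon_S[OF t \<omega>] this cl]
      obtain s where s: "\<And>l. 0 < l \<Longrightarrow> emeasure (S t \<omega>) (outside l) \<noteq> 0 \<longleftrightarrow> l < s" by blast
      have "c * l < s" using s[OF cl] \<open>emeasure (S t \<omega>) (outside (c * l)) \<noteq> 0\<close> by simp
      then obtain q where q: "q \<in> \<rat>" "c * l < q" "q < s" using Rats_dense_in_real by blast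
      then show "\<exists>q\<in>\<rat> \<inter> {0<..}. c * l < q \<and> emeasure (S t \<omega>) (outside q) \<noteq> 0"
        using s[of q] cl by (intro bexI[of _ q]) auto
    next
      assume "\<exists>q\<in>\<rat> \<inter> {0<..}. c * l < q \<and> emeasure (S t \<omega>) (outside q) \<noteq> 0"
      then obtain q where q: "c * l < q" "emeasure (S t \<omega>) (outside q) \<noteq> 0" by blast
      have "emeasure (S t \<omega>) (outside q) \<le> emeasure (S t \<omega>) (outside (c * l))"
        using q l c by (intro emeasure_mono outside_antimono) auto
      then show "emeasure (S t \<omega>) (outside (c * l)) \<noteq> 0" using q(2) by auto
    qed
    have eq: "{x \<in> space (m \<Otimes>\<^sub>M M). emeasure (S t (snd x)) (outside (c * fst x)) \<noteq> 0} =
      (\<Union>q\<in>\<rat> \<inter> {0<..}. {x \<in> space (m \<Otimes>\<^sub>M M). c * fst x < q \<and> emeasure (S t (snd x)) (outside q) \<noteq> 0})"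
      (is "?A = ?B")
    proof (rule set_eqI)
      fix x
      show "x \<in> ?A \<longleftrightarrow> x \<in> ?B"
      proof (cases "x \<in> space (m \<Otimes>\<^sub>M M)")
        case True
        then have "0 < fst x" "snd x \<in> space M" by (auto simp: space_pair_measure space_m)
        from iff[OF this] True show ?thesis by (simp only: mem_Collect_eq UN_iff) blast
      qed simp
    qed
    show ?thesis unfolding eq
    proof (rule sets.countable_UN'')
      show "countable (\<rat> \<inter> {0<..} :: real set)" using countable_rat by (rule countable_Int1)
      fix q :: real assume "q \<in> \<rat> \<inter> {0<..}"
      then have [measurable]: "(\<lambda>\<omega>. emeasure (S t \<omega>) (outside q)) \<in> borel_measurable M"
        using t by (intro measurable_emeasure_S) auto
      note [measurable] = fstm
      show "{x \<in> space (m \<Otimes>\<^sub>M M). c * fst x < q \<and> emeasure (S t (snd x)) (outside q) \<noteq> 0} \<in> sets (m \<Otimes>\<^sub>M M)"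
        by measurable
    qed
  qed
  let ?W = "{x \<in> space (m \<Otimes>\<^sub>M M). emeasure (S t (snd x)) (outside (1 * fst x)) \<noteq> 0} -
    {x \<in> space (m \<Otimes>\<^sub>M M). emeasure (S t (snd x)) (outside (2 * fst x)) \<noteq> 0}"
  have "?W \<in> sets (m \<Otimes>\<^sub>M M)" using Q[of 1] Q[of 2] by (intro sets.Diff) auto
  then have "(indicator ?W :: _ \<Rightarrow> real) \<in> borel_measurable (m \<Otimes>\<^sub>M M)" by (rule borel_measurable_indicator)
  moreover have "indicator (window (fst x)) (S t (snd x)) = (indicator ?W x :: real)" if "x \<in> space (m \<Otimes>\<^sub>M M)" for x
    using that by (simp add: window_def indicator_def)
  ultimately show ?thesis by (subst measurable_cong)
qed

lemma sigma_finite_m: "sigma_finite_measure m"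
proof
  show "\<exists>A. countable A \<and> A \<subseteq> sets m \<and> \<Union> A = space m \<and> (\<forall>a\<in>A. emeasure m a \<noteq> \<infinity>)"
  proof (intro exI conjI ballI)
    let ?A = "range (\<lambda>n. {1 / real (Suc n)<..})"
    show "countable ?A" "?A \<subseteq> sets m" using Ioi_sets by auto
    show "\<Union> ?A = space m"
    proof
      show "space m \<subseteq> \<Union> ?A" using reals_Archimedean by (auto simp: space_m divide_inverse)
    qed (auto simp: space_m intro: le_less_trans[rotated])
    fix a assume "a \<in> ?A"
    then show "emeasure m a \<noteq> \<infinity>" by (auto simp: tail)
  qed
qed

text \<open>
  A configuration of largest modulus \<open>s\<close> lies in \<open>window l\<close> exactly for \<open>s / 2 \<le> l < s\<close>, and the
  integral of \<open>l\<^bsup>\<alpha>\<^esup>\<close> over this interval does not depend on \<open>s\<close>. Averaging over windows with this weight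
  thus recovers integrals over all configurations.
\<close>

lemma window_integral:
  assumes t: "0 < t" and f: "f \<in> away_tests" and \<omega>: "\<omega> \<in> space M"
  shows "(\<integral>\<^sup>+l. ennreal (l powr \<alpha>) * ennreal (indicator (window l) (S t \<omega>) * (1 - exp_neg (\<integral>\<^sup>+u. f u \<partial>S t \<omega>))) \<partial>m) =
    ennreal (window_mass * (1 - exp_neg (\<integral>\<^sup>+u. f u \<partial>S t \<omega>)))"
proof -
  obtain \<epsilon> where fm: "f \<in> borel_measurable ereal_no0" and \<epsilon>: "0 < \<epsilon>" "\<And>u. u \<noteq> 0 \<Longrightarrow> u \<notin> outside \<epsilon> \<Longrightarrow> f u = 0"
    using f by (rule away_testsE) blast
  define g where "g = 1 - exp_neg (\<integral>\<^sup>+u. f u \<partial>S t \<omega>)"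
  have g: "0 \<le> g" using exp_neg_bounds by (simp add: g_def)
  show ?thesis
  \<comment> \<open>Without points beyond \<epsilon> there may be no largest modulus at all, but
    then the test integrates to 0 and both sides vanish.\<close>
  proof (cases "emeasure (S t \<omega>) (outside \<epsilon>) = 0")
    case True
    have "(\<integral>\<^sup>+u. f u \<partial>S t \<omega>) = 0"
      using nn_integral_eq_0_outside[OF fm sets_S _ \<epsilon>(2) True] \<epsilon>(1) by simp
    then show ?thesis by simp
  next
    case False
    from outside_threshold[OF radon_S[OF t \<omega>] False \<epsilon>(1)]
    obtain s where s: "0 < s" "\<And>l. 0 < l \<Longrightarrow> emeasure (S t \<omega>) (outside l) \<noteq> 0 \<longleftrightarrow> l < s" by blast
    have W: "indicator (window l) (S t \<omega>) = (indicator {s/2..<s} l :: real)" if "0 < l" for l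
      using s(2)[of l] s(2)[of "2 * l"] that by (auto simp: window_def indicator_def)
    have [measurable]: "(\<lambda>l. ennreal (l powr \<alpha>) * indicator {s/2..<s} l) \<in> borel_measurable m"
      unfolding measurable_cong_sets[OF sets_m refl] by (rule measurable_restrict_space1) measurable
    have "(\<integral>\<^sup>+l. ennreal (l powr \<alpha>) * ennreal (indicator (window l) (S t \<omega>) * g) \<partial>m) =
      (\<integral>\<^sup>+l. (ennreal (l powr \<alpha>) * indicator {s/2..<s} l) * ennreal g \<partial>m)"
      using g by (intro nn_integral_cong) (simp add: space_m W ennreal_mult ennreal_indicator mult.assoc)
    also have "\<dots> = (\<integral>\<^sup>+l. ennreal (l powr \<alpha>) * indicator {s/2..<s} l \<partial>m) * ennreal g"
      by (rule nn_integral_multc) measurable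
    also have "\<dots> = ennreal (window_mass * g)"
      using window_mass(1) window_mass(2)[OF s(1)] g by (simp add: ennreal_mult)
    finally show ?thesis by (simp add: g_def)
  qed
qed

text \<open>For fixed n the weighted window averages integrate exactly, by Fubini and
  \<open>window_integral\<close>, to a difference quotient of the Laplace transform. Dominated
  convergence in l then exchanges limit and integral.\<close>

proposition decode_laplace:
  assumes D: "prob_space D" "sets D = sets (PiM UNIV (\<lambda>_. borel))"
    and lim: "\<And>J \<Phi>. finite J \<Longrightarrow> \<Phi> \<in> borel_measurable (PiM J (\<lambda>_. borel)) \<Longrightarrow> (\<And>z. 0 \<le> \<Phi> z \<and> \<Phi> z \<le> 1) \<Longrightarrow>
      (\<lambda>n. (\<integral>\<omega>. indicator (window 1) (S (time n) \<omega>) * \<Phi> (coords J (S (time n) \<omega>)) \<partial>M) / (window_rate * time n))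
        \<longlonglongrightarrow> (\<integral>z. \<Phi> (restrict z J) \<partial>D)"
    and f: "f \<in> away_tests"
    and h: "0 \<le> h" "\<And>t. 0 < t \<Longrightarrow> (\<integral>\<omega>. exp_neg (\<integral>\<^sup>+u. f u \<partial>S t \<omega>) \<partial>M) = exp (- h * t)"
  shows "(\<integral>\<^sup>+l. ennreal (1 - LF D decode (\<lambda>u. f (ereal l * u))) \<partial>m) = ennreal (window_mass / window_rate * h)"
proof -
  obtain \<epsilon> where fm: "f \<in> borel_measurable ereal_no0" and \<epsilon>: "0 < \<epsilon>" "\<And>u. u \<noteq> 0 \<Longrightarrow> u \<notin> outside \<epsilon> \<Longrightarrow> f u = 0"
    using f by (rule away_testsE) blast
  interpret Mm: pair_sigma_finite m M
    by (intro pair_sigma_finite.intro sigma_finite_m sigma_finite_measure_axioms)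
  define g where "g t \<omega> = 1 - exp_neg (\<integral>\<^sup>+u. f u \<partial>S t \<omega>)" for t \<omega>
  have g01: "0 \<le> g t \<omega>" "g t \<omega> \<le> 1" for t \<omega> using exp_neg_bounds by (auto simp: g_def)
  have gm[measurable]: "g t \<in> borel_measurable M" if "0 < t" for t
    unfolding g_def using measurable_nn_integral_random_measure[OF S_measurable[OF that] fm] by measurable
  have g_int: "(\<integral>\<omega>. g t \<omega> \<partial>M) = 1 - exp (- h * t)" if t: "0 < t" for t
  proof -
    have "integrable M (\<lambda>\<omega>. exp_neg (\<integral>\<^sup>+u. f u \<partial>S t \<omega>))"
      by (intro integrable_exp_neg finite_measure_axioms measurable_nn_integral_random_measure[OF S_measurable[OF t] fm])
    then show ?thesis unfolding g_def using h(2)[OF t] by (simp add: prob_space)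
  qed
  define a where "a n l = (\<integral>\<omega>. indicator (window l) (S (time n) \<omega>) * g (time n) \<omega> \<partial>M)" for n l
  define u where "u n l = l powr \<alpha> / (window_rate * time n) * a n l" for n l
  have c: "0 < window_rate * time n" for n using window_rate_pos time_pos by simp
  have Wm: "(\<lambda>\<omega>. indicator (window l) (S (time n) \<omega>) :: real) \<in> borel_measurable M" if "0 < l" for l n
    using measurable_compose[OF S_measurable[OF time_pos] measurable_window[of l]] that by simp
  have int_a: "integrable M (\<lambda>\<omega>. indicator (window l) (S (time n) \<omega>) * g (time n) \<omega>)" if "0 < l" for n l
  proof (rule integrable_unit_interval[OF finite_measure_axioms])
    note [measurable] = Wm[OF that] gm[OF time_pos]
    show "(\<lambda>\<omega>. indicator (window l) (S (time n) \<omega>) * g (time n) \<omega>) \<in> borel_measurable M" by measurable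
  qed (use g01 in \<open>auto simp: indicator_def\<close>)
  have a0: "0 \<le> a n l" for n l unfolding a_def using g01 by (intro integral_nonneg_AE) auto
  have u0: "0 \<le> u n l" for n l unfolding u_def using a0 c[of n] by simp
  have jm: "(\<lambda>x. ennreal (fst x powr \<alpha>) * ennreal (indicator (window (fst x)) (S (time n) (snd x)) * g (time n) (snd x)))
      \<in> borel_measurable (m \<Otimes>\<^sub>M M)" for n
  proof -
    have [measurable]: "(\<lambda>x. x) \<in> borel_measurable m"
      unfolding measurable_cong_sets[OF sets_m refl] by (rule measurable_restrict_space1) simp
    note [measurable] = measurable_window_S[OF time_pos] gm[OF time_pos]
    show ?thesis by measurable
  qed
  have inner: "(\<integral>\<^sup>+\<omega>. ennreal (l powr \<alpha>) * ennreal (indicator (window l) (S (time n) \<omega>) * g (time n) \<omega>) \<partial>M) = ennreal (l powr \<alpha> * a n l)"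
    if "0 < l" for n l
  proof -
    have "(\<integral>\<^sup>+\<omega>. ennreal (l powr \<alpha>) * ennreal (indicator (window l) (S (time n) \<omega>) * g (time n) \<omega>) \<partial>M) =
      ennreal (l powr \<alpha>) * (\<integral>\<^sup>+\<omega>. ennreal (indicator (window l) (S (time n) \<omega>) * g (time n) \<omega>) \<partial>M)"
      using int_a[OF that, of n] by (intro nn_integral_cmult) auto
    also have "(\<integral>\<^sup>+\<omega>. ennreal (indicator (window l) (S (time n) \<omega>) * g (time n) \<omega>) \<partial>M) = ennreal (a n l)"
      unfolding a_def using int_a[OF that, of n] g01 by (intro nn_integral_eq_integral) auto
    finally show ?thesis using a0 by (simp add: ennreal_mult)
  qed
  have um: "(\<lambda>l. ennreal (u n l)) \<in> borel_measurable m" for n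
  proof -
    have "(\<lambda>l. ennreal (1 / (window_rate * time n)) * (\<integral>\<^sup>+\<omega>. ennreal (l powr \<alpha>) * ennreal (indicator (window l) (S (time n) \<omega>) * g (time n) \<omega>) \<partial>M)) \<in> borel_measurable m"
      using borel_measurable_nn_integral_fst[OF jm[of n]] by simp
    moreover have "ennreal (u n l) = ennreal (1 / (window_rate * time n)) * (\<integral>\<^sup>+\<omega>. ennreal (l powr \<alpha>) * ennreal (indicator (window l) (S (time n) \<omega>) * g (time n) \<omega>) \<partial>M)"
      if "l \<in> space m" for l
      using that inner[of l n] a0[of n l] c[of n] by (simp add: u_def space_m ennreal_mult[symmetric])
    ultimately show ?thesis by (subst measurable_cong)
  qed
  have int_u: "(\<integral>\<^sup>+l. ennreal (u n l) \<partial>m) = ennreal (window_mass / window_rate * ((1 - exp (- h * time n)) / time n))" for n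
  proof -
    have "(\<integral>\<^sup>+l. ennreal (u n l) \<partial>m) = (\<integral>\<^sup>+l. ennreal (1 / (window_rate * time n)) *
      (\<integral>\<^sup>+\<omega>. ennreal (l powr \<alpha>) * ennreal (indicator (window l) (S (time n) \<omega>) * g (time n) \<omega>) \<partial>M) \<partial>m)"
      using a0[of n] c[of n] by (intro nn_integral_cong) (simp add: inner u_def space_m ennreal_mult[symmetric])
    also have "\<dots> = ennreal (1 / (window_rate * time n)) *
      (\<integral>\<^sup>+l. (\<integral>\<^sup>+\<omega>. ennreal (l powr \<alpha>) * ennreal (indicator (window l) (S (time n) \<omega>) * g (time n) \<omega>) \<partial>M) \<partial>m)"
      using borel_measurable_nn_integral_fst[OF jm[of n]] by (intro nn_integral_cmult) simp
    also have "(\<integral>\<^sup>+l. (\<integral>\<^sup>+\<omega>. ennreal (l powr \<alpha>) * ennreal (indicator (window l) (S (time n) \<omega>) * g (time n) \<omega>) \<partial>M) \<partial>m) =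
      (\<integral>\<^sup>+\<omega>. (\<integral>\<^sup>+l. ennreal (l powr \<alpha>) * ennreal (indicator (window l) (S (time n) \<omega>) * g (time n) \<omega>) \<partial>m) \<partial>M)"
      using Mm.Fubini[OF jm[of n]] by simp
    also have "\<dots> = (\<integral>\<^sup>+\<omega>. ennreal (window_mass * g (time n) \<omega>) \<partial>M)"
      by (intro nn_integral_cong) (simp add: g_def window_integral[OF time_pos f])
    also have "\<dots> = ennreal (window_mass * (1 - exp (- h * time n)))"
    proof -
      have "integrable M (\<lambda>\<omega>. window_mass * g (time n) \<omega>)"
        using g01 gm[OF time_pos] by (intro integrable_mult_right integrable_unit_interval finite_measure_axioms) auto
      then show ?thesis using g01 window_mass(1)
        by (subst nn_integral_eq_integral) (auto simp: g_int[OF time_pos])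
    qed
    also have "ennreal (1 / (window_rate * time n)) * \<dots> = ennreal (1 / (window_rate * time n) * (window_mass * (1 - exp (- h * time n))))"
      using c[of n] window_mass(1) h(1) time_pos[of n] by (intro ennreal_mult[symmetric]) auto
    finally show ?thesis by (simp add: mult.commute)
  qed
  \<comment> \<open>For 2 l <= \<epsilon> the window keeps all points within \<epsilon> and the test
    vanishes. Otherwise the window event has probability at most 1 - exp(-x) <= x with x = rate
    l^(-\<alpha>) \<open>time n\<close>, and the weight cancels l^(-\<alpha>) and
    \<open>time n\<close>. The resulting bound is m-integrable.\<close>
  have bound: "u n l \<le> rate / window_rate * indicator {\<epsilon>/2<..} l" if l: "0 < l" for n l
  proof (cases "\<epsilon> / 2 < l")
    case True
    have "a n l \<le> (\<integral>\<omega>. 1 - indicator {\<omega> \<in> space M. emeasure (S (time n) \<omega>) (outside l) = 0} \<omega> \<partial>M)"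
      unfolding a_def
    proof (rule integral_mono[OF int_a[OF l]])
      have [measurable]: "(\<lambda>\<omega>. emeasure (S (time n) \<omega>) (outside l)) \<in> borel_measurable M"
        using l by (intro measurable_emeasure_S time_pos) auto
      show "integrable M (\<lambda>\<omega>. 1 - indicator {\<omega> \<in> space M. emeasure (S (time n) \<omega>) (outside l) = 0} \<omega> :: real)"
        by (intro integrable_unit_interval finite_measure_axioms) (auto simp: indicator_def)
      show "indicator (window l) (S (time n) \<omega>) * g (time n) \<omega> \<le> 1 - indicator {\<omega> \<in> space M. emeasure (S (time n) \<omega>) (outside l) = 0} \<omega>" for \<omega>
        using g01[of "time n" \<omega>] by (auto simp: indicator_def window_def)
    qed
    also have "\<dots> = 1 - exp (- (rate * l powr (- \<alpha>)) * time n)"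
    proof -
      have [measurable]: "(\<lambda>\<omega>. emeasure (S (time n) \<omega>) (outside l)) \<in> borel_measurable M"
        using l by (intro measurable_emeasure_S time_pos) auto
      have "{\<omega> \<in> space M. emeasure (S (time n) \<omega>) (outside l) = 0} \<subseteq> space M" by auto
      then show ?thesis using void_S[OF time_pos l, of n] by (simp add: prob_space Int_absorb2 less_top[symmetric])
    qed
    also have "\<dots> \<le> rate * l powr (- \<alpha>) * time n"
      using exp_ge_add_one_self[of "- (rate * l powr (- \<alpha>)) * time n"] by simp
    finally have "u n l \<le> l powr \<alpha> / (window_rate * time n) * (rate * l powr (- \<alpha>) * time n)"
      unfolding u_def using c[of n] by (intro mult_left_mono) auto
    also have "\<dots> = rate / window_rate"
    proof -
      have "l powr \<alpha> * l powr (- \<alpha>) = 1" using l by (simp flip: powr_add)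
      then show ?thesis using time_pos[of n] window_rate_pos by (simp add: field_simps)
    qed
    finally show ?thesis using True by simp
  next
    case False
    have "indicator (window l) (S (time n) \<omega>) * g (time n) \<omega> = 0" for \<omega>
    proof (cases "emeasure (S (time n) \<omega>) (outside (2 * l)) = 0")
      case True
      have "emeasure (S (time n) \<omega>) (outside \<epsilon>) \<le> emeasure (S (time n) \<omega>) (outside (2 * l))"
        using False l by (intro emeasure_mono outside_antimono) auto
      then have "emeasure (S (time n) \<omega>) (outside \<epsilon>) = 0" using True by simp
      then have "(\<integral>\<^sup>+u. f u \<partial>S (time n) \<omega>) = 0"
        using nn_integral_eq_0_outside[OF fm sets_S less_imp_le[OF \<epsilon>(1)] \<epsilon>(2)] by simp
      then show ?thesis by (simp add: g_def)
    qed (simp add: window_def)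
    then have "a n l = 0" unfolding a_def by (simp only: Bochner_Integration.integral_zero)
    then show ?thesis using False by (simp add: u_def)
  qed
  have Ie: "{\<epsilon>/2<..} \<in> sets m" using \<epsilon>(1) by (intro Ioi_sets) simp
  have "(\<lambda>n. \<integral>\<^sup>+l. ennreal (u n l) \<partial>m) \<longlonglongrightarrow> (\<integral>\<^sup>+l. ennreal (1 - LF D decode (\<lambda>u. f (ereal l * u))) \<partial>m)"
  proof (rule nn_integral_dominated_convergence[where w="\<lambda>l. ennreal (rate / window_rate) * indicator {\<epsilon>/2<..} l"])
    show "(\<lambda>l. ennreal (u n l)) \<in> borel_measurable m" for n by (rule um)
    show "(\<lambda>l. ennreal (1 - LF D decode (\<lambda>u. f (ereal l * u)))) \<in> borel_measurable m"
      using measurable_LF_scale[OF D(1) point_process_decode[OF D(2)] fm]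
      unfolding measurable_cong_sets[OF sets_m refl] by measurable
    show "(\<lambda>l. ennreal (rate / window_rate) * indicator {\<epsilon>/2<..} l) \<in> borel_measurable m" using Ie by measurable
    have "(\<integral>\<^sup>+l. ennreal (rate / window_rate) * indicator {\<epsilon>/2<..} l \<partial>m) = ennreal (rate / window_rate) * emeasure m {\<epsilon>/2<..}"
      using Ie by (rule nn_integral_cmult_indicator)
    also have "\<dots> < \<infinity>" using \<epsilon>(1) by (simp add: tail ennreal_mult_less_top)
    finally show "(\<integral>\<^sup>+l. ennreal (rate / window_rate) * indicator {\<epsilon>/2<..} l \<partial>m) < \<infinity>" .
    show "AE l in m. ennreal (u n l) \<le> ennreal (rate / window_rate) * indicator {\<epsilon>/2<..} l" for n
    proof (rule AE_I2)
      fix l assume "l \<in> space m"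
      then have "u n l \<le> rate / window_rate * indicator {\<epsilon>/2<..} l" by (intro bound) (simp add: space_m)
      then have "ennreal (u n l) \<le> ennreal (rate / window_rate * indicator {\<epsilon>/2<..} l)" by (rule ennreal_leI)
      then show "ennreal (u n l) \<le> ennreal (rate / window_rate) * indicator {\<epsilon>/2<..} l" by (auto simp: indicator_def)
    qed
    show "AE l in m. (\<lambda>n. ennreal (u n l)) \<longlonglongrightarrow> ennreal (1 - LF D decode (\<lambda>u. f (ereal l * u)))"
    proof (intro AE_I2 tendsto_ennrealI)
      fix l assume "l \<in> space m"
      then have "0 < l" by (simp add: space_m)
      from decode_intensity[OF D lim f this]
      show "(\<lambda>n. u n l) \<longlonglongrightarrow> 1 - LF D decode (\<lambda>u. f (ereal l * u))" unfolding u_def a_def g_def .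
    qed
  qed
  moreover have "(\<lambda>n. \<integral>\<^sup>+l. ennreal (u n l) \<partial>m) \<longlonglongrightarrow> ennreal (window_mass / window_rate * h)"
    unfolding int_u by (intro tendsto_ennrealI tendsto_mult tendsto_const tendsto_exp_rate)
  ultimately show ?thesis by (rule LIMSEQ_unique)
qed

end

section \<open>The equivalence\<close>

lemma (in power_measure) scale_decorated_poissonI:
  assumes M: "prob_space M" and N: "point_process M N" and D: "prob_space D" and P: "point_process D P"
    and eq: "\<And>f. f \<in> away_tests \<Longrightarrow> LF M N f = exp_neg (\<integral>\<^sup>+x. ennreal (1 - LF D P (\<lambda>u. f (ereal x * u))) \<partial>m)"
  shows "scale_decorated_poisson m D P M N"
proof -
  obtain L :: "(nat \<Rightarrow> real) measure" and l where L: "prob_space L" and l: "\<And>i::nat. l i \<in> L \<rightarrow>\<^sub>M real_pos"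
    and \<Lambda>: "poisson_random_measure L m (\<lambda>\<omega>. distr (count_space UNIV) real_pos (\<lambda>i. l i \<omega>))"
    using ex_poisson_random_measure by blast
  interpret L: prob_space L by fact
  interpret D: product_prob_space "\<lambda>_. D" "UNIV :: nat set"
    using D by (intro product_prob_spaceI)
  interpret pair_prob_space L "PiM (UNIV :: nat set) (\<lambda>_. D)" ..
  have "distr M (measure_algebra ereal_no0) N = distr (L \<Otimes>\<^sub>M (\<Pi>\<^sub>M i\<in>UNIV. D)) (measure_algebra ereal_no0) (decorated l P)"
  proof (rule distr_eq_if_LF_eq[OF M P.prob_space_axioms point_processD(1)[OF N] measurable_decorated[OF P l]])
    fix f assume f: "f \<in> away_tests"
    show "LF M N f = LF (L \<Otimes>\<^sub>M (\<Pi>\<^sub>M i\<in>UNIV. D)) (decorated l P) f"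
      using eq[OF f] LF_decorated[OF L D P l sets_m \<Lambda> away_testsD[OF f]] by simp
  qed
  then show ?thesis
    unfolding scale_decorated_poisson_def decorated_def using D P L l \<Lambda> by blast
qed

text \<open>\<open>decode\<close> reproduces the Laplace exponent up to the factor window_mass /
  window_rate. Scaling the decoration by \<open>\<rho>\<close> multiplies the exponent by
  \<open>\<rho> powr \<alpha>\<close>, and \<open>\<rho>\<close> is chosen to cancel that
  factor.\<close>

lemma (in stable_process) ex_decoration:
  obtains D :: "(nat \<Rightarrow> nat \<Rightarrow> real) measure" and P where "prob_space D" "point_process D P"
    "\<And>f. f \<in> away_tests \<Longrightarrow> LF M N f = exp_neg (\<integral>\<^sup>+x. ennreal (1 - LF D P (\<lambda>u. f (ereal x * u))) \<partial>m)"
proof -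
  obtain D :: "(nat \<Rightarrow> nat \<Rightarrow> real) measure"
    where D: "prob_space D" "sets D = sets (PiM UNIV (\<lambda>_. borel))"
      and lim: "\<And>J \<Phi>. finite J \<Longrightarrow> \<Phi> \<in> borel_measurable (PiM J (\<lambda>_. borel)) \<Longrightarrow> (\<And>z. 0 \<le> \<Phi> z \<and> \<Phi> z \<le> 1) \<Longrightarrow>
      (\<lambda>n. (\<integral>\<omega>. indicator (window 1) (S (time n) \<omega>) * \<Phi> (coords J (S (time n) \<omega>)) \<partial>M) / (window_rate * time n))
        \<longlonglongrightarrow> (\<integral>z. \<Phi> (restrict z J) \<partial>D)"
    using ex_coordinate_law by blast
  have decode: "point_process D decode" by (rule point_process_decode[OF D(2)])
  define \<rho> where "\<rho> = (window_rate / window_mass) powr (1 / \<alpha>)"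
  have \<rho>: "0 < \<rho>" "\<rho> powr \<alpha> = window_rate / window_mass"
    using window_rate_pos window_mass(1) \<alpha> by (auto simp: \<rho>_def powr_powr)
  show thesis
  proof (rule that[OF D(1) point_process_scale[OF decode \<rho>(1)]])
    fix f assume f: "f \<in> away_tests"
    note fm = away_testsD[OF f]
    obtain h where h: "0 \<le> h" "\<And>t. 0 < t \<Longrightarrow> (\<integral>\<omega>. exp_neg (\<integral>\<^sup>+u. f u \<partial>S t \<omega>) \<partial>M) = exp (- h * t)"
      using ex_laplace_exponent[OF f] by blast
    have "LF D (\<lambda>z. scale_measure_pts \<rho> (decode z)) (\<lambda>u. f (ereal x * u)) = LF D decode (\<lambda>u. f (ereal (\<rho> * x) * u))"
      if x: "0 < x" for x
    proof -
      have "(\<lambda>u. f (ereal x * u)) \<in> borel_measurable ereal_no0"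
        using measurable_compose[OF measurable_scale[OF x] fm] .
      from LF_scale[OF point_processD(1)[OF decode] \<rho>(1) this] show ?thesis
        by (simp add: mult.assoc[symmetric] mult.commute[of x \<rho>])
    qed
    then have "(\<integral>\<^sup>+x. ennreal (1 - LF D (\<lambda>z. scale_measure_pts \<rho> (decode z)) (\<lambda>u. f (ereal x * u))) \<partial>m) =
      (\<integral>\<^sup>+x. ennreal (1 - LF D decode (\<lambda>u. f (ereal (\<rho> * x) * u))) \<partial>m)"
      by (intro nn_integral_cong) (simp add: space_m)
    also have "\<dots> = ennreal (\<rho> powr \<alpha>) * (\<integral>\<^sup>+x. ennreal (1 - LF D decode (\<lambda>u. f (ereal x * u))) \<partial>m)"
      using measurable_LF_scale[OF D(1) decode fm] \<rho>(1) by (intro nn_integral_scale_m) auto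
    also have "\<dots> = ennreal (\<rho> powr \<alpha> * (window_mass / window_rate * h))"
      using h(1) window_mass(1) window_rate_pos
      by (subst decode_laplace[OF D lim f h]) (auto simp: ennreal_mult[symmetric])
    also have "\<rho> powr \<alpha> * (window_mass / window_rate * h) = h"
      using window_mass(1) window_rate_pos by (simp add: \<rho>(2))
    finally have I: "(\<integral>\<^sup>+x. ennreal (1 - LF D (\<lambda>z. scale_measure_pts \<rho> (decode z)) (\<lambda>u. f (ereal x * u))) \<partial>m) = ennreal h" .
    have "LF M N f = (\<integral>\<omega>. exp_neg (\<integral>\<^sup>+u. f u \<partial>S 1 \<omega>) \<partial>M)"
      using LF_scale[OF point_processD(1)[OF N] zero_less_one fm] by (simp add: S_def LF_def flip: one_ereal_def)
    also have "\<dots> = exp_neg (ennreal h)" using h(1) h(2)[of 1] by (simp add: exp_neg_def)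
    finally show "LF M N f = exp_neg (\<integral>\<^sup>+x. ennreal (1 - LF D (\<lambda>z. scale_measure_pts \<rho> (decode z)) (\<lambda>u. f (ereal x * u))) \<partial>m)"
      unfolding I .
  qed
qed

text \<open>The theorem fixes \<^typ>\<open>ereal measure\<close> as the sample space of the decoration.\<close>

lemma ex_inj_array_to_measure: "\<exists>\<iota> :: (nat \<Rightarrow> nat \<Rightarrow> real) \<Rightarrow> ereal measure. inj \<iota>"
proof
  \<comment> \<open>Natural numbers inside \<open>ereal\<close> index the array entries. The
    exponential makes the density positive, so distinct real entries give distinct masses of
    singletons.\<close>
  define \<phi> :: "(nat \<Rightarrow> nat \<Rightarrow> real) \<Rightarrow> ereal \<Rightarrow> real" where
    "\<phi> z u = (case prod_decode (nat \<lfloor>real_of_ereal u\<rfloor>) of (j, i) \<Rightarrow> z j i)" for z u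
  show "inj (\<lambda>z. density (count_space UNIV) (\<lambda>u. ennreal (exp (\<phi> z u))))"
  proof (rule injI)
    fix z z' assume eq: "density (count_space UNIV) (\<lambda>u. ennreal (exp (\<phi> z u))) = density (count_space UNIV) (\<lambda>u. ennreal (exp (\<phi> z' u)))"
    have *: "emeasure (density (count_space UNIV) (\<lambda>u. ennreal (exp (\<phi> z u)))) {u} = ennreal (exp (\<phi> z u))" for z u
      by (subst emeasure_density) auto
    have "\<phi> z u = \<phi> z' u" for u
      using *[of z u] *[of z' u] by (simp add: eq)
    from this[of "ereal (real (prod_encode (_, _)))"] show "z = z'" by (intro ext) (simp add: \<phi>_def)
  qed
qed

lemma embed_process:
  assumes \<iota>: "inj \<iota>" and D: "prob_space D" and P: "point_process D P"
  shows "prob_space (embed_measure D \<iota>)" "point_process (embed_measure D \<iota>) (\<lambda>x. P (inv \<iota> x))"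
    and "f \<in> borel_measurable ereal_no0 \<Longrightarrow> LF (embed_measure D \<iota>) (\<lambda>x. P (inv \<iota> x)) f = LF D P f"
proof -
  note distr = embed_measure_eq_distr[OF \<iota>, of D] and \<iota>m = measurable_embed_measure2[OF \<iota>, of D]
  show "prob_space (embed_measure D \<iota>)"
    using prob_space.prob_space_distr[OF D \<iota>m] distr by simp
  have m: "(\<lambda>x. P (inv \<iota> x)) \<in> embed_measure D \<iota> \<rightarrow>\<^sub>M measure_algebra ereal_no0"
    using point_processD(1)[OF P] \<iota> by (intro measurable_embed_measure1) simp
  then show "point_process (embed_measure D \<iota>) (\<lambda>x. P (inv \<iota> x))"
    using point_processD(2)[OF P] \<iota> by (auto simp: point_process_def space_embed_measure)
  assume "f \<in> borel_measurable ereal_no0"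
  note [measurable] = measurable_nn_integral_random_measure[OF m this]
  show "LF (embed_measure D \<iota>) (\<lambda>x. P (inv \<iota> x)) f = LF D P f"
    unfolding LF_def using \<iota> by (subst distr, subst integral_distr[OF \<iota>m]) auto
qed

theorem corollary2p5:
  fixes M :: "'w measure" and N :: "'w \<Rightarrow> ereal measure" and \<alpha> :: real
    and m\<^sub>\<alpha> :: "real measure"
  assumes "prob_space M"
    and "point_process M N"
    and "measure M {\<omega> \<in> space M. emeasure (N \<omega>) (UNIV - {0}) > 0} > 0"
    and "\<alpha> > 0"
    and "sets m\<^sub>\<alpha> = sets real_pos"
    and "\<And>x. x > 0 \<Longrightarrow> emeasure m\<^sub>\<alpha> {x<..} = ennreal (x powr (- \<alpha>))"
  shows "((\<exists>(D :: ereal measure measure) P. scale_decorated_poisson m\<^sub>\<alpha> D P M N) \<longleftrightarrow>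
            strictly_stable \<alpha> M N)
       \<and> (strictly_stable \<alpha> M N \<longleftrightarrow>
            scale_uniquely_supported M N (sc_class (frechet \<alpha>)))"
proof (intro conjI iffI)
  interpret power_measure \<alpha> m\<^sub>\<alpha> using assms(4-6) by unfold_locales
  show "strictly_stable \<alpha> M N" if "\<exists>(D :: ereal measure measure) P. scale_decorated_poisson m\<^sub>\<alpha> D P M N"
    using that decorated_imp_stable[OF assms(1,2)] by blast
  show "\<exists>(D :: ereal measure measure) P. scale_decorated_poisson m\<^sub>\<alpha> D P M N" if "strictly_stable \<alpha> M N"
  proof -
    interpret prob_space M by fact
    interpret stable_process M \<alpha> m\<^sub>\<alpha> N using assms(2,3) that by unfold_locales
    obtain D :: "(nat \<Rightarrow> nat \<Rightarrow> real) measure" and P where D: "prob_space D" and P: "point_process D P"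
      and eq: "\<And>f. f \<in> away_tests \<Longrightarrow> LF M N f = exp_neg (\<integral>\<^sup>+x. ennreal (1 - LF D P (\<lambda>u. f (ereal x * u))) \<partial>m\<^sub>\<alpha>)"
      using ex_decoration by blast
    obtain \<iota> :: "(nat \<Rightarrow> nat \<Rightarrow> real) \<Rightarrow> ereal measure" where \<iota>: "inj \<iota>"
      using ex_inj_array_to_measure by blast
    note embed = embed_process[OF \<iota> D P]
    have "scale_decorated_poisson m\<^sub>\<alpha> (embed_measure D \<iota>) (\<lambda>x. P (inv \<iota> x)) M N"
    proof (rule scale_decorated_poissonI[OF assms(1,2) embed(1,2)])
      fix f assume f: "f \<in> away_tests"
      have "(\<integral>\<^sup>+x. ennreal (1 - LF (embed_measure D \<iota>) (\<lambda>x. P (inv \<iota> x)) (\<lambda>u. f (ereal x * u))) \<partial>m\<^sub>\<alpha>) =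
        (\<integral>\<^sup>+x. ennreal (1 - LF D P (\<lambda>u. f (ereal x * u))) \<partial>m\<^sub>\<alpha>)"
        by (intro nn_integral_cong) (simp add: space_m embed(3)[OF measurable_compose[OF measurable_scale away_testsD[OF f]]])
      then show "LF M N f = exp_neg (\<integral>\<^sup>+x. ennreal (1 - LF (embed_measure D \<iota>) (\<lambda>x. P (inv \<iota> x)) (\<lambda>u. f (ereal x * u))) \<partial>m\<^sub>\<alpha>)"
        using eq[OF f] by simp
    qed
    then show ?thesis by blast
  qed
  show "scale_uniquely_supported M N (sc_class (frechet \<alpha>))" if "strictly_stable \<alpha> M N"
    using stable_imp_scale_uniquely_supported[OF assms(1,2,4) that] .
  show "strictly_stable \<alpha> M N" if "scale_uniquely_supported M N (sc_class (frechet \<alpha>))"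
    using scale_uniquely_supported_imp_stable[OF assms(1,2,4) that] .
qed

end
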